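(* For all $j=0,\dots, n-1$, the restriction of $V_{(n),j}$ to $\mathfrak S_{n-1}$ is the permutation representation whose Frobenius characteristic is $Q_{n-1,j-1}$.
   Context: For $n\ge1$, $\mathfrak S_n$ is the symmetric group on $[n]=\{1,\dots,n\}$, and $\sigma\in\mathfrak S_n$ is written $\sigma_1\cdots\sigma_n$ with $\sigma_i=\sigma(i)$. $\mathrm{EXC}(\sigma)=\{i\in[n-1]:\sigma_i>i\}$, $\mathrm{exc}(\sigma)=|\mathrm{EXC}(\sigma)|$, and $\lambda(\sigma)$ is the cycle type of $\sigma$. Totally order the alphabet $[n]\cup\{\bar1,\dots,\bar n\}$ by $\bar1<\cdots<\bar n<1<\cdots<n$. Let $\bar\sigma$ be the word obtained from $\sigma_1\cdots\sigma_n$ by replacing $\sigma_i$ with $\overline{\sigma_i}$ for each $i\in\mathrm{EXC}(\sigma)$, and let $\mathrm{DEX}(\sigma)$ be the set of $i\in[n-1]$ such that the $i$th letter of $\bar\sigma$ is larger than the $(i+1)$st. For $S\subseteq[n-1]$, $F_{S,n}(\mathbf x)=\sum x_{i_1}\cdots x_{i_n}$, summed over all $i_1\ge\cdots\ge i_n\ge1$ with $i_j>i_{j+1}$ whenever $j\in S$. $Q_{n,j}=\sum F_{\mathrm{DEX}(\sigma),n}$, summed over $\sigma\in\mathfrak S_n$ with $\mathrm{exc}(\sigma)=j$ (an empty sum being $0$); for $\lambda\vdash n$, $Q_{\lambda,j}$ is the same sum restricted to $\sigma$ with $\lambda(\sigma)=\lambda$. By convention $\mathfrak S_0=\{\theta\}$,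 where $\theta$ is the empty word, with $\mathrm{exc}(\theta)=0$, $\mathrm{DEX}(\theta)=\emptyset$ and $F_{\emptyset,0}=1$. $Q_{n,j}$ and $Q_{\lambda,j}$ are known to be symmetric functions (with integer coefficients). The Frobenius characteristic of a virtual representation $V$ of $\mathfrak S_n$ is $\mathrm{ch}\,V=\sum_{\mu\vdash n}z_\mu^{-1}\chi^V_\mu p_\mu$, where $\chi^V_\mu$ is the value of the character of $V$ on the conjugacy class of cycle type $\mu$, $p_\mu=p_{\mu_1}p_{\mu_2}\cdots$ with $p_m=\sum_i x_i^m$, and $z_\mu=\prod_i i^{m_i}m_i!$ if $\mu$ has $m_i$ parts of size $i$. It is an isomorphism from virtual representations of $\mathfrak S_n$ to homogeneous symmetric functions of degree $n$ over $\mathbb Z$. $V_{\lambda,j}$ denotes the virtual representation of $\mathfrak S_n$ with Frobenius characteristic $Q_{\lambda,j}$; $(n)$ is the partition with single part $n$. $\mathfrak S_{n-1}$ is embedded in $\mathfrak S_n$ as the stabilizer of $n$.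
   Formalization: The statement is proved for n ≥ 2; for n = 1, j = 0 it is false, since V_{(1),0} is the one-dimensional trivial representation, whose restriction has characteristic 1, while Q_{0,-1} is an empty sum and hence 0. *)

theory Defs
  imports
    Jordan_Normal_Form.Matrix
    "HOL-Algebra.Sym_Groups"
    "HOL-Algebra.Group_Action"
    "HOL-Combinatorics.Orbits"
    "HOL-Library.Multiset"
begin

section \<open>Formal power series in infinitely many variables\<close>

text \<open>
  A formal power series in commuting variables \<open>x\<^sub>0, x\<^sub>1, x\<^sub>2, \<dots>\<close> is given by its coefficients;
  the monomial \<open>x\<^sub>i\<^sub>1 \<cdots> x\<^sub>i\<^sub>n\<close> is encoded by the multiset of its indices.  The (quasi)symmetric
  functions below only involve the variables with positive index.
\<close>

typedef 'a pseries = "UNIV :: (nat multiset \<Rightarrow> 'a) set"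
  morphisms coef pseries ..

setup_lifting type_definition_pseries

lemma pseries_eqI: "(\<And>M. coef f M = coef g M) \<Longrightarrow> f = g"
  by transfer auto

lemma finite_mset_splits: "finite {(A, B). A + B = (M :: nat multiset)}"
proof (rule finite_subset)
  let ?S = "\<Union>k\<le>size M. multisets_of_size (set_mset M) k"
  show "{(A, B). A + B = M} \<subseteq> ?S \<times> ?S"
    by (auto simp: multisets_of_size_def)
  show "finite (?S \<times> ?S)" by auto
qed

instantiation pseries :: (comm_ring_1) comm_ring_1
begin

lift_definition zero_pseries :: "'a pseries" is "\<lambda>_. 0" .
lift_definition one_pseries :: "'a pseries" is "\<lambda>M. if M = {#} then 1 else 0" .
lift_definition plus_pseries :: "'a pseries \<Rightarrow> 'a pseries \<Rightarrow> 'a pseries"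
  is "\<lambda>f g M. f M + g M" .
lift_definition minus_pseries :: "'a pseries \<Rightarrow> 'a pseries \<Rightarrow> 'a pseries"
  is "\<lambda>f g M. f M - g M" .
lift_definition uminus_pseries :: "'a pseries \<Rightarrow> 'a pseries"
  is "\<lambda>f M. - f M" .
lift_definition times_pseries :: "'a pseries \<Rightarrow> 'a pseries \<Rightarrow> 'a pseries"
  is "\<lambda>f g M. \<Sum>(A, B)\<in>{(A, B). A + B = M}. f A * g B" .

instance
proof
  fix a b c :: "'a pseries"
  show "a + b + c = a + (b + c)" "a + b = b + a" "0 + a = a" "- a + a = 0" "a - b = a + - b"
    by (transfer, simp add: algebra_simps)+
  show "a * b = b * a"
  proof (transfer, rule ext)
    fix f g :: "nat multiset \<Rightarrow> 'a" and M
    show "(\<Sum>(A, B)\<in>{(A, B). A + B = M}. f A * g B) =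
          (\<Sum>(A, B)\<in>{(A, B). A + B = M}. g A * f B)"
      by (rule sum.reindex_bij_witness[of _ prod.swap prod.swap])
         (auto simp: add.commute mult.commute)
  qed
  show "1 * a = a"
  proof (transfer, rule ext)
    fix f :: "nat multiset \<Rightarrow> 'a" and M
    have "(\<Sum>(A, B)\<in>{(A, B). A + B = M}. (if A = {#} then 1 else 0) * f B) =
          (\<Sum>p\<in>{(A, B). A + B = M}. if p = ({#}, M) then f M else 0)"
      by (rule sum.cong) (auto split: if_splits)
    then show "(\<Sum>(A, B)\<in>{(A, B). A + B = M}. (if A = {#} then 1 else 0) * f B) = f M"
      by (simp add: finite_mset_splits)
  qed
  show "(a + b) * c = a * c + b * c"
    by (transfer, rule ext) (simp add: distrib_right sum.distrib case_prod_unfold)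
  show "(0 :: 'a pseries) \<noteq> 1"
    by (metis one_pseries.rep_eq zero_neq_one zero_pseries.rep_eq)
  show "a * b * c = a * (b * c)"
  proof (transfer, rule ext)
    fix f g h :: "nat multiset \<Rightarrow> 'a" and M
    have "(\<Sum>(A, B)\<in>{(A, B). A + B = M}. (\<Sum>(C, D)\<in>{(C, D). C + D = A}. f C * g D) * h B) =
          (\<Sum>p\<in>{(A, B). A + B = M}. \<Sum>q\<in>{(C, D). C + D = fst p}.
             f (fst q) * g (snd q) * h (snd p))"
      by (simp add: case_prod_unfold sum_distrib_right)
    also have "\<dots> = (\<Sum>(p, q)\<in>(SIGMA p:{(A, B). A + B = M}. {(C, D). C + D = fst p}).
             f (fst q) * g (snd q) * h (snd p))"
      by (rule sum.Sigma) (auto simp: finite_mset_splits)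
    also have "\<dots> = (\<Sum>(p, q)\<in>(SIGMA p:{(A, B). A + B = M}. {(C, D). C + D = snd p}).
             f (fst p) * g (fst q) * h (snd q))"
      by (rule sum.reindex_bij_witness[of _
            "\<lambda>((A, B), (C, D)). ((A + C, D), (A, C))"
            "\<lambda>((A, B), (C, D)). ((C, D + B), (D, B))"])
         (auto simp: add.assoc)
    also have "\<dots> = (\<Sum>p\<in>{(A, B). A + B = M}. \<Sum>q\<in>{(C, D). C + D = snd p}.
             f (fst p) * g (fst q) * h (snd q))"
      by (rule sum.Sigma[symmetric]) (auto simp: finite_mset_splits)
    also have "\<dots> = (\<Sum>(A, B)\<in>{(A, B). A + B = M}. f A * (\<Sum>(C, D)\<in>{(C, D). C + D = B}. g C * h D))"
      by (simp add: case_prod_unfold sum_distrib_left mult.assoc)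
    finally show "(\<Sum>(A, B)\<in>{(A, B). A + B = M}. (\<Sum>(C, D)\<in>{(C, D). C + D = A}. f C * g D) * h B) =
      (\<Sum>(A, B)\<in>{(A, B). A + B = M}. f A * (\<Sum>(C, D)\<in>{(C, D). C + D = B}. g C * h D))" .
  qed
qed

end

lift_definition scale :: "'a :: comm_ring_1 \<Rightarrow> 'a pseries \<Rightarrow> 'a pseries"
  is "\<lambda>c f M. c * f M" .

lift_definition power_sum :: "nat \<Rightarrow> 'a :: comm_ring_1 pseries"
  is "\<lambda>m M. of_nat (card {i. 1 \<le> i \<and> replicate_mset m i = M})" .

text \<open>The coefficient of \<open>M\<close> in \<open>F\<^sub>S\<^sub>,\<^sub>n\<close> counts the admissible index sequences whose monomial is \<open>M\<close>.\<close>

lift_definition fund_qsym :: "nat set \<Rightarrow> nat \<Rightarrow> 'a :: comm_ring_1 pseries"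
  is "\<lambda>S n M. of_nat (card {i \<in> {1..n} \<rightarrow>\<^sub>E {1..}.
        (\<forall>k\<in>{1..<n}. i k \<ge> i (k + 1)) \<and> (\<forall>k\<in>{1..<n} \<inter> S. i k > i (k + 1)) \<and>
        image_mset i (mset_set {1..n}) = M})" .


section \<open>Permutation statistics and Eulerian quasisymmetric functions\<close>

definition EXC :: "nat \<Rightarrow> (nat \<Rightarrow> nat) \<Rightarrow> nat set" where
  "EXC n \<sigma> = {i \<in> {1..<n}. \<sigma> i > i}"

definition exc :: "nat \<Rightarrow> (nat \<Rightarrow> nat) \<Rightarrow> nat" where
  "exc n \<sigma> = card (EXC n \<sigma>)"

datatype letter = Barred nat | Plain nat

fun letter_less :: "letter \<Rightarrow> letter \<Rightarrow> bool" where
  "letter_less (Barred a) (Barred b) \<longleftrightarrow> a < b"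
| "letter_less (Barred a) (Plain b) \<longleftrightarrow> True"
| "letter_less (Plain a) (Barred b) \<longleftrightarrow> False"
| "letter_less (Plain a) (Plain b) \<longleftrightarrow> a < b"

definition bar_word :: "nat \<Rightarrow> (nat \<Rightarrow> nat) \<Rightarrow> nat \<Rightarrow> letter" where
  "bar_word n \<sigma> i = (if i \<in> EXC n \<sigma> then Barred (\<sigma> i) else Plain (\<sigma> i))"

definition DEX :: "nat \<Rightarrow> (nat \<Rightarrow> nat) \<Rightarrow> nat set" where
  "DEX n \<sigma> = {i \<in> {1..<n}. letter_less (bar_word n \<sigma> (i + 1)) (bar_word n \<sigma> i)}"

text \<open>\<open>Group_Action\<close> also defines a constant \<open>orbit\<close>; here the orbits of a single map are meant.\<close>

definition cycle_type :: "nat \<Rightarrow> (nat \<Rightarrow> nat) \<Rightarrow> nat multiset" where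
  "cycle_type n \<sigma> = image_mset card (mset_set (Orbits.orbit \<sigma> ` {1..n}))"

text \<open>The index \<open>j\<close> is an integer, so that \<open>Q\<^sub>n\<^sub>,\<^sub>-\<^sub>1\<close> is an empty sum.\<close>

definition Q :: "nat \<Rightarrow> int \<Rightarrow> 'a :: comm_ring_1 pseries" where
  "Q n j = (\<Sum>\<sigma> | \<sigma> permutes {1..n} \<and> int (exc n \<sigma>) = j. fund_qsym (DEX n \<sigma>) n)"

definition Q_type :: "nat multiset \<Rightarrow> int \<Rightarrow> 'a :: comm_ring_1 pseries" where
  "Q_type \<mu> j = (let n = sum_mset \<mu> in
     \<Sum>\<sigma> | \<sigma> permutes {1..n} \<and> int (exc n \<sigma>) = j \<and> cycle_type n \<sigma> = \<mu>. fund_qsym (DEX n \<sigma>) n)"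


section \<open>Complex representations of a group\<close>

text \<open>
  A finite-dimensional representation is a homomorphism into the group of invertible
  complex matrices of some size; its values outside the carrier are irrelevant.
\<close>

type_synonym 'g rep = "'g \<Rightarrow> complex mat"

definition representation :: "('g, 'b) monoid_scheme \<Rightarrow> 'g rep \<Rightarrow> bool" where
  "representation G \<rho> \<longleftrightarrow> (\<exists>d. \<rho> \<in> hom G (units_of (ring_mat TYPE(complex) d ())))"

definition rep_iso :: "('g, 'b) monoid_scheme \<Rightarrow> 'g rep \<Rightarrow> 'g rep \<Rightarrow> bool" where
  "rep_iso G \<rho> \<tau> \<longleftrightarrow> (\<exists>P P'. \<forall>g\<in>carrier G. similar_mat_wit (\<rho> g) (\<tau> g) P P')"

definition rep_sum :: "'g rep \<Rightarrow> 'g rep \<Rightarrow> 'g rep" where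
  "rep_sum \<rho> \<tau> = (\<lambda>g. diag_block_mat [\<rho> g, \<tau> g])"

definition zero_rep :: "'g rep" where
  "zero_rep = (\<lambda>_. 0\<^sub>m 0 0)"

text \<open>The matrix of \<open>g\<close> sends the basis vector \<open>e\<^sub>k\<close> to \<open>e\<^bsub>g k\<^esub>\<close>.\<close>

definition permutation_rep :: "('g, 'b) monoid_scheme \<Rightarrow> 'g rep \<Rightarrow> bool" where
  "permutation_rep G \<rho> \<longleftrightarrow> (\<exists>(d :: nat) \<phi>. group_action G {..<d} \<phi> \<and>
     (\<forall>g\<in>carrier G. \<rho> g = mat d d (\<lambda>(i, k). if i = \<phi> g k then 1 else 0)))"

text \<open>
  The pair \<open>(\<rho>, \<tau>)\<close> stands for the formal difference \<open>\<rho> - \<tau>\<close>; \<open>vrep_eq\<close> is equality in the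
  Grothendieck group of the monoid of isomorphism classes of representations under direct sum.
\<close>

type_synonym 'g vrep = "'g rep \<times> 'g rep"

definition virtual_rep :: "('g, 'b) monoid_scheme \<Rightarrow> 'g vrep \<Rightarrow> bool" where
  "virtual_rep G V \<longleftrightarrow> representation G (fst V) \<and> representation G (snd V)"

definition vrep_eq :: "('g, 'b) monoid_scheme \<Rightarrow> 'g vrep \<Rightarrow> 'g vrep \<Rightarrow> bool" where
  "vrep_eq G V W \<longleftrightarrow> (\<exists>\<epsilon>. representation G \<epsilon> \<and>
     rep_iso G (rep_sum (rep_sum (fst V) (snd W)) \<epsilon>) (rep_sum (rep_sum (fst W) (snd V)) \<epsilon>))"

definition vrep_of :: "'g rep \<Rightarrow> 'g vrep" where
  "vrep_of \<rho> = (\<rho>, zero_rep)"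

definition vrep_restrict :: "('g, 'b) monoid_scheme \<Rightarrow> 'g vrep \<Rightarrow> 'g vrep" where
  "vrep_restrict H V = (restrict (fst V) (carrier H), restrict (snd V) (carrier H))"

definition mtrace :: "complex mat \<Rightarrow> complex" where
  "mtrace A = (\<Sum>i<dim_row A. A $$ (i, i))"

definition vrep_char :: "'g vrep \<Rightarrow> 'g \<Rightarrow> complex" where
  "vrep_char V g = mtrace (fst V g) - mtrace (snd V g)"


section \<open>The Frobenius characteristic\<close>

text \<open>
  No explicit embedding is needed to restrict from \<open>sym_group n\<close> to \<open>sym_group (n - 1)\<close>:
  permutations of \<open>{1..n - 1}\<close> are functions on all of \<open>nat\<close> that are the identity elsewhere.
\<close>

lemma sym_group_stabilizer:
  assumes "n \<ge> 1"
  shows "carrier (sym_group (n - 1)) = {\<sigma> \<in> carrier (sym_group n). \<sigma> n = n}"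
proof (intro equalityI subsetI)
  fix \<sigma> assume "\<sigma> \<in> carrier (sym_group (n - 1))"
  then have *: "\<sigma> permutes {1..n - 1}" by (simp add: sym_group_carrier)
  then have "\<sigma> permutes {1..n}" by (rule permutes_subset) auto
  moreover have "\<sigma> n = n" using * assms by (auto intro!: permutes_not_in)
  ultimately show "\<sigma> \<in> {\<sigma> \<in> carrier (sym_group n). \<sigma> n = n}"
    by (simp add: sym_group_carrier)
next
  fix \<sigma> assume "\<sigma> \<in> {\<sigma> \<in> carrier (sym_group n). \<sigma> n = n}"
  then have "\<sigma> permutes {1..n}" "\<sigma> n = n" by (simp_all add: sym_group_carrier)
  then have "\<sigma> permutes {1..n - 1}"
    by (elim permutes_superset) (auto simp: le_less)
  then show "\<sigma> \<in> carrier (sym_group (n - 1))" by (simp add: sym_group_carrier)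
qed

definition partitions :: "nat \<Rightarrow> nat multiset set" where
  "partitions n = {\<mu>. 0 \<notin># \<mu> \<and> sum_mset \<mu> = n}"

lemma finite_partitions: "finite (partitions n)"
proof (rule finite_subset)
  have size_le: "size \<mu> \<le> sum_mset \<mu>" if "0 \<notin># \<mu>" for \<mu> :: "nat multiset"
    using that by (induction \<mu>) auto
  show "partitions n \<subseteq> (\<Union>k\<le>n. multisets_of_size {..n} k)"
    using size_le
    by (auto simp: partitions_def multisets_of_size_def dest!: multi_member_split)
qed auto

definition z_part :: "nat multiset \<Rightarrow> nat" where
  "z_part \<mu> = (\<Prod>i\<in>set_mset \<mu>. i ^ count \<mu> i * fact (count \<mu> i))"

definition char_at :: "nat \<Rightarrow> (nat \<Rightarrow> nat) vrep \<Rightarrow> nat multiset \<Rightarrow> complex" where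
  "char_at n V \<mu> = vrep_char V (SOME \<sigma>. \<sigma> permutes {1..n} \<and> cycle_type n \<sigma> = \<mu>)"

definition frobenius_ch :: "nat \<Rightarrow> (nat \<Rightarrow> nat) vrep \<Rightarrow> complex pseries" where
  "frobenius_ch n V = (\<Sum>\<mu>\<in>partitions n.
     scale (inverse (of_nat (z_part \<mu>)) * char_at n V \<mu>) (prod_mset (image_mset power_sum \<mu>)))"

end

theory Submission
  imports Defs "Jordan_Normal_Form.Column_Operations" "Jordan_Normal_Form.Determinant"
    "HOL-Computational_Algebra.Polynomial"
begin

text \<open>
  Let \<open>m = n - 1\<close>. A permutation representation \<open>\<rho>\<close> of
  \<open>sym_group m\<close> is constructed whose Frobenius characteristic is \<open>Q m (j -
  1)\<close>, and the character of \<open>V\<close> on \<open>sym_group m\<close> is shown to be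
  the character of \<open>\<rho>\<close>. Over the complex numbers this suffices: representations
  of a finite group with equal characters are isomorphic
  (\<open>rep_iso_if_same_character\<close>, \<open>vrep_eq_if_same_character\<close>).

  \<^emph>\<open>The character of the restriction.\<close> Let \<open>\<nu>\<close> be a partition
  of \<open>m\<close> and \<open>M\<close> a monomial in the variables with index at least 2. In a
  product of power sums, a variable that occurs exactly once comes from a factor
  \<open>p\<^sub>1\<close>. So the coefficient of \<open>x\<^sub>1 M\<close> in
  \<open>frobenius_ch n V\<close> is the coefficient of \<open>M\<close> in the sum of the
  \<open>p\<^sub>\<nu>\<close>, each with the factor \<open>1 / z\<^sub>\<nu>\<close> and the
  value of the character of \<open>V\<close> at \<open>\<nu>\<close> enlarged by a part 1
  (\<open>coef_frobenius_ch_new\<close>). As the monomials \<open>M\<close> of this kind already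
  separate the products of power sums (\<open>p_prod_independent\<close>), the character of the
  restriction is determined by the coefficients of \<open>x\<^sub>1 M\<close> in \<open>Q_type
  {#n#} j\<close>, and it has to be shown that they are the coefficients of \<open>M\<close> in
  \<open>Q m (j - 1)\<close>.

  \<^emph>\<open>Banners.\<close> Arrange a monomial of degree \<open>n\<close> as a weakly
  decreasing sequence \<open>s 1 \<ge> \<dots> \<ge> s n\<close>. Its coefficient in a sum of
  functions \<open>fund_qsym (DEX n \<sigma>) n\<close> is the number of those
  \<open>\<sigma>\<close> that are compatible with \<open>s\<close>, that is, for which
  \<open>s\<close> drops at every element of \<open>DEX n \<sigma>\<close>. For \<open>x\<^sub>1
  M\<close> the least label is \<open>s n\<close> and occurs once. Following an
  \<open>n\<close>-cycle backwards from \<open>n\<close>, and writing down the label of each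
  position together with a colour that says whether it is an excedance, produces a two-coloured
  word of content \<open>M\<close>, a banner; the first position visited is always an excedance,
  and its letter is left blue. The cycle is recovered by sorting the initial segments of the word,
  read backwards, lexicographically. This is a bijection between compatible
  \<open>n\<close>-cycles with \<open>j\<close> excedances and banners with \<open>j - 1\<close>
  red letters (\<open>card_cycles\<close>). Compatible permutations of \<open>{1..m}\<close> with
  \<open>i\<close> excedances are also equinumerous with banners with \<open>i\<close> red letters
  (\<open>card_compatible_perms_banners\<close>): such permutations are encoded by labelled and
  coloured slots, and the generating polynomial of these fillings is compared with that of banners
  by deleting one slot at a time.

  \<^emph>\<open>The permutation representation.\<close> Cutting blocks off a banner turns it into
  a sequence of multisets \<open>K\<^sub>1, K\<^sub>2, \<dots>\<close> with marks \<open>0 <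
  b\<^sub>k < |K\<^sub>k|\<close>, plus an unmarked rest (\<open>marked_seqs_banners\<close>).
  These data are the orbits of \<open>sym_group m\<close> on pairs of a marked ordered set
  partition of \<open>{1..m}\<close> and a colouring of \<open>{1..m}\<close> by the letters of
  the monomial. Since the coefficient of \<open>M\<close> in \<open>p\<close> of the cycle type of
  \<open>g\<close> is the number of colourings of content \<open>M\<close> fixed by
  \<open>g\<close> (\<open>coef_p_prod_cycle_type\<close>), Burnside's lemma shows that the
  permutation representation on marked ordered set partitions with marks of sum \<open>j -
  1\<close> has Frobenius characteristic \<open>Q m (j - 1)\<close>
  (\<open>sum_fixed_marked\<close>).
\<close>

section \<open>Traces and sums of matrices\<close>

lemma mtrace_mult_commute:
  assumes "A \<in> carrier_mat n m" "B \<in> carrier_mat m n"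
  shows "mtrace (A * B) = mtrace (B * A)"
proof -
  have "mtrace (A * B) = (\<Sum>i<n. \<Sum>k<m. A $$ (i,k) * B $$ (k,i))"
    using assms by (auto simp: mtrace_def scalar_prod_def lessThan_atLeast0 intro!: sum.cong)
  also have "\<dots> = (\<Sum>k<m. \<Sum>i<n. B $$ (k,i) * A $$ (i,k))"
    by (subst sum.swap) (simp add: mult.commute)
  also have "\<dots> = mtrace (B * A)"
    using assms by (auto simp: mtrace_def scalar_prod_def lessThan_atLeast0 intro!: sum.cong)
  finally show ?thesis .
qed

lemma mat_inverse_cancel:
  fixes P :: "complex mat"
  assumes "P' * P = 1\<^sub>m n" "P' \<in> carrier_mat n n" "P \<in> carrier_mat n n" "X \<in> carrier_mat n k"
  shows "P' * (P * X) = X"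
proof -
  have "P' * (P * X) = (P' * P) * X" by (rule assoc_mult_mat[symmetric]) (use assms in auto)
  then show ?thesis using assms left_mult_one_mat[of X n k] by simp
qed

lemma mtrace_similar:
  assumes "similar_mat_wit A B P P'"
  shows "mtrace A = mtrace B"
proof -
  obtain n where n: "A \<in> carrier_mat n n" "B \<in> carrier_mat n n" "P \<in> carrier_mat n n" "P' \<in> carrier_mat n n"
    "P' * P = 1\<^sub>m n" "A = P * B * P'"
    using similar_mat_witD[OF refl assms] by blast
  have "mtrace (P * B * P') = mtrace (P' * (P * B))"
    by (rule mtrace_mult_commute[of _ n n]) (use n in auto)
  also have "P' * (P * B) = B" by (rule mat_inverse_cancel[of _ _ n _ n]) (use n in auto)
  finally show ?thesis using n by simp
qed

lemma mtrace_four_block: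
  assumes "A \<in> carrier_mat n n" "D \<in> carrier_mat k k"
  shows "mtrace (four_block_mat A B C D) = mtrace A + mtrace D"
proof -
  have "mtrace (four_block_mat A B C D) = (\<Sum>i<n + k. four_block_mat A B C D $$ (i,i))"
    using assms by (simp add: mtrace_def)
  also have "\<dots> = (\<Sum>i<n. four_block_mat A B C D $$ (i,i)) + (\<Sum>i<k. four_block_mat A B C D $$ (n+i,n+i))"
    by (induction k) (auto simp: add.assoc)
  also have "\<dots> = mtrace A + mtrace D"
    using assms by (auto simp: mtrace_def intro!: arg_cong2[where f="(+)"] sum.cong)
  finally show ?thesis .
qed

text \<open>
  The type of matrices of arbitrary size is not an additive monoid, so sums over a set are taken
  entrywise, with the size as a parameter.
\<close>

definition mat_sum :: "nat \<Rightarrow> nat \<Rightarrow> ('g \<Rightarrow> complex mat) \<Rightarrow> 'g set \<Rightarrow> complex mat" where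
  "mat_sum d e F A = mat d e (\<lambda>ij. \<Sum>g\<in>A. F g $$ ij)"

lemma mat_sum_carrier [simp]: "mat_sum d e F A \<in> carrier_mat d e"
  by (simp add: mat_sum_def)

lemma mat_sum_mult_left:
  assumes "B \<in> carrier_mat c d" "\<And>g. g \<in> A \<Longrightarrow> F g \<in> carrier_mat d e"
  shows "B * mat_sum d e F A = mat_sum c e (\<lambda>g. B * F g) A"
proof (rule eq_matI)
  fix i j assume "i < dim_row (mat_sum c e (\<lambda>g. B * F g) A)" "j < dim_col (mat_sum c e (\<lambda>g. B * F g) A)"
  then have ij: "i < c" "j < e" by (auto simp: mat_sum_def)
  have "(B * mat_sum d e F A) $$ (i,j) = (\<Sum>k<d. B $$ (i,k) * (\<Sum>g\<in>A. F g $$ (k,j)))"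
    using ij assms(1) by (auto simp: mat_sum_def scalar_prod_def lessThan_atLeast0 intro!: sum.cong)
  also have "\<dots> = (\<Sum>g\<in>A. \<Sum>k<d. B $$ (i,k) * F g $$ (k,j))"
    by (simp add: sum_distrib_left sum.swap[of _ A])
  also have "\<dots> = (\<Sum>g\<in>A. (B * F g) $$ (i,j))"
  proof (rule sum.cong[OF refl])
    fix g assume "g \<in> A"
    with assms have "F g \<in> carrier_mat d e" by auto
    then show "(\<Sum>k<d. B $$ (i,k) * F g $$ (k,j)) = (B * F g) $$ (i,j)"
      using ij assms(1) by (auto simp: scalar_prod_def lessThan_atLeast0 intro!: sum.cong)
  qed
  finally show "(B * mat_sum d e F A) $$ (i,j) = mat_sum c e (\<lambda>g. B * F g) A $$ (i,j)"
    using ij by (simp add: mat_sum_def)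
qed (use assms in \<open>auto simp: mat_sum_def\<close>)

lemma mat_sum_mult_right:
  assumes "B \<in> carrier_mat e c" "\<And>g. g \<in> A \<Longrightarrow> F g \<in> carrier_mat d e"
  shows "mat_sum d e F A * B = mat_sum d c (\<lambda>g. F g * B) A"
proof (rule eq_matI)
  fix i j assume "i < dim_row (mat_sum d c (\<lambda>g. F g * B) A)" "j < dim_col (mat_sum d c (\<lambda>g. F g * B) A)"
  then have ij: "i < d" "j < c" by (auto simp: mat_sum_def)
  have "(mat_sum d e F A * B) $$ (i,j) = (\<Sum>k<e. (\<Sum>g\<in>A. F g $$ (i,k)) * B $$ (k,j))"
    using ij assms(1) by (auto simp: mat_sum_def scalar_prod_def lessThan_atLeast0 intro!: sum.cong)
  also have "\<dots> = (\<Sum>g\<in>A. \<Sum>k<e. F g $$ (i,k) * B $$ (k,j))"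
    by (simp add: sum_distrib_right sum.swap[of _ A])
  also have "\<dots> = (\<Sum>g\<in>A. (F g * B) $$ (i,j))"
  proof (rule sum.cong[OF refl])
    fix g assume "g \<in> A"
    with assms have "F g \<in> carrier_mat d e" by auto
    then show "(\<Sum>k<e. F g $$ (i,k) * B $$ (k,j)) = (F g * B) $$ (i,j)"
      using ij assms(1) by (auto simp: scalar_prod_def lessThan_atLeast0 intro!: sum.cong)
  qed
  finally show "(mat_sum d e F A * B) $$ (i,j) = mat_sum d c (\<lambda>g. F g * B) A $$ (i,j)"
    using ij by (simp add: mat_sum_def)
qed (use assms in \<open>auto simp: mat_sum_def\<close>)

lemma mat_sum_cong:
  "A = B \<Longrightarrow> (\<And>g. g \<in> B \<Longrightarrow> F g = G g) \<Longrightarrow> mat_sum d e F A = mat_sum d e G B"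
  by (simp add: mat_sum_def)

lemma mat_sum_reindex:
  assumes "bij_betw h A B"
  shows "mat_sum d e (\<lambda>g. F (h g)) A = mat_sum d e F B"
  unfolding mat_sum_def by (subst sum.reindex_bij_betw[OF assms]) simp

lemma mat_sum_add:
  assumes "\<And>g. g \<in> A \<Longrightarrow> F g \<in> carrier_mat d e" "\<And>g. g \<in> A \<Longrightarrow> G g \<in> carrier_mat d e"
  shows "mat_sum d e (\<lambda>g. F g + G g) A = mat_sum d e F A + mat_sum d e G A"
proof (rule eq_matI)
  fix i j assume "i < dim_row (mat_sum d e F A + mat_sum d e G A)" "j < dim_col (mat_sum d e F A + mat_sum d e G A)"
  then have ij: "i < d" "j < e" by (auto simp: mat_sum_def)
  have "(\<Sum>g\<in>A. (F g + G g) $$ (i,j)) = (\<Sum>g\<in>A. F g $$ (i,j) + G g $$ (i,j))"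
  proof (rule sum.cong[OF refl])
    fix g assume "g \<in> A"
    then have "F g \<in> carrier_mat d e" "G g \<in> carrier_mat d e" using assms by auto
    then show "(F g + G g) $$ (i,j) = F g $$ (i,j) + G g $$ (i,j)" using ij by auto
  qed
  then show "mat_sum d e (\<lambda>g. F g + G g) A $$ (i,j) = (mat_sum d e F A + mat_sum d e G A) $$ (i,j)"
    using ij by (simp add: mat_sum_def sum.distrib)
qed (auto simp: mat_sum_def)

lemma mat_sum_const:
  assumes "B \<in> carrier_mat d e"
  shows "mat_sum d e (\<lambda>_. B) A = of_nat (card A) \<cdot>\<^sub>m B"
  using assms by (intro eq_matI) (auto simp: mat_sum_def)

section \<open>Matrix representations\<close>

text \<open>
  Multiplicative and unital maps into \<open>d \<times> d\<close> matrices; over a group their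
  values are invertible, so these are the representations of degree \<open>d\<close>.
\<close>

definition mat_rep :: "('g, 'b) monoid_scheme \<Rightarrow> nat \<Rightarrow> 'g rep \<Rightarrow> bool" where
  "mat_rep G d \<rho> \<longleftrightarrow> (\<forall>g\<in>carrier G. \<rho> g \<in> carrier_mat d d) \<and>
     (\<forall>g\<in>carrier G. \<forall>h\<in>carrier G. \<rho> (g \<otimes>\<^bsub>G\<^esub> h) = \<rho> g * \<rho> h) \<and> \<rho> \<one>\<^bsub>G\<^esub> = 1\<^sub>m d"

lemma mat_repD:
  assumes "mat_rep G d \<rho>"
  shows "\<And>g. g \<in> carrier G \<Longrightarrow> \<rho> g \<in> carrier_mat d d"
    "\<And>g h. g \<in> carrier G \<Longrightarrow> h \<in> carrier G \<Longrightarrow> \<rho> (g \<otimes>\<^bsub>G\<^esub> h) = \<rho> g * \<rho> h"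
    "\<rho> \<one>\<^bsub>G\<^esub> = 1\<^sub>m d"
  using assms by (auto simp: mat_rep_def)

lemma mat_rep_inv:
  assumes "mat_rep G d \<rho>" "group G" "g \<in> carrier G"
  shows "\<rho> g * \<rho> (inv\<^bsub>G\<^esub> g) = 1\<^sub>m d" "\<rho> (inv\<^bsub>G\<^esub> g) * \<rho> g = 1\<^sub>m d"
  using mat_repD[OF assms(1)] assms(2,3)
  by (metis group.inv_closed group.r_inv, metis group.inv_closed group.l_inv)

lemma mat_rep_transform:
  assumes "mat_rep G d \<rho>" and P: "P \<in> carrier_mat d d" "P' \<in> carrier_mat d d" "P * P' = 1\<^sub>m d" "P' * P = 1\<^sub>m d"
  shows "mat_rep G d (\<lambda>g. P * \<rho> g * P')" "rep_iso G (\<lambda>g. P * \<rho> g * P') \<rho>"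
proof -
  note r = mat_repD[OF assms(1)]
  have eq: "P * (A * B) * P' = P * A * P' * (P * B * P')" if "A \<in> carrier_mat d d" "B \<in> carrier_mat d d" for A B
  proof -
    have c: "P' * (P * (B * P')) = B * P'"
      by (rule mat_inverse_cancel[of _ _ d _ d]) (use that P in auto)
    have "P * A * P' * (P * B * P') = P * (A * (P' * (P * (B * P'))))"
      using that P by (simp add: assoc_mult_mat[of _ d d _ d _ d])
    also have "\<dots> = P * (A * B) * P'"
      unfolding c using that P by (simp add: assoc_mult_mat[of _ d d _ d _ d])
    finally show ?thesis by simp
  qed
  show "mat_rep G d (\<lambda>g. P * \<rho> g * P')"
    unfolding mat_rep_def using r P by (auto simp: eq)
  show "rep_iso G (\<lambda>g. P * \<rho> g * P') \<rho>"
    unfolding rep_iso_def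
    by (rule exI[of _ P], rule exI[of _ P'], intro ballI similar_mat_witI[of _ _ d]) (use r P in auto)
qed

lemma rep_iso_sym: "rep_iso G \<rho> \<tau> \<Longrightarrow> rep_iso G \<tau> \<rho>"
  unfolding rep_iso_def using similar_mat_wit_sym by blast

lemma rep_iso_trans: "rep_iso G \<rho> \<tau> \<Longrightarrow> rep_iso G \<tau> \<upsilon> \<Longrightarrow> rep_iso G \<rho> \<upsilon>"
  unfolding rep_iso_def using similar_mat_wit_trans by blast

lemma mtrace_rep_iso: "rep_iso G \<rho> \<tau> \<Longrightarrow> g \<in> carrier G \<Longrightarrow> mtrace (\<rho> g) = mtrace (\<tau> g)"
  unfolding rep_iso_def using mtrace_similar by blast

lemma rep_sum_eq:
  assumes "\<rho> g \<in> carrier_mat d d" "\<tau> g \<in> carrier_mat e e"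
  shows "rep_sum \<rho> \<tau> g = four_block_mat (\<rho> g) (0\<^sub>m d e) (0\<^sub>m e d) (\<tau> g)"
  unfolding rep_sum_def using assms
  by (subst diag_block_mat.simps(2)) (simp add: Let_def del: diag_block_mat.simps)

lemma rep_iso_rep_sum:
  assumes "mat_rep G d \<rho>" "mat_rep G e \<tau>" "rep_iso G \<rho> \<rho>'" "rep_iso G \<tau> \<tau>'"
  shows "rep_iso G (rep_sum \<rho> \<tau>) (rep_sum \<rho>' \<tau>')"
proof -
  obtain P P' Q Q' where P: "\<And>g. g \<in> carrier G \<Longrightarrow> similar_mat_wit (\<rho> g) (\<rho>' g) P P'"
    and Q: "\<And>g. g \<in> carrier G \<Longrightarrow> similar_mat_wit (\<tau> g) (\<tau>' g) Q Q'"
    using assms(3,4) unfolding rep_iso_def by blast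
  show ?thesis unfolding rep_iso_def
  proof (intro exI ballI)
    fix g assume g: "g \<in> carrier G"
    have c: "\<rho> g \<in> carrier_mat d d" "\<tau> g \<in> carrier_mat e e" using assms g by (auto simp: mat_rep_def)
    have c': "\<rho>' g \<in> carrier_mat d d" "P \<in> carrier_mat d d" "P' \<in> carrier_mat d d"
      "\<tau>' g \<in> carrier_mat e e" "Q \<in> carrier_mat e e" "Q' \<in> carrier_mat e e"
      using similar_mat_witD2[OF c(1) P[OF g]] similar_mat_witD2[OF c(2) Q[OF g]] by auto
    show "similar_mat_wit (rep_sum \<rho> \<tau> g) (rep_sum \<rho>' \<tau>' g)
       (four_block_mat P (0\<^sub>m d e) (0\<^sub>m e d) Q) (four_block_mat P' (0\<^sub>m d e) (0\<^sub>m e d) Q')"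
      unfolding rep_sum_eq[where \<rho>=\<rho> and \<tau>=\<tau>, OF c] rep_sum_eq[where \<rho>=\<rho>' and \<tau>=\<tau>', OF c'(1,4)]
      using similar_mat_wit_four_block[OF P[OF g] Q[OF g] _ _ c(1,2), of "0\<^sub>m d e" "0\<^sub>m d e" "0\<^sub>m e d" "0\<^sub>m e d"] c c'
      by simp
  qed
qed

lemma mult_bij:
  assumes "group G" "h \<in> carrier G"
  shows "bij_betw (\<lambda>g. h \<otimes>\<^bsub>G\<^esub> g) (carrier G) (carrier G)"
    "bij_betw (\<lambda>g. g \<otimes>\<^bsub>G\<^esub> h) (carrier G) (carrier G)"
proof -
  interpret group G by fact
  show "bij_betw (\<lambda>g. h \<otimes>\<^bsub>G\<^esub> g) (carrier G) (carrier G)"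
    by (rule bij_betwI[of _ _ _ "\<lambda>g. inv\<^bsub>G\<^esub> h \<otimes>\<^bsub>G\<^esub> g"]) (use assms(2) in \<open>auto simp: m_assoc[symmetric]\<close>)
  show "bij_betw (\<lambda>g. g \<otimes>\<^bsub>G\<^esub> h) (carrier G) (carrier G)"
    by (rule bij_betwI[of _ _ _ "\<lambda>g. g \<otimes>\<^bsub>G\<^esub> inv\<^bsub>G\<^esub> h"]) (use assms(2) in \<open>auto simp: m_assoc\<close>)
qed

text \<open>
  Maschke's theorem in matrix form. The off-diagonal block \<open>b\<close> of a block triangular
  representation is a cocycle, and the average of \<open>b h * q (inv h)\<close> over all
  \<open>h\<close> exhibits it as a coboundary.
\<close>

lemma cocycle_splits:
  assumes G: "group G" "finite (carrier G)" and p: "mat_rep G d p" and q: "mat_rep G e q"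
    and b: "\<And>g. g \<in> carrier G \<Longrightarrow> b g \<in> carrier_mat d e"
    and coc: "\<And>g h. g \<in> carrier G \<Longrightarrow> h \<in> carrier G \<Longrightarrow> b (g \<otimes>\<^bsub>G\<^esub> h) = p g * b h + b g * q h"
  obtains X where "X \<in> carrier_mat d e" "\<And>g. g \<in> carrier G \<Longrightarrow> p g * X + b g = X * q g"
proof
  interpret group G by fact
  note pD = mat_repD[OF p] and qD = mat_repD[OF q]
  let ?N = "of_nat (card (carrier G)) :: complex"
  let ?S = "mat_sum d e (\<lambda>h. b h * q (inv\<^bsub>G\<^esub> h)) (carrier G)"
  have N: "?N \<noteq> 0" using G(2) by auto
  show "inverse ?N \<cdot>\<^sub>m ?S \<in> carrier_mat d e" by simp
  fix g assume g: "g \<in> carrier G"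
  have bq: "b h * q (inv\<^bsub>G\<^esub> h') \<in> carrier_mat d e" if "h \<in> carrier G" "h' \<in> carrier G" for h h'
    using b[OF that(1)] qD(1)[of "inv\<^bsub>G\<^esub> h'"] that by auto
  have *: "p g * (b h * q (inv\<^bsub>G\<^esub> h)) + b g = b (g \<otimes>\<^bsub>G\<^esub> h) * q (inv\<^bsub>G\<^esub> (g \<otimes>\<^bsub>G\<^esub> h)) * q g"
    if h: "h \<in> carrier G" for h
  proof -
    have c: "p g \<in> carrier_mat d d" "b h \<in> carrier_mat d e" "b g \<in> carrier_mat d e"
      "q h \<in> carrier_mat e e" "q (inv\<^bsub>G\<^esub> h) \<in> carrier_mat e e" "q g \<in> carrier_mat e e"
      "q (inv\<^bsub>G\<^esub> g) \<in> carrier_mat e e"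
      using g h pD(1) qD(1) b by auto
    have "q (inv\<^bsub>G\<^esub> (g \<otimes>\<^bsub>G\<^esub> h)) * q g = q (inv\<^bsub>G\<^esub> (g \<otimes>\<^bsub>G\<^esub> h) \<otimes>\<^bsub>G\<^esub> g)"
      using g h by (simp add: qD(2))
    also have "inv\<^bsub>G\<^esub> (g \<otimes>\<^bsub>G\<^esub> h) \<otimes>\<^bsub>G\<^esub> g = inv\<^bsub>G\<^esub> h"
      using g h by (simp add: inv_mult_group m_assoc)
    finally have 1: "q (inv\<^bsub>G\<^esub> (g \<otimes>\<^bsub>G\<^esub> h)) * q g = q (inv\<^bsub>G\<^esub> h)" .
    have "b (g \<otimes>\<^bsub>G\<^esub> h) * q (inv\<^bsub>G\<^esub> (g \<otimes>\<^bsub>G\<^esub> h)) * q g = b (g \<otimes>\<^bsub>G\<^esub> h) * q (inv\<^bsub>G\<^esub> h)"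
      using g h b[of "g \<otimes>\<^bsub>G\<^esub> h"] qD(1)[of "inv\<^bsub>G\<^esub> (g \<otimes>\<^bsub>G\<^esub> h)"] qD(1)[of g] 1
      by (subst assoc_mult_mat[of _ d e _ e _ e]) auto
    also have "\<dots> = (p g * b h + b g * q h) * q (inv\<^bsub>G\<^esub> h)"
      using g h by (simp add: coc)
    also have "\<dots> = p g * b h * q (inv\<^bsub>G\<^esub> h) + b g * q h * q (inv\<^bsub>G\<^esub> h)"
      by (rule add_mult_distrib_mat[of _ d e]) (use c in auto)
    also have "p g * b h * q (inv\<^bsub>G\<^esub> h) = p g * (b h * q (inv\<^bsub>G\<^esub> h))"
      by (rule assoc_mult_mat[of _ d d _ e _ e]) (use c in auto)
    also have "b g * q h * q (inv\<^bsub>G\<^esub> h) = b g * (q h * q (inv\<^bsub>G\<^esub> h))"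
      by (rule assoc_mult_mat[of _ d e _ e _ e]) (use c in auto)
    also have "q h * q (inv\<^bsub>G\<^esub> h) = 1\<^sub>m e"
      using mat_rep_inv[OF q G(1) h] by simp
    also have "b g * 1\<^sub>m e = b g" using c by simp
    finally show ?thesis by simp
  qed
  have "p g * ?S + ?N \<cdot>\<^sub>m b g = mat_sum d e (\<lambda>h. p g * (b h * q (inv\<^bsub>G\<^esub> h))) (carrier G) + mat_sum d e (\<lambda>h. b g) (carrier G)"
    using g b bq pD(1) by (subst mat_sum_mult_left[of _ d d]) (auto simp: mat_sum_const)
  also have "\<dots> = mat_sum d e (\<lambda>h. p g * (b h * q (inv\<^bsub>G\<^esub> h)) + b g) (carrier G)"
    by (rule mat_sum_add[symmetric]) (use g b bq pD(1)[OF g] in auto)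
  also have "\<dots> = mat_sum d e (\<lambda>h. b (g \<otimes>\<^bsub>G\<^esub> h) * q (inv\<^bsub>G\<^esub> (g \<otimes>\<^bsub>G\<^esub> h)) * q g) (carrier G)"
    by (intro mat_sum_cong refl *)
  also have "\<dots> = mat_sum d e (\<lambda>h. b h * q (inv\<^bsub>G\<^esub> h) * q g) (carrier G)"
    by (rule mat_sum_reindex[OF mult_bij(1)[OF G(1) g], where F="\<lambda>h. b h * q (inv\<^bsub>G\<^esub> h) * q g"])
  also have "\<dots> = ?S * q g"
    by (rule mat_sum_mult_right[symmetric]) (use g bq qD(1) in auto)
  finally have fin: "p g * ?S + ?N \<cdot>\<^sub>m b g = ?S * q g" .
  have smult: "inverse ?N \<cdot>\<^sub>m T + B = inverse ?N \<cdot>\<^sub>m (T + ?N \<cdot>\<^sub>m B)"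
    if "T \<in> carrier_mat d e" "B \<in> carrier_mat d e" for T B
    using that N by (intro eq_matI) (auto simp: field_simps)
  have "p g * (inverse ?N \<cdot>\<^sub>m ?S) + b g = inverse ?N \<cdot>\<^sub>m (p g * ?S) + b g"
    using pD(1)[OF g] by (subst mult_smult_distrib[of _ d d _ e]) auto
  also have "\<dots> = inverse ?N \<cdot>\<^sub>m (p g * ?S + ?N \<cdot>\<^sub>m b g)"
    by (rule smult) (use pD(1)[OF g] b[OF g] in \<open>auto intro: mult_carrier_mat\<close>)
  also have "\<dots> = inverse ?N \<cdot>\<^sub>m (?S * q g)" using fin by simp
  also have "\<dots> = (inverse ?N \<cdot>\<^sub>m ?S) * q g"
    by (rule mult_smult_assoc_mat[symmetric, of _ d e _ e]) (use qD(1)[OF g] in auto)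
  finally show "p g * (inverse ?N \<cdot>\<^sub>m ?S) + b g = inverse ?N \<cdot>\<^sub>m ?S * q g" .
qed

section \<open>The character at an inverse\<close>

lemma conjugate_sprod_self: "v \<in> carrier_vec n \<Longrightarrow> (conjugate (v :: complex vec) \<bullet> v) = of_real (\<Sum>i<n. (cmod (v $ i))\<^sup>2)"
  by (auto simp: scalar_prod_def lessThan_atLeast0 complex_mult_cnj cmod_power2 mult.commute simp flip: of_real_power intro!: sum.cong)

definition adj :: "complex mat \<Rightarrow> complex mat" where
  "adj A = mat (dim_col A) (dim_row A) (\<lambda>(i,j). cnj (A $$ (j,i)))"

lemma adj_carrier [simp]: "A \<in> carrier_mat n m \<Longrightarrow> adj A \<in> carrier_mat m n"
  by (auto simp: adj_def)

lemma adj_mult: "A \<in> carrier_mat n m \<Longrightarrow> B \<in> carrier_mat m k \<Longrightarrow> adj (A * B) = adj B * adj A"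
  by (rule eq_matI) (auto simp: adj_def scalar_prod_def mult.commute)

lemma mtrace_adj: "A \<in> carrier_mat n n \<Longrightarrow> mtrace (adj A) = cnj (mtrace A)"
  by (auto simp: adj_def mtrace_def)

lemma adj_mult_vec_sprod:
  assumes "A \<in> carrier_mat n m" "v \<in> carrier_vec m"
  shows "conjugate v \<bullet> ((adj A * A) *\<^sub>v v) = conjugate (A *\<^sub>v v) \<bullet> (A *\<^sub>v v)"
proof -
  have 1: "(adj A * A) *\<^sub>v v = adj A *\<^sub>v (A *\<^sub>v v)"
    using assms by (simp add: assoc_mult_mat_vec[of "adj A" m n A m v])
  have "conjugate v \<bullet> (adj A *\<^sub>v w) = conjugate (A *\<^sub>v v) \<bullet> w" if w: "w \<in> carrier_vec n" for w
  proof -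
    have "conjugate v \<bullet> (adj A *\<^sub>v w) = (\<Sum>i<m. \<Sum>k<n. cnj (v $ i) * (cnj (A $$ (k,i)) * w $ k))"
      using assms w by (auto simp: scalar_prod_def lessThan_atLeast0 adj_def sum_distrib_left intro!: sum.cong)
    also have "\<dots> = (\<Sum>k<n. \<Sum>i<m. cnj (A $$ (k,i)) * cnj (v $ i) * w $ k)"
      by (subst sum.swap) (simp add: mult_ac)
    also have "\<dots> = conjugate (A *\<^sub>v v) \<bullet> w"
      using assms w by (auto simp: scalar_prod_def lessThan_atLeast0 sum_distrib_right intro!: sum.cong)
    finally show ?thesis .
  qed
  from this[of "A *\<^sub>v v"] show ?thesis using 1 assms by simp
qed

text \<open>
  The matrix \<open>H\<close>, the sum of all \<open>adj (\<rho> g) * \<rho> g\<close>, is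
  positive definite, hence invertible, and \<open>adj (\<rho> g) * H * \<rho> g = H\<close>
  because right multiplication by \<open>g\<close> permutes the summands. So \<open>\<rho> (inv
  g)\<close> is similar to \<open>adj (\<rho> g)\<close>.
\<close>

lemma character_inv:
  assumes G: "group G" "finite (carrier G)" and r: "mat_rep G d \<rho>" and g: "g \<in> carrier G"
  shows "mtrace (\<rho> (inv\<^bsub>G\<^esub> g)) = cnj (mtrace (\<rho> g))"
proof -
  interpret group G by fact
  note rD = mat_repD[OF r]
  define H where "H = mat_sum d d (\<lambda>g. adj (\<rho> g) * \<rho> g) (carrier G)"
  have Hc: "H \<in> carrier_mat d d" by (simp add: H_def)
  have ac: "adj (\<rho> g) * \<rho> g \<in> carrier_mat d d" if "g \<in> carrier G" for g
    using rD(1)[OF that] by (intro mult_carrier_mat[of _ d d]) auto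
  have "det H \<noteq> 0"
  proof
    assume "det H = 0"
    then obtain v where v: "v \<in> carrier_vec d" "v \<noteq> 0\<^sub>v d" "H *\<^sub>v v = 0\<^sub>v d"
      using det_0_iff_vec_prod_zero[OF Hc] by auto
    have "0 = conjugate v \<bullet> (H *\<^sub>v v)" using v by simp
    also have "\<dots> = (\<Sum>i<d. \<Sum>k<d. cnj (v $ i) * ((\<Sum>g\<in>carrier G. (adj (\<rho> g) * \<rho> g) $$ (i,k)) * v $ k))"
      using v(1) Hc by (auto simp: scalar_prod_def lessThan_atLeast0 sum_distrib_left H_def mat_sum_def simp del: index_mult_mat(1) intro!: sum.cong)
    also have "\<dots> = (\<Sum>g\<in>carrier G. \<Sum>i<d. \<Sum>k<d. cnj (v $ i) * ((adj (\<rho> g) * \<rho> g) $$ (i,k) * v $ k))"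
      by (simp add: sum_distrib_left sum_distrib_right sum.swap[of _ "carrier G"])
    also have "\<dots> = (\<Sum>g\<in>carrier G. conjugate v \<bullet> ((adj (\<rho> g) * \<rho> g) *\<^sub>v v))"
    proof (rule sum.cong[OF refl])
      fix g assume "g \<in> carrier G"
      then have T: "adj (\<rho> g) * \<rho> g \<in> carrier_mat d d" by (rule ac)
      have "(\<Sum>i<d. \<Sum>k<d. cnj (v $ i) * (T $$ (i,k) * v $ k)) = conjugate v \<bullet> (T *\<^sub>v v)"
        if "T \<in> carrier_mat d d" for T
        using v(1) that by (auto simp: scalar_prod_def lessThan_atLeast0 sum_distrib_left intro!: sum.cong)
      from this[OF T] show "(\<Sum>i<d. \<Sum>k<d. cnj (v $ i) * ((adj (\<rho> g) * \<rho> g) $$ (i,k) * v $ k)) =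
        conjugate v \<bullet> ((adj (\<rho> g) * \<rho> g) *\<^sub>v v)" .
    qed
    also have "\<dots> = (\<Sum>g\<in>carrier G. of_real (\<Sum>i<d. (cmod ((\<rho> g *\<^sub>v v) $ i))\<^sup>2))"
    proof (rule sum.cong[OF refl])
      fix g assume "g \<in> carrier G"
      then have c: "\<rho> g \<in> carrier_mat d d" using rD by auto
      show "conjugate v \<bullet> ((adj (\<rho> g) * \<rho> g) *\<^sub>v v) = of_real (\<Sum>i<d. (cmod ((\<rho> g *\<^sub>v v) $ i))\<^sup>2)"
        unfolding adj_mult_vec_sprod[OF c v(1)] by (rule conjugate_sprod_self) (use c v in auto)
    qed
    also have "\<dots> = of_real (\<Sum>g\<in>carrier G. (\<Sum>i<d. (cmod ((\<rho> g *\<^sub>v v) $ i))\<^sup>2))"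
      by (simp only: of_real_sum)
    finally have "(\<Sum>g\<in>carrier G. (\<Sum>i<d. (cmod ((\<rho> g *\<^sub>v v) $ i))\<^sup>2)) = 0"
      by (simp only: of_real_eq_0_iff eq_commute[of "0::complex"])
    then have "(\<Sum>i<d. (cmod ((\<rho> \<one>\<^bsub>G\<^esub> *\<^sub>v v) $ i))\<^sup>2) = 0"
      using G(2) by (subst (asm) sum_nonneg_eq_0_iff) (auto intro: sum_nonneg)
    then have "\<forall>i<d. v $ i = 0"
      using v(1) by (subst (asm) sum_nonneg_eq_0_iff) (auto simp: rD(3))
    then show False using v by auto
  qed
  then obtain H' where H': "H' \<in> carrier_mat d d" "H * H' = 1\<^sub>m d" "H' * H = 1\<^sub>m d"
    using det_non_zero_imp_unit[OF Hc, of "()"] by (auto simp: Units_def ring_mat_def)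
  have c: "\<rho> g \<in> carrier_mat d d" "\<rho> (inv\<^bsub>G\<^esub> g) \<in> carrier_mat d d" using g rD by auto
  have "adj (\<rho> g) * H * \<rho> g = adj (\<rho> g) * (H * \<rho> g)"
    by (rule assoc_mult_mat[of _ d d _ d _ d]) (use c Hc in auto)
  also have "H * \<rho> g = mat_sum d d (\<lambda>h. adj (\<rho> h) * \<rho> h * \<rho> g) (carrier G)"
    unfolding H_def by (rule mat_sum_mult_right) (use c ac in auto)
  also have "adj (\<rho> g) * \<dots> = mat_sum d d (\<lambda>h. adj (\<rho> g) * (adj (\<rho> h) * \<rho> h * \<rho> g)) (carrier G)"
    by (rule mat_sum_mult_left) (use c in \<open>auto intro!: mult_carrier_mat[of _ d d] rD(1) adj_carrier\<close>)
  also have "\<dots> = mat_sum d d (\<lambda>h. adj (\<rho> (h \<otimes>\<^bsub>G\<^esub> g)) * \<rho> (h \<otimes>\<^bsub>G\<^esub> g)) (carrier G)"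
  proof (rule mat_sum_cong[OF refl])
    fix h assume h: "h \<in> carrier G"
    then have ch: "\<rho> h \<in> carrier_mat d d" using rD by auto
    show "adj (\<rho> g) * (adj (\<rho> h) * \<rho> h * \<rho> g) = adj (\<rho> (h \<otimes>\<^bsub>G\<^esub> g)) * \<rho> (h \<otimes>\<^bsub>G\<^esub> g)"
      using ch c g h by (simp add: rD(2) adj_mult[of _ d d _ d] assoc_mult_mat[of _ d d _ d _ d])
  qed
  also have "\<dots> = H"
    unfolding H_def by (rule mat_sum_reindex[OF mult_bij(2)[OF G(1) g], where F="\<lambda>g. adj (\<rho> g) * \<rho> g"])
  finally have inv: "adj (\<rho> g) * H * \<rho> g = H" .
  have "adj (\<rho> g) * H = adj (\<rho> g) * H * (\<rho> g * \<rho> (inv\<^bsub>G\<^esub> g))"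
    using mat_rep_inv[OF r G(1) g] c Hc by simp
  also have "\<dots> = adj (\<rho> g) * H * \<rho> g * \<rho> (inv\<^bsub>G\<^esub> g)"
    using c Hc by (simp add: assoc_mult_mat[of _ d d _ d _ d])
  finally have 2: "adj (\<rho> g) * H = H * \<rho> (inv\<^bsub>G\<^esub> g)" using inv by simp
  have "mtrace (\<rho> (inv\<^bsub>G\<^esub> g)) = mtrace (H' * (H * \<rho> (inv\<^bsub>G\<^esub> g)))"
    by (subst mat_inverse_cancel[of _ _ d _ d]) (use c Hc H' in auto)
  also have "\<dots> = mtrace (H' * (adj (\<rho> g) * H))" by (simp add: 2)
  also have "\<dots> = mtrace (adj (\<rho> g) * H * H')"
    by (rule mtrace_mult_commute[of _ d d]) (use c Hc H' in \<open>auto intro!: mult_carrier_mat[of _ d d] adj_carrier\<close>)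
  also have "adj (\<rho> g) * H * H' = adj (\<rho> g) * (H * H')"
    by (rule assoc_mult_mat[of _ d d _ d _ d]) (use c Hc H' in auto)
  also have "\<dots> = adj (\<rho> g)" using c H' right_mult_one_mat[of "adj (\<rho> g)" d d] by simp
  finally show ?thesis using mtrace_adj[OF c(1)] by simp
qed

section \<open>Equivalence of matrices\<close>

definition inv_pair :: "nat \<Rightarrow> complex mat \<Rightarrow> complex mat \<Rightarrow> bool" where
  "inv_pair k P P' \<longleftrightarrow> P \<in> carrier_mat k k \<and> P' \<in> carrier_mat k k \<and> P * P' = 1\<^sub>m k \<and> P' * P = 1\<^sub>m k"

definition rank_mat :: "nat \<Rightarrow> nat \<Rightarrow> nat \<Rightarrow> complex mat" where
  "rank_mat m n r = mat m n (\<lambda>(i,j). if i = j \<and> i < r then 1 else 0)"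

definition mat_equiv :: "nat \<Rightarrow> nat \<Rightarrow> complex mat \<Rightarrow> complex mat \<Rightarrow> bool" where
  "mat_equiv m n A B \<longleftrightarrow> (\<exists>P P' Q Q'. inv_pair m P P' \<and> inv_pair n Q Q' \<and> P * A * Q = B)"

lemma inv_pair_one: "inv_pair k (1\<^sub>m k) (1\<^sub>m k)"
  by (auto simp: inv_pair_def)

lemma inv_pair_mult:
  assumes "inv_pair k P P'" "inv_pair k R R'"
  shows "inv_pair k (R * P) (P' * R')"
proof -
  have "(R * P) * (P' * R') = R * (P * (P' * R'))" "(P' * R') * (R * P) = P' * (R' * (R * P))"
    using assms by (auto simp: inv_pair_def assoc_mult_mat[of _ k k _ k _ k])
  moreover have "P * (P' * R') = R'" "R' * (R * P) = P"
    by (rule mat_inverse_cancel[of _ _ k _ k]; use assms in \<open>auto simp: inv_pair_def\<close>)+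
  ultimately show ?thesis using assms by (auto simp: inv_pair_def)
qed

lemma mat_equiv_trans:
  assumes "mat_equiv m n A B" "mat_equiv m n B C" "A \<in> carrier_mat m n"
  shows "mat_equiv m n A C"
proof -
  obtain P P' Q Q' R R' T T' where
    1: "inv_pair m P P'" "inv_pair n Q Q'" "P * A * Q = B" and
    2: "inv_pair m R R'" "inv_pair n T T'" "R * B * T = C"
    using assms unfolding mat_equiv_def by blast
  have c: "P \<in> carrier_mat m m" "R \<in> carrier_mat m m" "Q \<in> carrier_mat n n" "T \<in> carrier_mat n n"
    using 1 2 by (auto simp: inv_pair_def)
  have "(R * P) * A * (Q * T) = R * (P * A) * (Q * T)"
    using c assms(3) by (simp add: assoc_mult_mat[of R m m P m A n])
  also have "\<dots> = R * (P * A) * Q * T"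
    using c assms(3) by (intro assoc_mult_mat[symmetric, of _ m n _ n _ n]) auto
  also have "R * (P * A) * Q = R * (P * A * Q)"
    using c assms(3) by (intro assoc_mult_mat[of _ m m _ n _ n]) auto
  finally have "(R * P) * A * (Q * T) = C" using 1 2 by simp
  then show ?thesis
    using inv_pair_mult[OF 1(1) 2(1)] inv_pair_mult[OF 2(2) 1(2)] unfolding mat_equiv_def by blast
qed

lemma inv_pair_block:
  assumes "inv_pair k P P'"
  shows "inv_pair (1 + k) (four_block_mat (1\<^sub>m 1) (0\<^sub>m 1 k) (0\<^sub>m k 1) P) (four_block_mat (1\<^sub>m 1) (0\<^sub>m 1 k) (0\<^sub>m k 1) P')"
proof -
  have one: "four_block_mat (1\<^sub>m 1) (0\<^sub>m 1 k) (0\<^sub>m k 1) (1\<^sub>m k) = (1\<^sub>m (1 + k) :: complex mat)"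
    by (intro eq_matI) (auto simp: Suc_diff_le)
  have m: "four_block_mat (1\<^sub>m 1) (0\<^sub>m 1 k) (0\<^sub>m k 1) X * four_block_mat (1\<^sub>m 1) (0\<^sub>m 1 k) (0\<^sub>m k 1) Y
     = four_block_mat (1\<^sub>m 1) (0\<^sub>m 1 k) (0\<^sub>m k 1) (X * Y)" if "X \<in> carrier_mat k k" "Y \<in> carrier_mat k k" for X Y :: "complex mat"
    using that by (subst mult_four_block_mat[of _ 1 1 _ k _ k _ _ 1 _ k]) auto
  show ?thesis using assms unfolding inv_pair_def by (auto simp: m one simp del: One_nat_def)
qed

lemma mat_equiv_block:
  assumes "mat_equiv m n A B" "A \<in> carrier_mat m n"
  shows "mat_equiv (1 + m) (1 + n) (four_block_mat (1\<^sub>m 1) (0\<^sub>m 1 n) (0\<^sub>m m 1) A) (four_block_mat (1\<^sub>m 1) (0\<^sub>m 1 n) (0\<^sub>m m 1) B)"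
proof -
  obtain P P' Q Q' where
    1: "inv_pair m P P'" "inv_pair n Q Q'" "P * A * Q = B"
    using assms unfolding mat_equiv_def by blast
  have c: "P \<in> carrier_mat m m" "Q \<in> carrier_mat n n" "P * A \<in> carrier_mat m n"
    using 1 assms by (auto simp: inv_pair_def)
  have "four_block_mat (1\<^sub>m 1) (0\<^sub>m 1 m) (0\<^sub>m m 1) P * four_block_mat (1\<^sub>m 1) (0\<^sub>m 1 n) (0\<^sub>m m 1) A
     = four_block_mat (1\<^sub>m 1) (0\<^sub>m 1 n) (0\<^sub>m m 1) (P * A)"
    using c assms by (subst mult_four_block_mat[of _ 1 1 _ m _ m _ _ 1 _ n]) auto
  moreover have "four_block_mat (1\<^sub>m 1) (0\<^sub>m 1 n) (0\<^sub>m m 1) (P * A) * four_block_mat (1\<^sub>m 1) (0\<^sub>m 1 n) (0\<^sub>m n 1) Q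
     = four_block_mat (1\<^sub>m 1) (0\<^sub>m 1 n) (0\<^sub>m m 1) (P * A * Q)"
    using c assms by (subst mult_four_block_mat[of _ 1 1 _ n _ m _ _ 1 _ n]) auto
  ultimately show ?thesis
    using inv_pair_block[OF 1(1)] inv_pair_block[OF 1(2)] 1(3) unfolding mat_equiv_def by metis
qed

text \<open>
  Block elimination with the nonzero corner as a pivot; \<open>D\<close> is the Schur complement.
\<close>

lemma mat_equiv_pivot:
  fixes B :: "complex mat"
  assumes B: "B \<in> carrier_mat (1 + m) (1 + n)" and nz: "B $$ (0,0) \<noteq> 0"
  obtains D where "D \<in> carrier_mat m n"
    "mat_equiv (1 + m) (1 + n) B (four_block_mat (1\<^sub>m 1) (0\<^sub>m 1 n) (0\<^sub>m m 1) D)"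
proof -
  obtain b r c D where s: "split_block B 1 1 = (b, r, c, D)" by (metis prod_cases4)
  note sb = split_block[OF s, of m n]
  have car: "b \<in> carrier_mat 1 1" "r \<in> carrier_mat 1 n" "c \<in> carrier_mat m 1" "D \<in> carrier_mat m n"
    and BB: "B = four_block_mat b r c D" using sb B by auto
  define b' where "b' = mat 1 1 (\<lambda>_. inverse (B $$ (0,0)))"
  have b00: "b $$ (0,0) = B $$ (0,0)" using car BB by simp
  have b': "b' \<in> carrier_mat 1 1" "b' * b = 1\<^sub>m 1" "b * b' = 1\<^sub>m 1"
    using car nz b00 by (auto simp: b'_def scalar_prod_def intro!: eq_matI)
  have uminus_zero: "- 0\<^sub>m k l = (0\<^sub>m k l :: complex mat)" for k l
    by (intro eq_matI) auto
  have add_uminus: "X + - X = 0\<^sub>m k l" if "X \<in> carrier_mat k l" for X :: "complex mat" and k l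
    using that by (intro eq_matI) auto
  let ?P = "four_block_mat b' (0\<^sub>m 1 m) (- (c * b')) (1\<^sub>m m)"
  let ?P' = "four_block_mat b (0\<^sub>m 1 m) c (1\<^sub>m m)"
  let ?Q = "four_block_mat (1\<^sub>m 1) (- (b' * r)) (0\<^sub>m n 1) (1\<^sub>m n)"
  let ?Q' = "four_block_mat (1\<^sub>m 1) (b' * r) (0\<^sub>m n 1) (1\<^sub>m n)"
  have one: "four_block_mat (1\<^sub>m 1) (0\<^sub>m 1 k) (0\<^sub>m k 1) (1\<^sub>m k) = (1\<^sub>m (1 + k) :: complex mat)" for k
    by (intro eq_matI) (auto simp: Suc_diff_le)
  have cb: "c * b' \<in> carrier_mat m 1" "b' * r \<in> carrier_mat 1 n" "c * (b' * r) \<in> carrier_mat m n" "c * b' * r \<in> carrier_mat m n"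
    using car b' by auto
  have cbb: "c * b' * b = c" "c * (b' * b) = c"
    using car b' by (auto simp: assoc_mult_mat[of c m 1 b' 1 b 1])
  have PP': "?P * ?P' = 1\<^sub>m (1 + m)"
    using car b' cb cbb one[of m]
    by (subst mult_four_block_mat[of _ 1 1 _ m _ m _ _ 1 _ m]) (auto simp: uminus_zero uminus_l_inv_mat[of _ m 1] simp del: One_nat_def)
  have P'P: "?P' * ?P = 1\<^sub>m (1 + m)"
    using car b' cb cbb one[of m]
    by (subst mult_four_block_mat[of _ 1 1 _ m _ m _ _ 1 _ m]) (auto simp: uminus_zero add_uminus[of _ m 1] simp del: One_nat_def)
  have QQ': "?Q * ?Q' = 1\<^sub>m (1 + n)"
    using car b' cb one[of n]
    by (subst mult_four_block_mat[of _ 1 1 _ n _ n _ _ 1 _ n]) (auto simp: uminus_zero add_uminus[of _ 1 n] simp del: One_nat_def)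
  have Q'Q: "?Q' * ?Q = 1\<^sub>m (1 + n)"
    using car b' cb one[of n]
    by (subst mult_four_block_mat[of _ 1 1 _ n _ n _ _ 1 _ n]) (auto simp: uminus_zero uminus_l_inv_mat[of _ 1 n] simp del: One_nat_def)
  have neg: "- c + c = 0\<^sub>m m 1" using car by (simp add: uminus_l_inv_mat[of _ m 1])
  have "?P * B = four_block_mat (1\<^sub>m 1) (b' * r) (0\<^sub>m m 1) (- (c * b') * r + D)"
    unfolding BB using car b' cb cbb neg
    by (subst mult_four_block_mat[of _ 1 1 _ m _ m _ _ 1 _ n]) auto
  also have "\<dots> * ?Q = four_block_mat (1\<^sub>m 1) (0\<^sub>m 1 n) (0\<^sub>m m 1) (- (c * b') * r + D)"
    using car b' cb
    by (subst mult_four_block_mat[of _ 1 1 _ n _ m _ _ 1 _ n]) (auto simp: uminus_zero uminus_l_inv_mat[of _ 1 n] simp del: One_nat_def)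
  finally have "?P * B * ?Q = four_block_mat (1\<^sub>m 1) (0\<^sub>m 1 n) (0\<^sub>m m 1) (- (c * b') * r + D)" .
  moreover have "inv_pair (1 + m) ?P ?P'" "inv_pair (1 + n) ?Q ?Q'"
    using PP' P'P QQ' Q'Q car b' by (auto simp: inv_pair_def)
  ultimately have "mat_equiv (1 + m) (1 + n) B (four_block_mat (1\<^sub>m 1) (0\<^sub>m 1 n) (0\<^sub>m m 1) (- (c * b') * r + D))"
    unfolding mat_equiv_def by blast
  then show ?thesis using that[of "- (c * b') * r + D"] car cb by auto
qed

text \<open>
  A nonzero entry is swapped into the corner and used as a pivot; the induction hypothesis applies
  to the remaining block.
\<close>

lemma mat_equiv_rank_mat:
  assumes "A \<in> carrier_mat m n"
  obtains r where "r \<le> m" "r \<le> n" "mat_equiv m n A (rank_mat m n r)"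
proof -
  have "\<exists>r. r \<le> m \<and> r \<le> n \<and> mat_equiv m n A (rank_mat m n r)"
    using assms
  proof (induction m arbitrary: n A)
    case 0
    then have "A = rank_mat 0 n 0" by (intro eq_matI) (auto simp: rank_mat_def)
    then have "1\<^sub>m 0 * A * 1\<^sub>m n = rank_mat 0 n 0" using 0 by auto
    then show ?case using inv_pair_one unfolding mat_equiv_def by blast
  next
    case (Suc m)
    show ?case
    proof (cases "A = 0\<^sub>m (Suc m) n")
      case True
      then have "1\<^sub>m (Suc m) * A * 1\<^sub>m n = rank_mat (Suc m) n 0" by (auto simp: rank_mat_def)
      then show ?thesis using inv_pair_one unfolding mat_equiv_def by blast
    next
      case False
      then obtain i j where ij: "i < Suc m" "j < n" "A $$ (i,j) \<noteq> 0"
        using Suc.prems by (metis carrier_matD eq_matI index_zero_mat)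
      then obtain n' where n: "n = Suc n'" by (cases n) auto
      define B where "B = swapcols 0 j (swaprows 0 i A)"
      have Bc: "B \<in> carrier_mat (1 + m) (1 + n')" using Suc.prems n by (auto simp: B_def)
      have "B = swaprows_mat (Suc m) 0 i * A * swaprows_mat n 0 j"
        unfolding B_def using Suc.prems ij n
        by (subst swapcols_mat[of _ "Suc m" n]) (auto simp: swaprows_mat[of _ "Suc m" n])
      then have 1: "mat_equiv (1 + m) (1 + n') A B"
        unfolding mat_equiv_def inv_pair_def using ij n
        by (intro exI[of _ "swaprows_mat (Suc m) 0 i"] exI[of _ "swaprows_mat n 0 j"])
           (auto simp: swaprows_mat_inv)
      have "B $$ (0,0) \<noteq> 0" using ij n Suc.prems by (auto simp: B_def)
      then obtain D where D: "D \<in> carrier_mat m n'"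
        and 2: "mat_equiv (1 + m) (1 + n') B (four_block_mat (1\<^sub>m 1) (0\<^sub>m 1 n') (0\<^sub>m m 1) D)"
        using mat_equiv_pivot[OF Bc] by blast
      obtain r where r: "r \<le> m" "r \<le> n'" "mat_equiv m n' D (rank_mat m n' r)"
        using Suc.IH[OF D] by blast
      have "four_block_mat (1\<^sub>m 1) (0\<^sub>m 1 n') (0\<^sub>m m 1) (rank_mat m n' r) = rank_mat (Suc m) (Suc n') (Suc r)"
        by (intro eq_matI) (auto simp: rank_mat_def split: if_splits)
      then have 3: "mat_equiv (1 + m) (1 + n') (four_block_mat (1\<^sub>m 1) (0\<^sub>m 1 n') (0\<^sub>m m 1) D) (rank_mat (Suc m) (Suc n') (Suc r))"
        using mat_equiv_block[OF r(3) D] by simp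
      have "mat_equiv (1 + m) (1 + n') A (rank_mat (Suc m) (Suc n') (Suc r))"
        using mat_equiv_trans[OF 1 mat_equiv_trans[OF 2 3 Bc]] Suc.prems n by simp
      then show ?thesis using r n by (intro exI[of _ "Suc r"]) auto
    qed
  qed
  then show ?thesis using that by blast
qed

section \<open>Representations with equal characters\<close>

text \<open>
  For every matrix \<open>X\<close> the sum \<open>F X\<close> of all \<open>\<tau> g * X * \<rho>
  (inv g)\<close> is an intertwiner. If all of them were zero, then adding up the \<open>(i,
  j)\<close> entries of \<open>F (U i j)\<close> over the matrix units \<open>U i j\<close> would
  show that the squared absolute values of the common character sum to zero, although its value at
  the unit is \<open>d\<close>.
\<close>

lemma intertwiner_exists:
  assumes G: "group G" "finite (carrier G)" and r: "mat_rep G d \<rho>" and t: "mat_rep G d \<tau>" and d: "d > 0"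
    and eq: "\<And>g. g \<in> carrier G \<Longrightarrow> mtrace (\<rho> g) = mtrace (\<tau> g)"
  obtains f where "f \<in> carrier_mat d d" "f \<noteq> 0\<^sub>m d d" "\<And>h. h \<in> carrier G \<Longrightarrow> \<tau> h * f = f * \<rho> h"
proof (rule ccontr)
  assume no: "\<not> thesis"
  note fin = that
  interpret group G by fact
  note rD = mat_repD[OF r] and tD = mat_repD[OF t]
  define F where "F X = mat_sum d d (\<lambda>g. \<tau> g * X * \<rho> (inv\<^bsub>G\<^esub> g)) (carrier G)" for X
  have F: "\<tau> h * F X = F X * \<rho> h" if X: "X \<in> carrier_mat d d" and h: "h \<in> carrier G" for X h
  proof -
    have c: "\<tau> g * X * \<rho> (inv\<^bsub>G\<^esub> g') \<in> carrier_mat d d" if "g \<in> carrier G" "g' \<in> carrier G" for g g'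
      using X that tD(1) rD(1) by (intro mult_carrier_mat[of _ d d]) auto
    have "\<tau> h * F X = mat_sum d d (\<lambda>g. \<tau> h * (\<tau> g * X * \<rho> (inv\<^bsub>G\<^esub> g))) (carrier G)"
      unfolding F_def by (rule mat_sum_mult_left) (use c h tD in auto)
    also have "\<dots> = mat_sum d d (\<lambda>g. \<tau> (h \<otimes>\<^bsub>G\<^esub> g) * X * \<rho> (inv\<^bsub>G\<^esub> (h \<otimes>\<^bsub>G\<^esub> g)) * \<rho> h) (carrier G)"
    proof (rule mat_sum_cong[OF refl])
      fix g assume g: "g \<in> carrier G"
      have cc: "\<tau> h \<in> carrier_mat d d" "\<tau> g \<in> carrier_mat d d" "\<rho> h \<in> carrier_mat d d" "\<rho> (inv\<^bsub>G\<^esub> g) \<in> carrier_mat d d"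
        "\<rho> (inv\<^bsub>G\<^esub> (h \<otimes>\<^bsub>G\<^esub> g)) \<in> carrier_mat d d"
        using g h tD rD by auto
      have "inv\<^bsub>G\<^esub> (h \<otimes>\<^bsub>G\<^esub> g) \<otimes>\<^bsub>G\<^esub> h = inv\<^bsub>G\<^esub> g"
        using g h by (simp add: inv_mult_group m_assoc)
      then have i: "\<rho> (inv\<^bsub>G\<^esub> (h \<otimes>\<^bsub>G\<^esub> g)) * \<rho> h = \<rho> (inv\<^bsub>G\<^esub> g)"
        using g h by (metis rD(2) inv_closed m_closed)
      have "\<tau> (h \<otimes>\<^bsub>G\<^esub> g) * X * \<rho> (inv\<^bsub>G\<^esub> (h \<otimes>\<^bsub>G\<^esub> g)) * \<rho> h
          = \<tau> (h \<otimes>\<^bsub>G\<^esub> g) * X * (\<rho> (inv\<^bsub>G\<^esub> (h \<otimes>\<^bsub>G\<^esub> g)) * \<rho> h)"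
        by (rule assoc_mult_mat[of _ d d _ d _ d]) (use cc X g h tD in \<open>auto intro!: mult_carrier_mat[of _ d d]\<close>)
      also have "\<dots> = \<tau> h * (\<tau> g * X * \<rho> (inv\<^bsub>G\<^esub> g))"
        unfolding i using cc X g h by (simp add: tD(2) assoc_mult_mat[of _ d d _ d _ d])
      finally show "\<tau> h * (\<tau> g * X * \<rho> (inv\<^bsub>G\<^esub> g)) = \<tau> (h \<otimes>\<^bsub>G\<^esub> g) * X * \<rho> (inv\<^bsub>G\<^esub> (h \<otimes>\<^bsub>G\<^esub> g)) * \<rho> h" ..
    qed
    also have "\<dots> = mat_sum d d (\<lambda>g. \<tau> g * X * \<rho> (inv\<^bsub>G\<^esub> g) * \<rho> h) (carrier G)"
      by (rule mat_sum_reindex[OF mult_bij(1)[OF G(1) h], where F="\<lambda>g. \<tau> g * X * \<rho> (inv\<^bsub>G\<^esub> g) * \<rho> h"])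
    also have "\<dots> = F X * \<rho> h"
      unfolding F_def by (rule mat_sum_mult_right[symmetric]) (use c h rD in auto)
    finally show ?thesis .
  qed
  have F0: "F X = 0\<^sub>m d d" if "X \<in> carrier_mat d d" for X
  proof (rule ccontr)
    assume "F X \<noteq> 0\<^sub>m d d"
    then show False using no fin[of "F X"] F[OF \<open>X \<in> carrier_mat d d\<close>] by (auto simp: F_def)
  qed
  define U where "U i j = (mat d d (\<lambda>(k,l). if k = i \<and> l = j then 1 else 0) :: complex mat)" for i j
  have Uc: "U i j \<in> carrier_mat d d" for i j by (simp add: U_def)
  have ent: "(A * U i j * B) $$ (i,j) = A $$ (i,i) * B $$ (j,j)"
    if "A \<in> carrier_mat d d" "B \<in> carrier_mat d d" "i < d" "j < d" for A B i j
  proof -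
    have AU: "(A * U i j) $$ (i,k) = (if k = j then A $$ (i,i) else 0)" if "k < d" for k
      using \<open>A \<in> carrier_mat d d\<close> \<open>i < d\<close> that
      by (auto simp: U_def scalar_prod_def if_distrib[of "\<lambda>x. _ * x"] sum.delta cong: if_cong)
    have "(A * U i j * B) $$ (i,j) = (\<Sum>k<d. (A * U i j) $$ (i,k) * B $$ (k,j))"
    proof -
      have *: "(T * B) $$ (i,j) = (\<Sum>k<d. T $$ (i,k) * B $$ (k,j))" if "T \<in> carrier_mat d d" for T
        using that \<open>B \<in> carrier_mat d d\<close> \<open>i < d\<close> \<open>j < d\<close>
        by (auto simp: scalar_prod_def lessThan_atLeast0 intro!: sum.cong)
      show ?thesis by (rule *) (use that Uc in \<open>auto intro!: mult_carrier_mat[of _ d d]\<close>)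
    qed
    also have "\<dots> = (\<Sum>k<d. if k = j then A $$ (i,i) * B $$ (j,j) else 0)"
      by (intro sum.cong refl) (auto simp: AU simp del: index_mult_mat(1))
    finally show ?thesis using that by simp
  qed
  have "0 = (\<Sum>i<d. \<Sum>j<d. F (U i j) $$ (i,j))" using F0[OF Uc] by simp
  also have "\<dots> = (\<Sum>i<d. \<Sum>j<d. \<Sum>g\<in>carrier G. \<tau> g $$ (i,i) * \<rho> (inv\<^bsub>G\<^esub> g) $$ (j,j))"
    using tD(1) rD(1) by (auto simp: F_def mat_sum_def ent intro!: sum.cong simp del: index_mult_mat(1))
  also have "\<dots> = (\<Sum>g\<in>carrier G. \<Sum>i<d. \<Sum>j<d. \<tau> g $$ (i,i) * \<rho> (inv\<^bsub>G\<^esub> g) $$ (j,j))"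
    by (simp add: sum.swap[of _ "carrier G"])
  also have "\<dots> = (\<Sum>g\<in>carrier G. mtrace (\<tau> g) * mtrace (\<rho> (inv\<^bsub>G\<^esub> g)))"
  proof (rule sum.cong[OF refl])
    fix g assume g: "g \<in> carrier G"
    then have "dim_row (\<tau> g) = d" "dim_row (\<rho> (inv\<^bsub>G\<^esub> g)) = d" using tD(1)[OF g] rD(1)[of "inv\<^bsub>G\<^esub> g"] by auto
    then show "(\<Sum>i<d. \<Sum>j<d. \<tau> g $$ (i,i) * \<rho> (inv\<^bsub>G\<^esub> g) $$ (j,j)) = mtrace (\<tau> g) * mtrace (\<rho> (inv\<^bsub>G\<^esub> g))"
      by (simp add: mtrace_def sum_product)
  qed
  also have "\<dots> = (\<Sum>g\<in>carrier G. of_real ((cmod (mtrace (\<rho> g)))\<^sup>2))"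
    using character_inv[OF G r] eq by (auto simp: complex_mult_cnj cmod_power2 intro!: sum.cong)
  also have "\<dots> = of_real (\<Sum>g\<in>carrier G. (cmod (mtrace (\<rho> g)))\<^sup>2)" by simp
  finally have "(\<Sum>g\<in>carrier G. (cmod (mtrace (\<rho> g)))\<^sup>2) = 0"
    by (simp only: of_real_eq_0_iff eq_commute[of "0::complex"])
  then have "mtrace (\<rho> \<one>\<^bsub>G\<^esub>) = 0"
    using G(2) by (subst (asm) sum_nonneg_eq_0_iff) auto
  then show False using d by (simp add: rD(3) mtrace_def)
qed

lemma four_block_eqD:
  assumes "four_block_mat A B C D = four_block_mat A' B' C' D'"
    "A \<in> carrier_mat r s" "B \<in> carrier_mat r l" "C \<in> carrier_mat k s" "D \<in> carrier_mat k l"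
    "A' \<in> carrier_mat r s" "B' \<in> carrier_mat r l" "C' \<in> carrier_mat k s" "D' \<in> carrier_mat k l"
  shows "A = A'" "B = B'" "C = C'" "D = D'"
proof -
  have e: "four_block_mat A B C D $$ (i,j) = four_block_mat A' B' C' D' $$ (i,j)" for i j
    by (simp only: assms(1))
  show "A = A'"
  proof (rule eq_matI)
    fix i j assume "i < dim_row A'" "j < dim_col A'"
    then show "A $$ (i,j) = A' $$ (i,j)" using e[of i j] assms(2-) by (auto split: if_splits)
  qed (use assms in auto)
  show "B = B'"
  proof (rule eq_matI)
    fix i j assume "i < dim_row B'" "j < dim_col B'"
    then show "B $$ (i,j) = B' $$ (i,j)" using e[of i "s + j"] assms(2-) by (auto split: if_splits)
  qed (use assms in auto)
  show "C = C'"
  proof (rule eq_matI)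
    fix i j assume "i < dim_row C'" "j < dim_col C'"
    then show "C $$ (i,j) = C' $$ (i,j)" using e[of "r + i" j] assms(2-) by (auto split: if_splits)
  qed (use assms in auto)
  show "D = D'"
  proof (rule eq_matI)
    fix i j assume "i < dim_row D'" "j < dim_col D'"
    then show "D $$ (i,j) = D' $$ (i,j)" using e[of "r + i" "s + j"] assms(2-) by (auto split: if_splits)
  qed (use assms in auto)
qed

lemma rep_iso_intertwine:
  assumes S: "inv_pair d S S'" and A: "\<And>g. g \<in> carrier G \<Longrightarrow> A g \<in> carrier_mat d d"
    and B: "\<And>g. g \<in> carrier G \<Longrightarrow> B g \<in> carrier_mat d d"
    and eq: "\<And>g. g \<in> carrier G \<Longrightarrow> A g * S = S * B g"
  shows "rep_iso G A B"
  unfolding rep_iso_def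
proof (rule exI[of _ S], rule exI[of _ S'], intro ballI)
  fix g assume g: "g \<in> carrier G"
  have "S * B g * S' = A g * (S * S')"
    using S A[OF g] B[OF g] by (simp add: inv_pair_def eq[OF g, symmetric] assoc_mult_mat[of _ d d _ d _ d])
  then show "similar_mat_wit (A g) (B g) S S'"
    using S A[OF g] B[OF g] by (intro similar_mat_witI[of _ _ d]) (auto simp: inv_pair_def)
qed

text \<open>
  Multiplying out the blocks shows that the diagonal blocks are representations and that
  \<open>b\<close> is a cocycle; splitting it amounts to a base change that makes the
  representation block diagonal.
\<close>

lemma mat_rep_block_upper:
  assumes G: "group G" "finite (carrier G)" and rep: "mat_rep G (r + k) \<tau>"
    and bl: "\<And>g. g \<in> carrier G \<Longrightarrow> \<tau> g = four_block_mat (a g) (b g) (0\<^sub>m k r) (e g)"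
    and car: "\<And>g. g \<in> carrier G \<Longrightarrow> a g \<in> carrier_mat r r" "\<And>g. g \<in> carrier G \<Longrightarrow> b g \<in> carrier_mat r k"
      "\<And>g. g \<in> carrier G \<Longrightarrow> e g \<in> carrier_mat k k"
  shows "mat_rep G r a" "mat_rep G k e" "rep_iso G \<tau> (rep_sum a e)"
proof -
  interpret group G by fact
  have one: "four_block_mat (1\<^sub>m r) (0\<^sub>m r k) (0\<^sub>m k r) (1\<^sub>m k) = (1\<^sub>m (r + k) :: complex mat)"
    by (intro eq_matI) auto
  have hom: "a (g \<otimes>\<^bsub>G\<^esub> h) = a g * a h \<and> b (g \<otimes>\<^bsub>G\<^esub> h) = a g * b h + b g * e h \<and> e (g \<otimes>\<^bsub>G\<^esub> h) = e g * e h"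
    if g: "g \<in> carrier G" and h: "h \<in> carrier G" for g h
  proof -
    have "four_block_mat (a (g \<otimes>\<^bsub>G\<^esub> h)) (b (g \<otimes>\<^bsub>G\<^esub> h)) (0\<^sub>m k r) (e (g \<otimes>\<^bsub>G\<^esub> h)) = \<tau> g * \<tau> h"
      using g h bl mat_repD(2)[OF rep g h] by simp
    also have "\<dots> = four_block_mat (a g * a h) (a g * b h + b g * e h) (0\<^sub>m k r) (e g * e h)"
      unfolding bl[OF g] bl[OF h] using car[OF g] car[OF h]
      by (subst mult_four_block_mat[of _ r r _ k _ k _ _ r _ k]) (auto intro!: cong_four_block_mat)
    finally have *: "four_block_mat (a (g \<otimes>\<^bsub>G\<^esub> h)) (b (g \<otimes>\<^bsub>G\<^esub> h)) (0\<^sub>m k r) (e (g \<otimes>\<^bsub>G\<^esub> h)) =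
      four_block_mat (a g * a h) (a g * b h + b g * e h) (0\<^sub>m k r) (e g * e h)" .
    have gh: "g \<otimes>\<^bsub>G\<^esub> h \<in> carrier G" using g h by simp
    show ?thesis
      using four_block_eqD[OF *, of r r k k] car[OF g] car[OF h] car[OF gh] by auto
  qed
  have "four_block_mat (a \<one>\<^bsub>G\<^esub>) (b \<one>\<^bsub>G\<^esub>) (0\<^sub>m k r) (e \<one>\<^bsub>G\<^esub>) = four_block_mat (1\<^sub>m r) (0\<^sub>m r k) (0\<^sub>m k r) (1\<^sub>m k)"
    using bl[of "\<one>\<^bsub>G\<^esub>"] mat_repD(3)[OF rep] one by simp
  from four_block_eqD[OF this, of r r k k] car[of "\<one>\<^bsub>G\<^esub>"]
  have ones: "a \<one>\<^bsub>G\<^esub> = 1\<^sub>m r" "e \<one>\<^bsub>G\<^esub> = 1\<^sub>m k" by auto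
  show ra: "mat_rep G r a" and re: "mat_rep G k e"
    using car hom ones by (auto simp: mat_rep_def)
  obtain X where X: "X \<in> carrier_mat r k" "\<And>g. g \<in> carrier G \<Longrightarrow> a g * X + b g = X * e g"
    using cocycle_splits[OF G ra re, of b] car hom by metis
  let ?S = "four_block_mat (1\<^sub>m r) X (0\<^sub>m k r) (1\<^sub>m k)"
  let ?S' = "four_block_mat (1\<^sub>m r) (- X) (0\<^sub>m k r) (1\<^sub>m k)"
  have inv: "inv_pair (r + k) ?S ?S'"
  proof -
    have "- X + X = 0\<^sub>m r k" "X + - X = 0\<^sub>m r k" "- 0\<^sub>m r r = (0\<^sub>m r r :: complex mat)" "- 0\<^sub>m k k = (0\<^sub>m k k :: complex mat)"
      using X(1) by (auto intro!: eq_matI)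
    then have "?S * ?S' = 1\<^sub>m (r + k)" "?S' * ?S = 1\<^sub>m (r + k)"
      using X(1) one by (subst mult_four_block_mat[of _ r r _ k _ k _ _ r _ k]; auto)+
    then show ?thesis using X(1) by (auto simp: inv_pair_def)
  qed
  show "rep_iso G \<tau> (rep_sum a e)"
  proof (rule rep_iso_intertwine[OF inv])
    fix g assume g: "g \<in> carrier G"
    note c = car[OF g]
    have s: "rep_sum a e g = four_block_mat (a g) (0\<^sub>m r k) (0\<^sub>m k r) (e g)" by (rule rep_sum_eq) (use c in auto)
    show "\<tau> g \<in> carrier_mat (r + k) (r + k)" "rep_sum a e g \<in> carrier_mat (r + k) (r + k)"
      using c by (auto simp: bl[OF g] s)
    have "\<tau> g * ?S = four_block_mat (a g) (a g * X + b g) (0\<^sub>m k r) (e g)"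
      unfolding bl[OF g] using c X(1) by (subst mult_four_block_mat[of _ r r _ k _ k _ _ r _ k]) auto
    moreover have "?S * rep_sum a e g = four_block_mat (a g) (X * e g) (0\<^sub>m k r) (e g)"
      unfolding s using c X(1) by (subst mult_four_block_mat[of _ r r _ k _ k _ _ r _ k]) auto
    ultimately show "\<tau> g * ?S = ?S * rep_sum a e g" using X(2)[OF g] by simp
  qed
qed

text \<open>
  Both triangular shapes are needed: an intertwiner of rank \<open>r\<close> in normal form has an
  invariant image in one of the two representations and an invariant kernel in the other.
\<close>

lemma mat_rep_block_lower:
  assumes G: "group G" "finite (carrier G)" and rep: "mat_rep G (r + k) \<tau>"
    and bl: "\<And>g. g \<in> carrier G \<Longrightarrow> \<tau> g = four_block_mat (a g) (0\<^sub>m r k) (b g) (e g)"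
    and car: "\<And>g. g \<in> carrier G \<Longrightarrow> a g \<in> carrier_mat r r" "\<And>g. g \<in> carrier G \<Longrightarrow> b g \<in> carrier_mat k r"
      "\<And>g. g \<in> carrier G \<Longrightarrow> e g \<in> carrier_mat k k"
  shows "mat_rep G r a" "mat_rep G k e" "rep_iso G \<tau> (rep_sum a e)"
proof -
  interpret group G by fact
  have one: "four_block_mat (1\<^sub>m r) (0\<^sub>m r k) (0\<^sub>m k r) (1\<^sub>m k) = (1\<^sub>m (r + k) :: complex mat)"
    by (intro eq_matI) auto
  have hom: "a (g \<otimes>\<^bsub>G\<^esub> h) = a g * a h \<and> b (g \<otimes>\<^bsub>G\<^esub> h) = e g * b h + b g * a h \<and> e (g \<otimes>\<^bsub>G\<^esub> h) = e g * e h"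
    if g: "g \<in> carrier G" and h: "h \<in> carrier G" for g h
  proof -
    have cb: "b g * a h \<in> carrier_mat k r" "e g * b h \<in> carrier_mat k r" using car[OF g] car[OF h] by auto
    have "four_block_mat (a (g \<otimes>\<^bsub>G\<^esub> h)) (0\<^sub>m r k) (b (g \<otimes>\<^bsub>G\<^esub> h)) (e (g \<otimes>\<^bsub>G\<^esub> h)) = \<tau> g * \<tau> h"
      using g h bl mat_repD(2)[OF rep g h] by simp
    also have "\<dots> = four_block_mat (a g * a h) (0\<^sub>m r k) (b g * a h + e g * b h) (e g * e h)"
      unfolding bl[OF g] bl[OF h] using car[OF g] car[OF h]
      by (subst mult_four_block_mat[of _ r r _ k _ k _ _ r _ k]) (auto intro!: cong_four_block_mat)
    also have "b g * a h + e g * b h = e g * b h + b g * a h"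
      by (rule comm_add_mat[OF cb])
    finally have *: "four_block_mat (a (g \<otimes>\<^bsub>G\<^esub> h)) (0\<^sub>m r k) (b (g \<otimes>\<^bsub>G\<^esub> h)) (e (g \<otimes>\<^bsub>G\<^esub> h)) =
      four_block_mat (a g * a h) (0\<^sub>m r k) (e g * b h + b g * a h) (e g * e h)" .
    have gh: "g \<otimes>\<^bsub>G\<^esub> h \<in> carrier G" using g h by simp
    show ?thesis
      using four_block_eqD[OF *, of r r k k] car[OF g] car[OF h] car[OF gh] by auto
  qed
  have "four_block_mat (a \<one>\<^bsub>G\<^esub>) (0\<^sub>m r k) (b \<one>\<^bsub>G\<^esub>) (e \<one>\<^bsub>G\<^esub>) = four_block_mat (1\<^sub>m r) (0\<^sub>m r k) (0\<^sub>m k r) (1\<^sub>m k)"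
    using bl[of "\<one>\<^bsub>G\<^esub>"] mat_repD(3)[OF rep] one by simp
  from four_block_eqD[OF this, of r r k k] car[of "\<one>\<^bsub>G\<^esub>"]
  have ones: "a \<one>\<^bsub>G\<^esub> = 1\<^sub>m r" "e \<one>\<^bsub>G\<^esub> = 1\<^sub>m k" by auto
  show ra: "mat_rep G r a" and re: "mat_rep G k e"
    using car hom ones by (auto simp: mat_rep_def)
  obtain X where X: "X \<in> carrier_mat k r" "\<And>g. g \<in> carrier G \<Longrightarrow> e g * X + b g = X * a g"
    using cocycle_splits[OF G re ra, of b] car hom by metis
  let ?S = "four_block_mat (1\<^sub>m r) (0\<^sub>m r k) X (1\<^sub>m k)"
  let ?S' = "four_block_mat (1\<^sub>m r) (0\<^sub>m r k) (- X) (1\<^sub>m k)"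
  have inv: "inv_pair (r + k) ?S ?S'"
  proof -
    have "- X + X = 0\<^sub>m k r" "X + - X = 0\<^sub>m k r" "- 0\<^sub>m r r = (0\<^sub>m r r :: complex mat)" "- 0\<^sub>m k k = (0\<^sub>m k k :: complex mat)"
      using X(1) by (auto intro!: eq_matI)
    then have "?S * ?S' = 1\<^sub>m (r + k)" "?S' * ?S = 1\<^sub>m (r + k)"
      using X(1) one by (subst mult_four_block_mat[of _ r r _ k _ k _ _ r _ k]; auto)+
    then show ?thesis using X(1) by (auto simp: inv_pair_def)
  qed
  show "rep_iso G \<tau> (rep_sum a e)"
  proof (rule rep_iso_intertwine[OF inv])
    fix g assume g: "g \<in> carrier G"
    note c = car[OF g]
    have s: "rep_sum a e g = four_block_mat (a g) (0\<^sub>m r k) (0\<^sub>m k r) (e g)" by (rule rep_sum_eq) (use c in auto)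
    show "\<tau> g \<in> carrier_mat (r + k) (r + k)" "rep_sum a e g \<in> carrier_mat (r + k) (r + k)"
      using c by (auto simp: bl[OF g] s)
    have "\<tau> g * ?S = four_block_mat (a g) (0\<^sub>m r k) (b g + e g * X) (e g)"
      unfolding bl[OF g] using c X(1) by (subst mult_four_block_mat[of _ r r _ k _ k _ _ r _ k]) auto
    also have "b g + e g * X = e g * X + b g" by (rule comm_add_mat[of _ k r]) (use c X(1) in auto)
    finally have "\<tau> g * ?S = four_block_mat (a g) (0\<^sub>m r k) (e g * X + b g) (e g)" .
    moreover have "?S * rep_sum a e g = four_block_mat (a g) (0\<^sub>m r k) (X * a g) (e g)"
      unfolding s using c X(1) by (subst mult_four_block_mat[of _ r r _ k _ k _ _ r _ k]) auto
    ultimately show "\<tau> g * ?S = ?S * rep_sum a e g" using X(2)[OF g] by simp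
  qed
qed

text \<open>
  By induction on the degree. There is a nonzero intertwiner, and after base changes it is a
  matrix \<open>rank_mat d d q\<close> with \<open>q > 0\<close>. Commuting with it means that one
  representation is block upper and the other block lower triangular, with the same first diagonal
  block of degree \<open>q\<close>. By Maschke's theorem this block splits off from both, and the
  two remaining blocks have equal characters and smaller degree.
\<close>

theorem rep_iso_if_same_character:
  assumes G: "group G" "finite (carrier G)" and "mat_rep G d \<rho>" "mat_rep G d \<tau>"
    and "\<And>g. g \<in> carrier G \<Longrightarrow> mtrace (\<rho> g) = mtrace (\<tau> g)"
  shows "rep_iso G \<rho> \<tau>"
  using assms(3-)
proof (induction d arbitrary: \<rho> \<tau> rule: less_induct)
  case (less d)
  note r = less.prems(1) and t = less.prems(2) and eq = less.prems(3)
  show ?case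
  proof (cases "d = 0")
    case True
    have z: "A = 1\<^sub>m 0" if "A \<in> carrier_mat 0 0" for A :: "complex mat"
      by (rule eq_matI) (use that in auto)
    have "\<rho> g = 1\<^sub>m 0" "\<tau> g = 1\<^sub>m 0" if "g \<in> carrier G" for g
      using mat_repD(1)[OF r that] mat_repD(1)[OF t that] True by (auto intro: z)
    then show ?thesis
      by (intro rep_iso_intertwine[OF inv_pair_one[of 0]]) auto
  next
    case False
    then obtain f where f: "f \<in> carrier_mat d d" "f \<noteq> 0\<^sub>m d d" "\<And>h. h \<in> carrier G \<Longrightarrow> \<tau> h * f = f * \<rho> h"
      using intertwiner_exists[OF G r t _ eq] by blast
    obtain q where q: "q \<le> d" "mat_equiv d d f (rank_mat d d q)" using mat_equiv_rank_mat[OF f(1)] by blast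
    then obtain P P' Q Q' where P: "inv_pair d P P'" and Q: "inv_pair d Q Q'" and PfQ: "P * f * Q = rank_mat d d q"
      unfolding mat_equiv_def by blast
    have c: "P \<in> carrier_mat d d" "P' \<in> carrier_mat d d" "Q \<in> carrier_mat d d" "Q' \<in> carrier_mat d d"
      using P Q by (auto simp: inv_pair_def)
    have "q \<noteq> 0"
    proof
      assume "q = 0"
      then have "P * f * Q = 0\<^sub>m d d" using PfQ by (auto simp: rank_mat_def)
      then have "P' * (P * (f * Q)) * Q' = P' * (0\<^sub>m d d) * Q'" using c f(1) by (simp add: assoc_mult_mat[of _ d d _ d _ d])
      also have "P' * (P * (f * Q)) = f * Q" by (rule mat_inverse_cancel[of _ _ d _ d]) (use c f(1) P in \<open>auto simp: inv_pair_def\<close>)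
      also have "f * Q * Q' = f * (Q * Q')" by (rule assoc_mult_mat[of _ d d _ d _ d]) (use c f(1) in auto)
      also have "\<dots> = f" using Q f(1) by (simp add: inv_pair_def)
      finally show False using f(2) c by simp
    qed
    define k where "k = d - q"
    have d: "d = q + k" and kd: "k < d" using q(1) \<open>q \<noteq> 0\<close> by (auto simp: k_def)
    define \<tau>' where "\<tau>' g = P * \<tau> g * P'" for g
    define \<rho>' where "\<rho>' g = Q' * \<rho> g * Q" for g
    have t': "mat_rep G d \<tau>'" "rep_iso G \<tau>' \<tau>" and r': "mat_rep G d \<rho>'" "rep_iso G \<rho>' \<rho>"
      unfolding \<tau>'_def \<rho>'_def
      using mat_rep_transform[OF t, of P P'] mat_rep_transform[OF r, of Q' Q] P Q by (auto simp: inv_pair_def)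
    have inter: "\<tau>' g * rank_mat d d q = rank_mat d d q * \<rho>' g" if g: "g \<in> carrier G" for g
    proof -
      have cg: "\<tau> g \<in> carrier_mat d d" "\<rho> g \<in> carrier_mat d d" using mat_repD(1)[OF t g] mat_repD(1)[OF r g] by auto
      have "\<tau>' g * rank_mat d d q = P * (\<tau> g * (P' * (P * (f * Q))))"
        unfolding \<tau>'_def PfQ[symmetric] using c cg f(1) by (simp add: assoc_mult_mat[of _ d d _ d _ d])
      also have "P' * (P * (f * Q)) = f * Q" by (rule mat_inverse_cancel[of _ _ d _ d]) (use c f(1) P in \<open>auto simp: inv_pair_def\<close>)
      also have "P * (\<tau> g * (f * Q)) = P * (\<tau> g * f * Q)" using c cg f(1) by (simp add: assoc_mult_mat[of _ d d _ d _ d])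
      also have "\<dots> = P * (f * (\<rho> g * Q))" unfolding f(3)[OF g] using c cg f(1) by (simp add: assoc_mult_mat[of _ d d _ d _ d])
      also have "\<rho> g * Q = Q * (Q' * (\<rho> g * Q))" by (rule mat_inverse_cancel[symmetric, of _ _ d _ d]) (use c cg Q in \<open>auto simp: inv_pair_def\<close>)
      also have "P * (f * (Q * (Q' * (\<rho> g * Q)))) = rank_mat d d q * \<rho>' g"
        unfolding \<rho>'_def PfQ[symmetric] using c cg f(1) by (simp add: assoc_mult_mat[of _ d d _ d _ d])
      finally show ?thesis .
    qed
    define a where "a g = mat q q (\<lambda>(i,j). \<tau>' g $$ (i,j))" for g
    define b where "b g = mat q k (\<lambda>(i,j). \<tau>' g $$ (i,q + j))" for g
    define e where "e g = mat k k (\<lambda>(i,j). \<tau>' g $$ (q + i,q + j))" for g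
    define b' where "b' g = mat k q (\<lambda>(i,j). \<rho>' g $$ (q + i,j))" for g
    define e' where "e' g = mat k k (\<lambda>(i,j). \<rho>' g $$ (q + i,q + j))" for g
    note defs = a_def b_def e_def b'_def e'_def
    have blocks: "\<tau>' g = four_block_mat (a g) (b g) (0\<^sub>m k q) (e g) \<and> \<rho>' g = four_block_mat (a g) (0\<^sub>m q k) (b' g) (e' g)"
      if g: "g \<in> carrier G" for g
    proof -
      have cg: "\<tau>' g \<in> carrier_mat d d" "\<rho>' g \<in> carrier_mat d d" using mat_repD(1)[OF t'(1) g] mat_repD(1)[OF r'(1) g] by auto
      have L: "(A * rank_mat d d q) $$ (i,j) = (if j < q then A $$ (i,j) else 0)"
        if "A \<in> carrier_mat d d" "i < d" "j < d" for A i j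
      proof -
        have "(A * rank_mat d d q) $$ (i,j) = (\<Sum>l<d. A $$ (i,l) * (if l = j \<and> l < q then 1 else 0))"
          using that by (auto simp: rank_mat_def scalar_prod_def lessThan_atLeast0 intro!: sum.cong)
        also have "\<dots> = (\<Sum>l<d. if l = j then (if j < q then A $$ (i,j) else 0) else 0)"
          by (intro sum.cong) auto
        finally show ?thesis using that by simp
      qed
      have R: "(rank_mat d d q * A) $$ (i,j) = (if i < q then A $$ (i,j) else 0)"
        if "A \<in> carrier_mat d d" "i < d" "j < d" for A i j
      proof -
        have "(rank_mat d d q * A) $$ (i,j) = (\<Sum>l<d. (if i = l \<and> i < q then 1 else 0) * A $$ (l,j))"
          using that by (auto simp: rank_mat_def scalar_prod_def lessThan_atLeast0 intro!: sum.cong)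
        also have "\<dots> = (\<Sum>l<d. if l = i then (if i < q then A $$ (i,j) else 0) else 0)"
          by (intro sum.cong) auto
        finally show ?thesis using that by simp
      qed
      have ent: "(if j < q then \<tau>' g $$ (i,j) else 0) = (if i < q then \<rho>' g $$ (i,j) else 0)" if "i < d" "j < d" for i j
        using L[OF cg(1) that] R[OF cg(2) that] inter[OF g] by simp
      have "\<tau>' g = four_block_mat (a g) (b g) (0\<^sub>m k q) (e g)"
      proof (rule eq_matI)
        fix i j assume "i < dim_row (four_block_mat (a g) (b g) (0\<^sub>m k q) (e g))" "j < dim_col (four_block_mat (a g) (b g) (0\<^sub>m k q) (e g))"
        then have ij: "i < d" "j < d" by (auto simp: defs d)
        then show "\<tau>' g $$ (i,j) = four_block_mat (a g) (b g) (0\<^sub>m k q) (e g) $$ (i,j)"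
          using ent[OF ij] by (auto simp: defs d)
      qed (use cg in \<open>auto simp: defs d\<close>)
      moreover have "\<rho>' g = four_block_mat (a g) (0\<^sub>m q k) (b' g) (e' g)"
      proof (rule eq_matI)
        fix i j assume "i < dim_row (four_block_mat (a g) (0\<^sub>m q k) (b' g) (e' g))" "j < dim_col (four_block_mat (a g) (0\<^sub>m q k) (b' g) (e' g))"
        then have ij: "i < d" "j < d" by (auto simp: defs d)
        then show "\<rho>' g $$ (i,j) = four_block_mat (a g) (0\<^sub>m q k) (b' g) (e' g) $$ (i,j)"
          using ent[OF ij] by (auto simp: defs d)
      qed (use cg in \<open>auto simp: defs d\<close>)
      ultimately show ?thesis ..
    qed
    have car: "a g \<in> carrier_mat q q" "b g \<in> carrier_mat q k" "e g \<in> carrier_mat k k" "b' g \<in> carrier_mat k q" "e' g \<in> carrier_mat k k" for g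
      by (auto simp: defs)
    have up: "mat_rep G q a" "mat_rep G k e" "rep_iso G \<tau>' (rep_sum a e)"
      by (rule mat_rep_block_upper[OF G t'(1)[unfolded d], of a b e]; use blocks car in blast)+
    have lo: "mat_rep G k e'" "rep_iso G \<rho>' (rep_sum a e')"
      by (rule mat_rep_block_lower[OF G r'(1)[unfolded d], of a b' e']; use blocks car in blast)+
    have tr: "mtrace (e' g) = mtrace (e g)" if g: "g \<in> carrier G" for g
    proof -
      have "mtrace (a g) + mtrace (e g) = mtrace (\<tau>' g)"
        using blocks[OF g] mtrace_four_block[OF car(1,3)] by simp
      also have "\<dots> = mtrace (\<rho>' g)"
        using mtrace_rep_iso[OF t'(2) g] mtrace_rep_iso[OF r'(2) g] eq[OF g] by simp
      also have "\<dots> = mtrace (a g) + mtrace (e' g)"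
        using blocks[OF g] mtrace_four_block[OF car(1,5)] by simp
      finally show ?thesis by simp
    qed
    have "rep_iso G e' e" by (rule less.IH[OF kd lo(1) up(2) tr])
    moreover have "rep_iso G a a"
    proof (rule rep_iso_intertwine[OF inv_pair_one[of q]])
      show "a g * 1\<^sub>m q = 1\<^sub>m q * a g" for g
        unfolding left_mult_one_mat[OF car(1)] right_mult_one_mat[OF car(1)] ..
    qed (rule car)+
    ultimately have "rep_iso G (rep_sum a e') (rep_sum a e)"
      by (intro rep_iso_rep_sum[OF up(1) lo(1)])
    then show ?thesis
      using r'(2) lo(2) up(3) t'(2) by (meson rep_iso_sym rep_iso_trans)
  qed
qed

lemma mat_rep_of_representation:
  assumes "group G" "representation G \<rho>"
  obtains d where "mat_rep G d \<rho>"
proof -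
  obtain d where h: "\<rho> \<in> hom G (units_of (ring_mat TYPE(complex) d ()))"
    using assms(2) by (auto simp: representation_def)
  interpret R: semiring "ring_mat TYPE(complex) d ()" by (rule semiring_mat)
  interpret U: group "units_of (ring_mat TYPE(complex) d ())" by (rule R.units_group)
  interpret group_hom G "units_of (ring_mat TYPE(complex) d ())" \<rho>
    using assms(1) h by (simp add: group_hom_def group_hom_axioms_def U.is_group)
  have "mat_rep G d \<rho>"
    unfolding mat_rep_def using hom_closed hom_mult hom_one
    by (auto simp: units_of_def ring_mat_def Units_def)
  then show ?thesis by (rule that)
qed

lemma representation_of_mat_rep:
  assumes "group G" "mat_rep G d \<rho>"
  shows "representation G \<rho>"
  unfolding representation_def
proof
  note r = mat_repD[OF assms(2)]
  show "\<rho> \<in> hom G (units_of (ring_mat TYPE(complex) d ()))"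
  proof (rule homI)
    fix g assume g: "g \<in> carrier G"
    have "\<rho> (inv\<^bsub>G\<^esub> g) \<in> carrier_mat d d" using r(1) assms(1) g group.inv_closed by metis
    then show "\<rho> g \<in> carrier (units_of (ring_mat TYPE(complex) d ()))"
      using r(1)[OF g] mat_rep_inv[OF assms(2,1) g]
      by (auto simp: units_of_def Units_def ring_mat_def)
  next
    fix g h assume "g \<in> carrier G" "h \<in> carrier G"
    then show "\<rho> (g \<otimes>\<^bsub>G\<^esub> h) = \<rho> g \<otimes>\<^bsub>units_of (ring_mat TYPE(complex) d ())\<^esub> \<rho> h"
      using r(2) by (simp add: units_of_def ring_mat_def)
  qed
qed

lemma mat_rep_zero_rep: "mat_rep G 0 zero_rep"
  by (auto simp: mat_rep_def zero_rep_def intro!: eq_matI)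

lemma mat_rep_rep_sum:
  assumes "group G" "mat_rep G d \<rho>" "mat_rep G e \<tau>"
  shows "mat_rep G (d + e) (rep_sum \<rho> \<tau>)"
    "g \<in> carrier G \<Longrightarrow> mtrace (rep_sum \<rho> \<tau> g) = mtrace (\<rho> g) + mtrace (\<tau> g)"
proof -
  interpret group G by fact
  note r = mat_repD[OF assms(2)] and t = mat_repD[OF assms(3)]
  have s: "rep_sum \<rho> \<tau> g = four_block_mat (\<rho> g) (0\<^sub>m d e) (0\<^sub>m e d) (\<tau> g)" if "g \<in> carrier G" for g
    by (rule rep_sum_eq) (use r t that in auto)
  show "mat_rep G (d + e) (rep_sum \<rho> \<tau>)"
    unfolding mat_rep_def
  proof (intro conjI ballI)
    fix g assume g: "g \<in> carrier G"
    show "rep_sum \<rho> \<tau> g \<in> carrier_mat (d + e) (d + e)" unfolding s[OF g] using r(1)[OF g] t(1)[OF g] by auto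
    fix h assume h: "h \<in> carrier G"
    show "rep_sum \<rho> \<tau> (g \<otimes>\<^bsub>G\<^esub> h) = rep_sum \<rho> \<tau> g * rep_sum \<rho> \<tau> h"
      unfolding s[OF g] s[OF h] s[OF m_closed[OF g h]]
      using r(1)[OF g] t(1)[OF g] r(1)[OF h] t(1)[OF h] r(2)[OF g h] t(2)[OF g h]
      by (subst mult_four_block_mat[of _ d d _ e _ e _ _ d _ e]) auto
  next
    show "rep_sum \<rho> \<tau> \<one>\<^bsub>G\<^esub> = 1\<^sub>m (d + e)"
      unfolding s[OF one_closed] r(3) t(3) by (intro eq_matI) auto
  qed
  show "mtrace (rep_sum \<rho> \<tau> g) = mtrace (\<rho> g) + mtrace (\<tau> g)" if "g \<in> carrier G"
    unfolding s[OF that] by (rule mtrace_four_block[OF r(1)[OF that] t(1)[OF that]])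
qed

text \<open>
  Comparing the characters at the unit gives \<open>d = k + e\<close>, so the two representations
  in the definition of \<open>vrep_eq\<close> have the same degree and the same character; the
  zero representation serves as the auxiliary summand.
\<close>

theorem vrep_eq_if_same_character:
  assumes G: "group G" "finite (carrier G)" and "mat_rep G d (fst V)" "mat_rep G e (snd V)" "mat_rep G k \<rho>"
    and ch: "\<And>g. g \<in> carrier G \<Longrightarrow> vrep_char V g = mtrace (\<rho> g)"
  shows "vrep_eq G V (vrep_of \<rho>)"
proof -
  interpret group G by fact
  have mt1: "mtrace (1\<^sub>m n) = of_nat n" for n by (simp add: mtrace_def)
  have mt0: "mtrace (zero_rep g) = 0" for g :: 'a by (simp add: mtrace_def zero_rep_def)
  note z = mat_rep_zero_rep[of G]
  note L1 = mat_rep_rep_sum[OF G(1) assms(3) z] and R1 = mat_rep_rep_sum[OF G(1) assms(5,4)]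
  note L2 = mat_rep_rep_sum[OF G(1) L1(1) z] and R2 = mat_rep_rep_sum[OF G(1) R1(1) z]
  have "complex_of_nat d - of_nat e = of_nat k"
    using ch[of "\<one>\<^bsub>G\<^esub>"] mat_repD(3)[OF assms(3)] mat_repD(3)[OF assms(4)] mat_repD(3)[OF assms(5)]
    by (simp add: vrep_char_def mt1)
  then have "complex_of_nat d = of_nat (k + e)" by (simp add: algebra_simps)
  then have d: "d = k + e" by (simp only: of_nat_eq_iff)
  have "rep_iso G (rep_sum (rep_sum (fst V) zero_rep) zero_rep) (rep_sum (rep_sum \<rho> (snd V)) zero_rep)"
  proof (rule rep_iso_if_same_character[OF G])
    show "mat_rep G d (rep_sum (rep_sum (fst V) zero_rep) zero_rep)" using L2(1) by simp
    show "mat_rep G d (rep_sum (rep_sum \<rho> (snd V)) zero_rep)" using R2(1) d by simp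
    fix g assume g: "g \<in> carrier G"
    show "mtrace (rep_sum (rep_sum (fst V) zero_rep) zero_rep g) = mtrace (rep_sum (rep_sum \<rho> (snd V)) zero_rep g)"
    proof -
      have "mtrace (fst V g) = mtrace (\<rho> g) + mtrace (snd V g)"
        using ch[OF g] unfolding vrep_char_def by (metis diff_add_cancel)
      then show ?thesis by (simp add: L2(2)[OF g] R2(2)[OF g] L1(2)[OF g] R1(2)[OF g] mt0)
    qed
  qed
  then show ?thesis
    unfolding vrep_eq_def vrep_of_def using representation_of_mat_rep[OF G(1) z] by auto
qed

section \<open>Coefficients of sums of fundamental quasisymmetric functions\<close>

definition decr :: "nat \<Rightarrow> (nat \<Rightarrow> nat) \<Rightarrow> bool" where
  "decr n s \<longleftrightarrow> (\<forall>p q. 1 \<le> p \<longrightarrow> p \<le> q \<longrightarrow> q \<le> n \<longrightarrow> s q \<le> s p)"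

definition content :: "nat \<Rightarrow> (nat \<Rightarrow> nat) \<Rightarrow> nat multiset" where
  "content n s = image_mset s (mset_set {1..n})"

lemma decrD: "decr n s \<Longrightarrow> 1 \<le> p \<Longrightarrow> p \<le> q \<Longrightarrow> q \<le> n \<Longrightarrow> s q \<le> s p"
  by (auto simp: decr_def)

lemma decr_less: "decr n s \<Longrightarrow> 1 \<le> q \<Longrightarrow> p \<le> n \<Longrightarrow> s q < s p \<Longrightarrow> p < q"
  by (metis decrD leD not_le)

lemma decrI_Suc: "(\<And>k. 1 \<le> k \<Longrightarrow> k < n \<Longrightarrow> s (k + 1) \<le> s k) \<Longrightarrow> decr n s"
proof -
  assume a: "\<And>k. 1 \<le> k \<Longrightarrow> k < n \<Longrightarrow> s (k + 1) \<le> s k"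
  have "s q \<le> s p" if "1 \<le> p" "p \<le> q" "q \<le> n" for p q
    using that(2,3)
  proof (induction q rule: dec_induct)
    case (step k)
    then show ?case using a[of k] that(1) by simp
  qed simp
  then show ?thesis by (simp add: decr_def)
qed

lemma content_list: "content n s = mset (map s [1..<Suc n])"
  unfolding content_def by (simp add: atLeastLessThanSuc_atLeastAtMost del: upt_Suc)

lemma decr_sorted: "decr n s \<longleftrightarrow> sorted (rev (map s [1..<Suc n]))"
proof
  assume d: "decr n s"
  show "sorted (rev (map s [1..<Suc n]))"
    unfolding sorted_wrt_rev sorted_wrt_map
    by (rule sorted_wrt_mono_rel[OF _ sorted_wrt_upt]) (use d in \<open>auto simp: decr_def\<close>)
next
  assume "sorted (rev (map s [1..<Suc n]))"
  then have "sorted_wrt (\<lambda>p q. s q \<le> s p) [1..<Suc n]"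
    unfolding sorted_wrt_rev sorted_wrt_map .
  then have *: "s ([1..<Suc n] ! j) \<le> s ([1..<Suc n] ! i)" if "i < j" "j < n" for i j
    unfolding sorted_wrt_iff_nth_less using that by (auto simp del: upt_Suc)
  show "decr n s"
  proof (rule decrI_Suc)
    fix k :: nat assume "1 \<le> k" "k < n"
    then show "s (k + 1) \<le> s k" using *[of "k - 1" k] by (simp del: upt_Suc)
  qed
qed

lemma decr_unique:
  assumes "decr n s" "decr n s'" "content n s = content n s'" "k \<in> {1..n}"
  shows "s k = s' k"
proof -
  have "rev (map s [1..<Suc n]) = rev (map s' [1..<Suc n])"
    using assms(1-3) unfolding decr_sorted content_list
    by (metis mset_rev properties_for_sort)
  then have "map s [1..<Suc n] = map s' [1..<Suc n]" by simp
  then show ?thesis using assms(4) by (auto simp del: upt_Suc)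
qed

lemma decr_exists:
  assumes "size M = n"
  obtains s where "decr n s" "content n s = M"
proof
  let ?l = "rev (sorted_list_of_multiset M)"
  let ?s = "\<lambda>k. ?l ! (k - 1)"
  have l: "length ?l = n" using assms by (metis length_rev mset_sorted_list_of_multiset size_mset)
  have m: "map ?s [1..<Suc n] = ?l"
    by (rule nth_equalityI) (use l in \<open>auto simp del: upt_Suc\<close>)
  show "decr n ?s" unfolding decr_sorted m by simp
  show "content n ?s = M" unfolding content_list m by simp
qed

lemma size_content [simp]: "size (content n s) = n"
  by (simp add: content_def)

text \<open>
  The only weakly decreasing index sequence with content \<open>content n s\<close> is
  \<open>s\<close> itself.
\<close>

lemma coef_fund_qsym:
  assumes "decr n s" "\<forall>k\<in>{1..n}. 1 \<le> s k"
  shows "coef (fund_qsym S n :: 'a :: comm_ring_1 pseries) (content n s) = (if \<forall>k\<in>{1..<n} \<inter> S. s (k + 1) < s k then 1 else 0)"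
proof -
  let ?X = "{i \<in> {1..n} \<rightarrow>\<^sub>E {1..}. (\<forall>k\<in>{1..<n}. i k \<ge> i (k + 1)) \<and> (\<forall>k\<in>{1..<n} \<inter> S. i k > i (k + 1)) \<and>
        image_mset i (mset_set {1..n}) = content n s}"
  have X: "i = restrict s {1..n}" if "i \<in> ?X" for i
  proof
    fix k
    have "decr n i" by (rule decrI_Suc) (use that in auto)
    moreover have "content n i = content n s" using that by (simp add: content_def)
    ultimately have "k \<in> {1..n} \<Longrightarrow> i k = s k" using assms(1) by (metis decr_unique)
    then show "i k = restrict s {1..n} k" using that by (auto simp: PiE_def extensional_def)
  qed
  have "image_mset (restrict s {1..n}) (mset_set {1..n}) = content n s"
    unfolding content_def by (rule image_mset_cong) simp
  then have Y: "restrict s {1..n} \<in> ?X" if "\<forall>k\<in>{1..<n} \<inter> S. s (k + 1) < s k"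
    using assms that decrD[OF assms(1)] by auto
  have Z: "\<forall>k\<in>{1..<n} \<inter> S. s (k + 1) < s k" if "restrict s {1..n} \<in> ?X"
    using that by auto
  have "?X = (if \<forall>k\<in>{1..<n} \<inter> S. s (k + 1) < s k then {restrict s {1..n}} else {})"
  proof (cases "\<forall>k\<in>{1..<n} \<inter> S. s (k + 1) < s k")
    case True
    then show ?thesis unfolding if_P[OF True] using X Y by blast
  next
    case False
    have "?X = {}"
    proof (rule equals0I)
      fix i assume i: "i \<in> ?X"
      then have "restrict s {1..n} \<in> ?X" by (subst (asm) X[OF i])
      then show False using Z False by blast
    qed
    then show ?thesis unfolding if_not_P[OF False] .
  qed
  then have "card ?X = (if \<forall>k\<in>{1..<n} \<inter> S. s (k + 1) < s k then 1 else 0)" by simp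
  then show ?thesis unfolding fund_qsym.rep_eq by simp
qed

lemma coef_fund_qsym_eq_0:
  assumes "size M \<noteq> n \<or> 0 \<in># M"
  shows "coef (fund_qsym S n :: 'a :: comm_ring_1 pseries) M = 0"
proof -
  have "size M = n \<and> 0 \<notin># M" if "i \<in> {1..n} \<rightarrow>\<^sub>E {1..}" "image_mset i (mset_set {1..n}) = M" for i
  proof
    show "size M = n" using that(2) by auto
    have "i k \<noteq> 0" if "k \<in> {1..n}" for k using PiE_mem[OF \<open>i \<in> _\<close> that] by simp
    then show "0 \<notin># M" using that(2) by (metis (no_types, lifting) finite_atLeastAtMost finite_set_mset_mset_set image_iff set_image_mset)
  qed
  then have "{i \<in> {1..n} \<rightarrow>\<^sub>E {1..}. (\<forall>k\<in>{1..<n}. i k \<ge> i (k + 1)) \<and> (\<forall>k\<in>{1..<n} \<inter> S. i k > i (k + 1)) \<and>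
        image_mset i (mset_set {1..n}) = M} = {}"
    using assms by blast
  then show ?thesis unfolding fund_qsym.rep_eq by (simp only: card.empty of_nat_0)
qed

lemma coef_add: "coef (f + g) M = coef f M + coef g M" by (simp add: plus_pseries.rep_eq)
lemma coef_zero: "coef 0 M = 0" by (simp add: zero_pseries.rep_eq)
lemma coef_sum: "coef (sum f A) M = (\<Sum>a\<in>A. coef (f a) M)"
  by (induction A rule: infinite_finite_induct) (auto simp: coef_add coef_zero)

text \<open>
  By \<open>coef_fund_qsym\<close> these are the permutations that contribute to the coefficient
  of the monomial with index sequence \<open>s\<close>.
\<close>

definition compatible :: "nat \<Rightarrow> (nat \<Rightarrow> nat) \<Rightarrow> (nat \<Rightarrow> nat) \<Rightarrow> bool" where
  "compatible n s \<sigma> \<longleftrightarrow> (\<forall>k\<in>{1..<n} \<inter> DEX n \<sigma>. s (k + 1) < s k)"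

lemma coef_sum_fund_qsym:
  assumes "decr n s" "\<forall>k\<in>{1..n}. 1 \<le> s k" "finite A"
  shows "coef (\<Sum>\<sigma>\<in>A. fund_qsym (DEX n \<sigma>) n :: 'a :: comm_ring_1 pseries) (content n s) = of_nat (card {\<sigma>\<in>A. compatible n s \<sigma>})"
  using assms(3) unfolding coef_sum coef_fund_qsym[OF assms(1,2)] compatible_def[symmetric]
  by (simp add: sum.If_cases Int_def)

text \<open>
  The comparison of the letters of \<open>bar_word\<close> at \<open>p\<close> and
  \<open>q\<close>, with excedances recognized without reference to \<open>n\<close>.
\<close>

definition bar_less :: "(nat \<Rightarrow> nat) \<Rightarrow> nat \<Rightarrow> nat \<Rightarrow> bool" where
  "bar_less \<sigma> p q \<longleftrightarrow> (p < \<sigma> p \<and> \<not> q < \<sigma> q) \<or> ((p < \<sigma> p \<longleftrightarrow> q < \<sigma> q) \<and> \<sigma> p < \<sigma> q)"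

lemma letter_less_bar_word:
  assumes "\<sigma> permutes {1..n}" "p \<in> {1..n}" "q \<in> {1..n}"
  shows "letter_less (bar_word n \<sigma> p) (bar_word n \<sigma> q) \<longleftrightarrow> bar_less \<sigma> p q"
proof -
  have "\<sigma> k \<le> n" if "k \<in> {1..n}" for k using permutes_in_image[OF assms(1), of k] that by auto
  then have "k \<in> EXC n \<sigma> \<longleftrightarrow> k < \<sigma> k" if "k \<in> {1..n}" for k
    using that by (force simp: EXC_def)
  then show ?thesis using assms(2,3) by (auto simp: bar_word_def bar_less_def)
qed

text \<open>
  Positions with the same label form an interval, on which the barred word must not descend at any
  adjacent pair; since its letters are distinct, it increases along the interval.
\<close>

lemma compatible_iff:
  assumes "decr n s" "\<sigma> permutes {1..n}"
  shows "compatible n s \<sigma> \<longleftrightarrow> (\<forall>p q. 1 \<le> p \<longrightarrow> p < q \<longrightarrow> q \<le> n \<longrightarrow> s p = s q \<longrightarrow> bar_less \<sigma> p q)"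
proof
  assume comp: "compatible n s \<sigma>"
  have *: "bar_less \<sigma> k (Suc k)" if "1 \<le> k" "Suc k \<le> n" "s k = s (Suc k)" for k
  proof -
    have "k \<notin> DEX n \<sigma>" using comp that by (force simp: compatible_def)
    then have "\<not> bar_less \<sigma> (Suc k) k"
      using that letter_less_bar_word[OF assms(2), of "Suc k" k] by (auto simp: DEX_def)
    moreover have "\<sigma> k \<noteq> \<sigma> (Suc k)" using inj_eq[OF permutes_inj[OF assms(2)], of k "Suc k"] by simp
    ultimately show ?thesis by (auto simp: bar_less_def)
  qed
  have "bar_less \<sigma> p q" if "1 \<le> p" "Suc p \<le> q" "q \<le> n" "s p = s q" for p q
    using that(2,3,4)
  proof (induction q rule: dec_induct)
    case base
    then show ?case using *[of p] that(1) by simp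
  next
    case (step k)
    have "s k = s p" "s (Suc k) = s k"
      using decrD[OF assms(1), of p k] decrD[OF assms(1), of k "Suc k"] step that(1) by auto
    then have "bar_less \<sigma> p k" "bar_less \<sigma> k (Suc k)" using step *[of k] that(1) by auto
    then show ?case by (auto simp: bar_less_def)
  qed
  then show "\<forall>p q. 1 \<le> p \<longrightarrow> p < q \<longrightarrow> q \<le> n \<longrightarrow> s p = s q \<longrightarrow> bar_less \<sigma> p q" by auto
next
  assume r: "\<forall>p q. 1 \<le> p \<longrightarrow> p < q \<longrightarrow> q \<le> n \<longrightarrow> s p = s q \<longrightarrow> bar_less \<sigma> p q"
  show "compatible n s \<sigma>"
    unfolding compatible_def
  proof
    fix k assume k: "k \<in> {1..<n} \<inter> DEX n \<sigma>"
    then have "bar_less \<sigma> (Suc k) k"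
      using letter_less_bar_word[OF assms(2), of "Suc k" k] by (auto simp: DEX_def)
    then have "\<not> bar_less \<sigma> k (Suc k)" by (auto simp: bar_less_def)
    then have "s k \<noteq> s (Suc k)" using r k by auto
    then show "s (k + 1) < s k" using decrD[OF assms(1), of k "Suc k"] k by auto
  qed
qed

section \<open>Ranks in finite strict orders\<close>

definition strict_order_on :: "'b set \<Rightarrow> ('b \<Rightarrow> 'b \<Rightarrow> bool) \<Rightarrow> bool" where
  "strict_order_on A r \<longleftrightarrow> (\<forall>x\<in>A. \<not> r x x) \<and> (\<forall>x\<in>A. \<forall>y\<in>A. \<forall>z\<in>A. r x y \<longrightarrow> r y z \<longrightarrow> r x z) \<and>
     (\<forall>x\<in>A. \<forall>y\<in>A. x \<noteq> y \<longrightarrow> r x y \<or> r y x)"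

text \<open>
  Ranks start at 1, so that the rank in a set of cardinality \<open>n\<close> is a position in
  \<open>{1..n}\<close>.
\<close>

definition rank :: "('b \<Rightarrow> 'b \<Rightarrow> bool) \<Rightarrow> 'b set \<Rightarrow> 'b \<Rightarrow> nat" where
  "rank r A x = Suc (card {y\<in>A. r y x})"

lemma rank_less:
  assumes "strict_order_on A r" "finite A" "x \<in> A" "y \<in> A"
  shows "rank r A x < rank r A y \<longleftrightarrow> r x y"
proof -
  note o = assms(1)[unfolded strict_order_on_def]
  have *: "rank r A x < rank r A y" if "r x y" "x \<in> A" "y \<in> A" for x y
    unfolding rank_def Suc_less_eq
  proof (rule psubset_card_mono)
    show "{z \<in> A. r z x} \<subset> {z \<in> A. r z y}" using o that by blast
  qed (use assms in simp)
  show ?thesis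
  proof
    assume l: "rank r A x < rank r A y"
    then have "x \<noteq> y" by auto
    then have "r x y \<or> r y x" using o assms(3,4) by blast
    then show "r x y" using *[of y x] assms(3,4) l by linarith
  qed (use * assms in blast)
qed

lemma rank_bij:
  assumes "strict_order_on A r" "finite A"
  shows "bij_betw (rank r A) A {1..card A}"
proof -
  have inj: "inj_on (rank r A) A"
  proof (rule inj_onI, rule ccontr)
    fix x y assume xy: "x \<in> A" "y \<in> A" "rank r A x = rank r A y" "x \<noteq> y"
    then have "r x y \<or> r y x" using assms(1) unfolding strict_order_on_def by blast
    then show False using rank_less[OF assms] xy by (metis less_irrefl)
  qed
  have "rank r A ` A \<subseteq> {1..card A}"
  proof
    fix k assume "k \<in> rank r A ` A"
    then obtain x where x: "x \<in> A" "k = rank r A x" by auto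
    have "\<not> r x x" using assms(1) x(1) unfolding strict_order_on_def by blast
    then have "{y\<in>A. r y x} \<subset> A" using x(1) by blast
    then have "card {y\<in>A. r y x} < card A" using assms(2) by (rule psubset_card_mono[rotated])
    then show "k \<in> {1..card A}" using x by (auto simp: rank_def)
  qed
  moreover have "card (rank r A ` A) = card {1..card A}" using card_image[OF inj] by simp
  ultimately have "rank r A ` A = {1..card A}" by (intro card_subset_eq) auto
  then show ?thesis using inj by (simp add: bij_betw_def)
qed

lemma rank_unique:
  assumes "bij_betw \<tau> A {1..card A}" "finite A" "\<And>x y. x \<in> A \<Longrightarrow> y \<in> A \<Longrightarrow> r x y \<longleftrightarrow> \<tau> x < \<tau> y" "x \<in> A"
  shows "\<tau> x = rank r A x"
proof -
  have "{y\<in>A. r y x} = {y\<in>A. \<tau> y < \<tau> x}" using assms(3,4) by blast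
  then have "card {y\<in>A. r y x} = card {y\<in>A. \<tau> y < \<tau> x}" by simp
  also have "card {y\<in>A. \<tau> y < \<tau> x} = card (\<tau> ` {y\<in>A. \<tau> y < \<tau> x})"
    using assms(1) by (intro card_image[symmetric]) (auto simp: bij_betw_def inj_on_def)
  also have "\<tau> ` {y\<in>A. \<tau> y < \<tau> x} = {1..<\<tau> x}"
  proof -
    have "\<tau> x \<le> card A" using assms(1,4) by (force simp: bij_betw_def)
    have "k \<in> \<tau> ` {y\<in>A. \<tau> y < \<tau> x}" if "k \<in> {1..<\<tau> x}" for k
    proof -
      have "k \<in> \<tau> ` A" using that \<open>\<tau> x \<le> card A\<close> assms(1) by (auto simp: bij_betw_def)
      then show ?thesis using that by auto
    qed
    moreover have "\<tau> y \<ge> 1" if "y \<in> A" for y using assms(1) that by (force simp: bij_betw_def)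
    ultimately show ?thesis by auto
  qed
  finally have "card {y\<in>A. r y x} = \<tau> x - 1" by simp
  moreover have "\<tau> x \<ge> 1" using assms(1,4) by (force simp: bij_betw_def)
  ultimately show ?thesis by (simp add: rank_def)
qed

text \<open>
  Listing the elements of \<open>A\<close> by rank puts their labels into weakly decreasing order,
  and \<open>s\<close> is the only such arrangement of them.
\<close>

lemma label_rank:
  assumes o: "strict_order_on A r" "finite A" and s: "decr (card A) s"
    and lab: "\<And>x y. x \<in> A \<Longrightarrow> y \<in> A \<Longrightarrow> r x y \<Longrightarrow> lab y \<le> lab x"
    and cont: "image_mset lab (mset_set A) = content (card A) s" and x: "x \<in> A"
  shows "s (rank r A x) = lab x"
proof -
  note bij = rank_bij[OF o]
  define g where "g = lab \<circ> the_inv_into A (rank r A)"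
  have g: "g (rank r A y) = lab y" if "y \<in> A" for y
    using that bij by (simp add: g_def the_inv_into_f_f bij_betw_def)
  have "decr (card A) g"
    unfolding decr_def
  proof (intro allI impI)
    fix p q assume pq: "1 \<le> p" "p \<le> q" "q \<le> card A"
    then have "p \<in> rank r A ` A" "q \<in> rank r A ` A" using bij by (auto simp: bij_betw_def)
    then obtain y z where yz: "y \<in> A" "z \<in> A" "p = rank r A y" "q = rank r A z" by auto
    show "g q \<le> g p"
    proof (cases "y = z")
      case False
      then have "r y z \<or> r z y" using o(1) yz unfolding strict_order_on_def by blast
      moreover have "\<not> r z y" using rank_less[OF o yz(2,1)] yz pq by simp
      ultimately have "r y z" by blast
      then show ?thesis using lab yz g by auto
    qed (use yz in auto)
  qed
  moreover have "content (card A) g = content (card A) s"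
  proof -
    have "content (card A) g = image_mset g (image_mset (rank r A) (mset_set A))"
      using bij by (simp add: content_def bij_betw_def image_mset_mset_set)
    also have "\<dots> = image_mset lab (mset_set A)"
      using g o(2) by (auto simp: image_mset.compositionality intro!: image_mset_cong)
    finally show ?thesis using cont by simp
  qed
  moreover have "rank r A x \<in> {1..card A}" using bij x by (auto simp: bij_betw_def)
  ultimately show ?thesis using decr_unique[of "card A" g s] s g[OF x] by metis
qed

text \<open>
  Families of fillings and of banners are compared by generating polynomials in which the exponent
  counts red letters.
\<close>

abbreviation tvar :: "int poly" where "tvar \<equiv> monom 1 1"

lemma coeff_gen_poly: "finite X \<Longrightarrow> poly.coeff (\<Sum>x\<in>X. tvar ^ f x) i = int (card {x\<in>X. f x = i})"
  by (simp add: coeff_sum monom_power coeff_monom sum.If_cases Int_def)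

section \<open>Banners and marked blocks\<close>

text \<open>
  The second component of a letter is its colour, and \<open>True\<close> stands for red. The
  colour records how the letter compares with the preceding one: a red letter is at least as
  large, a blue one at most as large. Both colours are possible for equal letters. The first
  letter of a banner is blue by convention.
\<close>

definition banner_step :: "nat \<times> bool \<Rightarrow> nat \<times> bool \<Rightarrow> bool" where
  "banner_step x y \<longleftrightarrow> (if snd y then fst x \<le> fst y else fst y \<le> fst x)"

definition banner :: "(nat \<times> bool) list \<Rightarrow> bool" where
  "banner u \<longleftrightarrow> (u \<noteq> [] \<longrightarrow> \<not> snd (hd u)) \<and> successively banner_step u"

definition reds :: "(nat \<times> bool) list \<Rightarrow> nat" where
  "reds u = length (filter snd u)"

definition banners :: "nat multiset \<Rightarrow> nat \<Rightarrow> (nat \<times> bool) list set" where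
  "banners M i = {u. mset (map fst u) = M \<and> banner u \<and> reds u = i}"

text \<open>
  A sequence of disjoint submultisets of \<open>M\<close>, each with a mark strictly between 0 and
  its size. The letters outside these blocks form a rest without a mark, which may be empty.
\<close>

definition marked_seqs :: "nat multiset \<Rightarrow> nat \<Rightarrow> (nat multiset \<times> nat) list set" where
  "marked_seqs M i = {L. (\<forall>(K,b)\<in>set L. 1 \<le> b \<and> b < size K) \<and>
     sum_list (map fst L) \<subseteq># M \<and> sum_list (map snd L) = i}"

definition marked_blocks :: "nat multiset \<Rightarrow> nat \<Rightarrow> (nat multiset \<times> nat) set" where
  "marked_blocks M i = {(K,b). K \<subseteq># M \<and> 1 \<le> b \<and> b < size K \<and> b \<le> i}"

abbreviation "blue \<equiv> map (\<lambda>x. (x :: nat, False))"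
abbreviation "red \<equiv> map (\<lambda>x. (x :: nat, True))"

lemma reds_simps [simp]: "reds [] = 0" "reds (blue xs) = 0" "reds (red xs) = length xs" "reds (u @ v) = reds u + reds v"
  by (auto simp: reds_def filter_map o_def)

lemma successively_blue: "successively banner_step (blue xs) \<longleftrightarrow> sorted_wrt (\<ge>) xs"
  by (simp add: successively_map banner_step_def successively_conv_sorted_wrt[OF transp_on_ge])

lemma successively_red: "successively banner_step (red xs) \<longleftrightarrow> sorted xs"
  by (simp add: successively_map banner_step_def successively_conv_sorted_wrt[OF transp_on_le])

lemma sorted_le_last: "sorted xs \<Longrightarrow> x \<in> set xs \<Longrightarrow> x \<le> last xs" for x :: nat
  by (induction xs) auto

lemma list_eq_blue: "(\<forall>x\<in>set u. \<not> snd x) \<Longrightarrow> u = blue (map fst u)"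
  by (induction u) auto

lemma list_eq_red: "(\<forall>x\<in>set u. snd x) \<Longrightarrow> u = red (map fst u)"
  by (induction u) auto

lemma image_fst_tag [simp]: "image_mset fst {#(x, c). x \<in># M#} = M"
  by (induction M) auto

text \<open>
  A banner with a red letter is cut as \<open>blue Z1 @ blue Z2 @ red A @ R\<close>. Here
  \<open>Z1 @ Z2\<close> is the initial blue run, \<open>Z2\<close> consisting of its letters that
  do not exceed the first red letter, and \<open>A\<close> consists of the red letters that
  follow, as long as they are smaller than all of \<open>Z1\<close>. The letters of
  \<open>Z2\<close> and \<open>A\<close> form a block with mark \<open>length A\<close>. The
  conditions express that \<open>blue Z1 @ R\<close> is again a banner and that the place of the
  cut can be found from it.
\<close>

definition split_ok :: "nat list \<Rightarrow> nat list \<Rightarrow> nat list \<Rightarrow> (nat \<times> bool) list \<Rightarrow> bool" where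
  "split_ok Z1 Z2 A R \<longleftrightarrow> sorted_wrt (\<ge>) (Z1 @ Z2) \<and> Z2 \<noteq> [] \<and> A \<noteq> [] \<and> sorted A \<and>
     (\<forall>x\<in>set Z2. x \<le> hd A) \<and> (\<forall>x\<in>set Z1. last A < x) \<and> successively banner_step R \<and>
     (R \<noteq> [] \<longrightarrow> (if snd (hd R) then Z1 \<noteq> [] \<and> last Z1 \<le> fst (hd R) else fst (hd R) \<le> last A))"

lemma split_ok_banner:
  assumes "split_ok Z1 Z2 A R"
  shows "banner (blue Z1 @ blue Z2 @ red A @ R)" "banner (blue Z1 @ R)"
proof -
  note ok = assms[unfolded split_ok_def]
  have s: "successively banner_step (blue (Z1 @ Z2))" "successively banner_step (red A)"
    using ok by (auto simp: successively_blue successively_red simp del: map_append)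
  have "successively banner_step (blue Z1)"
    using ok by (auto simp: successively_blue sorted_wrt_append)
  have lz: "Z1 \<noteq> [] \<Longrightarrow> last A < last Z1" using ok by auto
  then have lz': "Z1 \<noteq> [] \<Longrightarrow> last Z1 \<le> n \<Longrightarrow> last A \<le> n" for n by fastforce
  have lz'': "Z1 \<noteq> [] \<Longrightarrow> n \<le> last A \<Longrightarrow> n \<le> last Z1" for n using lz by fastforce
  have "banner_step (last (blue (Z1 @ Z2))) (hd (red A))"
    using ok by (auto simp: banner_step_def last_map hd_map)
  moreover have "R \<noteq> [] \<Longrightarrow> banner_step (last (red A)) (hd R)"
    using ok lz' by (auto simp: banner_step_def last_map split: if_splits)
  ultimately have "successively banner_step (blue (Z1 @ Z2) @ red A @ R)"
    unfolding successively_append_iff using s ok by auto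
  moreover have "\<not> snd (hd (blue (Z1 @ Z2) @ red A @ R))"
    using ok by (cases "Z1 @ Z2") auto
  ultimately show "banner (blue Z1 @ blue Z2 @ red A @ R)" by (simp add: banner_def)
  have "Z1 \<noteq> [] \<Longrightarrow> R \<noteq> [] \<Longrightarrow> banner_step (last (blue Z1)) (hd R)"
    using ok lz' lz'' by (auto simp: banner_step_def last_map split: if_splits)
  then have "successively banner_step (blue Z1 @ R)"
    unfolding successively_append_iff using \<open>successively banner_step (blue Z1)\<close> ok by auto
  moreover have "blue Z1 @ R \<noteq> [] \<Longrightarrow> \<not> snd (hd (blue Z1 @ R))"
    using ok by (cases Z1) (auto split: if_splits)
  ultimately show "banner (blue Z1 @ R)" by (simp add: banner_def)
qed

text \<open>
  The \<open>b\<close> largest letters of the block become red and the others blue, and the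
  initial blue letters of \<open>u\<close> that exceed the whole block stay in front of it.
\<close>

definition insert_block :: "(nat multiset \<times> nat) \<times> (nat \<times> bool) list \<Rightarrow> (nat \<times> bool) list" where
  "insert_block = (\<lambda>((K, b), u). let s = sorted_list_of_multiset K; k = size K - b;
      p = (\<lambda>x. \<not> snd x \<and> last s < fst x) in
      takeWhile p u @ blue (rev (take k s)) @ red (drop k s) @ dropWhile p u)"

definition extract_block :: "(nat \<times> bool) list \<Rightarrow> (nat multiset \<times> nat) \<times> (nat \<times> bool) list" where
  "extract_block u = (let Z = takeWhile (\<lambda>x. \<not> snd x) u; V = dropWhile (\<lambda>x. \<not> snd x) u;
      Z1 = takeWhile (\<lambda>x. fst (hd V) < fst x) Z; Z2 = dropWhile (\<lambda>x. fst (hd V) < fst x) Z;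
      q = (\<lambda>x. snd x \<and> (Z1 = [] \<or> fst x < fst (last Z1)));
      A = takeWhile q V
    in ((mset (map fst Z2) + mset (map fst A), length A), Z1 @ dropWhile q V))"

lemma takeWhile_append_exact:
  assumes "\<forall>x\<in>set xs. p x" "ys \<noteq> [] \<Longrightarrow> \<not> p (hd ys)"
  shows "takeWhile p (xs @ ys) = xs" "dropWhile p (xs @ ys) = ys"
  using assms by (cases ys; simp add: takeWhile_append dropWhile_append)+

lemma extract_block_split:
  assumes "split_ok Z1 Z2 A R"
  shows "extract_block (blue Z1 @ blue Z2 @ red A @ R) = ((mset Z2 + mset A, length A), blue Z1 @ R)"
proof -
  note ok = assms[unfolded split_ok_def]
  let ?u = "blue Z1 @ blue Z2 @ red A @ R"
  have "\<forall>x\<in>set (blue Z1 @ blue Z2). \<not> snd x" by auto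
  moreover have "red A @ R \<noteq> [] \<Longrightarrow> \<not> \<not> snd (hd (red A @ R))" using ok by (cases A) auto
  ultimately have 1: "takeWhile (\<lambda>x. \<not> snd x) ?u = blue Z1 @ blue Z2" "dropWhile (\<lambda>x. \<not> snd x) ?u = red A @ R"
    using takeWhile_append_exact[of "blue Z1 @ blue Z2" "\<lambda>x. \<not> snd x" "red A @ R"] by auto
  have hdA: "fst (hd (red A @ R)) = hd A" using ok by (cases A) auto
  have "hd A \<le> last A" using ok by (cases A) auto
  then have "\<forall>x\<in>set (blue Z1). hd A < fst x" using ok by fastforce
  moreover have "\<not> hd A < fst (hd (blue Z2))" using ok by (cases Z2) auto
  ultimately have 2: "takeWhile (\<lambda>x. hd A < fst x) (blue Z1 @ blue Z2) = blue Z1"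
    "dropWhile (\<lambda>x. hd A < fst x) (blue Z1 @ blue Z2) = blue Z2"
    using takeWhile_append_exact[of "blue Z1" "\<lambda>x. hd A < fst x" "blue Z2"] by auto
  let ?q = "\<lambda>x. snd x \<and> (blue Z1 = [] \<or> fst x < fst (last (blue Z1)))"
  have "x < last Z1" if "x \<in> set A" "Z1 \<noteq> []" for x
  proof -
    have "x \<le> last A" using ok that(1) by (simp add: sorted_le_last)
    also have "\<dots> < last Z1" using ok that by auto
    finally show ?thesis .
  qed
  then have "\<forall>x\<in>set (red A). ?q x" by (auto simp: last_map)
  moreover have "R \<noteq> [] \<Longrightarrow> \<not> ?q (hd R)" using ok by (auto simp: last_map split: if_splits)
  ultimately have 3: "takeWhile ?q (red A @ R) = red A" "dropWhile ?q (red A @ R) = R"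
    using takeWhile_append_exact[of "red A" ?q R] by auto
  show ?thesis
    unfolding extract_block_def Let_def 1 hdA 2 3 by (simp add: o_def)
qed

lemma insert_block_split:
  assumes "split_ok Z1 Z2 A R"
  shows "insert_block ((mset Z2 + mset A, length A), blue Z1 @ R) = blue Z1 @ blue Z2 @ red A @ R"
proof -
  note ok = assms[unfolded split_ok_def]
  have "sorted (rev Z2 @ A)"
  proof -
    have "sorted (rev Z2)" using ok by (simp add: sorted_wrt_append sorted_wrt_rev)
    moreover have "x \<le> y" if "x \<in> set Z2" "y \<in> set A" for x y
    proof -
      have "hd A \<le> y" using ok that by (cases A) auto
      then show ?thesis using ok that by fastforce
    qed
    ultimately show ?thesis using ok by (auto simp: sorted_append)
  qed
  then have s: "sorted_list_of_multiset (mset Z2 + mset A) = rev Z2 @ A"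
    by (metis mset_append mset_rev sorted_list_of_multiset_mset sorted_sort_id)
  have l: "last (rev Z2 @ A) = last A" using ok by simp
  let ?p = "\<lambda>x. \<not> snd x \<and> last A < fst x"
  have "\<forall>x\<in>set (blue Z1). ?p x" using ok by auto
  moreover have "R \<noteq> [] \<Longrightarrow> \<not> ?p (hd R)" using ok by (auto split: if_splits)
  ultimately have 3: "takeWhile ?p (blue Z1 @ R) = blue Z1" "dropWhile ?p (blue Z1 @ R) = R"
    using takeWhile_append_exact[of "blue Z1" ?p R] by auto
  show ?thesis
    unfolding insert_block_def Let_def prod.case s l 3 by simp
qed

lemma banner_split_exists:
  assumes "banner u" "reds u > 0"
  obtains Z1 Z2 A R where "split_ok Z1 Z2 A R" "u = blue Z1 @ blue Z2 @ red A @ R"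
proof -
  define Z where "Z = map fst (takeWhile (\<lambda>x. \<not> snd x) u)"
  define V where "V = dropWhile (\<lambda>x. \<not> snd x) u"
  have "takeWhile (\<lambda>x. \<not> snd x) u = blue Z"
    unfolding Z_def by (rule list_eq_blue) (auto dest: set_takeWhileD)
  then have u: "u = blue Z @ V" unfolding V_def by (metis takeWhile_dropWhile_id)
  have "V \<noteq> []" using assms(2) u by auto
  then have hV: "snd (hd V)" unfolding V_def by (metis hd_dropWhile)
  have "Z \<noteq> []" using assms(1) u hV \<open>V \<noteq> []\<close> by (auto simp: banner_def)
  define B where "B = map fst (takeWhile snd V)"
  define W where "W = dropWhile snd V"
  have "takeWhile snd V = red B"
    unfolding B_def by (rule list_eq_red) (auto dest: set_takeWhileD)
  then have V: "V = red B @ W" unfolding W_def by (metis takeWhile_dropWhile_id)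
  have hW: "W \<noteq> [] \<Longrightarrow> \<not> snd (hd W)" unfolding W_def by (metis hd_dropWhile)
  have "B \<noteq> []" using V hV hW \<open>V \<noteq> []\<close> by auto
  have succ: "successively banner_step (blue Z @ red B @ W)" using assms(1) u V by (simp add: banner_def)
  have sZ: "sorted_wrt (\<ge>) Z" using succ by (auto simp: successively_append_iff successively_blue)
  have sB: "sorted B" using succ by (auto simp: successively_append_iff successively_red)
  have sW: "successively banner_step W" using succ by (auto simp: successively_append_iff)
  have ZB: "last Z \<le> hd B"
    using succ \<open>Z \<noteq> []\<close> \<open>B \<noteq> []\<close> by (auto simp: successively_append_iff banner_step_def last_map hd_map)
  have BW: "fst (hd W) \<le> last B" if "W \<noteq> []"
    using succ hW[OF that] that \<open>B \<noteq> []\<close> by (auto simp: successively_append_iff banner_step_def last_map)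
  define Z1 where "Z1 = takeWhile (\<lambda>x. hd B < x) Z"
  define Z2 where "Z2 = dropWhile (\<lambda>x. hd B < x) Z"
  have Z: "Z = Z1 @ Z2" by (simp add: Z1_def Z2_def)
  have "Z2 \<noteq> []" unfolding Z2_def using ZB \<open>Z \<noteq> []\<close> by (auto simp: dropWhile_eq_Nil_conv not_less intro!: bexI[of _ "last Z"])
  then have "\<not> hd B < hd Z2" unfolding Z2_def by (metis hd_dropWhile)
  moreover have "sorted_wrt (\<ge>) Z2" using sZ Z by (simp add: sorted_wrt_append)
  ultimately have Z2B: "\<forall>x\<in>set Z2. x \<le> hd B" using \<open>Z2 \<noteq> []\<close> by (cases Z2) auto
  define q where "q = (\<lambda>x. Z1 = [] \<or> x < last Z1)"
  define A where "A = takeWhile q B"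
  define R where "R = red (dropWhile q B) @ W"
  have B: "B = A @ dropWhile q B" by (simp add: A_def)
  have Z1B: "\<forall>x\<in>set Z1. hd B < x" unfolding Z1_def by (auto dest: set_takeWhileD)
  then have "q (hd B)" using last_in_set[of Z1] by (cases "Z1 = []") (auto simp: q_def)
  then have "A \<noteq> []" and hA: "hd A = hd B" unfolding A_def using \<open>B \<noteq> []\<close> by (cases B; simp)+
  have sA: "sorted A" using sB B by (metis sorted_append)
  have A: "q x" if "x \<in> set A" for x using that unfolding A_def by (auto dest: set_takeWhileD)
  have Z1A: "\<forall>x\<in>set Z1. last A < x"
  proof
    fix x assume x: "x \<in> set Z1"
    then have "last A < last Z1" using A[OF last_in_set[OF \<open>A \<noteq> []\<close>]] by (auto simp: q_def)
    also have "last Z1 \<le> x"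
    proof -
      have "sorted_wrt (\<ge>) Z1" using sZ Z by (simp add: sorted_wrt_append)
      moreover have "Z1 \<noteq> []" using x by auto
      ultimately show ?thesis using x by (induction Z1) auto
    qed
    finally show "last A < x" .
  qed
  have "successively banner_step R"
    unfolding R_def using succ B by (metis append_assoc map_append successively_append_iff)
  moreover have "R \<noteq> [] \<longrightarrow> (if snd (hd R) then Z1 \<noteq> [] \<and> last Z1 \<le> fst (hd R) else fst (hd R) \<le> last A)"
  proof (cases "dropWhile q B")
    case Nil
    then have "A = B" using B by (metis append_Nil2)
    moreover have "R = W" using Nil unfolding R_def by (simp only: list.map append_Nil)
    ultimately show ?thesis using hW BW by simp
  next
    case (Cons y ys)
    then have "\<not> q y" by (metis hd_dropWhile list.distinct(1) list.sel(1))
    then show ?thesis using Cons by (auto simp: R_def q_def)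
  qed
  ultimately have "split_ok Z1 Z2 A R"
    unfolding split_ok_def using sZ Z \<open>Z2 \<noteq> []\<close> \<open>A \<noteq> []\<close> sA Z2B hA Z1A by simp
  moreover have "red B = red A @ red (dropWhile q B)" using B by (metis map_append)
  then have "u = blue Z1 @ blue Z2 @ red A @ R" using u V Z by (simp add: R_def)
  ultimately show ?thesis by (rule that)
qed

lemma insert_split_exists:
  assumes "banner u" "1 \<le> b" "b < size K"
  obtains Z1 Z2 A R where "split_ok Z1 Z2 A R" "u = blue Z1 @ R" "K = mset Z2 + mset A" "b = length A"
proof -
  define s where "s = sorted_list_of_multiset K"
  define k where "k = size K - b"
  define A where "A = drop k s"
  define Z2 where "Z2 = rev (take k s)"
  have ms: "mset s = K" and ss: "sorted s" by (auto simp: s_def)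
  then have ls: "length s = size K" by (metis size_mset)
  have k: "0 < k" "k < length s" using assms ls by (auto simp: k_def)
  have lA: "length A = b" using assms ls by (auto simp: A_def k_def)
  have "A \<noteq> []" using lA assms by auto
  have "Z2 \<noteq> []" using k by (auto simp: Z2_def)
  have s: "s = rev Z2 @ A" by (simp add: A_def Z2_def)
  have K: "K = mset Z2 + mset A" using ms s by auto
  have lastA: "last A = last s" using s \<open>A \<noteq> []\<close> by simp
  have so: "sorted (rev Z2)" "sorted A" "\<And>x y. x \<in> set Z2 \<Longrightarrow> y \<in> set A \<Longrightarrow> x \<le> y"
    using ss s by (auto simp: sorted_append)
  define p where "p = (\<lambda>x :: nat \<times> bool. \<not> snd x \<and> last A < fst x)"
  define Z1 where "Z1 = map fst (takeWhile p u)"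
  define R where "R = dropWhile p u"
  have "takeWhile p u = blue Z1"
    unfolding Z1_def by (rule list_eq_blue) (auto dest: set_takeWhileD simp: p_def)
  then have u: "u = blue Z1 @ R" unfolding R_def by (metis takeWhile_dropWhile_id)
  have Z1A: "\<forall>x\<in>set Z1. last A < x" unfolding Z1_def by (auto dest: set_takeWhileD simp: p_def)
  have succ: "successively banner_step (blue Z1 @ R)" using assms(1) u by (simp add: banner_def)
  then have sR: "successively banner_step R" and sZ1: "sorted_wrt (\<ge>) Z1"
    by (auto simp: successively_append_iff successively_blue)
  have "R \<noteq> [] \<longrightarrow> (if snd (hd R) then Z1 \<noteq> [] \<and> last Z1 \<le> fst (hd R) else fst (hd R) \<le> last A)"
  proof
    assume R: "R \<noteq> []"
    have np: "\<not> p (hd R)" using R unfolding R_def by (metis hd_dropWhile)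
    show "if snd (hd R) then Z1 \<noteq> [] \<and> last Z1 \<le> fst (hd R) else fst (hd R) \<le> last A"
    proof (cases "snd (hd R)")
      case True
      then have "Z1 \<noteq> []" using assms(1) u R by (auto simp: banner_def)
      moreover have "banner_step (last (blue Z1)) (hd R)"
        using succ R \<open>Z1 \<noteq> []\<close> by (auto simp: successively_append_iff)
      ultimately show ?thesis using True by (auto simp: banner_step_def last_map)
    next
      case False
      then show ?thesis using np by (auto simp: p_def)
    qed
  qed
  moreover have "sorted_wrt (\<ge>) (Z1 @ Z2)"
  proof -
    have "x \<ge> y" if "x \<in> set Z1" "y \<in> set Z2" for x y
      using Z1A that so(3)[OF that(2) last_in_set[OF \<open>A \<noteq> []\<close>]] by fastforce
    then show ?thesis using sZ1 so(1) by (auto simp: sorted_wrt_append sorted_wrt_rev)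
  qed
  ultimately have "split_ok Z1 Z2 A R"
    unfolding split_ok_def using \<open>A \<noteq> []\<close> \<open>Z2 \<noteq> []\<close> so Z1A sR by auto
  then show ?thesis using that u K lA by blast
qed

text \<open>
  Banners with a red letter satisfy the recursion by which nonempty marked sequences are built
  from their first block.
\<close>

lemma bij_insert_block:
  assumes "i > 0"
  shows "bij_betw insert_block (SIGMA p:marked_blocks M i. banners (M - fst p) (i - snd p)) (banners M i)"
    (is "bij_betw _ ?S _")
proof (rule bij_betw_byWitness[where f' = extract_block])
  have ins: "\<exists>Z1 Z2 A R. split_ok Z1 Z2 A R \<and> x = ((mset Z2 + mset A, length A), blue Z1 @ R)" if "x \<in> ?S" for x
  proof -
    obtain K b u where x: "x = ((K, b), u)" by (metis prod.exhaust)
    then have "banner u" "1 \<le> b" "b < size K" using that by (auto simp: marked_blocks_def banners_def)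
    from insert_split_exists[OF this] show ?thesis unfolding x by metis
  qed
  have ext: "\<exists>Z1 Z2 A R. split_ok Z1 Z2 A R \<and> u = blue Z1 @ blue Z2 @ red A @ R" if "u \<in> banners M i" for u
    using banner_split_exists[of u] that assms by (auto simp: banners_def) metis
  show "\<forall>x\<in>?S. extract_block (insert_block x) = x"
  proof
    fix x assume "x \<in> ?S"
    then obtain Z1 Z2 A R where s: "split_ok Z1 Z2 A R" and x: "x = ((mset Z2 + mset A, length A), blue Z1 @ R)"
      using ins by blast
    show "extract_block (insert_block x) = x"
      unfolding x insert_block_split[OF s] extract_block_split[OF s] ..
  qed
  show "\<forall>u\<in>banners M i. insert_block (extract_block u) = u"
  proof
    fix u assume "u \<in> banners M i"
    then obtain Z1 Z2 A R where s: "split_ok Z1 Z2 A R" and u: "u = blue Z1 @ blue Z2 @ red A @ R"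
      using ext by blast
    show "insert_block (extract_block u) = u"
      unfolding u insert_block_split[OF s] extract_block_split[OF s] ..
  qed
  show "insert_block ` ?S \<subseteq> banners M i"
  proof safe
    fix K b u assume *: "(K, b) \<in> marked_blocks M i" "u \<in> banners (M - fst (K, b)) (i - snd (K, b))"
    then obtain Z1 Z2 A R where s: "split_ok Z1 Z2 A R" "((K, b), u) = ((mset Z2 + mset A, length A), blue Z1 @ R)"
      using ins[of "((K, b), u)"] by auto
    then have e: "insert_block ((K, b), u) = blue Z1 @ blue Z2 @ red A @ R" using insert_block_split by metis
    have m: "mset (map fst u) = M - K" "K \<subseteq># M" "reds u = i - b" "b \<le> i"
      using * by (auto simp: marked_blocks_def banners_def)
    then have "mset (map fst u) + K = M" by simp
    then show "insert_block ((K, b), u) \<in> banners M i"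
      unfolding e banners_def using split_ok_banner(1)[OF s(1)] s(2) m(3,4) by (auto simp: ac_simps)
  qed
  show "extract_block ` banners M i \<subseteq> ?S"
  proof
    fix y assume "y \<in> extract_block ` banners M i"
    then obtain u where u: "u \<in> banners M i" "y = extract_block u" by auto
    from ext[OF u(1)] obtain Z1 Z2 A R where s: "split_ok Z1 Z2 A R" "u = blue Z1 @ blue Z2 @ red A @ R" by auto
    then have y: "y = ((mset Z2 + mset A, length A), blue Z1 @ R)" using u extract_block_split by metis
    have ne: "Z2 \<noteq> []" "A \<noteq> []" using s(1) by (auto simp: split_ok_def)
    have M: "M = mset Z1 + mset Z2 + mset A + mset (map fst R)" and i: "i = length A + reds R"
      using u(1) s(2) by (auto simp: banners_def o_def)
    have "(mset Z2 + mset A, length A) \<in> marked_blocks M i"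
      using ne by (cases A; cases Z2) (auto simp: marked_blocks_def M i)
    moreover have "blue Z1 @ R \<in> banners (M - (mset Z2 + mset A)) (i - length A)"
      using split_ok_banner(2)[OF s(1)] by (auto simp: banners_def M i o_def)
    ultimately show "y \<in> ?S" unfolding y by simp
  qed
qed

lemma banners_zero: "banners M 0 = {blue (rev (sorted_list_of_multiset M))}"
proof -
  have "u = blue (rev (sorted_list_of_multiset M))" if "u \<in> banners M 0" for u
  proof -
    have "\<forall>x\<in>set u. \<not> snd x" using that by (auto simp: banners_def reds_def filter_empty_conv)
    then have u: "u = blue (map fst u)" by (rule list_eq_blue)
    then have "sorted_wrt (\<ge>) (map fst u)" using that successively_blue by (metis (mono_tags, lifting) banner_def banners_def mem_Collect_eq)
    then have "sorted (rev (map fst u))" by (simp add: sorted_wrt_rev)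
    moreover have "mset (rev (map fst u)) = M" using that by (simp add: banners_def)
    ultimately have "sorted_list_of_multiset M = rev (map fst u)"
      by (metis sorted_list_of_multiset_mset sorted_sort_id)
    then show ?thesis using u by (metis rev_rev_ident)
  qed
  moreover have "blue (rev (sorted_list_of_multiset M)) \<in> banners M 0"
  proof -
    have "blue w \<in> banners (mset w) 0" if "sorted_wrt (\<ge>) w" for w
    proof -
      have "successively banner_step (blue w)" using that by (simp only: successively_blue)
      moreover have "map fst (blue w) = w" by (simp add: o_def)
      then have "mset (map fst (blue w)) = mset w" by (simp only:)
      moreover have "blue w \<noteq> [] \<Longrightarrow> \<not> snd (hd (blue w))" by (cases w) simp_all
      ultimately show ?thesis
        unfolding banners_def banner_def mem_Collect_eq reds_simps by (intro conjI impI) blast+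
    qed
    from this[of "rev (sorted_list_of_multiset M)"] show ?thesis by (simp add: sorted_wrt_rev)
  qed
  ultimately show ?thesis by blast
qed

lemma marked_seqs_zero: "marked_seqs M 0 = {[]}"
proof -
  have "L = []" if "\<forall>(K,b)\<in>set L. 1 \<le> b \<and> b < size K" "sum_list (map snd L) = 0" for L :: "(nat multiset \<times> nat) list"
    using that by (cases L) auto
  then show ?thesis by (auto simp: marked_seqs_def)
qed

lemma bij_marked_seqs:
  assumes "i > 0"
  shows "bij_betw (\<lambda>(p, L). p # L) (SIGMA p:marked_blocks M i. marked_seqs (M - fst p) (i - snd p)) (marked_seqs M i)"
proof (rule bij_betw_byWitness[where f' = "\<lambda>L. (hd L, tl L)"])
  show "(\<lambda>(p, L). p # L) ` (SIGMA p:marked_blocks M i. marked_seqs (M - fst p) (i - snd p)) \<subseteq> marked_seqs M i"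
    by (auto simp: marked_blocks_def marked_seqs_def subset_mset.le_diff_conv2 add.commute)
  show "(\<lambda>L. (hd L, tl L)) ` marked_seqs M i \<subseteq> (SIGMA p:marked_blocks M i. marked_seqs (M - fst p) (i - snd p))"
  proof (rule image_subsetI)
    fix L assume L: "L \<in> marked_seqs M i"
    then obtain K b L' where L': "L = (K, b) # L'" using assms by (cases L) (auto simp: marked_seqs_def)
    have sub: "K + sum_list (map fst L') \<subseteq># M" using L by (simp add: marked_seqs_def L')
    then have "K \<subseteq># M" by (metis mset_subset_eq_add_left subset_mset.order_trans)
    then show "(hd L, tl L) \<in> (SIGMA p:marked_blocks M i. marked_seqs (M - fst p) (i - snd p))"
      using L sub by (auto simp: marked_seqs_def L' marked_blocks_def subset_mset.le_diff_conv2 add.commute)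
  qed
  show "\<forall>L\<in>marked_seqs M i. (case (hd L, tl L) of (p, L) \<Rightarrow> p # L) = L"
  proof
    fix L assume "L \<in> marked_seqs M i"
    then have "L \<noteq> []" using assms by (auto simp: marked_seqs_def)
    then show "(case (hd L, tl L) of (p, L) \<Rightarrow> p # L) = L" by simp
  qed
qed auto

lemma finite_banners: "finite (banners M i)"
proof (rule finite_subset)
  show "banners M i \<subseteq> {u. set u \<subseteq> set_mset M \<times> UNIV \<and> length u = size M}"
    by (force simp: banners_def)
qed (rule finite_lists_length_eq, simp)

lemma finite_marked_blocks: "finite (marked_blocks M i)"
proof (rule finite_subset)
  show "marked_blocks M i \<subseteq> {K. K \<subseteq># M} \<times> {..i}" by (auto simp: marked_blocks_def)
  have "{K. K \<subseteq># M} \<subseteq> fst ` {(A, B). A + B = M}" by (force simp: mset_subset_eq_exists_conv)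
  then show "finite ({K. K \<subseteq># M} \<times> {..i})" using finite_mset_splits[of M] finite_subset by blast
qed

text \<open>
  By induction along the common recursion. It ends at \<open>i = 0\<close>, where the only marked
  sequence is empty and the only banner is the decreasing blue word.
\<close>

lemma marked_seqs_banners: "finite (marked_seqs M i) \<and> card (marked_seqs M i) = card (banners M i)"
proof (induction "size M" arbitrary: M i rule: less_induct)
  case less
  show ?case
  proof (cases "i = 0")
    case True
    then show ?thesis by (simp add: banners_zero marked_seqs_zero)
  next
    case False
    let ?S = "SIGMA p:marked_blocks M i. marked_seqs (M - fst p) (i - snd p)"
    have IH: "finite (marked_seqs (M - fst p) (i - snd p))"
      "card (marked_seqs (M - fst p) (i - snd p)) = card (banners (M - fst p) (i - snd p))"
      if p: "p \<in> marked_blocks M i" for p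
    proof -
      have "fst p \<subseteq># M" "0 < size (fst p)" using p by (auto simp: marked_blocks_def)
      then have "size (M - fst p) < size M"
        using size_mset_mono[of "fst p" M] by (simp add: size_Diff_submset)
      from less[OF this] show "finite (marked_seqs (M - fst p) (i - snd p))"
        "card (marked_seqs (M - fst p) (i - snd p)) = card (banners (M - fst p) (i - snd p))" by auto
    qed
    have bij: "bij_betw (\<lambda>(p, L). p # L) ?S (marked_seqs M i)"
      using bij_marked_seqs False by simp
    have "finite ?S" using finite_marked_blocks IH by blast
    then have fin: "finite (marked_seqs M i)" using bij_betw_finite[OF bij] by simp
    have "card (marked_seqs M i) = (\<Sum>p\<in>marked_blocks M i. card (marked_seqs (M - fst p) (i - snd p)))"
      using bij_betw_same_card[OF bij] finite_marked_blocks IH by simp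
    also have "\<dots> = (\<Sum>p\<in>marked_blocks M i. card (banners (M - fst p) (i - snd p)))"
      by (rule sum.cong[OF refl IH(2)])
    also have "\<dots> = card (banners M i)"
      using bij_betw_same_card[OF bij_insert_block[of i M]] False finite_marked_blocks finite_banners by simp
    finally show ?thesis using fin by simp
  qed
qed

section \<open>Permutations as fillings\<close>

definition block_first :: "(nat \<Rightarrow> nat) \<Rightarrow> nat \<Rightarrow> bool" where
  "block_first s v \<longleftrightarrow> (\<forall>u. 1 \<le> u \<longrightarrow> u < v \<longrightarrow> s u \<noteq> s v)"

text \<open>
  Think of the value \<open>v\<close> of a permutation as a slot that carries the label \<open>s
  p\<close> of the position \<open>p\<close> of this value, coloured red if \<open>p < v\<close>,
  that is, if \<open>p\<close> is an excedance. As \<open>s\<close> is weakly decreasing, \<open>p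
  < v\<close> implies that the label is at least \<open>s v\<close>, and that \<open>v\<close> is
  not the first place with its label in case of equality; \<open>v \<le> p\<close> implies that
  the label is at most \<open>s v\<close>.
\<close>

definition allowed :: "(nat \<Rightarrow> nat) \<Rightarrow> nat \<Rightarrow> nat \<times> bool \<Rightarrow> bool" where
  "allowed s v x \<longleftrightarrow> (if snd x then s v \<le> fst x \<and> \<not> (fst x = s v \<and> block_first s v) else fst x \<le> s v)"

definition fillings :: "(nat \<Rightarrow> nat) \<Rightarrow> nat set \<Rightarrow> nat multiset \<Rightarrow> (nat \<Rightarrow> nat \<times> bool) set" where
  "fillings s D B = {l \<in> extensional D. (\<forall>v\<in>D. allowed s v (l v)) \<and> image_mset (fst \<circ> l) (mset_set D) = B}"

definition red_slots :: "nat set \<Rightarrow> (nat \<Rightarrow> nat \<times> bool) \<Rightarrow> nat" where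
  "red_slots D l = card {v\<in>D. snd (l v)}"

definition perm_filling :: "nat \<Rightarrow> (nat \<Rightarrow> nat) \<Rightarrow> (nat \<Rightarrow> nat) \<Rightarrow> nat \<Rightarrow> nat \<times> bool" where
  "perm_filling m s \<sigma> = restrict (\<lambda>v. (s (inv' \<sigma> v), inv' \<sigma> v < v)) {1..m}"

text \<open>
  The order in which the values appear in a permutation that is compatible with \<open>s\<close>
  and has the filling \<open>l\<close>.
\<close>

definition filling_less :: "(nat \<Rightarrow> nat \<times> bool) \<Rightarrow> nat \<Rightarrow> nat \<Rightarrow> bool" where
  "filling_less l v w \<longleftrightarrow> fst (l w) < fst (l v) \<or> fst (l v) = fst (l w) \<and>
     (snd (l v) \<and> \<not> snd (l w) \<or> (snd (l v) \<longleftrightarrow> snd (l w)) \<and> v < w)"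

definition filling_perm :: "nat \<Rightarrow> (nat \<Rightarrow> nat \<times> bool) \<Rightarrow> nat \<Rightarrow> nat" where
  "filling_perm m l = inv' (\<lambda>v. if v \<in> {1..m} then rank (filling_less l) {1..m} v else v)"

lemma filling_less_order: "strict_order_on A (filling_less l)"
  unfolding strict_order_on_def filling_less_def by auto

lemma filling_label_le: "filling_less l v w \<Longrightarrow> fst (l w) \<le> fst (l v)"
  by (auto simp: filling_less_def)

lemma perm_filling_less:
  assumes s: "decr m s" and \<sigma>: "\<sigma> permutes {1..m}" and c: "compatible m s \<sigma>" and v: "v \<in> {1..m}" "w \<in> {1..m}"
  shows "filling_less (perm_filling m s \<sigma>) v w \<longleftrightarrow> inv' \<sigma> v < inv' \<sigma> w"
proof -
  have *: "filling_less (perm_filling m s \<sigma>) v w" if "inv' \<sigma> v < inv' \<sigma> w" "v \<in> {1..m}" "w \<in> {1..m}" for v w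
  proof -
    have p: "inv' \<sigma> v \<in> {1..m}" "inv' \<sigma> w \<in> {1..m}"
      using that permutes_in_image[OF permutes_inv[OF \<sigma>]] by auto
    have "s (inv' \<sigma> w) \<le> s (inv' \<sigma> v)" using p that(1) by (intro decrD[OF s]) auto
    moreover have "bar_less \<sigma> (inv' \<sigma> v) (inv' \<sigma> w)" if "s (inv' \<sigma> v) = s (inv' \<sigma> w)"
      using c[unfolded compatible_iff[OF s \<sigma>]] p that \<open>inv' \<sigma> v < inv' \<sigma> w\<close> by auto
    ultimately show ?thesis
      using that(2,3) permutes_inverses(1)[OF \<sigma>]
      by (auto simp: filling_less_def perm_filling_def bar_less_def)
  qed
  show ?thesis
  proof
    assume f: "filling_less (perm_filling m s \<sigma>) v w"
    show "inv' \<sigma> v < inv' \<sigma> w"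
    proof (rule ccontr)
      assume "\<not> inv' \<sigma> v < inv' \<sigma> w"
      then consider "inv' \<sigma> v = inv' \<sigma> w" | "inv' \<sigma> w < inv' \<sigma> v" by linarith
      then show False
      proof cases
        case 1
        then have "v = w" by (metis permutes_inverses(1)[OF \<sigma>])
        then show ?thesis using f by (simp add: filling_less_def)
      next
        case 2
        then show ?thesis using *[OF 2 v(2,1)] f by (auto simp: filling_less_def)
      qed
    qed
  qed (use * v in blast)
qed

lemma perm_filling_in:
  assumes s: "decr m s" and \<sigma>: "\<sigma> permutes {1..m}"
  shows "perm_filling m s \<sigma> \<in> fillings s {1..m} (content m s)" "red_slots {1..m} (perm_filling m s \<sigma>) = exc m \<sigma>"
proof -
  have p: "inv' \<sigma> v \<in> {1..m}" if "v \<in> {1..m}" for v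
    using that permutes_in_image[OF permutes_inv[OF \<sigma>]] by auto
  have "allowed s v (perm_filling m s \<sigma> v)" if v: "v \<in> {1..m}" for v
  proof (cases "inv' \<sigma> v < v")
    case True
    then have "s v \<le> s (inv' \<sigma> v)" using p[OF v] v by (intro decrD[OF s]) auto
    moreover have "\<not> (s (inv' \<sigma> v) = s v \<and> block_first s v)" using p[OF v] True by (auto simp: block_first_def)
    ultimately show ?thesis using True v by (simp add: allowed_def perm_filling_def)
  next
    case False
    then have "s (inv' \<sigma> v) \<le> s v" using p[OF v] v by (intro decrD[OF s]) auto
    then show ?thesis using False v by (simp add: allowed_def perm_filling_def)
  qed
  moreover have "image_mset (fst \<circ> perm_filling m s \<sigma>) (mset_set {1..m}) = content m s"
  proof -
    have "image_mset (fst \<circ> perm_filling m s \<sigma>) (mset_set {1..m}) = image_mset (\<lambda>v. s (inv' \<sigma> v)) (mset_set {1..m})"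
      by (rule image_mset_cong) (auto simp: perm_filling_def)
    also have "\<dots> = image_mset s (image_mset (inv' \<sigma>) (mset_set {1..m}))"
      by (simp add: image_mset.compositionality o_def)
    also have "image_mset (inv' \<sigma>) (mset_set {1..m}) = mset_set {1..m}"
      using permutes_inv[OF \<sigma>] by (simp add: permutes_image image_mset_mset_set permutes_inj_on)
    finally show ?thesis by (simp add: content_def o_def)
  qed
  ultimately show "perm_filling m s \<sigma> \<in> fillings s {1..m} (content m s)"
    by (auto simp: fillings_def perm_filling_def)
  have "{v \<in> {1..m}. snd (perm_filling m s \<sigma> v)} = \<sigma> ` EXC m \<sigma>"
  proof safe
    fix v assume v: "v \<in> {1..m}" "snd (perm_filling m s \<sigma> v)"
    then have "inv' \<sigma> v \<in> EXC m \<sigma>"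
      using p[OF v(1)] permutes_inverses(1)[OF \<sigma>] by (auto simp: EXC_def perm_filling_def)
    then show "v \<in> \<sigma> ` EXC m \<sigma>" using permutes_inverses(1)[OF \<sigma>] by (metis imageI)
  next
    fix k assume k: "k \<in> EXC m \<sigma>"
    then show "\<sigma> k \<in> {1..m}" using permutes_in_image[OF \<sigma>, of k] by (auto simp: EXC_def)
    then show "snd (perm_filling m s \<sigma> (\<sigma> k))"
      using k permutes_inverses(2)[OF \<sigma>] by (auto simp: EXC_def perm_filling_def)
  qed
  then show "red_slots {1..m} (perm_filling m s \<sigma>) = exc m \<sigma>"
    by (simp add: red_slots_def exc_def card_image permutes_inj_on[OF \<sigma>])
qed

lemma filling_perm_left_inverse:
  assumes s: "decr m s" and \<sigma>: "\<sigma> permutes {1..m}" and c: "compatible m s \<sigma>"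
  shows "filling_perm m (perm_filling m s \<sigma>) = \<sigma>"
proof -
  have bij: "bij_betw (inv' \<sigma>) {1..m} {1..card {1..m}}"
    using permutes_imp_bij[OF permutes_inv[OF \<sigma>]] by simp
  have "rank (filling_less (perm_filling m s \<sigma>)) {1..m} v = inv' \<sigma> v" if "v \<in> {1..m}" for v
    by (rule rank_unique[symmetric, OF bij _ _ that]) (simp_all add: perm_filling_less[OF s \<sigma> c])
  moreover have "inv' \<sigma> v = v" if "v \<notin> {1..m}" for v
    using permutes_not_in[OF permutes_inv[OF \<sigma>] that] .
  ultimately have "(\<lambda>v. if v \<in> {1..m} then rank (filling_less (perm_filling m s \<sigma>)) {1..m} v else v) = inv' \<sigma>"
    by auto
  then show ?thesis by (simp add: filling_perm_def inv_inv_eq permutes_bij[OF \<sigma>])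
qed

lemma card_label_eq:
  assumes "image_mset f (mset_set A) = image_mset g (mset_set A)" "finite A"
  shows "card {x\<in>A. P (f x)} = card {x\<in>A. P (g x)}"
proof -
  have "size (filter_mset P (image_mset f (mset_set A))) = card {x\<in>A. P (f x)}" for f
    using assms(2) by (simp add: filter_mset_image_mset)
  then show ?thesis using assms(1) by metis
qed

text \<open>
  If the label of \<open>v\<close> differs from \<open>s v\<close>, it decides on which side of
  \<open>v\<close> the position of \<open>v\<close> lies, and \<open>allowed\<close> makes the
  colour agree. For equal labels \<open>c = s v\<close> the position is determined by counting. As
  many slots carry labels above \<open>c\<close> as there are places with labels above
  \<open>c\<close>. If \<open>v\<close> is red, then the other slots ahead of it are red slots
  \<open>w < v\<close> with label \<open>c\<close>, hence \<open>s w \<le> c\<close>, and the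
  first place labelled \<open>c\<close> is not among them. If \<open>v\<close> is blue, the slots
  that are not ahead of it are counted in the same way.
\<close>

lemma filling_red_iff:
  assumes s: "decr m s" and l: "l \<in> fillings s {1..m} (content m s)" and v: "v \<in> {1..m}"
  shows "rank (filling_less l) {1..m} v < v \<longleftrightarrow> snd (l v)"
proof -
  let ?A = "{1..m}"
  let ?\<tau> = "rank (filling_less l) ?A"
  have al: "allowed s w (l w)" if "w \<in> ?A" for w using l that by (auto simp: fillings_def)
  have im: "image_mset (fst \<circ> l) (mset_set ?A) = image_mset s (mset_set ?A)"
    using l by (simp add: fillings_def content_def)
  have lab: "s (?\<tau> w) = fst (l w)" if "w \<in> ?A" for w
    using label_rank[OF filling_less_order[of ?A l] _ _ _ _ that, of s "fst \<circ> l"] s im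
    by (simp add: content_def filling_label_le)
  have \<tau>: "?\<tau> v \<in> ?A" using rank_bij[OF filling_less_order[of ?A l]] v by (auto simp: bij_betw_def)
  consider "fst (l v) < s v" | "s v < fst (l v)" | "fst (l v) = s v" by linarith
  then show ?thesis
  proof cases
    case 1
    then have "v < ?\<tau> v" using decr_less[OF s, of "?\<tau> v" v] lab[OF v] v \<tau> by simp
    then show ?thesis using al[OF v] 1 by (auto simp: allowed_def split: if_splits)
  next
    case 2
    then have "?\<tau> v < v" using decr_less[OF s, of v "?\<tau> v"] lab[OF v] v \<tau> by simp
    then show ?thesis using al[OF v] 2 by (auto simp: allowed_def split: if_splits)
  next
    case 3
    let ?c = "s v"
    show ?thesis
    proof (cases "snd (l v)")
      case True
      then have nf: "\<not> block_first s v" using al[OF v] 3 by (auto simp: allowed_def split: if_splits)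
      \<comment> \<open>the first place labelled \<open>c\<close>; \<open>allowed\<close> forbids a red \<open>c\<close> there\<close>
      define u0 where "u0 = (LEAST u. 1 \<le> u \<and> s u = ?c)"
      have "1 \<le> v \<and> s v = ?c" using v by simp
      then have u0: "1 \<le> u0" "s u0 = ?c" unfolding u0_def by (metis (mono_tags, lifting) LeastI)+
      have u0_le: "u0 \<le> u" if "1 \<le> u" "s u = ?c" for u
        unfolding u0_def using that by (intro Least_le) auto
      have u0v: "u0 < v" using nf u0_le unfolding block_first_def by (meson le_less_trans)
      have u0f: "block_first s u0" unfolding block_first_def using u0_le u0 by (metis not_le)
      have "{w\<in>?A. filling_less l w v} \<subseteq> {w\<in>?A. ?c < fst (l w)} \<union> ({w\<in>?A. w < v \<and> s w \<le> ?c} - {u0})"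
      proof
        fix w assume w: "w \<in> {w\<in>?A. filling_less l w v}"
        show "w \<in> {w\<in>?A. ?c < fst (l w)} \<union> ({w\<in>?A. w < v \<and> s w \<le> ?c} - {u0})"
        proof (cases "?c < fst (l w)")
          case False
          then have "fst (l w) = ?c" "snd (l w)" "w < v" using w True 3 by (auto simp: filling_less_def)
          then show ?thesis using al[of w] w u0f u0(2) by (auto simp: allowed_def split: if_splits)
        qed (use w in auto)
      qed
      then have "card {w\<in>?A. filling_less l w v} \<le> card ({w\<in>?A. ?c < fst (l w)} \<union> ({w\<in>?A. w < v \<and> s w \<le> ?c} - {u0}))"
        by (intro card_mono) auto
      also have "\<dots> \<le> card {w\<in>?A. ?c < fst (l w)} + card ({w\<in>?A. w < v \<and> s w \<le> ?c} - {u0})"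
        by (rule card_Un_le)
      also have "card ({w\<in>?A. w < v \<and> s w \<le> ?c} - {u0}) = card {w\<in>?A. w < v \<and> s w \<le> ?c} - 1"
        using u0 u0v v by (intro card_Diff_singleton) auto
      also have "card {w\<in>?A. ?c < fst (l w)} = card {w\<in>?A. ?c < s w}"
        using card_label_eq[OF im, of "\<lambda>a. ?c < a"] by simp
      also have "card {w\<in>?A. ?c < s w} + (card {w\<in>?A. w < v \<and> s w \<le> ?c} - 1) = card {w\<in>?A. ?c < s w} + card {w\<in>?A. w < v \<and> s w \<le> ?c} - 1"
      proof -
        have "u0 \<in> {w\<in>?A. w < v \<and> s w \<le> ?c}" using u0 u0v v by auto
        then have "card {w\<in>?A. w < v \<and> s w \<le> ?c} \<noteq> 0" by (subst card_0_eq) auto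
        then show ?thesis by linarith
      qed
      also have "card {w\<in>?A. ?c < s w} + card {w\<in>?A. w < v \<and> s w \<le> ?c} = card ({w\<in>?A. ?c < s w} \<union> {w\<in>?A. w < v \<and> s w \<le> ?c})"
        by (rule card_Un_disjoint[symmetric]) auto
      also have "\<dots> \<le> card {1..<v}"
      proof (rule card_mono)
        show "{w\<in>?A. ?c < s w} \<union> {w\<in>?A. w < v \<and> s w \<le> ?c} \<subseteq> {1..<v}"
          using decr_less[OF s, of v] v by auto
      qed simp
      also have "\<dots> = v - 1" by simp
      finally have "card {w\<in>?A. filling_less l w v} \<le> v - 1 - 1" by simp
      then show ?thesis using True u0v u0(1) by (simp add: rank_def)
    next
      case False
      have "{w\<in>?A. \<not> filling_less l w v} \<subseteq> {w\<in>?A. fst (l w) < ?c} \<union> {w\<in>?A. v \<le> w \<and> ?c \<le> s w}"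
      proof
        fix w assume w: "w \<in> {w\<in>?A. \<not> filling_less l w v}"
        show "w \<in> {w\<in>?A. fst (l w) < ?c} \<union> {w\<in>?A. v \<le> w \<and> ?c \<le> s w}"
        proof (cases "fst (l w) < ?c")
          case nl: False
          then have "fst (l w) = ?c" "\<not> snd (l w)" "v \<le> w" using w False 3 by (auto simp: filling_less_def)
          then show ?thesis using al[of w] w by (auto simp: allowed_def split: if_splits)
        qed (use w in auto)
      qed
      then have "card {w\<in>?A. \<not> filling_less l w v} \<le> card ({w\<in>?A. fst (l w) < ?c} \<union> {w\<in>?A. v \<le> w \<and> ?c \<le> s w})"
        by (intro card_mono) auto
      also have "\<dots> \<le> card {w\<in>?A. fst (l w) < ?c} + card {w\<in>?A. v \<le> w \<and> ?c \<le> s w}"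
        by (rule card_Un_le)
      also have "card {w\<in>?A. fst (l w) < ?c} = card {w\<in>?A. s w < ?c}"
        using card_label_eq[OF im, of "\<lambda>a. a < ?c"] by simp
      also have "card {w\<in>?A. s w < ?c} + card {w\<in>?A. v \<le> w \<and> ?c \<le> s w} = card ({w\<in>?A. s w < ?c} \<union> {w\<in>?A. v \<le> w \<and> ?c \<le> s w})"
        by (rule card_Un_disjoint[symmetric]) auto
      also have "\<dots> \<le> card {v..m}"
      proof (rule card_mono)
        show "{w\<in>?A. s w < ?c} \<union> {w\<in>?A. v \<le> w \<and> ?c \<le> s w} \<subseteq> {v..m}"
          using decr_less[OF s, of _ v] v by (auto simp: less_imp_le)
      qed simp
      also have "\<dots> = Suc m - v" by simp
      finally have "card {w\<in>?A. \<not> filling_less l w v} \<le> Suc m - v" .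
      moreover have "card {w\<in>?A. \<not> filling_less l w v} = m - card {w\<in>?A. filling_less l w v}"
      proof -
        have "{w\<in>?A. \<not> filling_less l w v} = ?A - {w\<in>?A. filling_less l w v}" by auto
        then have "card {w\<in>?A. \<not> filling_less l w v} = card (?A - {w\<in>?A. filling_less l w v})"
          by (rule arg_cong)
        also have "\<dots> = card ?A - card {w\<in>?A. filling_less l w v}"
          by (rule card_Diff_subset) auto
        finally show ?thesis by simp
      qed
      moreover have "v \<le> m" using v by simp
      ultimately have "\<not> Suc (card {w\<in>?A. filling_less l w v}) < v" by linarith
      then show ?thesis using False by (simp add: rank_def)
    qed
  qed
qed

lemma filling_perm_right_inverse:
  assumes s: "decr m s" and l: "l \<in> fillings s {1..m} (content m s)"
  shows "filling_perm m l permutes {1..m}" "compatible m s (filling_perm m l)" "perm_filling m s (filling_perm m l) = l"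
proof -
  let ?A = "{1..m}"
  define \<tau> where "\<tau> v = (if v \<in> ?A then rank (filling_less l) ?A v else v)" for v
  have rb: "bij_betw (rank (filling_less l) ?A) ?A ?A"
    using rank_bij[OF filling_less_order[of ?A l]] by simp
  have "bij_betw \<tau> ?A ?A" using rb by (rule bij_betw_cong[THEN iffD1, rotated]) (simp add: \<tau>_def)
  then have \<tau>: "\<tau> permutes ?A" by (rule bij_imp_permutes) (simp only: \<tau>_def if_False)
  have fp: "filling_perm m l = inv' \<tau>" by (simp add: filling_perm_def \<tau>_def[abs_def])
  have ifp: "inv' (filling_perm m l) = \<tau>" by (simp add: fp inv_inv_eq permutes_bij[OF \<tau>])
  show perm: "filling_perm m l permutes ?A" unfolding fp by (rule permutes_inv[OF \<tau>])
  have im: "image_mset (fst \<circ> l) (mset_set ?A) = content m s" using l by (simp add: fillings_def)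
  have lab: "s (\<tau> w) = fst (l w)" if "w \<in> ?A" for w
    using label_rank[OF filling_less_order[of ?A l] _ _ _ _ that, of s "fst \<circ> l"] s im that
    by (simp add: \<tau>_def filling_label_le)
  have red: "\<tau> w < w \<longleftrightarrow> snd (l w)" if "w \<in> ?A" for w
    using filling_red_iff[OF s l that] that by (simp add: \<tau>_def)
  show "perm_filling m s (filling_perm m l) = l"
  proof
    fix w show "perm_filling m s (filling_perm m l) w = l w"
    proof (cases "w \<in> ?A")
      case True
      then show ?thesis using lab red by (simp add: perm_filling_def ifp prod_eq_iff)
    next
      case False
      then have "l w = undefined" using l by (auto simp: fillings_def extensional_def)
      then show ?thesis using False by (auto simp: perm_filling_def)
    qed
  qed
  show "compatible m s (filling_perm m l)"
    unfolding compatible_iff[OF s perm]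
  proof (intro allI impI)
    fix p q assume pq: "1 \<le> p" "p < q" "q \<le> m" "s p = s q"
    let ?v = "filling_perm m l p" and ?w = "filling_perm m l q"
    have vw: "?v \<in> ?A" "?w \<in> ?A" using pq permutes_in_image[OF perm] by auto
    have t: "\<tau> ?v = p" "\<tau> ?w = q" unfolding fp using permutes_inverses(1)[OF \<tau>] by auto
    have "filling_less l ?v ?w"
      using rank_less[OF filling_less_order[of ?A l] _ vw] vw t pq by (simp add: \<tau>_def split: if_splits)
    moreover have "fst (l ?v) = fst (l ?w)" using lab[OF vw(1)] lab[OF vw(2)] t pq by simp
    ultimately show "bar_less (filling_perm m l) p q"
      using red[OF vw(1)] red[OF vw(2)] t by (auto simp: filling_less_def bar_less_def)
  qed
qed

lemma card_compatible_perms: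
  assumes s: "decr m s"
  shows "card {\<sigma>. \<sigma> permutes {1..m} \<and> exc m \<sigma> = i \<and> compatible m s \<sigma>}
       = card {l \<in> fillings s {1..m} (content m s). red_slots {1..m} l = i}"
proof (rule bij_betw_same_card)
  show "bij_betw (perm_filling m s) {\<sigma>. \<sigma> permutes {1..m} \<and> exc m \<sigma> = i \<and> compatible m s \<sigma>}
     {l \<in> fillings s {1..m} (content m s). red_slots {1..m} l = i}"
  proof (rule bij_betw_byWitness[where f' = "filling_perm m"])
    show "filling_perm m ` {l \<in> fillings s {1..m} (content m s). red_slots {1..m} l = i}
      \<subseteq> {\<sigma>. \<sigma> permutes {1..m} \<and> exc m \<sigma> = i \<and> compatible m s \<sigma>}"
      using filling_perm_right_inverse[OF s] perm_filling_in(2)[OF s] by force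
  qed (use filling_perm_left_inverse[OF s] filling_perm_right_inverse[OF s] perm_filling_in[OF s] in auto)
qed

section \<open>Generating polynomials of fillings and banners\<close>

lemma finite_fillings:
  assumes "finite D"
  shows "finite (fillings s D B)"
proof (rule finite_subset)
  show "fillings s D B \<subseteq> D \<rightarrow>\<^sub>E (set_mset B \<times> UNIV)"
  proof
    fix l assume l: "l \<in> fillings s D B"
    then have "fst (l v) \<in># B" if "v \<in> D" for v using that assms by (auto simp: fillings_def)
    then show "l \<in> D \<rightarrow>\<^sub>E (set_mset B \<times> UNIV)" using l by (auto simp: fillings_def PiE_def mem_Times_iff)
  qed
  show "finite (D \<rightarrow>\<^sub>E (set_mset B \<times> (UNIV :: bool set)))"
    using assms by (intro finite_PiE) auto
qed

definition filling_poly :: "(nat \<Rightarrow> nat) \<Rightarrow> nat set \<Rightarrow> nat multiset \<Rightarrow> int poly" where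
  "filling_poly s D B = (\<Sum>l\<in>fillings s D B. tvar ^ red_slots D l)"

definition slot_weight :: "(nat \<Rightarrow> nat) \<Rightarrow> nat \<Rightarrow> nat \<Rightarrow> int poly" where
  "slot_weight s v a = (if allowed s v (a, True) then tvar else 0) + (if allowed s v (a, False) then 1 else 0)"

lemma filling_poly_empty: "filling_poly s {} B = (if B = {#} then 1 else 0)"
proof -
  have "fillings s {} B = (if B = {#} then {\<lambda>_. undefined} else {})"
    by (auto simp: fillings_def)
  then show ?thesis by (simp add: filling_poly_def red_slots_def)
qed

lemma filling_poly_remove:
  assumes D: "finite D" "v \<in> D"
  shows "filling_poly s D B = (\<Sum>a\<in>set_mset B. slot_weight s v a * filling_poly s (D - {v}) (B - {#a#}))"
proof -
  let ?X = "{x \<in> set_mset B \<times> (UNIV :: bool set). allowed s v x}"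
  let ?S = "SIGMA x:?X. fillings s (D - {v}) (B - {#fst x#})"
  have ins: "mset_set D = add_mset v (mset_set (D - {v}))"
    using D by (metis finite_Diff insert_Diff mset_set.insert Diff_iff singletonI)
  have fx: "finite ?X" by (rule finite_subset[of _ "set_mset B \<times> UNIV"]) auto
  have "filling_poly s D B = (\<Sum>(x, l)\<in>?S. (if snd x then tvar else 1) * tvar ^ red_slots (D - {v}) l)"
    unfolding filling_poly_def
  proof (rule sum.reindex_bij_witness[of _ "\<lambda>(x, l). l(v := x)" "\<lambda>l. (l v, l(v := undefined))"])
    fix l assume l: "l \<in> fillings s D B"
    then show "(\<lambda>(x, l). l(v := x)) (l v, l(v := undefined)) = l" by simp
    have "image_mset (fst \<circ> l(v := undefined)) (mset_set (D - {v})) = image_mset (fst \<circ> l) (mset_set (D - {v}))"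
      using D by (intro image_mset_cong) auto
    moreover have B: "B = add_mset (fst (l v)) (image_mset (fst \<circ> l) (mset_set (D - {v})))"
      using l ins by (simp add: fillings_def)
    moreover have "allowed s v (l v)" "l(v := undefined) \<in> extensional (D - {v})"
      "\<forall>w\<in>D - {v}. allowed s w ((l(v := undefined)) w)"
      using l D by (auto simp: fillings_def extensional_def)
    ultimately show "(l v, l(v := undefined)) \<in> ?S" by (auto simp: fillings_def mem_Times_iff)
    have "{w \<in> D. snd (l w)} = (if snd (l v) then {v} else {}) \<union> {w \<in> D - {v}. snd ((l(v := undefined)) w)}"
      using D by auto
    then have "red_slots D l = (if snd (l v) then 1 else 0) + red_slots (D - {v}) (l(v := undefined))"
      using D(1) unfolding red_slots_def by (simp add: card_insert_if)
    then show "(case (l v, l(v := undefined)) of (x, l) \<Rightarrow> (if snd x then tvar else 1) * tvar ^ red_slots (D - {v}) l) = tvar ^ red_slots D l"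
      by simp
  next
    fix p assume p: "p \<in> ?S"
    then obtain x l where xl: "p = (x, l)" "x \<in> ?X" "l \<in> fillings s (D - {v}) (B - {#fst x#})" by auto
    have "l v = undefined" using xl(3) by (auto simp: fillings_def extensional_def)
    then show "(\<lambda>l. (l v, l(v := undefined))) ((\<lambda>(x, l). l(v := x)) p) = p" by (auto simp: xl(1) fun_eq_iff)
    have "image_mset (fst \<circ> l(v := x)) (mset_set (D - {v})) = image_mset (fst \<circ> l) (mset_set (D - {v}))"
      using D by (intro image_mset_cong) auto
    then have "image_mset (fst \<circ> l(v := x)) (mset_set D) = B"
      using xl ins by (auto simp: fillings_def)
    then show "(\<lambda>(x, l). l(v := x)) p \<in> fillings s D B"
      using xl D by (auto simp: fillings_def extensional_def)
  qed
  also have "\<dots> = (\<Sum>x\<in>?X. \<Sum>l\<in>fillings s (D - {v}) (B - {#fst x#}). (if snd x then tvar else 1) * tvar ^ red_slots (D - {v}) l)"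
    using fx D by (intro sum.Sigma[symmetric]) (auto simp: finite_fillings)
  also have "\<dots> = (\<Sum>x\<in>?X. (if snd x then tvar else 1) * filling_poly s (D - {v}) (B - {#fst x#}))"
    by (simp add: filling_poly_def sum_distrib_left)
  also have "\<dots> = (\<Sum>x\<in>set_mset B \<times> UNIV. if allowed s v x then (if snd x then tvar else 1) * filling_poly s (D - {v}) (B - {#fst x#}) else 0)"
    by (simp add: sum.inter_filter)
  also have "\<dots> = (\<Sum>a\<in>set_mset B. \<Sum>c\<in>UNIV. if allowed s v (a, c) then (if c then tvar else 1) * filling_poly s (D - {v}) (B - {#a#}) else 0)"
    by (simp add: sum.cartesian_product case_prod_beta)
  also have "\<dots> = (\<Sum>a\<in>set_mset B. slot_weight s v a * filling_poly s (D - {v}) (B - {#a#}))"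
    by (intro sum.cong refl) (simp add: UNIV_bool slot_weight_def algebra_simps)
  finally show ?thesis .
qed

definition all_banners :: "nat multiset \<Rightarrow> (nat \<times> bool) list set" where
  "all_banners M = {u. mset (map fst u) = M \<and> banner u}"

definition banners_from :: "nat \<Rightarrow> nat multiset \<Rightarrow> (nat \<times> bool) list set" where
  "banners_from c M = {u \<in> all_banners M. u \<noteq> [] \<and> fst (hd u) = c}"

definition banner_poly :: "nat multiset \<Rightarrow> int poly" where
  "banner_poly M = (\<Sum>u\<in>all_banners M. tvar ^ reds u)"

definition banner_poly_from :: "nat \<Rightarrow> nat multiset \<Rightarrow> int poly" where
  "banner_poly_from c M = (\<Sum>u\<in>banners_from c M. tvar ^ reds u)"

definition step_weight :: "nat \<Rightarrow> nat \<Rightarrow> int poly" where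
  "step_weight c a = (if c \<le> a then tvar else 0) + (if a \<le> c then 1 else 0)"

lemma finite_all_banners: "finite (all_banners M)"
proof (rule finite_subset)
  show "all_banners M \<subseteq> {u. set u \<subseteq> set_mset M \<times> UNIV \<and> length u = size M}"
    by (force simp: all_banners_def)
qed (rule finite_lists_length_eq, simp)

lemma finite_banners_from: "finite (banners_from c M)"
  by (rule finite_subset[OF _ finite_all_banners[of M]]) (auto simp: banners_from_def)

lemma all_banners_empty: "all_banners {#} = {[]}"
  by (auto simp: all_banners_def banner_def)

lemma banner_poly_empty: "banner_poly {#} = 1"
  by (simp add: banner_poly_def all_banners_empty)

lemma banner_poly_from_notin: "c \<notin># M \<Longrightarrow> banner_poly_from c M = 0"
proof -
  assume "c \<notin># M"
  then have "banners_from c M = {}"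
    by (auto simp: banners_from_def all_banners_def)
  then show ?thesis by (simp add: banner_poly_from_def)
qed

lemma banner_Cons_Cons:
  "banner ((c, False) # (a, d) # r) \<longleftrightarrow> (if d then c \<le> a else a \<le> c) \<and> banner ((a, False) # r)"
proof -
  have *: "successively banner_step ((a, x) # r) \<longleftrightarrow> successively banner_step ((a, y) # r)" for x y
    by (cases r) (auto simp: banner_step_def[of "(a, _)"])
  have "banner ((c, False) # (a, d) # r) \<longleftrightarrow> banner_step (c, False) (a, d) \<and> successively banner_step ((a, d) # r)"
    by (simp add: banner_def)
  also have "\<dots> \<longleftrightarrow> (if d then c \<le> a else a \<le> c) \<and> successively banner_step ((a, False) # r)"
    unfolding *[of d False] by (simp add: banner_step_def[of "(c, False)"])
  finally show ?thesis by (simp add: banner_def)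
qed

text \<open>
  The first letter is removed; the next letter, which could have either colour subject to
  \<open>banner_step\<close>, becomes first and is recoloured blue.
\<close>

lemma banner_poly_from_rec:
  assumes "c \<in># M"
  shows "banner_poly_from c M = (if M = {#c#} then 1 else 0) +
    (\<Sum>a\<in>set_mset (M - {#c#}). step_weight c a * banner_poly_from a (M - {#c#}))"
proof -
  let ?M = "M - {#c#}"
  have M: "M = add_mset c ?M" using assms by simp
  let ?ok = "\<lambda>x. if snd x then c \<le> fst x else fst x \<le> c"
  let ?X = "{x \<in> set_mset ?M \<times> (UNIV :: bool set). ?ok x}"
  let ?S = "SIGMA x:?X. banners_from (fst x) ?M"
  have hd: "\<exists>r. u = (c, False) # r" if "u \<in> banners_from c M" for u
    using that by (cases u) (auto simp: banners_from_def all_banners_def banner_def)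
  have split: "banners_from c M = {u \<in> banners_from c M. tl u = []} \<union> {u \<in> banners_from c M. tl u \<noteq> []}" by auto
  have one: "{u \<in> banners_from c M. tl u = []} = (if M = {#c#} then {[(c, False)]} else {})"
  proof -
    have 1: "u = [(c, False)] \<and> M = {#c#}" if "u \<in> banners_from c M" "tl u = []" for u
      using hd[OF that(1)] that by (auto simp: banners_from_def all_banners_def)
    have 2: "[(c, False)] \<in> banners_from c {#c#}"
      by (auto simp: banners_from_def all_banners_def banner_def)
    show ?thesis
    proof (cases "M = {#c#}")
      case True
      have "{u \<in> banners_from c M. tl u = []} = {[(c, False)]}"
      proof (intro equalityI subsetI)
        fix u assume "u \<in> {u \<in> banners_from c M. tl u = []}"
        then show "u \<in> {[(c, False)]}" using 1[of u] by simp
      next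
        fix u assume "u \<in> {[(c, False)]}"
        then show "u \<in> {u \<in> banners_from c M. tl u = []}" using 2 unfolding True by simp
      qed
      then show ?thesis unfolding if_P[OF True] .
    next
      case False
      then have "{u \<in> banners_from c M. tl u = []} = {}" using 1 by blast
      then show ?thesis unfolding if_not_P[OF False] .
    qed
  qed
  have "banner_poly_from c M = (\<Sum>u\<in>{u \<in> banners_from c M. tl u = []}. tvar ^ reds u) + (\<Sum>u\<in>{u \<in> banners_from c M. tl u \<noteq> []}. tvar ^ reds u)"
    unfolding banner_poly_from_def by (subst split, rule sum.union_disjoint) (auto simp: finite_banners_from)
  also have "(\<Sum>u\<in>{u \<in> banners_from c M. tl u = []}. tvar ^ reds u) = (if M = {#c#} then 1 else 0)"
    unfolding one by (simp add: reds_def)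
  also have "(\<Sum>u\<in>{u \<in> banners_from c M. tl u \<noteq> []}. tvar ^ reds u) = (\<Sum>(x, u)\<in>?S. (if snd x then tvar else 1) * tvar ^ reds u)"
  proof (rule sum.reindex_bij_witness[of _ "\<lambda>(x, u). (c, False) # x # tl u" "\<lambda>u. (hd (tl u), (fst (hd (tl u)), False) # tl (tl u))"])
    fix u assume u: "u \<in> {u \<in> banners_from c M. tl u \<noteq> []}"
    then obtain a d r where ur: "u = (c, False) # (a, d) # r"
      using hd[of u] by (auto simp: neq_Nil_conv)
    have b: "banner u" "mset (map fst u) = M" using u by (auto simp: banners_from_def all_banners_def)
    then have m: "mset (map fst ((a, d) # r)) = ?M" unfolding ur by auto
    have "a \<in># ?M" unfolding m[symmetric] by simp
    moreover have "(a, False) # r \<in> banners_from a ?M"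
      using b(1) m unfolding ur banner_Cons_Cons by (simp add: banners_from_def all_banners_def)
    ultimately show "(hd (tl u), (fst (hd (tl u)), False) # tl (tl u)) \<in> ?S"
      using b(1) unfolding ur banner_Cons_Cons by simp
    show "(case (hd (tl u), (fst (hd (tl u)), False) # tl (tl u)) of (x, u) \<Rightarrow> (if snd x then tvar else 1) * tvar ^ reds u) = tvar ^ reds u"
      by (simp add: ur reds_def)
    show "(case (hd (tl u), (fst (hd (tl u)), False) # tl (tl u)) of (x, u) \<Rightarrow> (c, False) # x # tl u) = u"
      by (simp add: ur)
  next
    fix p assume p: "p \<in> ?S"
    then obtain a d u where xu: "p = ((a, d), u)" "(a, d) \<in> ?X" "u \<in> banners_from a ?M" by auto
    then obtain r where u: "u = (a, False) # r"
      by (cases u) (auto simp: banners_from_def all_banners_def banner_def)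
    have b: "banner u" "mset (map fst u) = ?M" using xu(3) by (auto simp: banners_from_def all_banners_def)
    show "(\<lambda>u. (hd (tl u), (fst (hd (tl u)), False) # tl (tl u))) ((\<lambda>(x, u). (c, False) # x # tl u) p) = p"
      by (simp add: xu(1) u)
    have "mset (map fst ((c, False) # (a, d) # r)) = M" using b(2) M unfolding u by simp
    moreover have "banner ((c, False) # (a, d) # r)"
      using b(1) xu(2) unfolding u banner_Cons_Cons by auto
    ultimately show "(\<lambda>(x, u). (c, False) # x # tl u) p \<in> {u \<in> banners_from c M. tl u \<noteq> []}"
      by (simp add: xu(1) u banners_from_def all_banners_def)
  qed
  also have "\<dots> = (\<Sum>x\<in>?X. \<Sum>u\<in>banners_from (fst x) ?M. (if snd x then tvar else 1) * tvar ^ reds u)"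
    by (rule sum.Sigma[symmetric]) (auto simp: finite_banners_from intro: finite_subset[of _ "set_mset ?M \<times> UNIV"])
  also have "\<dots> = (\<Sum>x\<in>?X. (if snd x then tvar else 1) * banner_poly_from (fst x) ?M)"
    by (simp add: banner_poly_from_def sum_distrib_left)
  also have "\<dots> = (\<Sum>x\<in>set_mset ?M \<times> UNIV. if ?ok x then (if snd x then tvar else 1) * banner_poly_from (fst x) ?M else 0)"
    by (rule sum.inter_filter) simp
  also have "\<dots> = (\<Sum>a\<in>set_mset ?M. \<Sum>d\<in>UNIV. if ?ok (a, d) then (if d then tvar else 1) * banner_poly_from a ?M else 0)"
    unfolding sum.cartesian_product by (rule sum.cong) auto
  also have "\<dots> = (\<Sum>a\<in>set_mset ?M. step_weight c a * banner_poly_from a ?M)"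
    by (intro sum.cong refl) (simp add: UNIV_bool step_weight_def algebra_simps)
  finally show ?thesis .
qed

definition full_parts :: "nat multiset \<Rightarrow> nat \<Rightarrow> nat multiset set" where
  "full_parts A h = {\<Gamma>. \<Gamma> \<subseteq># A \<and> count \<Gamma> h = count A h}"

lemma finite_full_parts: "finite (full_parts A h)"
proof -
  have "full_parts A h \<subseteq> fst ` {(X, Y). X + Y = A}" by (force simp: full_parts_def mset_subset_eq_exists_conv)
  then show ?thesis using finite_mset_splits[of A] finite_subset by blast
qed

text \<open>
  Pairs of banners whose contents add up to \<open>A\<close>, where the second one starts with
  \<open>c\<close> and contains every copy of \<open>h\<close>.
\<close>

definition trace_poly :: "nat multiset \<Rightarrow> nat \<Rightarrow> nat \<Rightarrow> int poly" where
  "trace_poly A c h = (\<Sum>\<Gamma>\<in>full_parts A h. banner_poly (A - \<Gamma>) * banner_poly_from c \<Gamma>)"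

text \<open>
  A banner is cut in front of the first copy of its least letter \<open>h\<close>. This copy is
  blue, as any preceding letter is larger, so the second piece is a banner as well.
\<close>

lemma banner_poly_split_min:
  assumes h: "h \<in># A" "\<forall>a\<in>#A. h \<le> a"
  shows "banner_poly A = trace_poly A h h"
proof -
  let ?S = "SIGMA \<Gamma>:full_parts A h. all_banners (A - \<Gamma>) \<times> banners_from h \<Gamma>"
  let ?q = "\<lambda>x :: nat \<times> bool. fst x \<noteq> h"
  have "banner_poly A = (\<Sum>(\<Gamma>, x, y)\<in>?S. tvar ^ reds x * tvar ^ reds y)"
    unfolding banner_poly_def
  proof (rule sum.reindex_bij_witness[of _ "\<lambda>(\<Gamma>, x, y). x @ y" "\<lambda>u. (mset (map fst (dropWhile ?q u)), takeWhile ?q u, dropWhile ?q u)"])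
    fix u assume u: "u \<in> all_banners A"
    define x where "x = takeWhile ?q u"
    define y where "y = dropWhile ?q u"
    have uxy: "u = x @ y" by (simp add: x_def y_def)
    have A: "mset (map fst x) + mset (map fst y) = A" using u uxy by (auto simp: all_banners_def)
    have x: "\<forall>z\<in>set x. fst z \<noteq> h" unfolding x_def by (auto dest: set_takeWhileD)
    then have hx: "h \<notin># mset (map fst x)" by auto
    then have "y \<noteq> []" using A h by auto
    then have hy: "fst (hd y) = h" using hd_dropWhile[of ?q u] unfolding y_def by simp
    have succ: "successively banner_step (x @ y)" "\<not> snd (hd (x @ y))" using u uxy \<open>y \<noteq> []\<close> by (auto simp: all_banners_def banner_def)
    have "\<not> snd (hd y)"
    proof (cases "x = []")
      case False
      then have "banner_step (last x) (hd y)" using succ \<open>y \<noteq> []\<close> by (auto simp: successively_append_iff)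
      moreover have "fst (last x) \<in># A" using A False by (metis image_eqI last_in_set list.set_map set_mset_mset union_iff)
      then have "h < fst (last x)" using h x False by (metis last_in_set le_neq_implies_less)
      ultimately show ?thesis using hy by (auto simp: banner_step_def split: if_splits)
    qed (use succ in simp)
    then have "y \<in> banners_from h (mset (map fst y))"
      using succ hy \<open>y \<noteq> []\<close> by (auto simp: banners_from_def all_banners_def banner_def successively_append_iff)
    moreover have "x \<in> all_banners (A - mset (map fst y))"
      using succ A[symmetric] by (auto simp: all_banners_def banner_def successively_append_iff)
    moreover have "mset (map fst y) \<in> full_parts A h"
    proof -
      have "count (mset (map fst x)) h = 0" using hx unfolding not_in_iff .
      then show ?thesis unfolding full_parts_def A[symmetric] by (simp del: mset_map)
    qed
    ultimately show "(mset (map fst (dropWhile ?q u)), takeWhile ?q u, dropWhile ?q u) \<in> ?S"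
      unfolding x_def[symmetric] y_def[symmetric] by simp
    show "(case (mset (map fst (dropWhile ?q u)), takeWhile ?q u, dropWhile ?q u) of (\<Gamma>, x, y) \<Rightarrow> x @ y) = u" by simp
    have "tvar ^ reds u = tvar ^ reds x * tvar ^ reds y" by (simp only: uxy reds_simps power_add)
    then show "(case (mset (map fst (dropWhile ?q u)), takeWhile ?q u, dropWhile ?q u) of (\<Gamma>, x, y) \<Rightarrow> tvar ^ reds x * tvar ^ reds y) = tvar ^ reds u"
      unfolding x_def y_def by simp
  next
    fix p assume "p \<in> ?S"
    then obtain \<Gamma> x y where p: "p = (\<Gamma>, x, y)" "\<Gamma> \<in> full_parts A h" "x \<in> all_banners (A - \<Gamma>)" "y \<in> banners_from h \<Gamma>" by auto
    have y: "y \<noteq> []" "fst (hd y) = h" "banner y" "mset (map fst y) = \<Gamma>"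
      using p(4) by (auto simp: banners_from_def all_banners_def)
    have x: "banner x" "mset (map fst x) = A - \<Gamma>" using p(3) by (auto simp: all_banners_def)
    have "count (A - \<Gamma>) h = 0" using p(2) by (auto simp: full_parts_def)
    then have nx: "h \<notin># mset (map fst x)" unfolding x(2) by (simp add: not_in_iff)
    have nx': "\<forall>z\<in>set x. ?q z" using nx by force
    have tk: "takeWhile ?q (x @ y) = x" "dropWhile ?q (x @ y) = y"
      using takeWhile_append_exact[of x ?q y] nx' y by auto
    show "(\<lambda>u. (mset (map fst (dropWhile ?q u)), takeWhile ?q u, dropWhile ?q u)) ((\<lambda>(\<Gamma>, x, y). x @ y) p) = p"
      using tk y by (simp add: p(1))
    have "banner_step (last x) (hd y)" if "x \<noteq> []"
    proof -
      have "fst (last x) \<in># A - \<Gamma>" using x(2) that by (metis image_eqI last_in_set list.set_map set_mset_mset)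
      then have "h \<le> fst (last x)" using h by (meson in_diffD)
      moreover have "\<not> snd (hd y)" using y by (auto simp: banner_def)
      ultimately show ?thesis using y by (auto simp: banner_step_def)
    qed
    then have "successively banner_step (x @ y)"
      unfolding successively_append_iff using x(1) y(3) unfolding banner_def by blast
    then have "banner (x @ y)" using x(1) y(1,3) by (cases "x = []") (simp_all add: banner_def)
    moreover have "mset (map fst (x @ y)) = A" using x(2) y(4) p(2) by (simp add: full_parts_def)
    ultimately show "(\<lambda>(\<Gamma>, x, y). x @ y) p \<in> all_banners A" by (simp add: p(1) all_banners_def)
  qed
  also have "\<dots> = (\<Sum>\<Gamma>\<in>full_parts A h. \<Sum>(x, y)\<in>all_banners (A - \<Gamma>) \<times> banners_from h \<Gamma>. tvar ^ reds x * tvar ^ reds y)"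
    by (subst sum.Sigma) (auto simp: finite_full_parts finite_all_banners finite_banners_from case_prod_unfold)
  also have "\<dots> = trace_poly A h h"
    by (simp add: trace_poly_def banner_poly_def banner_poly_from_def sum_product sum.cartesian_product)
  finally show ?thesis .
qed

text \<open>
  The first letter \<open>c\<close> of the second banner is removed. It may be the last letter
  only if it leaves no copy of \<open>h\<close> behind.
\<close>

lemma trace_poly_rec:
  assumes c: "c \<in># A"
  shows "trace_poly A c h = (if h \<in># A - {#c#} then 0 else banner_poly (A - {#c#})) +
    (\<Sum>a\<in>set_mset (A - {#c#}). step_weight c a * trace_poly (A - {#c#}) a h)"
proof -
  let ?A = "A - {#c#}"
  have A: "A = add_mset c ?A" using c by simp
  have sub: "{\<Gamma> \<in> full_parts A h. c \<in># \<Gamma>} = add_mset c ` full_parts ?A h"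
  proof (intro equalityI subsetI)
    fix \<Gamma> assume "\<Gamma> \<in> {\<Gamma> \<in> full_parts A h. c \<in># \<Gamma>}"
    then have g: "\<Gamma> \<subseteq># A" "count \<Gamma> h = count A h" "c \<in># \<Gamma>" by (auto simp: full_parts_def)
    then have "\<Gamma> - {#c#} \<in> full_parts ?A h"
      using mset_subset_eq_count[OF g(1)] by (auto simp: full_parts_def intro!: mset_subset_eqI diff_le_mono)
    then show "\<Gamma> \<in> add_mset c ` full_parts ?A h" using g(3) by (metis image_eqI insert_DiffM)
  next
    fix \<Gamma> assume "\<Gamma> \<in> add_mset c ` full_parts ?A h"
    then obtain \<Gamma>' where g: "\<Gamma> = add_mset c \<Gamma>'" "\<Gamma>' \<subseteq># ?A" "count \<Gamma>' h = count ?A h" by (auto simp: full_parts_def)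
    have "add_mset c \<Gamma>' \<subseteq># add_mset c ?A" using g(2) by simp
    moreover have "count (add_mset c \<Gamma>') h = count (add_mset c ?A) h" using g(3) by simp
    ultimately show "\<Gamma> \<in> {\<Gamma> \<in> full_parts A h. c \<in># \<Gamma>}" using A g(1) by (simp add: full_parts_def)
  qed
  have "trace_poly A c h = (\<Sum>\<Gamma>\<in>{\<Gamma> \<in> full_parts A h. c \<in># \<Gamma>}. banner_poly (A - \<Gamma>) * banner_poly_from c \<Gamma>)"
    unfolding trace_poly_def
    by (rule sum.mono_neutral_right) (auto simp: finite_full_parts banner_poly_from_notin)
  also have "\<dots> = (\<Sum>\<Gamma>\<in>full_parts ?A h. banner_poly (A - add_mset c \<Gamma>) * banner_poly_from c (add_mset c \<Gamma>))"
    unfolding sub by (subst sum.reindex) (auto simp: inj_on_def)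
  also have "\<dots> = (\<Sum>\<Gamma>\<in>full_parts ?A h. (if \<Gamma> = {#} then banner_poly ?A else 0) +
      (\<Sum>a\<in>set_mset ?A. step_weight c a * (banner_poly (?A - \<Gamma>) * banner_poly_from a \<Gamma>)))"
  proof (rule sum.cong[OF refl])
    fix \<Gamma> assume g: "\<Gamma> \<in> full_parts ?A h"
    have "banner_poly_from c (add_mset c \<Gamma>) = (if \<Gamma> = {#} then 1 else 0) + (\<Sum>a\<in>set_mset \<Gamma>. step_weight c a * banner_poly_from a \<Gamma>)"
      by (subst banner_poly_from_rec) auto
    also have "(\<Sum>a\<in>set_mset \<Gamma>. step_weight c a * banner_poly_from a \<Gamma>) = (\<Sum>a\<in>set_mset ?A. step_weight c a * banner_poly_from a \<Gamma>)"
    proof (rule sum.mono_neutral_left)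
      show "set_mset \<Gamma> \<subseteq> set_mset ?A" using g by (auto simp: full_parts_def dest: set_mset_mono)
    qed (auto simp: banner_poly_from_notin)
    finally show "banner_poly (A - add_mset c \<Gamma>) * banner_poly_from c (add_mset c \<Gamma>) =
      (if \<Gamma> = {#} then banner_poly ?A else 0) + (\<Sum>a\<in>set_mset ?A. step_weight c a * (banner_poly (?A - \<Gamma>) * banner_poly_from a \<Gamma>))"
      by (simp add: algebra_simps sum_distrib_left)
  qed
  also have "\<dots> = (\<Sum>\<Gamma>\<in>full_parts ?A h. if \<Gamma> = {#} then banner_poly ?A else 0) +
      (\<Sum>\<Gamma>\<in>full_parts ?A h. \<Sum>a\<in>set_mset ?A. step_weight c a * (banner_poly (?A - \<Gamma>) * banner_poly_from a \<Gamma>))"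
    by (rule sum.distrib)
  also have "(\<Sum>\<Gamma>\<in>full_parts ?A h. if \<Gamma> = {#} then banner_poly ?A else 0) = (if {#} \<in> full_parts ?A h then banner_poly ?A else 0)"
    by (simp add: finite_full_parts)
  also have "{#} \<in> full_parts ?A h \<longleftrightarrow> h \<notin># ?A" by (auto simp: full_parts_def not_in_iff)
  also have "(\<Sum>\<Gamma>\<in>full_parts ?A h. \<Sum>a\<in>set_mset ?A. step_weight c a * (banner_poly (?A - \<Gamma>) * banner_poly_from a \<Gamma>)) =
     (\<Sum>a\<in>set_mset ?A. step_weight c a * trace_poly ?A a h)"
    by (subst sum.swap) (simp add: trace_poly_def sum_distrib_left)
  finally have "trace_poly A c h = (if h \<notin># ?A then banner_poly ?A else 0) +
    (\<Sum>a\<in>set_mset ?A. step_weight c a * trace_poly ?A a h)" .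
  moreover have "(if h \<notin># ?A then X else 0) = (if h \<in># ?A then 0 else X)" for X :: "int poly" by (cases "h \<in># ?A") simp_all
  ultimately show ?thesis by (rule trans[OF _ arg_cong2[where f = "(+)"]]) (rule refl)
qed

text \<open>
  Slots are deleted from the end of the intervals on which \<open>s\<close> is constant. So the
  slot \<open>v\<close> that is deleted next satisfies \<open>block_first s v\<close> iff it is
  the only remaining one of its interval.
\<close>

definition block_closed :: "(nat \<Rightarrow> nat) \<Rightarrow> nat set \<Rightarrow> bool" where
  "block_closed s D \<longleftrightarrow> (\<forall>v\<in>D. \<forall>u. 1 \<le> u \<longrightarrow> u < v \<longrightarrow> s u = s v \<longrightarrow> u \<in> D)"

text \<open>
  Both identities are proved together by deleting slots. In the second one the slots have the
  places labelled \<open>A\<close>, but the labels at hand are \<open>A\<close> with one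
  \<open>c\<close> replaced by an extra \<open>h\<close>. Let \<open>v\<close> be the last slot
  with \<open>s v = c\<close>. If it receives the label \<open>a\<close>, then \<open>a\<close>
  has become the surplus place label, and the weight of this choice is that of a banner in which
  \<open>c\<close> is followed by \<open>a\<close>. Going on like this spells out a banner, until
  the last copy of \<open>h\<close> is used up and the labels at hand match the remaining places.
  The first identity is the case in which the process starts with \<open>c = h\<close>, the least
  label.
\<close>

lemma filling_poly_trace:
  assumes "finite D" "0 \<notin> D" "block_closed s D" "A = image_mset s (mset_set D)"
  shows "filling_poly s D A = banner_poly A"
    "c \<in># A \<Longrightarrow> \<forall>a\<in>#A. h \<le> a \<Longrightarrow> filling_poly s D (add_mset h (A - {#c#})) = trace_poly A c h"
proof -
  have "filling_poly s D A = banner_poly A \<and>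
    (\<forall>c h. c \<in># A \<longrightarrow> (\<forall>a\<in>#A. h \<le> a) \<longrightarrow> filling_poly s D (add_mset h (A - {#c#})) = trace_poly A c h)"
    using assms
  proof (induction "card D" arbitrary: D A rule: less_induct)
    case less
    note fin = less.prems(1) and z = less.prems(2) and cl = less.prems(3) and A = less.prems(4)
    have 2: "filling_poly s D (add_mset h (A - {#c#})) = trace_poly A c h"
      if c: "c \<in># A" and h: "\<forall>a\<in>#A. h \<le> a" for c h
    proof -
      let ?V = "{u\<in>D. s u = c}"
      have V: "finite ?V" "?V \<noteq> {}" using c A fin by auto
      define v where "v = Max ?V"
      have v: "v \<in> D" "s v = c" using Max_in[OF V] by (auto simp: v_def)
      have vmax: "u \<le> v" if "u \<in> D" "s u = c" for u using Max_ge[OF V(1)] that by (auto simp: v_def)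
      let ?D = "D - {v}" and ?A = "A - {#c#}"
      have A': "?A = image_mset s (mset_set ?D)"
      proof -
        have "mset_set D = add_mset v (mset_set ?D)"
          using v fin by (metis finite_Diff insert_Diff mset_set.insert Diff_iff singletonI)
        then show ?thesis using A v by simp
      qed
      have cl': "block_closed s ?D"
        using cl vmax v unfolding block_closed_def by (metis Diff_iff leD singletonD singletonI insertE)
      have card: "card ?D < card D" using v fin by (intro psubset_card_mono) auto
      have "finite ?D" "0 \<notin> ?D" using fin z by auto
      note IH = less.hyps[OF card this cl' A']
      have IH1: "filling_poly s ?D ?A = banner_poly ?A" using IH by blast
      have hA': "\<forall>a\<in>#?A. h \<le> a" using h by (meson in_diffD)
      have IH2: "filling_poly s ?D (add_mset h (?A - {#a#})) = trace_poly ?A a h" if "a \<in># ?A" for a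
        using IH hA' that by blast
      have w1: "slot_weight s v a = step_weight c a" if "a \<in># ?A" for a
      proof -
        have "\<not> block_first s v" if "a = c"
        proof -
          have "c \<in># image_mset s (mset_set ?D)" using \<open>a \<in># ?A\<close> that A' by simp
          then obtain u where u: "u \<in> ?D" "s u = c" using fin by auto
          then have "u < v" using vmax[of u] by (auto simp: le_less)
          moreover have "1 \<le> u"
          proof (rule ccontr)
            assume "\<not> 1 \<le> u"
            then have "u = 0" by simp
            then show False using u(1) z by simp
          qed
          moreover have "s u = s v" using u(2) v(2) by simp
          ultimately show ?thesis unfolding block_first_def by meson
        qed
        then show ?thesis using v by (auto simp: slot_weight_def step_weight_def allowed_def)
      qed
      have w2: "slot_weight s v h = 1" if "h \<notin># ?A"
      proof (cases "h = c")
        case True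
        have "block_first s v"
          unfolding block_first_def
        proof (intro allI impI notI)
          fix u assume u: "1 \<le> u" "u < v" "s u = s v"
          then have "u \<in> ?D" using cl v by (auto simp: block_closed_def)
          then have "s u \<in># image_mset s (mset_set ?D)" using fin by simp
          then have "c \<in># ?A" using A' u(3) v(2) by metis
          then show False using that True by simp
        qed
        then show ?thesis using True v by (simp add: slot_weight_def allowed_def)
      next
        case False
        then have "h < c" using h c by force
        then show ?thesis using v by (simp add: slot_weight_def allowed_def)
      qed
      have "filling_poly s D (add_mset h ?A) = (\<Sum>a\<in>set_mset (add_mset h ?A). slot_weight s v a * filling_poly s ?D (add_mset h ?A - {#a#}))"
        by (rule filling_poly_remove[OF fin v(1)])
      also have "\<dots> = (if h \<in># ?A then 0 else banner_poly ?A) + (\<Sum>a\<in>set_mset ?A. slot_weight s v a * filling_poly s ?D (add_mset h ?A - {#a#}))"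
      proof (cases "h \<in># ?A")
        case True
        then have "set_mset (add_mset h ?A) = set_mset ?A" by auto
        then show ?thesis using True by (simp only: if_True add_0)
      next
        case False
        then show ?thesis using IH1 w2 by (simp only: set_mset_add_mset_insert) simp
      qed
      also have "(\<Sum>a\<in>set_mset ?A. slot_weight s v a * filling_poly s ?D (add_mset h ?A - {#a#})) = (\<Sum>a\<in>set_mset ?A. step_weight c a * trace_poly ?A a h)"
      proof (rule sum.cong[OF refl])
        fix a assume a: "a \<in># ?A"
        then have "add_mset h ?A - {#a#} = add_mset h (?A - {#a#})"
          by (metis add_mset_diff_bothsides add_mset_remove_trivial insert_DiffM2 union_mset_add_mset_right add_mset_add_single diff_union_swap)
        then show "slot_weight s v a * filling_poly s ?D (add_mset h ?A - {#a#}) = step_weight c a * trace_poly ?A a h"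
          using w1[OF a] IH2[OF a] by simp
      qed
      finally show ?thesis unfolding trace_poly_rec[OF c] .
    qed
    have 1: "filling_poly s D A = banner_poly A"
    proof (cases "A = {#}")
      case True
      then have "D = {}" using A fin by (simp add: mset_set_empty_iff)
      then show ?thesis using True by (simp add: filling_poly_empty banner_poly_empty)
    next
      case False
      define h where "h = Min (set_mset A)"
      have h: "h \<in># A" "\<forall>a\<in>#A. h \<le> a" using False by (auto simp: h_def)
      then show ?thesis using 2[OF h] banner_poly_split_min[OF h] by simp
    qed
    show ?case using 1 2 by blast
  qed
  then show "filling_poly s D A = banner_poly A"
    "c \<in># A \<Longrightarrow> \<forall>a\<in>#A. h \<le> a \<Longrightarrow> filling_poly s D (add_mset h (A - {#c#})) = trace_poly A c h"
    by blast+
qed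

theorem card_compatible_perms_banners:
  assumes s: "decr m s"
  shows "card {\<sigma>. \<sigma> permutes {1..m} \<and> exc m \<sigma> = i \<and> compatible m s \<sigma>} = card (banners (content m s) i)"
proof -
  have "filling_poly s {1..m} (content m s) = banner_poly (content m s)"
  proof (rule filling_poly_trace(1))
    show "block_closed s {1..m}" by (auto simp: block_closed_def)
  qed (auto simp: content_def)
  then have "poly.coeff (filling_poly s {1..m} (content m s)) i = poly.coeff (banner_poly (content m s)) i" by simp
  then have "card {l \<in> fillings s {1..m} (content m s). red_slots {1..m} l = i} = card {u \<in> all_banners (content m s). reds u = i}"
    by (simp add: filling_poly_def banner_poly_def coeff_gen_poly finite_fillings finite_all_banners del: One_nat_def)
  also have "{u \<in> all_banners (content m s). reds u = i} = banners (content m s) i"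
    by (auto simp: all_banners_def banners_def)
  finally show ?thesis using card_compatible_perms[OF s] by simp
qed

section \<open>Cycles as banners\<close>

abbreviation orb :: "('b \<Rightarrow> 'b) \<Rightarrow> 'b \<Rightarrow> 'b set" where "orb \<equiv> Orbits.orbit"

lemma orbit_enum:
  assumes "f permutes S" "finite S"
  shows "bij_betw (\<lambda>k. (f ^^ k) x) {..<card (orb f x)} (orb f x)" "(f ^^ card (orb f x)) x = x"
proof -
  have p: "permutation f" using assms by (auto simp: permutation_permutes)
  have x: "x \<in> orb f x" using permutation_self_in_orbit[OF p] .
  let ?d = "funpow_dist1 f x x"
  have o: "orb f x = (\<lambda>n. (f ^^ n) x) ` {0..<?d}" by (rule orbit_conv_funpow_dist1[OF x])
  have i: "inj_on (\<lambda>n. (f ^^ n) x) {0..<?d}" by (rule inj_on_funpow_dist1[OF x])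
  have c: "card (orb f x) = ?d" using card_image[OF i] o by simp
  show "bij_betw (\<lambda>k. (f ^^ k) x) {..<card (orb f x)} (orb f x)"
    unfolding c using o i by (simp add: bij_betw_def lessThan_atLeast0)
  show "(f ^^ card (orb f x)) x = x" unfolding c by (rule funpow_dist1_prop[OF x])
qed

text \<open>
  Lexicographic comparison of the words \<open>f k, f (k - 1), \<dots>, f 1\<close> and \<open>f
  l, f (l - 1), \<dots>, f 1\<close>: larger labels come first, red comes before blue, and a word
  comes after all words that it is a prefix of.
\<close>

fun trace_less :: "(nat \<Rightarrow> nat \<times> bool) \<Rightarrow> nat \<Rightarrow> nat \<Rightarrow> bool" where
  "trace_less f 0 l \<longleftrightarrow> False"
| "trace_less f (Suc k) 0 \<longleftrightarrow> True"
| "trace_less f (Suc k) (Suc l) \<longleftrightarrow> fst (f (Suc l)) < fst (f (Suc k)) \<or> fst (f (Suc k)) = fst (f (Suc l)) \<and>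
     (snd (f (Suc k)) \<and> \<not> snd (f (Suc l)) \<or> (snd (f (Suc k)) \<longleftrightarrow> snd (f (Suc l))) \<and> trace_less f k l)"

lemma trace_less_irrefl: "\<not> trace_less f k k"
  by (induction k) auto

lemma trace_less_trans: "trace_less f k l \<Longrightarrow> trace_less f l m \<Longrightarrow> trace_less f k m"
proof (induction k arbitrary: l m)
  case (Suc k)
  show ?case
  proof (cases l)
    case 0
    then show ?thesis using Suc.prems by simp
  next
    case l: (Suc l')
    show ?thesis
    proof (cases m)
      case m: (Suc m')
      show ?thesis using Suc.prems Suc.IH[of l' m'] unfolding l m trace_less.simps by auto
    qed simp
  qed
qed simp

lemma trace_less_total: "k \<noteq> l \<Longrightarrow> trace_less f k l \<or> trace_less f l k"
proof (induction k arbitrary: l)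
  case 0
  then show ?case by (cases l) auto
next
  case (Suc k)
  show ?case
  proof (cases l)
    case l: (Suc l')
    then show ?thesis using Suc.IH[of l'] Suc.prems unfolding l trace_less.simps by auto
  qed simp
qed

lemma trace_less_order: "strict_order_on A (trace_less f)"
  unfolding strict_order_on_def using trace_less_irrefl trace_less_trans trace_less_total by metis

text \<open>
  Letters are counted from 1. The first letter of a banner is blue by convention, but corresponds
  to an excedance of the cycle and is therefore read as red.
\<close>

definition word_letter :: "(nat \<times> bool) list \<Rightarrow> nat \<Rightarrow> nat \<times> bool" where
  "word_letter u k = (fst (u ! (k - 1)), k = 1 \<or> snd (u ! (k - 1)))"

definition cyc_trace :: "nat \<Rightarrow> (nat \<Rightarrow> nat) \<Rightarrow> nat \<Rightarrow> nat" where
  "cyc_trace n \<sigma> k = (inv' \<sigma> ^^ k) n"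

text \<open>
  Following an \<open>n\<close>-cycle backwards from \<open>n\<close> visits every position. The
  position visited at time \<open>k\<close> is mapped by \<open>\<sigma>\<close> to the one
  visited before, so it is an excedance iff that one is larger.
\<close>

definition cyc_word :: "nat \<Rightarrow> (nat \<Rightarrow> nat) \<Rightarrow> (nat \<Rightarrow> nat) \<Rightarrow> (nat \<times> bool) list" where
  "cyc_word n s \<sigma> = map (\<lambda>k. (s (cyc_trace n \<sigma> k), k \<noteq> 1 \<and> cyc_trace n \<sigma> k < cyc_trace n \<sigma> (k - 1))) [1..<n]"

lemma cyc_word_letter:
  assumes "1 \<le> k" "k < n"
  shows "word_letter (cyc_word n s \<sigma>) k = (s (cyc_trace n \<sigma> k), k = 1 \<or> cyc_trace n \<sigma> k < cyc_trace n \<sigma> (k - 1))"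
  using assms by (auto simp: word_letter_def cyc_word_def)

locale least_label_last =
  fixes n :: nat and s :: "nat \<Rightarrow> nat"
  assumes n: "n \<ge> 2" and s: "decr n s" and smin: "\<And>k. 1 \<le> k \<Longrightarrow> k < n \<Longrightarrow> s n < s k"
begin

definition "cycles = {\<sigma>. \<sigma> permutes {1..n} \<and> orb \<sigma> n = {1..n} \<and> compatible n s \<sigma>}"

context
  fixes \<sigma> assumes \<sigma>: "\<sigma> \<in> cycles"
begin

lemma perm: "\<sigma> permutes {1..n}" and orb: "orb \<sigma> n = {1..n}" and comp: "compatible n s \<sigma>"
  using \<sigma> by (auto simp: cycles_def)

abbreviation "tr \<equiv> cyc_trace n \<sigma>"

lemma tr_bij: "bij_betw tr {..<n} {1..n}" and tr_n: "tr n = n"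
proof -
  have "orb (inv' \<sigma>) n = orb \<sigma> n"
    using perm by (intro orbit_inv_eq) (auto simp: permutation_permutes)
  then have o: "orb (inv' \<sigma>) n = {1..n}" using orb by simp
  show "bij_betw tr {..<n} {1..n}" "tr n = n"
    using orbit_enum[OF permutes_inv[OF perm], of n] unfolding o cyc_trace_def by simp_all
qed

lemma tr_0: "tr 0 = n" by (simp add: cyc_trace_def)

lemma \<sigma>_tr: "\<sigma> (tr (Suc k)) = tr k"
  using permutes_inverses(1)[OF perm] by (simp add: cyc_trace_def)

lemma tr_in: "k < n \<Longrightarrow> tr k \<in> {1..n}"
  using tr_bij by (auto simp: bij_betw_def)

lemma tr_inj: "k < n \<Longrightarrow> l < n \<Longrightarrow> tr k = tr l \<Longrightarrow> k = l"
  using tr_bij by (auto simp: bij_betw_def inj_on_def)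

lemma tr_less: "0 < k \<Longrightarrow> k < n \<Longrightarrow> tr k < n"
  using tr_in[of k] tr_inj[of k 0] tr_0 by fastforce

lemma letter_tr: "Suc k < n \<Longrightarrow> word_letter (cyc_word n s \<sigma>) (Suc k) = (s (tr (Suc k)), tr (Suc k) < tr k)"
  using cyc_word_letter[of "Suc k" n s \<sigma>] tr_less[of 1] tr_0 by auto

text \<open>
  In a compatible permutation, positions are ordered by decreasing label, then excedances come
  first, and then the images decide. These images are the positions visited one step earlier, so
  the recursion is that of \<open>trace_less\<close>.
\<close>

lemma trace_less_if: "k < n \<Longrightarrow> l < n \<Longrightarrow> tr k < tr l \<Longrightarrow> trace_less (word_letter (cyc_word n s \<sigma>)) k l"
proof (induction k arbitrary: l)
  case 0
  then show ?case using tr_in[of l] tr_0 by auto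
next
  case (Suc k)
  show ?case
  proof (cases l)
    case l: (Suc l')
    have in_n: "tr (Suc k) \<in> {1..n}" "tr (Suc l') \<in> {1..n}" using Suc.prems l tr_in by auto
    have le: "s (tr (Suc l')) \<le> s (tr (Suc k))" using Suc.prems l in_n by (intro decrD[OF s]) auto
    have bl: "bar_less \<sigma> (tr (Suc k)) (tr (Suc l'))" if "s (tr (Suc k)) = s (tr (Suc l'))"
      using comp[unfolded compatible_iff[OF s perm]] that in_n Suc.prems l by auto
    show ?thesis
      using le bl Suc.IH[of l'] Suc.prems unfolding l trace_less.simps bar_less_def \<sigma>_tr
      by (auto simp: letter_tr)
  qed simp
qed

lemma trace_less_iff:
  assumes "k < n" "l < n"
  shows "trace_less (word_letter (cyc_word n s \<sigma>)) k l \<longleftrightarrow> tr k < tr l"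
proof
  assume t: "trace_less (word_letter (cyc_word n s \<sigma>)) k l"
  then have "k \<noteq> l" using trace_less_irrefl by metis
  then have "tr k \<noteq> tr l" using tr_inj assms by blast
  moreover have "\<not> tr l < tr k"
    using trace_less_if[of l k] t trace_less_irrefl trace_less_trans assms by metis
  ultimately show "tr k < tr l" by simp
qed (rule trace_less_if[OF assms])

text \<open>
  Hence the word determines the trace, and with it the cycle.
\<close>

lemma tr_rank: "k < n \<Longrightarrow> tr k = rank (trace_less (word_letter (cyc_word n s \<sigma>))) {..<n} k"
  by (rule rank_unique) (use tr_bij trace_less_iff in auto)

lemma tr_bij': "bij_betw tr {1..<n} {1..n - 1}"
proof -
  have "bij_betw tr ({..<n} - {0}) ({1..n} - {tr 0})"
    using tr_bij n by (intro bij_betw_DiffI bij_betw_singletonI) (auto simp: tr_0)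
  moreover have "{..<n} - {0} = {1..<n}" "{1..n} - {tr 0} = {1..n - 1}" using n by (auto simp: tr_0)
  ultimately show ?thesis by simp
qed

lemma cyc_word_banner: "banner (cyc_word n s \<sigma>)"
proof -
  have "banner_step (cyc_word n s \<sigma> ! i) (cyc_word n s \<sigma> ! Suc i)" if i: "Suc i < n - 1" for i
  proof -
    have "s (tr (Suc (Suc i))) \<le> s (tr (Suc i))" if "tr (Suc i) \<le> tr (Suc (Suc i))"
      using tr_in[of "Suc i"] tr_in[of "Suc (Suc i)"] i that by (intro decrD[OF s]) auto
    moreover have "s (tr (Suc i)) \<le> s (tr (Suc (Suc i)))" if "tr (Suc (Suc i)) \<le> tr (Suc i)"
      using tr_in[of "Suc i"] tr_in[of "Suc (Suc i)"] i that by (intro decrD[OF s]) auto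
    ultimately show ?thesis using i by (auto simp: cyc_word_def banner_step_def)
  qed
  then have "successively banner_step (cyc_word n s \<sigma>)"
    by (simp add: successively_conv_nth) (simp add: cyc_word_def)
  moreover have "cyc_word n s \<sigma> ! 0 = (s (tr 1), False)" using n by (simp add: cyc_word_def)
  moreover have "cyc_word n s \<sigma> \<noteq> []" using n by (simp add: cyc_word_def)
  ultimately show ?thesis by (simp add: banner_def hd_conv_nth)
qed

lemma cyc_word_content: "mset (map fst (cyc_word n s \<sigma>)) = content (n - 1) s"
proof -
  have "mset (map fst (cyc_word n s \<sigma>)) = image_mset s (image_mset tr (mset_set {1..<n}))"
    by (simp add: cyc_word_def o_def image_mset.compositionality)
  also have "image_mset tr (mset_set {1..<n}) = mset_set {1..n - 1}"
    using tr_bij' by (simp add: bij_betw_def image_mset_mset_set)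
  finally show ?thesis by (simp add: content_def)
qed

lemma cyc_word_reds: "exc n \<sigma> = Suc (reds (cyc_word n s \<sigma>))"
proof -
  let ?E = "{k \<in> {1..<n}. tr k < tr (k - 1)}"
  have "EXC n \<sigma> = tr ` ?E"
  proof (intro equalityI subsetI)
    fix p assume p: "p \<in> EXC n \<sigma>"
    then have "p \<in> tr ` {1..<n}" using tr_bij' by (auto simp: bij_betw_def EXC_def)
    then obtain k where k: "p = tr k" "k \<in> {1..<n}" by auto
    then show "p \<in> tr ` ?E" using p \<sigma>_tr[of "k - 1"] by (auto simp: EXC_def)
  next
    fix p assume "p \<in> tr ` ?E"
    then obtain k where k: "p = tr k" "k \<in> {1..<n}" "tr k < tr (k - 1)" by auto
    then have "p \<in> {1..n - 1}" using tr_bij' by (auto simp: bij_betw_def)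
    then show "p \<in> EXC n \<sigma>" using k \<sigma>_tr[of "k - 1"] n by (auto simp: EXC_def)
  qed
  moreover have "inj_on tr ?E" using tr_bij' by (auto simp: bij_betw_def inj_on_def)
  ultimately have "exc n \<sigma> = card ?E" by (simp add: exc_def card_image)
  also have "?E = insert 1 {k \<in> {1..<n}. k \<noteq> 1 \<and> tr k < tr (k - 1)}"
    using n tr_less[of 1] by (auto simp: tr_0)
  also have "card \<dots> = Suc (card {k \<in> {1..<n}. k \<noteq> 1 \<and> tr k < tr (k - 1)})"
    by (subst card_insert_disjoint) auto
  also have "card {k \<in> {1..<n}. k \<noteq> 1 \<and> tr k < tr (k - 1)} = reds (cyc_word n s \<sigma>)"
    unfolding reds_def cyc_word_def
    by (simp add: filter_map o_def distinct_length_filter Int_def conj_commute)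
  finally show ?thesis .
qed

end

lemma cyc_word_inj: "inj_on (cyc_word n s) cycles"
proof (rule inj_onI)
  fix \<sigma> \<sigma>' assume \<sigma>: "\<sigma> \<in> cycles" "\<sigma>' \<in> cycles" and eq: "cyc_word n s \<sigma> = cyc_word n s \<sigma>'"
  have t: "cyc_trace n \<sigma> k = cyc_trace n \<sigma>' k" if "k < n" for k
    using tr_rank[OF \<sigma>(1) that] tr_rank[OF \<sigma>(2) that] eq by simp
  have t': "cyc_trace n \<sigma> k = cyc_trace n \<sigma>' k" if "k \<le> n" for k
    using t that tr_n[OF \<sigma>(1)] tr_n[OF \<sigma>(2)] by (cases "k = n") auto
  show "\<sigma> = \<sigma>'"
  proof
    fix p show "\<sigma> p = \<sigma>' p"
    proof (cases "p \<in> {1..n}")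
      case True
      then have "p \<in> cyc_trace n \<sigma> ` {..<n}" using bij_betw_imp_surj_on[OF tr_bij[OF \<sigma>(1)]] by simp
      then obtain k where k: "k < n" "p = cyc_trace n \<sigma> k" by auto
      show ?thesis
      proof (cases k)
        case 0
        then have "p = cyc_trace n \<sigma> (Suc (n - 1))" "p = cyc_trace n \<sigma>' (Suc (n - 1))"
          using k(2) tr_n[OF \<sigma>(1)] tr_n[OF \<sigma>(2)] tr_0[OF \<sigma>(1)] n by auto
        then show ?thesis using \<sigma>_tr[OF \<sigma>(1), of "n - 1"] \<sigma>_tr[OF \<sigma>(2), of "n - 1"] t'[of "n - 1"] by simp
      next
        case (Suc k')
        then show ?thesis using \<sigma>_tr[OF \<sigma>(1), of k'] \<sigma>_tr[OF \<sigma>(2), of k'] t[of k'] t[of k] k by simp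
      qed
    next
      case False
      then show ?thesis using permutes_not_in perm[OF \<sigma>(1)] perm[OF \<sigma>(2)] by metis
    qed
  qed
qed

context
  fixes u assumes u: "banner u" "mset (map fst u) = content (n - 1) s"
begin

abbreviation "word_less \<equiv> trace_less (word_letter u)"

text \<open>
  Conversely, a banner \<open>u\<close> prescribes the order of the positions of the cycle that it
  should come from.
\<close>

definition "pos = rank word_less {..<n}"

lemma len_u: "length u = n - 1"
  using arg_cong[OF u(2), of size] by simp

lemma pos_bij: "bij_betw pos {..<n} {1..n}"
  using rank_bij[OF trace_less_order, of "{..<n}" "word_letter u"] by (simp add: pos_def)

lemma pos_less: "k < n \<Longrightarrow> l < n \<Longrightarrow> pos k < pos l \<longleftrightarrow> word_less k l"
  using rank_less[OF trace_less_order, of "{..<n}" k l "word_letter u"] by (simp add: pos_def)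

lemma pos_0: "pos 0 = n"
proof -
  have "{k \<in> {..<n}. word_less k 0} = {1..<n}"
  proof (intro equalityI subsetI)
    show "k \<in> {1..<n}" if "k \<in> {k \<in> {..<n}. word_less k 0}" for k using that by (cases k) simp_all
    show "k \<in> {k \<in> {..<n}. word_less k 0}" if "k \<in> {1..<n}" for k using that by (cases k) simp_all
  qed
  then show ?thesis using n by (simp add: pos_def rank_def)
qed

lemma letter_fst: "k < n \<Longrightarrow> 1 \<le> k \<Longrightarrow> s n < fst (word_letter u k)"
proof -
  assume k: "k < n" "1 \<le> k"
  then have "fst (word_letter u k) \<in># mset (map fst u)" using len_u by (auto simp: word_letter_def)
  then obtain p where "p \<in> {1..n - 1}" "fst (word_letter u k) = s p" unfolding u(2) by (auto simp: content_def)
  then show ?thesis using smin[of p] by auto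
qed

lemma pos_label: "k < n \<Longrightarrow> 1 \<le> k \<Longrightarrow> s (pos k) = fst (word_letter u k)"
proof -
  assume k: "k < n" "1 \<le> k"
  define lab where "lab k = (if k = 0 then s n else fst (word_letter u k))" for k
  have lab: "lab l \<le> lab k" if "k \<in> {..<n}" "l \<in> {..<n}" "word_less k l" for k l
    using that letter_fst[of k] by (cases k; cases l) (auto simp: lab_def less_imp_le)
  have "image_mset lab (mset_set {..<n}) = content n s"
  proof -
    have "map (\<lambda>k. fst (word_letter u k)) [1..<n] = map fst u"
      by (rule nth_equalityI) (use len_u in \<open>auto simp: word_letter_def\<close>)
    then have "image_mset (\<lambda>k. fst (word_letter u k)) (mset_set {1..<n}) = content (n - 1) s"
      using u(2) by (metis mset_map mset_upt)
    moreover have "image_mset lab (mset_set {1..<n}) = image_mset (\<lambda>k. fst (word_letter u k)) (mset_set {1..<n})"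
      by (rule image_mset_cong) (auto simp: lab_def)
    moreover have "{..<n} = insert 0 {1..<n}" using n by auto
    ultimately have "image_mset lab (mset_set {..<n}) = add_mset (s n) (content (n - 1) s)"
      by (simp add: lab_def)
    also have "{1..n} = insert n {1..n - 1}" using n by auto
    then have "add_mset (s n) (content (n - 1) s) = content n s"
      using n by (simp add: content_def)
    finally show ?thesis .
  qed
  then have "s (pos k) = lab k"
    unfolding pos_def
    using label_rank[OF trace_less_order, of "{..<n}" s "word_letter u" lab k] s lab k by simp
  then show ?thesis using k by (simp add: lab_def)
qed

text \<open>
  By induction on \<open>k\<close>: the labels of neighbouring letters compare as the colour of
  the second one demands, and in case of equality the comparison is passed on to the preceding
  letters.
\<close>

lemma word_red: "1 \<le> k \<Longrightarrow> k < n \<Longrightarrow> word_less k (k - 1) \<longleftrightarrow> snd (word_letter u k)"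
proof (induction k rule: dec_induct)
  case base
  then show ?case by (simp add: word_letter_def)
next
  case (step k)
  obtain k' where k': "k = Suc k'" using step.hyps by (cases k) auto
  have IH: "word_less k k' \<longleftrightarrow> snd (word_letter u k)" using step k' by simp
  have "successively banner_step u" using u(1) by (simp add: banner_def)
  then have "banner_step (u ! k') (u ! Suc k')"
    using step.prems len_u k' by (auto simp: successively_conv_nth)
  then have b: "if snd (word_letter u (Suc k)) then fst (word_letter u k) \<le> fst (word_letter u (Suc k))
     else fst (word_letter u (Suc k)) \<le> fst (word_letter u k)"
    by (auto simp: banner_step_def word_letter_def k')
  show ?case using b IH unfolding k' by (auto simp: le_less split: if_splits)
qed

definition "advance p = (if p \<in> {1..n} then pos (Suc (the_inv_into {..<n} pos p) mod n) else p)"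

lemma advance_perm: "advance permutes {1..n}"
proof (rule bij_imp_permutes)
  have "bij_betw (\<lambda>k. Suc k mod n) {..<n} {..<n}"
    by (rule bij_betw_byWitness[where f' = "\<lambda>k. if k = 0 then n - 1 else k - 1"]) (use n in \<open>auto simp: mod_Suc\<close>)
  then have "bij_betw (pos \<circ> ((\<lambda>k. Suc k mod n) \<circ> the_inv_into {..<n} pos)) {1..n} {1..n}"
    using bij_betw_the_inv_into[OF pos_bij] pos_bij by (intro bij_betw_trans)
  then show "bij_betw advance {1..n} {1..n}"
    by (rule bij_betw_cong[THEN iffD1, rotated]) (simp add: advance_def)
qed (simp only: advance_def if_False)

lemma advance_pos: "k < n \<Longrightarrow> advance (pos k) = pos (Suc k mod n)"
proof -
  assume k: "k < n"
  then have "pos k \<in> {1..n}" "the_inv_into {..<n} pos (pos k) = k"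
    using pos_bij by (auto simp: bij_betw_def the_inv_into_f_f)
  then show ?thesis by (simp add: advance_def)
qed

lemma advance_pow: "k < n \<Longrightarrow> (advance ^^ k) n = pos k"
  by (induction k) (use pos_0 advance_pos in auto)

definition "word_cycle = inv' advance"

lemma word_cycle: "word_cycle \<in> cycles" "cyc_word n s word_cycle = u"
proof -
  have perm: "word_cycle permutes {1..n}" unfolding word_cycle_def by (rule permutes_inv[OF advance_perm])
  have inv: "inv' word_cycle = advance" unfolding word_cycle_def by (simp add: inv_inv_eq permutes_bij[OF advance_perm])
  have tr: "cyc_trace n word_cycle k = pos k" if "k < n" for k
    using advance_pow[OF that] by (simp add: cyc_trace_def inv)
  have pm: "permutation advance" using advance_perm by (auto simp: permutation_permutes)
  have "orb word_cycle n = orb advance n" unfolding word_cycle_def by (rule orbit_inv_eq[OF pm])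
  also have "orb advance n = {1..n}"
  proof (intro equalityI subsetI)
    fix p assume "p \<in> {1..n}"
    then have "p \<in> pos ` {..<n}" using bij_betw_imp_surj_on[OF pos_bij] by simp
    then obtain k where "k < n" "p = pos k" by auto
    then have "p = (advance ^^ k) n" using advance_pow by simp
    then show "p \<in> orb advance n" unfolding orbit_altdef_permutation[OF pm] by auto
  next
    fix p assume "p \<in> orb advance n"
    then show "p \<in> {1..n}" using permutes_orbit_subset[OF advance_perm, of n] n by auto
  qed
  finally have orb: "orb word_cycle n = {1..n}" .
  have wc: "word_cycle (pos (Suc k)) = pos k" if "Suc k < n" for k
    using advance_pos[of k] that permutes_inverses(2)[OF advance_perm, of "pos k"] by (simp add: word_cycle_def)
  have "compatible n s word_cycle"
    unfolding compatible_iff[OF s perm]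
  proof (intro allI impI)
    fix p q assume pq: "1 \<le> p" "p < q" "q \<le> n" "s p = s q"
    then have "p \<in> pos ` {..<n}" "q \<in> pos ` {..<n}" using pos_bij by (auto simp: bij_betw_def)
    then obtain k l where kl: "k < n" "l < n" "p = pos k" "q = pos l" by auto
    have t: "word_less k l" using pos_less[OF kl(1,2)] kl pq by simp
    have "l \<noteq> 0"
    proof
      assume "l = 0"
      then have "q = n" using kl pos_0 by simp
      then show False using pq smin[of p] by simp
    qed
    then obtain k' l' where k': "k = Suc k'" "l = Suc l'" using t by (cases k; cases l) auto
    have f: "fst (word_letter u k) = fst (word_letter u l)" using pq kl pos_label[of k] pos_label[of l] k' by auto
    have r: "pos k < pos k' \<longleftrightarrow> snd (word_letter u k)" "pos l < pos l' \<longleftrightarrow> snd (word_letter u l)"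
      using word_red[of k] word_red[of l] pos_less[of k k'] pos_less[of l l'] kl k' by auto
    show "bar_less word_cycle p q"
      using t f pos_less[of k' l'] kl unfolding bar_less_def kl(3,4)
      unfolding k' using wc[of k'] wc[of l'] r k' kl by auto
  qed
  then show "word_cycle \<in> cycles" using perm orb by (simp add: cycles_def)
  show "cyc_word n s word_cycle = u"
  proof (rule nth_equalityI)
    show "length (cyc_word n s word_cycle) = length u" using len_u by (simp add: cyc_word_def)
    fix i assume "i < length (cyc_word n s word_cycle)"
    then have i: "Suc i < n" by (simp add: cyc_word_def)
    have "pos (Suc i) < pos i \<longleftrightarrow> snd (word_letter u (Suc i))"
      using word_red[of "Suc i"] pos_less[of "Suc i" i] i by simp
    moreover have "\<not> snd (u ! 0)" using u(1) len_u n by (cases u) (auto simp: banner_def)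
    ultimately have "u ! i = (s (pos (Suc i)), Suc i \<noteq> 1 \<and> pos (Suc i) < pos i)"
      using pos_label[of "Suc i"] i by (cases "i = 0") (auto simp: word_letter_def prod_eq_iff)
    moreover have "cyc_word n s word_cycle ! i = (s (pos (Suc i)), Suc i \<noteq> 1 \<and> pos (Suc i) < pos i)"
    proof -
      have "[1..<n] ! i = Suc i" using i by (subst nth_upt) auto
      moreover have "i < length [1..<n]" using i by simp
      ultimately show ?thesis using i tr[of i] tr[of "Suc i"] unfolding cyc_word_def by (subst nth_map) auto
    qed
    ultimately show "cyc_word n s word_cycle ! i = u ! i" by simp
  qed
qed

end

theorem card_cycles:
  "card {\<sigma> \<in> cycles. exc n \<sigma> = Suc i} = card (banners (content (n - 1) s) i)"
proof (rule bij_betw_same_card)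
  show "bij_betw (cyc_word n s) {\<sigma> \<in> cycles. exc n \<sigma> = Suc i} (banners (content (n - 1) s) i)"
    unfolding bij_betw_def
  proof
    show "inj_on (cyc_word n s) {\<sigma> \<in> cycles. exc n \<sigma> = Suc i}"
      by (rule inj_on_subset[OF cyc_word_inj]) auto
    show "cyc_word n s ` {\<sigma> \<in> cycles. exc n \<sigma> = Suc i} = banners (content (n - 1) s) i"
    proof (intro equalityI subsetI)
      fix v assume "v \<in> cyc_word n s ` {\<sigma> \<in> cycles. exc n \<sigma> = Suc i}"
      then show "v \<in> banners (content (n - 1) s) i"
        using cyc_word_banner cyc_word_content cyc_word_reds by (auto simp: banners_def simp del: mset_map)
    next
      fix v assume "v \<in> banners (content (n - 1) s) i"
      then have v: "banner v" "mset (map fst v) = content (n - 1) s" "reds v = i" by (auto simp: banners_def)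
      then show "v \<in> cyc_word n s ` {\<sigma> \<in> cycles. exc n \<sigma> = Suc i}"
        using word_cycle[OF v(1,2)] cyc_word_reds[OF word_cycle(1)[OF v(1,2)]] by force
    qed
  qed
qed

lemma exc_cycles: "\<sigma> \<in> cycles \<Longrightarrow> exc n \<sigma> \<noteq> 0"
  using cyc_word_reds by simp

end

section \<open>Products of power sums\<close>

text \<open>
  The coefficient of \<open>M\<close> in the product of the power sums \<open>p\<^bsub>f
  x\<^esub>\<close> counts the ways of choosing a variable \<open>d x\<close> for every factor
  such that the product of their powers is \<open>M\<close>.
\<close>

definition index_choices :: "'b set \<Rightarrow> ('b \<Rightarrow> nat) \<Rightarrow> nat multiset \<Rightarrow> ('b \<Rightarrow> nat) set" where
  "index_choices A f M = {d \<in> A \<rightarrow>\<^sub>E {1..}. (\<Sum>x\<in>A. replicate_mset (f x) (d x)) = M}"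

lemma index_choices_mem:
  assumes "finite A" "\<forall>x\<in>A. 0 < f x" "d \<in> index_choices A f M" "x \<in> A"
  shows "d x \<in># M"
proof -
  have "replicate_mset (f x) (d x) \<subseteq># (\<Sum>x\<in>A. replicate_mset (f x) (d x))"
    unfolding sum.remove[OF assms(1,4)] by simp
  then have "replicate_mset (f x) (d x) \<subseteq># M" using assms(3) by (simp add: index_choices_def)
  moreover have "d x \<in># replicate_mset (f x) (d x)" using assms(2,4) by auto
  ultimately show ?thesis by (rule mset_subset_eqD)
qed

lemma finite_index_choices:
  assumes "finite A" "\<forall>x\<in>A. 0 < f x"
  shows "finite (index_choices A f M)"
proof (rule finite_subset)
  show "index_choices A f M \<subseteq> A \<rightarrow>\<^sub>E set_mset M"
    using index_choices_mem[OF assms] by (auto simp: index_choices_def PiE_def Pi_def)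
qed (use assms in \<open>auto intro: finite_PiE\<close>)

lemma coef_prod_power_sum:
  assumes "finite A" "\<forall>x\<in>A. 0 < f x"
  shows "coef (\<Prod>x\<in>A. power_sum (f x) :: 'a :: comm_ring_1 pseries) M = of_nat (card (index_choices A f M))"
  using assms
proof (induction A arbitrary: M rule: finite_induct)
  case empty
  have "index_choices {} f M = (if M = {#} then {\<lambda>_. undefined} else {})"
    by (auto simp: index_choices_def)
  then show ?case by (simp add: one_pseries.rep_eq)
next
  case (insert x A)
  let ?X = "\<lambda>B. {i. 1 \<le> i \<and> replicate_mset (f x) i = B}"
  let ?S = "SIGMA p:{(B, C). B + C = M}. ?X (fst p) \<times> index_choices A f (snd p)"
  let ?enc = "\<lambda>d. ((replicate_mset (f x) (d x), \<Sum>y\<in>A. replicate_mset (f y) (d y)), d x, restrict d A)"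
  let ?dec = "\<lambda>(p, i, d). d(x := i)"
  have fX: "finite (?X B)" for B
  proof (rule finite_subset)
    show "?X B \<subseteq> set_mset B" using insert.prems by auto
  qed simp
  have "card (index_choices (insert x A) f M) = card ?S"
  proof (rule bij_betw_same_card[of "?enc"],
      rule bij_betw_byWitness[where f' = "?dec"])
    show "\<forall>d\<in>index_choices (insert x A) f M. ?dec (?enc d) = d"
      by (auto simp: index_choices_def PiE_def extensional_def fun_eq_iff)
    have upd: "(\<Sum>y\<in>A. replicate_mset (f y) ((d(x := i)) y)) = (\<Sum>y\<in>A. replicate_mset (f y) (d y))" for d i
      using insert.hyps by (intro sum.cong) auto
    show "\<forall>z\<in>?S. ?enc (?dec z) = z"
    proof
      fix z assume "z \<in> ?S"
      then obtain B C i d where z: "z = ((B, C), i, d)" "B + C = M" "1 \<le> i" "replicate_mset (f x) i = B" "d \<in> index_choices A f C" by auto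
      have "restrict (d(x := i)) A = d"
        using z(5) insert.hyps by (auto simp: index_choices_def PiE_def extensional_def fun_eq_iff)
      then show "?enc (?dec z) = z"
        using z upd[of d i] by (simp add: index_choices_def)
    qed
    show "?enc ` index_choices (insert x A) f M \<subseteq> ?S"
    proof (rule image_subsetI)
      fix d assume d: "d \<in> index_choices (insert x A) f M"
      have "(\<Sum>y\<in>A. replicate_mset (f y) (restrict d A y)) = (\<Sum>y\<in>A. replicate_mset (f y) (d y))"
        by (rule sum.cong) auto
      then show "?enc d \<in> ?S"
        using d insert.hyps by (auto simp: index_choices_def PiE_def Pi_def)
    qed
    show "?dec ` ?S \<subseteq> index_choices (insert x A) f M"
    proof (rule image_subsetI)
      fix z assume "z \<in> ?S"
      then obtain B C i d where z: "z = ((B, C), i, d)" "B + C = M" "1 \<le> i" "replicate_mset (f x) i = B" "d \<in> index_choices A f C" by auto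
      then show "?dec z \<in> index_choices (insert x A) f M"
        using insert.hyps upd[of d i] by (auto simp: index_choices_def PiE_def Pi_def extensional_def)
    qed
  qed
  also have "\<dots> = (\<Sum>p\<in>{(B, C). B + C = M}. card (?X (fst p)) * card (index_choices A f (snd p)))"
  proof (subst card_SigmaI)
    show "finite {(B, C). B + C = M}" by (rule finite_mset_splits)
    show "\<forall>p\<in>{(B, C). B + C = M}. finite (?X (fst p) \<times> index_choices A f (snd p))"
      using fX finite_index_choices[OF insert.hyps(1)] insert.prems by blast
  qed (simp only: card_cartesian_product)
  finally have "(of_nat (card (index_choices (insert x A) f M)) :: 'a) =
     (\<Sum>p\<in>{(B, C). B + C = M}. of_nat (card (?X (fst p))) * of_nat (card (index_choices A f (snd p))))"
    by (simp add: of_nat_sum)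
  also have "\<dots> = coef (\<Prod>x\<in>insert x A. power_sum (f x) :: 'a pseries) M"
    using insert by (simp add: times_pseries.rep_eq power_sum.rep_eq case_prod_unfold)
  finally show ?case ..
qed

lemma mset_as_image: obtains f where "M = image_mset f (mset_set {..<size M})"
proof -
  obtain xs where xs: "mset xs = M" using ex_mset by blast
  then have "M = image_mset (\<lambda>i. xs ! i) (mset_set {..<size M})"
    by (metis map_nth mset_map mset_upt lessThan_atLeast0 size_mset)
  then show ?thesis by (rule that)
qed

definition p_prod :: "nat multiset \<Rightarrow> complex pseries" where
  "p_prod \<mu> = prod_mset (image_mset power_sum \<mu>)"

lemma coef_p_prod:
  assumes "finite A" "\<forall>x\<in>A. 0 < f x" "\<mu> = image_mset f (mset_set A)"
  shows "coef (p_prod \<mu>) M = of_nat (card (index_choices A f M))"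
proof -
  have "p_prod \<mu> = (\<Prod>x\<in>A. power_sum (f x))"
    by (simp add: p_prod_def assms(3) prod_unfold_prod_mset image_mset.compositionality o_def)
  then show ?thesis using coef_prod_power_sum[OF assms(1,2), of M, where 'a = complex] by simp
qed

section \<open>Linear independence of products of power sums\<close>

text \<open>
  A monomial in which each part of \<open>\<mu>\<close> is the exponent of a variable of its own.
  Numbering starts at 2, as the variable with index 1 has to stay free.
\<close>

definition spread :: "nat multiset \<Rightarrow> nat multiset" where
  "spread \<mu> = (let f = (SOME f. \<mu> = image_mset f (mset_set {..<size \<mu>})) in \<Sum>i<size \<mu>. replicate_mset (f i) (i + 2))"

lemma spread_obtain:
  obtains f where "\<mu> = image_mset f (mset_set {..<size \<mu>})" "spread \<mu> = (\<Sum>i<size \<mu>. replicate_mset (f i) (i + 2))"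
proof -
  have "\<exists>f. \<mu> = image_mset f (mset_set {..<size \<mu>})" using mset_as_image by metis
  from someI_ex[OF this] show ?thesis using that by (auto simp: spread_def Let_def)
qed

lemma set_sum_replicate: "finite A \<Longrightarrow> set_mset (\<Sum>x\<in>A. replicate_mset (f x) (d x)) = d ` {x\<in>A. 0 < f x}"
  by (induction A rule: finite_induct) (auto simp: set_mset_replicate_mset_subset)

lemma count_sum_replicate:
  assumes "finite A" "inj_on d A" "x \<in> A"
  shows "count (\<Sum>x\<in>A. replicate_mset (f x) (d x)) (d x) = f x"
proof -
  have "count (\<Sum>x\<in>A. replicate_mset (f x) (d x)) (d x) = (\<Sum>y\<in>A. if y = x then f x else 0)"
    unfolding count_sum by (rule sum.cong) (use assms in \<open>auto simp: inj_on_def\<close>)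
  then show ?thesis using assms by simp
qed

lemma coef_p_prod_spread_self:
  assumes "0 \<notin># \<mu>"
  shows "coef (p_prod \<mu>) (spread \<mu>) \<noteq> 0"
proof -
  obtain f where f: "\<mu> = image_mset f (mset_set {..<size \<mu>})" "spread \<mu> = (\<Sum>i<size \<mu>. replicate_mset (f i) (i + 2))"
    using spread_obtain by blast
  have pos: "\<forall>x\<in>{..<size \<mu>}. 0 < f x"
  proof
    fix x assume "x \<in> {..<size \<mu>}"
    then have "f x \<in># \<mu>" by (subst f(1)) simp
    then show "0 < f x" using assms by (metis gr0I)
  qed
  have "restrict (\<lambda>i. i + 2) {..<size \<mu>} \<in> index_choices {..<size \<mu>} f (spread \<mu>)"
    using f(2) by (auto simp: index_choices_def)
  moreover have "finite (index_choices {..<size \<mu>} f (spread \<mu>))" by (rule finite_index_choices) (use pos in auto)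
  ultimately have "card (index_choices {..<size \<mu>} f (spread \<mu>)) \<noteq> 0" by (metis card_eq_0_iff empty_iff)
  then show ?thesis using coef_p_prod[OF _ pos f(1)] by simp
qed

text \<open>
  If \<open>p\<^sub>\<nu>\<close> contributes to this monomial, then every part of
  \<open>\<mu>\<close> is a sum of parts of \<open>\<nu>\<close>. So \<open>\<nu>\<close> has at
  least as many parts as \<open>\<mu>\<close>, with equality only if every such sum has a single
  term.
\<close>

lemma coef_p_prod_spread:
  assumes \<mu>: "0 \<notin># \<mu>" and \<nu>: "0 \<notin># \<nu>" and le: "size \<nu> \<le> size \<mu>" and nz: "coef (p_prod \<nu>) (spread \<mu>) \<noteq> 0"
  shows "\<nu> = \<mu>"
proof -
  obtain f where f: "\<mu> = image_mset f (mset_set {..<size \<mu>})" "spread \<mu> = (\<Sum>i<size \<mu>. replicate_mset (f i) (i + 2))"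
    using spread_obtain by blast
  obtain g where g: "\<nu> = image_mset g (mset_set {..<size \<nu>})" using mset_as_image by blast
  have posf: "0 < f x" if "x < size \<mu>" for x
  proof -
    have "f x \<in># \<mu>" using that by (subst f(1)) simp
    then show "0 < f x" using \<mu> by (metis gr0I)
  qed
  have posg: "0 < g x" if "x < size \<nu>" for x
  proof -
    have "g x \<in># \<nu>" using that by (subst g) simp
    then show "0 < g x" using \<nu> by (metis gr0I)
  qed
  have "index_choices {..<size \<nu>} g (spread \<mu>) \<noteq> {}"
    using nz coef_p_prod[OF _ _ g, of "spread \<mu>"] posg by auto
  then obtain d where "d \<in> index_choices {..<size \<nu>} g (spread \<mu>)" by blast
  then have d: "spread \<mu> = (\<Sum>j<size \<nu>. replicate_mset (g j) (d j))" by (simp add: index_choices_def)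
  have "set_mset (spread \<mu>) = (\<lambda>i. i + 2) ` {..<size \<mu>}"
    unfolding f(2) set_sum_replicate[OF finite_lessThan] using posf by auto
  moreover have "set_mset (spread \<mu>) = d ` {..<size \<nu>}"
    unfolding d set_sum_replicate[OF finite_lessThan] using posg by auto
  ultimately have im: "d ` {..<size \<nu>} = (\<lambda>i. i + 2) ` {..<size \<mu>}" by simp
  have inj2: "inj_on (\<lambda>i. i + 2 :: nat) {..<size \<mu>}" by (auto simp: inj_on_def)
  have cd: "card (d ` {..<size \<nu>}) = size \<mu>" unfolding im card_image[OF inj2] by simp
  have "size \<mu> = card (d ` {..<size \<nu>})" unfolding cd ..
  also have "\<dots> \<le> size \<nu>" using card_image_le[of "{..<size \<nu>}" d] by simp
  finally have eq: "size \<nu> = size \<mu>" using le by simp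
  have inj: "inj_on d {..<size \<nu>}"
    by (rule eq_card_imp_inj_on) (simp_all only: cd[unfolded eq] eq card_lessThan finite_lessThan)
  have "\<nu> = image_mset (\<lambda>j. count (spread \<mu>) (d j)) (mset_set {..<size \<nu>})"
    by (subst g, rule image_mset_cong) (use count_sum_replicate[OF _ inj, of _ g] d in auto)
  also have "\<dots> = image_mset (count (spread \<mu>)) (mset_set (d ` {..<size \<nu>}))"
    by (subst image_mset_mset_set[OF inj, symmetric]) (simp add: image_mset.compositionality o_def)
  also have "\<dots> = image_mset (\<lambda>i. count (spread \<mu>) (i + 2)) (mset_set {..<size \<mu>})"
    unfolding im by (subst image_mset_mset_set[OF inj2, symmetric]) (simp only: image_mset.compositionality o_def)
  also have "\<dots> = \<mu>"
  proof -
    have "count (spread \<mu>) (i + 2) = f i" if "i < size \<mu>" for i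
      using count_sum_replicate[OF _ inj2, of i f] that unfolding f(2) by simp
    then have "image_mset (\<lambda>i. count (spread \<mu>) (i + 2)) (mset_set {..<size \<mu>}) = image_mset f (mset_set {..<size \<mu>})"
      by (intro image_mset_cong) auto
    then show ?thesis using f(1) by simp
  qed
  finally show ?thesis .
qed

lemma spread_ge_2: "x \<in># spread \<mu> \<Longrightarrow> 2 \<le> x"
proof -
  assume x: "x \<in># spread \<mu>"
  obtain f where f: "spread \<mu> = (\<Sum>i<size \<mu>. replicate_mset (f i) (i + 2))" using spread_obtain by blast
  show ?thesis using x unfolding f set_sum_replicate[OF finite_lessThan] by auto
qed

text \<open>
  A nontrivial relation is tested on \<open>spread \<kappa>\<close>, where \<open>\<kappa>\<close>
  has the most parts among its terms: by \<open>coef_p_prod_spread\<close> no other term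
  contributes.
\<close>

theorem p_prod_independent:
  fixes a :: "nat multiset \<Rightarrow> complex"
  assumes "finite P" "\<And>\<mu>. \<mu> \<in> P \<Longrightarrow> 0 \<notin># \<mu>"
    and zero: "\<And>M. (\<And>x. x \<in># M \<Longrightarrow> 2 \<le> x) \<Longrightarrow> (\<Sum>\<mu>\<in>P. a \<mu> * coef (p_prod \<mu>) M) = 0"
    and "\<mu> \<in> P"
  shows "a \<mu> = 0"
proof (rule ccontr)
  assume "a \<mu> \<noteq> 0"
  let ?Q = "{\<nu>\<in>P. a \<nu> \<noteq> 0}"
  have Q: "finite ?Q" "?Q \<noteq> {}" using assms(1,4) \<open>a \<mu> \<noteq> 0\<close> by auto
  define m where "m = Max (size ` ?Q)"
  have "m \<in> size ` ?Q" unfolding m_def using Q by (intro Max_in) auto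
  then obtain \<kappa> where \<kappa>: "\<kappa> \<in> P" "a \<kappa> \<noteq> 0" "size \<kappa> = m" by auto
  have max: "size \<nu> \<le> size \<kappa>" if "\<nu> \<in> P" "a \<nu> \<noteq> 0" for \<nu>
    unfolding \<kappa>(3) m_def using Q that by (intro Max_ge) auto
  have "(\<Sum>\<nu>\<in>P. a \<nu> * coef (p_prod \<nu>) (spread \<kappa>)) = (\<Sum>\<nu>\<in>P. if \<nu> = \<kappa> then a \<kappa> * coef (p_prod \<kappa>) (spread \<kappa>) else 0)"
  proof (rule sum.cong[OF refl])
    fix \<nu> assume \<nu>: "\<nu> \<in> P"
    show "a \<nu> * coef (p_prod \<nu>) (spread \<kappa>) = (if \<nu> = \<kappa> then a \<kappa> * coef (p_prod \<kappa>) (spread \<kappa>) else 0)"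
      using coef_p_prod_spread[of \<kappa> \<nu>] max[OF \<nu>] assms(2)[OF \<nu>] assms(2)[OF \<kappa>(1)] by auto
  qed
  also have "\<dots> = a \<kappa> * coef (p_prod \<kappa>) (spread \<kappa>)" using assms(1) \<kappa>(1) by simp
  finally show False using zero[of "spread \<kappa>"] spread_ge_2 \<kappa>(2) coef_p_prod_spread_self[OF assms(2)[OF \<kappa>(1)]] by simp
qed

section \<open>A variable of multiplicity one\<close>

lemma coef_times_new:
  fixes F G :: "complex pseries"
  assumes "c \<notin># M"
  shows "coef (F * G) (add_mset c M) =
    (\<Sum>(A, B)\<in>{(A, B). A + B = M}. coef F (add_mset c A) * coef G B) + (\<Sum>(A, B)\<in>{(A, B). A + B = M}. coef F A * coef G (add_mset c B))"
proof -
  let ?S = "{(A, B). A + B = M}"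
  let ?l = "\<lambda>(A, B). (add_mset c A, B)" and ?r = "\<lambda>(A, B). (A, add_mset c B)"
  have "{(A, B). A + B = add_mset c M} = ?l ` ?S \<union> ?r ` ?S"
  proof (intro equalityI subsetI)
    fix p assume "p \<in> {(A, B). A + B = add_mset c M}"
    then obtain A B where p: "p = (A, B)" "A + B = add_mset c M" by auto
    then have "c \<in># A \<or> c \<in># B" by (metis union_iff union_single_eq_member)
    then show "p \<in> ?l ` ?S \<union> ?r ` ?S"
    proof
      assume "c \<in># A"
      then obtain A' where A': "A = add_mset c A'" by (metis insert_DiffM)
      then show ?thesis using p by force
    next
      assume "c \<in># B"
      then obtain B' where B': "B = add_mset c B'" by (metis insert_DiffM)
      then show ?thesis using p by force
    qed
  qed auto
  moreover have "?l ` ?S \<inter> ?r ` ?S = {}" using assms by auto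
  moreover have "inj_on ?l ?S" "inj_on ?r ?S" by (auto simp: inj_on_def)
  ultimately show ?thesis
    using finite_mset_splits[of M] unfolding times_pseries.rep_eq
    by (simp add: sum.union_disjoint sum.reindex case_prod_unfold o_def)
qed

lemma coef_power_sum_new:
  assumes "c \<notin># M" "1 \<le> c"
  shows "coef (power_sum k) (add_mset c M) = (if k = 1 \<and> M = {#} then 1 else (0 :: complex))"
proof -
  have "{i. 1 \<le> i \<and> replicate_mset k i = add_mset c M} = (if k = 1 \<and> M = {#} then {c} else {})"
  proof -
    have *: "i = c \<and> k = 1 \<and> M = {#}" if "replicate_mset k i = add_mset c M" for i
    proof -
      have ic: "i = c" using that by (metis in_replicate_mset union_single_eq_member)
      have "count (replicate_mset k i) c = 1" unfolding that using assms(1) by (simp add: not_in_iff)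
      then have "k = 1" using ic by simp
      then show ?thesis using that ic by simp
    qed
    show ?thesis
    proof (cases "k = 1 \<and> M = {#}")
      case True
      then have "{i. 1 \<le> i \<and> replicate_mset k i = add_mset c M} = {c}" using assms(2) by auto
      then show ?thesis unfolding if_P[OF True] .
    next
      case False
      then have "{i. 1 \<le> i \<and> replicate_mset k i = add_mset c M} = {}" using * by blast
      then show ?thesis unfolding if_not_P[OF False] .
    qed
  qed
  then show ?thesis unfolding power_sum.rep_eq by simp
qed

text \<open>
  A variable that occurs exactly once has to come from one of the \<open>count \<mu> 1\<close>
  factors \<open>p\<^sub>1\<close>.
\<close>

lemma coef_p_prod_new:
  assumes "c \<notin># M" "1 \<le> c"
  shows "coef (p_prod \<mu>) (add_mset c M) = of_nat (count \<mu> 1) * coef (p_prod (\<mu> - {#1#})) M"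
  using assms(1)
proof (induction \<mu> arbitrary: M)
  case empty
  then show ?case by (simp add: p_prod_def one_pseries.rep_eq)
next
  case (add k \<mu>)
  have notin: "c \<notin># A \<and> c \<notin># B" if "A + B = M" for A B using add.prems that by auto
  have p: "p_prod (add_mset k \<mu>) = power_sum k * p_prod \<mu>" by (simp add: p_prod_def)
  have "(\<Sum>(A, B)\<in>{(A, B). A + B = M}. coef (power_sum k) (add_mset c A) * coef (p_prod \<mu>) B)
      = (\<Sum>q\<in>{(A, B). A + B = M}. if q = ({#}, M) then if k = 1 then coef (p_prod \<mu>) M else 0 else 0)"
    by (rule sum.cong) (use notin coef_power_sum_new[OF _ assms(2)] in \<open>auto split: if_splits\<close>)
  also have "\<dots> = (if k = 1 then coef (p_prod \<mu>) M else 0)"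
    using finite_mset_splits[of M] by simp
  finally have 1: "(\<Sum>(A, B)\<in>{(A, B). A + B = M}. coef (power_sum k) (add_mset c A) * coef (p_prod \<mu>) B)
    = (if k = 1 then coef (p_prod \<mu>) M else 0)" .
  have "(\<Sum>(A, B)\<in>{(A, B). A + B = M}. coef (power_sum k) A * coef (p_prod \<mu>) (add_mset c B))
      = (\<Sum>(A, B)\<in>{(A, B). A + B = M}. of_nat (count \<mu> 1) * (coef (power_sum k) A * coef (p_prod (\<mu> - {#1#})) B))"
    by (rule sum.cong) (use notin add.IH in auto)
  also have "\<dots> = of_nat (count \<mu> 1) * coef (power_sum k * p_prod (\<mu> - {#1#})) M"
    by (simp add: times_pseries.rep_eq sum_distrib_left case_prod_unfold)
  also have "\<dots> = of_nat (count \<mu> 1) * coef (p_prod (add_mset k \<mu> - {#1#})) M"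
  proof (cases "1 \<in># \<mu>")
    case True
    then have "add_mset k \<mu> - {#1#} = add_mset k (\<mu> - {#1#})" by (auto simp: multiset_eq_iff)
    then show ?thesis by (simp add: p_prod_def)
  next
    case False
    then show ?thesis by (simp add: not_in_iff)
  qed
  finally have 2: "(\<Sum>(A, B)\<in>{(A, B). A + B = M}. coef (power_sum k) A * coef (p_prod \<mu>) (add_mset c B))
    = of_nat (count \<mu> 1) * coef (p_prod (add_mset k \<mu> - {#1#})) M" .
  show ?case unfolding p coef_times_new[OF add.prems] 1 2 by (auto simp: algebra_simps)
qed

section \<open>Cycle types\<close>

text \<open>
  Arbitrary finite sets in place of \<open>{1..n}\<close> permit induction on the set.
\<close>

definition cycle_type_on :: "'b set \<Rightarrow> ('b \<Rightarrow> 'b) \<Rightarrow> nat multiset" where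
  "cycle_type_on A \<sigma> = image_mset card (mset_set (orb \<sigma> ` A))"

lemma cycle_type_eq: "cycle_type n \<sigma> = cycle_type_on {1..n} \<sigma>"
  by (simp add: cycle_type_def cycle_type_on_def)

context
  fixes A :: "'b set" and \<sigma> assumes fin: "finite A" and \<sigma>: "\<sigma> permutes A"
begin

lemma permutation_\<sigma>: "permutation \<sigma>" using fin \<sigma> by (auto simp: permutation_permutes)

lemma self_orb: "x \<in> orb \<sigma> x" by (rule permutation_self_in_orbit[OF permutation_\<sigma>])

lemma orb_eq: "y \<in> orb \<sigma> x \<Longrightarrow> orb \<sigma> y = orb \<sigma> x"
  by (rule orbit_cyclic_eq3[OF cyclic_on_orbit'[OF permutation_\<sigma>]])

lemma orb_subset: "x \<in> A \<Longrightarrow> orb \<sigma> x \<subseteq> A" by (rule permutes_orbit_subset[OF \<sigma>])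

lemma finite_orb: "finite (orb \<sigma> x)"
  by (rule finite_orbit[OF self_orb])

lemma Union_orb: "\<Union>(orb \<sigma> ` A) = A" using orb_subset self_orb by blast

lemma orb_disjoint: "X \<in> orb \<sigma> ` A \<Longrightarrow> Y \<in> orb \<sigma> ` A \<Longrightarrow> X \<noteq> Y \<Longrightarrow> X \<inter> Y = {}"
  using orb_eq by blast

lemma sum_cycle_type: "sum_mset (cycle_type_on A \<sigma>) = card A"
proof -
  have "sum_mset (cycle_type_on A \<sigma>) = (\<Sum>X\<in>orb \<sigma> ` A. card X)"
    by (simp add: cycle_type_on_def sum_unfold_sum_mset)
  also have "\<dots> = card (\<Union>(orb \<sigma> ` A))"
    by (rule card_Union_disjoint[symmetric]) (use orb_disjoint finite_orb in \<open>auto simp: pairwise_def disjnt_def\<close>)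
  finally show ?thesis using Union_orb by simp
qed

lemma zero_notin_cycle_type: "0 \<notin># cycle_type_on A \<sigma>"
proof
  assume "0 \<in># cycle_type_on A \<sigma>"
  then obtain x where "x \<in> A" "card (orb \<sigma> x) = 0" using fin by (auto simp: cycle_type_on_def)
  then show False using finite_orb[of x] self_orb[of x] by auto
qed

lemma count_cycle_type: "count (cycle_type_on A \<sigma>) k = card {X \<in> orb \<sigma> ` A. card X = k}"
proof -
  have "count (cycle_type_on A \<sigma>) k = size (filter_mset (\<lambda>y. y = k) (cycle_type_on A \<sigma>))"
    by (simp add: filter_eq_replicate_mset)
  also have "\<dots> = card {X \<in> orb \<sigma> ` A. card X = k}"
    using fin by (simp add: cycle_type_on_def filter_mset_image_mset)
  finally show ?thesis .
qed

lemma card_elements_of_cycle_length: "card {b\<in>A. card (orb \<sigma> b) = k} = k * count (cycle_type_on A \<sigma>) k"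
proof -
  let ?Y = "{X \<in> orb \<sigma> ` A. card X = k}"
  have "{b\<in>A. card (orb \<sigma> b) = k} = \<Union>?Y"
  proof (intro equalityI subsetI)
    fix b assume "b \<in> {b\<in>A. card (orb \<sigma> b) = k}"
    then show "b \<in> \<Union>?Y" using self_orb[of b] by blast
  next
    fix b assume "b \<in> \<Union>?Y"
    then obtain x where "x \<in> A" "b \<in> orb \<sigma> x" "card (orb \<sigma> x) = k" by auto
    then show "b \<in> {b\<in>A. card (orb \<sigma> b) = k}" using orb_eq[of b x] orb_subset[of x] by auto
  qed
  also have "card (\<Union>?Y) = (\<Sum>X\<in>?Y. card X)"
    by (rule card_Union_disjoint) (use orb_disjoint finite_orb in \<open>auto simp: pairwise_def disjnt_def\<close>)
  also have "\<dots> = k * card ?Y" by simp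
  finally show ?thesis by (simp add: count_cycle_type)
qed

lemma cycle_type_insert_fixed:
  assumes "a \<notin> A"
  shows "cycle_type_on (insert a A) \<sigma> = add_mset 1 (cycle_type_on A \<sigma>)"
proof -
  have "\<sigma> a = a" using \<sigma> assms by (rule permutes_not_in)
  then have a: "orb \<sigma> a = {a}" by (simp add: orbit_eq_singleton_iff)
  moreover have "{a} \<notin> orb \<sigma> ` A" using orb_subset assms by blast
  ultimately show ?thesis using fin by (simp add: cycle_type_on_def)
qed

text \<open>
  The permutation \<open>\<tau>\<close> arises from \<open>\<sigma>\<close> by inserting the new
  element \<open>a\<close> into the cycle of \<open>b\<close>, in front of \<open>b\<close>.
\<close>

lemma cycle_type_insert_after:
  assumes "a \<notin> A" "b \<in> A"
  defines "\<tau> \<equiv> Transposition.transpose a b \<circ> \<sigma>"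
  shows "cycle_type_on (insert a A) \<tau> = add_mset (Suc (card (orb \<sigma> b))) (cycle_type_on A \<sigma> - {#card (orb \<sigma> b)#})"
proof -
  let ?O = "orb \<sigma> b"
  have a: "\<sigma> a = a" using \<sigma> assms(1) by (rule permutes_not_in)
  have ab: "a \<noteq> b" using assms by auto
  have \<tau>a: "\<tau> a = b" by (simp add: \<tau>_def a)
  have \<tau>x: "\<tau> x = (if \<sigma> x = b then a else \<sigma> x)" if "x \<in> A" for x
    using that assms(1) permutes_in_image[OF \<sigma>, of x] by (auto simp: \<tau>_def Transposition.transpose_def)
  have other: "orb \<tau> x = orb \<sigma> x" if x: "x \<in> A" "x \<notin> ?O" for x
  proof (rule orbit_cong[OF self_orb])
    fix y assume y: "y \<in> orb \<sigma> x"
    then have "y \<in> A" using orb_subset x by blast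
    moreover have "\<sigma> y \<noteq> b"
    proof
      assume "\<sigma> y = b"
      then have "b \<in> orb \<sigma> x" using y by (metis orbit.step)
      then have "orb \<sigma> b = orb \<sigma> x" by (rule orb_eq)
      then show False using x(2) self_orb[of x] by blast
    qed
    ultimately show "\<tau> y = \<sigma> y" using \<tau>x by simp
  qed
  have OA: "?O \<subseteq> A" using orb_subset assms by blast
  have \<tau>p: "\<tau> permutes insert a A"
  proof -
    have "\<sigma> permutes insert a A" using \<sigma> by (rule permutes_subset) auto
    moreover have "Transposition.transpose a b permutes insert a A" using assms by (intro permutes_swap_id) auto
    ultimately show ?thesis unfolding \<tau>_def by (rule permutes_compose)
  qed
  have pt: "permutation \<tau>" using \<tau>p fin by (auto simp: permutation_permutes)
  have "orb \<tau> a = insert a ?O"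
  proof (intro equalityI subsetI)
    fix y assume "y \<in> orb \<tau> a"
    then show "y \<in> insert a ?O"
    proof induction
      case base
      then show ?case using \<tau>a self_orb by simp
    next
      case (step y)
      show ?case
      proof (cases "y = a")
        case True
        then show ?thesis using \<tau>a self_orb by simp
      next
        case False
        then have "y \<in> ?O" using step by simp
        then have "y \<in> A" using OA by blast
        then show ?thesis using \<tau>x[of y] orbit.step[OF \<open>y \<in> ?O\<close>] by simp
      qed
    qed
  next
    fix y assume y: "y \<in> insert a ?O"
    have bij: "bij_betw (\<lambda>k. (\<sigma> ^^ k) b) {..<card ?O} ?O" by (rule orbit_enum(1)[OF \<sigma> fin])
    have pow: "(\<sigma> ^^ k) b \<in> orb \<tau> a" if "k < card ?O" for k
      using that
    proof (induction k)
      case 0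
      then show ?case using \<tau>a orbit.base[of \<tau> a] by simp
    next
      case (Suc k)
      have "(\<sigma> ^^ Suc k) b \<noteq> (\<sigma> ^^ 0) b"
        using bij Suc.prems inj_onD[OF bij_betw_imp_inj_on[OF bij], of "Suc k" 0] by auto
      moreover have "(\<sigma> ^^ k) b \<in> A" using bij Suc.prems OA by (auto simp: bij_betw_def)
      ultimately have "\<tau> ((\<sigma> ^^ k) b) = (\<sigma> ^^ Suc k) b" using \<tau>x by simp
      then show ?case using Suc by (metis Suc_lessD orbit.step)
    qed
    show "y \<in> orb \<tau> a"
    proof (cases "y = a")
      case True
      then show ?thesis using permutation_self_in_orbit[OF pt] by simp
    next
      case False
      then have "y \<in> (\<lambda>k. (\<sigma> ^^ k) b) ` {..<card ?O}" using y bij_betw_imp_surj_on[OF bij] by simp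
      then show ?thesis using pow by auto
    qed
  qed
  then have orba: "orb \<tau> x = insert a ?O" if "x \<in> insert a ?O" for x
    using that orbit_cyclic_eq3[OF cyclic_on_orbit'[OF pt], of x a] by simp
  have "orb \<tau> ` insert a A = insert (insert a ?O) (orb \<sigma> ` A - {?O})"
  proof (intro equalityI subsetI)
    fix X assume "X \<in> orb \<tau> ` insert a A"
    then obtain x where x: "x \<in> insert a A" "X = orb \<tau> x" by auto
    show "X \<in> insert (insert a ?O) (orb \<sigma> ` A - {?O})"
    proof (cases "x \<in> insert a ?O")
      case True
      then show ?thesis using orba x by simp
    next
      case False
      then have "X = orb \<sigma> x" "x \<in> A" using other x by auto
      moreover have "orb \<sigma> x \<noteq> ?O" using False self_orb[of x] by auto
      ultimately show ?thesis by auto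
    qed
  next
    fix X assume "X \<in> insert (insert a ?O) (orb \<sigma> ` A - {?O})"
    then consider "X = insert a ?O" | x where "x \<in> A" "X = orb \<sigma> x" "X \<noteq> ?O" by auto
    then show "X \<in> orb \<tau> ` insert a A"
    proof cases
      case 1
      then show ?thesis using orba[of a] by auto
    next
      case 2
      then have "x \<notin> ?O" using orb_eq by blast
      then show ?thesis using other[of x] 2 by auto
    qed
  qed
  moreover have "insert a ?O \<notin> orb \<sigma> ` A - {?O}" using orb_subset assms(1) by blast
  moreover have "mset_set (orb \<sigma> ` A) = add_mset ?O (mset_set (orb \<sigma> ` A - {?O}))"
    using assms(2) fin by (metis finite_Diff finite_imageI imageI insert_Diff mset_set.insert Diff_iff singletonI)
  ultimately show ?thesis
    using fin assms(1) OA finite_orb[of b] by (auto simp: cycle_type_on_def card_insert_if)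
qed

end

section \<open>Sizes of conjugacy classes\<close>

lemma z_part_add: "0 < k \<Longrightarrow> z_part (add_mset k \<nu>) = z_part \<nu> * k * Suc (count \<nu> k)"
proof -
  assume k: "0 < k"
  let ?f = "\<lambda>\<nu> i. i ^ count \<nu> i * fact (count \<nu> i) :: nat"
  have z: "z_part \<nu> = (\<Prod>i\<in>insert k (set_mset \<nu>). ?f \<nu> i)" for \<nu>
    unfolding z_part_def by (rule prod.mono_neutral_left) (auto simp: not_in_iff)
  have "z_part (add_mset k \<nu>) = (\<Prod>i\<in>insert k (set_mset \<nu>). ?f (add_mset k \<nu>) i)"
    unfolding z[of "add_mset k \<nu>"] by simp
  also have "\<dots> = ?f (add_mset k \<nu>) k * (\<Prod>i\<in>insert k (set_mset \<nu>) - {k}. ?f (add_mset k \<nu>) i)"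
    by (rule prod.remove) auto
  also have "(\<Prod>i\<in>insert k (set_mset \<nu>) - {k}. ?f (add_mset k \<nu>) i) = (\<Prod>i\<in>insert k (set_mset \<nu>) - {k}. ?f \<nu> i)"
    by (rule prod.cong) auto
  also have "?f (add_mset k \<nu>) k = k * Suc (count \<nu> k) * ?f \<nu> k" by (simp add: algebra_simps)
  finally have "z_part (add_mset k \<nu>) = k * Suc (count \<nu> k) * (?f \<nu> k * (\<Prod>i\<in>insert k (set_mset \<nu>) - {k}. ?f \<nu> i))"
    by (simp only: mult.assoc)
  also have "?f \<nu> k * (\<Prod>i\<in>insert k (set_mset \<nu>) - {k}. ?f \<nu> i) = z_part \<nu>"
    unfolding z[of \<nu>] by (rule prod.remove[symmetric]) auto
  finally show ?thesis by (simp only: mult_ac)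
qed

lemma z_part_pos: "0 \<notin># \<mu> \<Longrightarrow> 0 < z_part \<mu>"
  unfolding z_part_def by (rule prod_pos) (auto intro: gr0I)

lemma sum_mset_count: "sum_mset (\<mu> :: nat multiset) = (\<Sum>i\<in>set_mset \<mu>. i * count \<mu> i)"
proof (induction \<mu>)
  case (add k \<mu>)
  have e: "(\<Sum>i\<in>set_mset \<mu>. i * count \<mu> i) = (\<Sum>i\<in>insert k (set_mset \<mu>). i * count \<mu> i)"
    by (rule sum.mono_neutral_left) (auto simp: not_in_iff)
  have "(\<Sum>i\<in>set_mset (add_mset k \<mu>). i * count (add_mset k \<mu>) i) = (\<Sum>i\<in>insert k (set_mset \<mu>). i * count \<mu> i + (if i = k then k else 0))"
    by (rule sum.cong) auto
  also have "\<dots> = sum_mset \<mu> + k" by (simp add: sum.distrib add e)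
  finally show ?case by simp
qed simp

definition class_count :: "'b set \<Rightarrow> nat multiset \<Rightarrow> nat" where
  "class_count A \<mu> = card {\<sigma>. \<sigma> permutes A \<and> cycle_type_on A \<sigma> = \<mu>}"

text \<open>
  A permutation of \<open>insert a A\<close> arises from a permutation of \<open>A\<close> by
  leaving \<open>a\<close> fixed or by inserting it in front of some \<open>b\<close>. The
  summation index \<open>i\<close> is the length of the cycle of \<open>a\<close>; for \<open>i >
  1\<close> the element \<open>b\<close> can be any of those in cycles of length \<open>i -
  1\<close>.
\<close>

lemma class_count_insert:
  assumes "finite A" "a \<notin> A" "0 \<notin># \<mu>"
  shows "class_count (insert a A) \<mu> = (\<Sum>i\<in>set_mset \<mu>. if i = 1 then class_count A (\<mu> - {#1#})
     else class_count A (add_mset (i - 1) (\<mu> - {#i#})) * ((i - 1) * Suc (count (\<mu> - {#i#}) (i - 1))))"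
proof -
  let ?P = "{p. p permutes A}"
  let ?T = "\<lambda>(b, p). Transposition.transpose a b \<circ> p"
  let ?s = "\<lambda>p i. if i = 1 then (if cycle_type_on A p = \<mu> - {#1#} then 1 else 0)
     else (if cycle_type_on A p = add_mset (i - 1) (\<mu> - {#i#}) then (i - 1) * Suc (count (\<mu> - {#i#}) (i - 1)) else 0)"
  let ?t = "\<lambda>i. if i = 1 then class_count A (\<mu> - {#1#})
     else class_count A (add_mset (i - 1) (\<mu> - {#i#})) * ((i - 1) * Suc (count (\<mu> - {#i#}) (i - 1)))"
  have fP: "finite ?P" using assms(1) by (rule finite_permutations)
  have inj: "inj_on ?T (insert a A \<times> ?P)"
  proof (rule inj_onI, clarsimp)
    fix b p b' p' assume p: "p permutes A" "p' permutes A" and eq: "Transposition.transpose a b \<circ> p = Transposition.transpose a b' \<circ> p'"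
    have "p a = a" "p' a = a" using p assms(2) by (auto intro: permutes_not_in)
    then have "b = b'" using fun_cong[OF eq, of a] by simp
    moreover from this have "p = p'" using arg_cong[OF eq, of "\<lambda>f. Transposition.transpose a b \<circ> f"]
      by (simp add: comp_assoc[symmetric])
    ultimately show "b = b' \<and> p = p'" ..
  qed
  have "{\<sigma>. \<sigma> permutes insert a A \<and> cycle_type_on (insert a A) \<sigma> = \<mu>} = ?T ` {z \<in> insert a A \<times> ?P. cycle_type_on (insert a A) (?T z) = \<mu>}"
  proof -
    have "{\<sigma>. \<sigma> permutes insert a A} = ?T ` (insert a A \<times> ?P)"
      unfolding permutes_insert by (rule arg_cong[where f = "\<lambda>X. ?T ` X"]) auto
    then have "{\<sigma>. \<sigma> permutes insert a A \<and> cycle_type_on (insert a A) \<sigma> = \<mu>} =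
      {\<sigma> \<in> ?T ` (insert a A \<times> ?P). cycle_type_on (insert a A) \<sigma> = \<mu>}" by blast
    then show ?thesis by (simp only:) blast
  qed
  then have "class_count (insert a A) \<mu> = card {z \<in> insert a A \<times> ?P. cycle_type_on (insert a A) (?T z) = \<mu>}"
    unfolding class_count_def by (simp only:) (rule card_image, rule inj_on_subset[OF inj], auto)
  also have "\<dots> = card {(p, b) \<in> ?P \<times> insert a A. cycle_type_on (insert a A) (?T (b, p)) = \<mu>}"
    by (rule bij_betw_same_card[of prod.swap], rule bij_betw_byWitness[where f' = prod.swap]) auto
  also have "{(p, b) \<in> ?P \<times> insert a A. cycle_type_on (insert a A) (?T (b, p)) = \<mu>} =
     (SIGMA p:?P. {b \<in> insert a A. cycle_type_on (insert a A) (?T (b, p)) = \<mu>})" by auto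
  also have "card \<dots> = (\<Sum>p\<in>?P. card {b \<in> insert a A. cycle_type_on (insert a A) (?T (b, p)) = \<mu>})"
    using fP assms(1) by simp
  also have "\<dots> = (\<Sum>p\<in>?P. \<Sum>i\<in>set_mset \<mu>. ?s p i)"
  proof (rule sum.cong[OF refl])
    fix p assume "p \<in> ?P"
    then have p: "p permutes A" by simp
    let ?B = "\<lambda>i. if i = 1 then {b \<in> {a}. add_mset 1 (cycle_type_on A p) = \<mu>}
       else {b \<in> A. card (orb p b) = i - 1 \<and> cycle_type_on A p = add_mset (i - 1) (\<mu> - {#i#})}"
    have "{b \<in> insert a A. cycle_type_on (insert a A) (?T (b, p)) = \<mu>} = (\<Union>i\<in>set_mset \<mu>. ?B i)"
    proof (intro equalityI subsetI)
      fix b assume b: "b \<in> {b \<in> insert a A. cycle_type_on (insert a A) (?T (b, p)) = \<mu>}"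
      show "b \<in> (\<Union>i\<in>set_mset \<mu>. ?B i)"
      proof (cases "b = a")
        case True
        then have e: "add_mset 1 (cycle_type_on A p) = \<mu>" using b cycle_type_insert_fixed[OF assms(1) p assms(2)] by simp
        then have "1 \<in># \<mu>" by auto
        moreover have "b \<in> ?B 1" using e True by simp
        ultimately show ?thesis by blast
      next
        case False
        then have bA: "b \<in> A" using b by simp
        let ?k = "card (orb p b)"
        have kp: "?k \<noteq> 0" using finite_orb[OF assms(1) p, of b] self_orb[OF assms(1) p, of b] by auto
        have e: "\<mu> = add_mset (Suc ?k) (cycle_type_on A p - {#?k#})"
          using b cycle_type_insert_after[OF assms(1) p assms(2) bA] by simp
        have "?k \<in># cycle_type_on A p" using bA assms(1) by (auto simp: cycle_type_on_def)
        then have "cycle_type_on A p = add_mset ?k (\<mu> - {#Suc ?k#})" using e by simp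
        then have "b \<in> ?B (Suc ?k)" using bA kp by simp
        moreover have "Suc ?k \<in># \<mu>" by (subst e) simp
        ultimately show ?thesis by blast
      qed
    next
      fix b assume "b \<in> (\<Union>i\<in>set_mset \<mu>. ?B i)"
      then obtain i where i: "i \<in># \<mu>" "b \<in> ?B i" by blast
      show "b \<in> {b \<in> insert a A. cycle_type_on (insert a A) (?T (b, p)) = \<mu>}"
      proof (cases "i = 1")
        case True
        then show ?thesis using i cycle_type_insert_fixed[OF assms(1) p assms(2)] by auto
      next
        case False
        then have bi: "b \<in> A" "card (orb p b) = i - 1" "cycle_type_on A p = add_mset (i - 1) (\<mu> - {#i#})" using i(2) by auto
        have "i \<noteq> 0" using i(1) assms(3) by metis
        then have "cycle_type_on (insert a A) (?T (b, p)) = \<mu>"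
          using cycle_type_insert_after[OF assms(1) p assms(2) bi(1)] bi i(1) by simp
        then show ?thesis using bi(1) by simp
      qed
    qed
    also have "card (\<Union>i\<in>set_mset \<mu>. ?B i) = (\<Sum>i\<in>set_mset \<mu>. card (?B i))"
    proof (rule card_UN_disjoint)
      show "\<forall>i\<in>set_mset \<mu>. finite (?B i)" using assms(1) by simp
      show "\<forall>i\<in>set_mset \<mu>. \<forall>j\<in>set_mset \<mu>. i \<noteq> j \<longrightarrow> ?B i \<inter> ?B j = {}"
      proof (intro ballI impI)
        fix i j assume "i \<in># \<mu>" "j \<in># \<mu>" "i \<noteq> j"
        then have "i \<noteq> 0" "j \<noteq> 0" using assms(3) by metis+
        then show "?B i \<inter> ?B j = {}" using \<open>i \<noteq> j\<close> assms(2) by (auto split: if_splits)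
      qed
    qed simp
    also have "\<dots> = (\<Sum>i\<in>set_mset \<mu>. ?s p i)"
    proof (rule sum.cong[OF refl])
      fix i assume i: "i \<in># \<mu>"
      show "card (?B i) = (?s p i)"
      proof (cases "i = 1")
        case True
        have "add_mset 1 (cycle_type_on A p) = \<mu> \<longleftrightarrow> cycle_type_on A p = \<mu> - {#1#}"
          using insert_DiffM[of 1 \<mu>] i True by auto
        then show ?thesis using True by simp
      next
        case False
        show ?thesis
        proof (cases "cycle_type_on A p = add_mset (i - 1) (\<mu> - {#i#})")
          case True
          then have "?B i = {b \<in> A. card (orb p b) = i - 1}" using False by auto
          then have "card (?B i) = card {b \<in> A. card (orb p b) = i - 1}" by (rule arg_cong)
          also have "\<dots> = (i - 1) * count (cycle_type_on A p) (i - 1)"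
            by (rule card_elements_of_cycle_length[OF assms(1) p])
          also have "count (cycle_type_on A p) (i - 1) = Suc (count (\<mu> - {#i#}) (i - 1))" unfolding True by simp
          finally show ?thesis using True False by simp
        qed (use False in simp)
      qed
    qed
    finally show "card {b \<in> insert a A. cycle_type_on (insert a A) (?T (b, p)) = \<mu>} = (\<Sum>i\<in>set_mset \<mu>. ?s p i)" .
  qed
  also have "\<dots> = (\<Sum>i\<in>set_mset \<mu>. \<Sum>p\<in>?P. ?s p i)"
    by (rule sum.swap)
  also have "\<dots> = (\<Sum>i\<in>set_mset \<mu>. ?t i)"
  proof (rule sum.cong[OF refl])
    fix i
    have *: "(\<Sum>p\<in>?P. if cycle_type_on A p = \<nu> then c else 0) = class_count A \<nu> * c" for \<nu> and c :: nat
      using fP by (simp add: sum.If_cases class_count_def Int_def)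
    show "(\<Sum>p\<in>?P. ?s p i) =
      (?t i)"
    proof (cases "i = 1")
      case True
      then show ?thesis using *[of "\<mu> - {#1#}" 1] by simp
    next
      case False
      then show ?thesis using *[of "add_mset (i - 1) (\<mu> - {#i#})"] by simp
    qed
  qed
  finally show ?thesis .
qed

text \<open>
  After multiplication by \<open>z_part \<mu>\<close> the summand for \<open>i\<close> in
  \<open>class_count_insert\<close> becomes \<open>fact (card A) * (i * count \<mu> i)\<close>,
  and the numbers \<open>i * count \<mu> i\<close> add up to \<open>card A + 1\<close>.
\<close>

theorem class_count_z_part:
  assumes "finite A" "0 \<notin># \<mu>" "sum_mset \<mu> = card A"
  shows "class_count A \<mu> * z_part \<mu> = fact (card A)"
  using assms
proof (induction A arbitrary: \<mu> rule: finite_induct)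
  case empty
  have "\<mu> = {#}"
  proof (rule ccontr)
    assume "\<mu> \<noteq> {#}"
    then obtain x where "x \<in># \<mu>" by auto
    then have "x = 0" using empty.prems(2) by simp
    then show False using empty.prems(1) \<open>x \<in># \<mu>\<close> by simp
  qed
  moreover have "{\<sigma> :: 'a \<Rightarrow> 'a. \<sigma> permutes {} \<and> cycle_type_on {} \<sigma> = {#}} = {id}"
    by (auto simp: cycle_type_on_def permutes_empty)
  ultimately show ?case by (simp add: class_count_def z_part_def)
next
  case (insert a A)
  have summand: "(if i = 1 then class_count A (\<mu> - {#1#})
     else class_count A (add_mset (i - 1) (\<mu> - {#i#})) * ((i - 1) * Suc (count (\<mu> - {#i#}) (i - 1)))) * z_part \<mu>
     = fact (card A) * (i * count \<mu> i)" if i: "i \<in># \<mu>" for i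
  proof -
    have i0: "i \<noteq> 0" using i insert.prems(1) by metis
    have \<mu>: "\<mu> = add_mset i (\<mu> - {#i#})" using i by simp
    have z: "z_part \<mu> = z_part (\<mu> - {#i#}) * (i * count \<mu> i)"
      using z_part_add[of i "\<mu> - {#i#}"] i0 \<mu>[symmetric] i by simp
    have nz: "0 \<notin># \<mu> - {#i#}" using insert.prems(1) by (meson in_diffD)
    have sm: "sum_mset (\<mu> - {#i#}) + i = Suc (card A)"
      using insert.prems(2) insert.hyps by (subst (asm) \<mu>) (simp add: add.commute)
    show ?thesis
    proof (cases "i = 1")
      case True
      have "class_count A (\<mu> - {#1#}) * z_part (\<mu> - {#1#}) = fact (card A)"
        using sm True nz by (intro insert.IH) auto
      then show ?thesis using z True by simp
    next
      case False
      let ?\<nu> = "add_mset (i - 1) (\<mu> - {#i#})"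
      have "class_count A ?\<nu> * z_part ?\<nu> = fact (card A)"
        using sm i0 False nz by (intro insert.IH) auto
      moreover have "z_part ?\<nu> = z_part (\<mu> - {#i#}) * (i - 1) * Suc (count (\<mu> - {#i#}) (i - 1))"
        using False i0 by (intro z_part_add) simp
      ultimately have "class_count A ?\<nu> * ((i - 1) * Suc (count (\<mu> - {#i#}) (i - 1))) * z_part (\<mu> - {#i#}) = fact (card A)"
        by (simp only: mult_ac)
      then show ?thesis unfolding z if_not_P[OF False] by (metis mult.assoc)
    qed
  qed
  have "class_count (insert a A) \<mu> * z_part \<mu> = (\<Sum>i\<in>set_mset \<mu>. fact (card A) * (i * count \<mu> i))"
    unfolding class_count_insert[OF insert.hyps insert.prems(1)] sum_distrib_right
    by (rule sum.cong[OF refl summand])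
  also have "\<dots> = fact (card A) * sum_mset \<mu>" by (simp add: sum_mset_count sum_distrib_left)
  also have "\<dots> = fact (card (insert a A))" using insert by simp
  finally show ?case .
qed

section \<open>Conjugate permutations\<close>

text \<open>
  Coordinates in which the permutation is a cyclic shift along each of its cycles. They depend
  only on the list of cycle lengths, so matching them for two permutations gives a conjugation.
\<close>

lemma cycle_enumeration:
  assumes "finite A" "\<sigma> permutes A" "distinct Xs" "set Xs = orb \<sigma> ` A"
  obtains F where "bij_betw F (SIGMA i:{..<length Xs}. {..<card (Xs ! i)}) A"
    "\<And>i k. i < length Xs \<Longrightarrow> k < card (Xs ! i) \<Longrightarrow> \<sigma> (F (i, k)) = F (i, Suc k mod card (Xs ! i))"
proof -
  have "\<exists>x\<in>A. orb \<sigma> x = Xs ! i" if "i < length Xs" for i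
    using nth_mem[OF that] unfolding assms(4) by auto
  then obtain a where a: "\<And>i. i < length Xs \<Longrightarrow> a i \<in> A \<and> orb \<sigma> (a i) = Xs ! i" by metis
  have en: "bij_betw (\<lambda>k. (\<sigma> ^^ k) (a i)) {..<card (Xs ! i)} (Xs ! i)" "(\<sigma> ^^ card (Xs ! i)) (a i) = a i"
    if "i < length Xs" for i
    using orbit_enum[OF assms(2,1), of "a i"] a[OF that] by simp_all
  let ?F = "\<lambda>(i, k). (\<sigma> ^^ k) (a i)" and ?I = "SIGMA i:{..<length Xs}. {..<card (Xs ! i)}"
  have mem: "(\<sigma> ^^ k) (a i) \<in> Xs ! i" if "i < length Xs" "k < card (Xs ! i)" for i k
    using bij_betw_imp_surj_on[OF en(1)[OF that(1)]] that(2) by blast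
  show ?thesis
  proof (rule that)
    show "bij_betw ?F ?I A"
      unfolding bij_betw_def
    proof
      show "inj_on ?F ?I"
      proof (rule inj_onI, clarsimp)
        fix i k j l assume *: "i < length Xs" "k < card (Xs ! i)" "j < length Xs" "l < card (Xs ! j)"
          and eq: "(\<sigma> ^^ k) (a i) = (\<sigma> ^^ l) (a j)"
        have "Xs ! i \<in> orb \<sigma> ` A" "Xs ! j \<in> orb \<sigma> ` A" using nth_mem * assms(4) by blast+
        moreover have "Xs ! i \<inter> Xs ! j \<noteq> {}" using mem[of i k] mem[of j l] * eq by auto
        ultimately have "Xs ! i = Xs ! j" using orb_disjoint[OF assms(1,2)] by blast
        then have "i = j" using assms(3) * by (simp add: nth_eq_iff_index_eq)
        then show "i = j \<and> k = l" using en(1)[of i] * eq by (auto simp: bij_betw_def inj_on_def)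
      qed
      show "?F ` ?I = A"
      proof (intro equalityI subsetI)
        fix x assume "x \<in> ?F ` ?I"
        then obtain i k where *: "x = (\<sigma> ^^ k) (a i)" "i < length Xs" "k < card (Xs ! i)" by auto
        then have "x \<in> orb \<sigma> (a i)" using mem[of i k] a[of i] by simp
        then show "x \<in> A" using orb_subset[OF assms(1,2), of "a i"] a[of i] * by auto
      next
        fix x assume x: "x \<in> A"
        then have "orb \<sigma> x \<in> set Xs" using assms(4) by simp
        then obtain i where i: "i < length Xs" "Xs ! i = orb \<sigma> x" by (metis in_set_conv_nth)
        then have "x \<in> Xs ! i" using self_orb[OF assms(1,2)] by simp
        then have "x \<in> (\<lambda>k. (\<sigma> ^^ k) (a i)) ` {..<card (Xs ! i)}" using bij_betw_imp_surj_on[OF en(1)[OF i(1)]] by simp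
        then show "x \<in> ?F ` ?I" using i(1) by force
      qed
    qed
    fix i k assume *: "i < length Xs" "k < card (Xs ! i)"
    show "\<sigma> (?F (i, k)) = ?F (i, Suc k mod card (Xs ! i))"
    proof (cases "Suc k = card (Xs ! i)")
      case True
      then have "\<sigma> ((\<sigma> ^^ k) (a i)) = a i" using en(2)[OF *(1)] by (metis comp_apply funpow.simps(2))
      then show ?thesis using True by simp
    qed (use * in simp)
  qed
qed

theorem conjugate_if_same_cycle_type:
  assumes A: "finite A" and \<sigma>: "\<sigma> permutes A" and \<tau>: "\<tau> permutes A" and eq: "cycle_type_on A \<sigma> = cycle_type_on A \<tau>"
  obtains \<pi> where "\<pi> permutes A" "\<pi> \<circ> \<sigma> = \<tau> \<circ> \<pi>"
proof -
  obtain Xs where Xs: "set Xs = orb \<sigma> ` A" "distinct Xs" using finite_distinct_list[of "orb \<sigma> ` A"] A by auto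
  obtain Zs where Zs: "set Zs = orb \<tau> ` A" "distinct Zs" using finite_distinct_list[of "orb \<tau> ` A"] A by auto
  have "mset (map card Xs) = mset (map card Zs)"
    using eq unfolding cycle_type_on_def Xs(1)[symmetric] Zs(1)[symmetric] mset_set_set[OF Xs(2)] mset_set_set[OF Zs(2)] by simp
  then obtain p where p: "p permutes {..<length (map card Zs)}" "permute_list p (map card Zs) = map card Xs"
    by (rule mset_eq_permutation)
  then have p': "p permutes {..<length Zs}" by simp
  define Ys where "Ys = permute_list p Zs"
  have Ys: "set Ys = orb \<tau> ` A" "distinct Ys" using p' Zs by (simp_all add: Ys_def)
  have "map card Ys = map card Xs" using p(2) p' by (simp add: Ys_def permute_list_map)
  then have len: "length Ys = length Xs" and cards: "\<And>i. i < length Xs \<Longrightarrow> card (Ys ! i) = card (Xs ! i)"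
    by (metis length_map, metis length_map nth_map)
  let ?I = "SIGMA i:{..<length Xs}. {..<card (Xs ! i)}"
  obtain F where F: "bij_betw F ?I A" "\<And>i k. i < length Xs \<Longrightarrow> k < card (Xs ! i) \<Longrightarrow> \<sigma> (F (i, k)) = F (i, Suc k mod card (Xs ! i))"
    using cycle_enumeration[OF A \<sigma> Xs(2,1)] by blast
  obtain G where G0: "bij_betw G (SIGMA i:{..<length Ys}. {..<card (Ys ! i)}) A"
      "\<And>i k. i < length Ys \<Longrightarrow> k < card (Ys ! i) \<Longrightarrow> \<tau> (G (i, k)) = G (i, Suc k mod card (Ys ! i))"
    using cycle_enumeration[OF A \<tau> Ys(2,1)] by blast
  have "(SIGMA i:{..<length Ys}. {..<card (Ys ! i)}) = ?I" using len cards by auto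
  then have G: "bij_betw G ?I A" "\<And>i k. i < length Xs \<Longrightarrow> k < card (Xs ! i) \<Longrightarrow> \<tau> (G (i, k)) = G (i, Suc k mod card (Xs ! i))"
    using G0 len cards by simp_all
  define \<pi> where "\<pi> x = (if x \<in> A then G (the_inv_into ?I F x) else x)" for x
  have \<pi>F: "\<pi> (F z) = G z" if "z \<in> ?I" for z
    using that F(1) by (auto simp: \<pi>_def bij_betw_def the_inv_into_f_f)
  have "bij_betw (G \<circ> the_inv_into ?I F) A A"
    using bij_betw_the_inv_into[OF F(1)] G(1) by (rule bij_betw_trans)
  then have "bij_betw \<pi> A A" by (rule bij_betw_cong[THEN iffD1, rotated]) (simp add: \<pi>_def)
  then have \<pi>: "\<pi> permutes A" by (rule bij_imp_permutes) (simp only: \<pi>_def if_False)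
  have "\<pi> (\<sigma> x) = \<tau> (\<pi> x)" for x
  proof (cases "x \<in> A")
    case True
    then have "x \<in> F ` ?I" using bij_betw_imp_surj_on[OF F(1)] by simp
    then obtain i k where ik: "i < length Xs" "k < card (Xs ! i)" "x = F (i, k)" by auto
    then have "(i, Suc k mod card (Xs ! i)) \<in> ?I" "(i, k) \<in> ?I" by auto
    then show ?thesis using ik F(2)[OF ik(1,2)] G(2)[OF ik(1,2)] \<pi>F by simp
  next
    case False
    then show ?thesis using permutes_not_in[OF \<sigma>] permutes_not_in[OF \<tau>] permutes_not_in[OF \<pi>] by simp
  qed
  then show ?thesis using that[OF \<pi>] by (simp add: fun_eq_iff)
qed

section \<open>Colourings fixed by a permutation\<close>

lemma image_mset_eq_sum: "finite A \<Longrightarrow> image_mset g (mset_set A) = (\<Sum>x\<in>A. {#g x#})"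
  by (induction A rule: finite_induct) auto

lemma sum_single_const: "finite X \<Longrightarrow> (\<Sum>x\<in>X. {#a#}) = replicate_mset (card X) a"
  by (induction X rule: finite_induct) auto

definition colourings :: "'b set \<Rightarrow> nat multiset \<Rightarrow> ('b \<Rightarrow> nat) set" where
  "colourings A M = {c \<in> extensional A. image_mset c (mset_set A) = M}"

lemma finite_colourings:
  assumes "finite A"
  shows "finite (colourings A M)"
proof (rule finite_subset)
  show "colourings A M \<subseteq> A \<rightarrow>\<^sub>E set_mset M" using assms by (auto simp: colourings_def PiE_def)
  show "finite (A \<rightarrow>\<^sub>E set_mset M)" using assms by (rule finite_PiE) simp
qed

text \<open>
  A colouring fixed by \<open>\<sigma>\<close> is constant on cycles, so it chooses one variable
  for every factor of the product of power sums.
\<close>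

lemma coef_p_prod_cycle_type:
  assumes A: "finite A" and \<sigma>: "\<sigma> permutes A" and M: "0 \<notin># M"
  shows "coef (p_prod (cycle_type_on A \<sigma>)) M = of_nat (card {c \<in> colourings A M. \<forall>x\<in>A. c (\<sigma> x) = c x})"
proof -
  let ?X = "orb \<sigma> ` A"
  let ?C = "{c \<in> colourings A M. \<forall>x\<in>A. c (\<sigma> x) = c x}"
  let ?spread = "\<lambda>d. restrict (\<lambda>x. d (orb \<sigma> x)) A"
  let ?choose = "\<lambda>c. restrict (\<lambda>X. c (SOME x. x \<in> X)) ?X"
  have pos: "\<forall>X\<in>?X. 0 < card X" using finite_orb[OF A \<sigma>] self_orb[OF A \<sigma>] by (auto simp: card_gt_0_iff)
  have blocks: "{x\<in>A. orb \<sigma> x = X} = X" if "X \<in> ?X" for X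
    using that orb_eq[OF A \<sigma>] orb_subset[OF A \<sigma>] self_orb[OF A \<sigma>] by blast
  have image: "image_mset (\<lambda>x. d (orb \<sigma> x)) (mset_set A) = (\<Sum>X\<in>?X. replicate_mset (card X) (d X))" for d :: "'a set \<Rightarrow> nat"
  proof -
    have "image_mset (\<lambda>x. d (orb \<sigma> x)) (mset_set A) = (\<Sum>X\<in>?X. \<Sum>x\<in>{x\<in>A. orb \<sigma> x = X}. {#d (orb \<sigma> x)#})"
      unfolding image_mset_eq_sum[OF A] by (rule sum.image_gen[OF A])
    also have "\<dots> = (\<Sum>X\<in>?X. replicate_mset (card X) (d X))"
    proof (rule sum.cong[OF refl])
      fix X assume X: "X \<in> ?X"
      have "(\<Sum>x\<in>{x\<in>A. orb \<sigma> x = X}. {#d (orb \<sigma> x)#}) = (\<Sum>x\<in>{x\<in>A. orb \<sigma> x = X}. {#d X#})"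
        by (rule sum.cong) auto
      also have "\<dots> = replicate_mset (card {x\<in>A. orb \<sigma> x = X}) (d X)"
        by (rule sum_single_const) (use A in simp)
      also have "\<dots> = replicate_mset (card X) (d X)" unfolding blocks[OF X] ..
      finally show "(\<Sum>x\<in>{x\<in>A. orb \<sigma> x = X}. {#d (orb \<sigma> x)#}) = replicate_mset (card X) (d X)" .
    qed
    finally show ?thesis .
  qed
  have const: "c y = c x" if c: "\<forall>x\<in>A. c (\<sigma> x) = c x" and x: "x \<in> A" and y: "y \<in> orb \<sigma> x" for c :: "'a \<Rightarrow> nat" and x y
    using y
  proof induction
    case (step y)
    then show ?case using c orb_subset[OF A \<sigma> x] by auto
  qed (use c x in simp)
  have "card (index_choices ?X card M) = card ?C"
  proof (rule bij_betw_same_card[of "?spread"], rule bij_betw_byWitness[where f' = "?choose"])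
    have some: "(SOME x. x \<in> X) \<in> X" if "X \<in> ?X" for X using self_orb[OF A \<sigma>] that by (metis imageE someI_ex)
    have some_orb: "(SOME x. x \<in> X) \<in> A \<and> orb \<sigma> (SOME x. x \<in> X) = X" if "X \<in> ?X" for X
      using some[OF that] blocks[OF that] by blast
    show "\<forall>d\<in>index_choices ?X card M. ?choose (?spread d) = d"
    proof
      fix d assume d: "d \<in> index_choices ?X card M"
      show "?choose (?spread d) = d"
      proof
        fix X show "?choose (?spread d) X = d X"
        proof (cases "X \<in> ?X")
          case True
          then show ?thesis using some_orb[OF True] by simp
        next
          case False
          then show ?thesis using d by (auto simp: index_choices_def PiE_def extensional_def)
        qed
      qed
    qed
    show "\<forall>c\<in>?C. ?spread (?choose c) = c"
    proof
      fix c assume c: "c \<in> ?C"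
      show "?spread (?choose c) = c"
      proof
        fix x show "?spread (?choose c) x = c x"
        proof (cases "x \<in> A")
          case True
          then have "?spread (?choose c) x = c (SOME y. y \<in> orb \<sigma> x)"
            by (simp only: restrict_apply imageI if_True)
          also have "\<dots> = c x"
          proof (rule const[OF _ True])
            show "(SOME y. y \<in> orb \<sigma> x) \<in> orb \<sigma> x" using some[of "orb \<sigma> x"] True by blast
          qed (use c in blast)
          finally show ?thesis .
        next
          case False
          then show ?thesis using c by (auto simp: colourings_def extensional_def)
        qed
      qed
    qed
    show "?spread ` index_choices ?X card M \<subseteq> ?C"
    proof (rule image_subsetI)
      fix d assume d: "d \<in> index_choices ?X card M"
      have "image_mset (?spread d) (mset_set A) = image_mset (\<lambda>x. d (orb \<sigma> x)) (mset_set A)"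
        by (rule image_mset_cong) (use A in simp)
      also have "\<dots> = M" using d by (simp add: image index_choices_def)
      finally have "?spread d \<in> colourings A M" by (simp add: colourings_def)
      moreover have "orb \<sigma> (\<sigma> x) = orb \<sigma> x" for x by (rule orb_eq[OF A \<sigma>]) (rule orbit.base)
      ultimately show "?spread d \<in> ?C"
        using permutes_in_image[OF \<sigma>] by simp
    qed
    show "?choose ` ?C \<subseteq> index_choices ?X card M"
    proof (rule image_subsetI)
      fix c assume c: "c \<in> ?C"
      let ?d = "?choose c"
      have cM: "image_mset c (mset_set A) = M" using c by (simp add: colourings_def)
      have "c x \<in># M" if "x \<in> A" for x unfolding cM[symmetric] using that A by simp
      then have "1 \<le> c x" if "x \<in> A" for x using that M by (metis Suc_leI gr0I One_nat_def)
      then have "?d \<in> ?X \<rightarrow>\<^sub>E {1..}" using some_orb by auto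
      moreover have "(\<Sum>X\<in>?X. replicate_mset (card X) (?d X)) = M"
      proof -
        have "image_mset (\<lambda>x. ?d (orb \<sigma> x)) (mset_set A) = image_mset c (mset_set A)"
        proof (rule image_mset_cong)
          fix x assume "x \<in># mset_set A"
          then have x: "x \<in> A" using A by simp
          have "?d (orb \<sigma> x) = c (SOME y. y \<in> orb \<sigma> x)" using x by (simp only: restrict_apply imageI if_True)
          also have "\<dots> = c x"
          proof (rule const[OF _ x])
            show "(SOME y. y \<in> orb \<sigma> x) \<in> orb \<sigma> x" using some[of "orb \<sigma> x"] x by blast
          qed (use c in blast)
          finally show "?d (orb \<sigma> x) = c x" .
        qed
        then show ?thesis using image[of ?d] cM by simp
      qed
      ultimately show "?d \<in> index_choices ?X card M" by (simp add: index_choices_def)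
    qed
  qed
  moreover have "coef (p_prod (cycle_type_on A \<sigma>)) M = of_nat (card (index_choices ?X card M))"
    by (rule coef_p_prod) (use A pos in \<open>auto simp: cycle_type_on_def\<close>)
  ultimately show ?thesis by simp
qed

text \<open>
  The values of \<open>kind\<close> on \<open>X\<close> stand for the orbits. For a point
  \<open>x\<close>, the group is the disjoint union of the sets of elements that carry
  \<open>x\<close> to \<open>y\<close>, each of the size of the stabilizer of \<open>y\<close>.
\<close>

lemma burnside:
  fixes act :: "('b \<Rightarrow> 'b) \<Rightarrow> 'x \<Rightarrow> 'x" and kind :: "'x \<Rightarrow> 'y"
  assumes A: "finite A" and X: "finite X"
    and closed: "\<And>g x. g permutes A \<Longrightarrow> x \<in> X \<Longrightarrow> act g x \<in> X"
    and comp: "\<And>g h x. g permutes A \<Longrightarrow> h permutes A \<Longrightarrow> x \<in> X \<Longrightarrow> act (g \<circ> h) x = act g (act h x)"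
    and ident: "\<And>x. x \<in> X \<Longrightarrow> act id x = x"
    and invariant: "\<And>g x. g permutes A \<Longrightarrow> x \<in> X \<Longrightarrow> kind (act g x) = kind x"
    and transitive: "\<And>x y. x \<in> X \<Longrightarrow> y \<in> X \<Longrightarrow> kind x = kind y \<Longrightarrow> \<exists>g. g permutes A \<and> act g x = y"
  shows "(\<Sum>g | g permutes A. card {x\<in>X. act g x = x}) = fact (card A) * card (kind ` X)"
proof -
  let ?G = "{g. g permutes A}"
  have G: "finite ?G" using A by (rule finite_permutations)
  have stab: "card {g\<in>?G. act g x = y} = card {g\<in>?G. act g y = y}" if xy: "x \<in> X" "y \<in> X" "kind x = kind y" for x y
  proof -
    obtain h where h: "h permutes A" "act h x = y" using transitive[OF xy] by blast
    note h' = permutes_inv[OF h(1)]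
    have hh: "inv' h \<circ> h = id" "h \<circ> inv' h = id" using permutes_inv_o[OF h(1)] by auto
    have hy: "act (inv' h) y = x" using comp[OF h' h(1) xy(1)] hh ident[OF xy(1)] h(2) by simp
    show ?thesis
    proof (rule bij_betw_same_card[of "\<lambda>g. g \<circ> inv' h"], rule bij_betw_byWitness[where f' = "\<lambda>g. g \<circ> h"])
      show "(\<lambda>g. g \<circ> inv' h) ` {g \<in> ?G. act g x = y} \<subseteq> {g \<in> ?G. act g y = y}"
        using comp[OF _ h' xy(2)] hy permutes_compose[OF h'] by auto
      show "(\<lambda>g. g \<circ> h) ` {g \<in> ?G. act g y = y} \<subseteq> {g \<in> ?G. act g x = y}"
        using comp[OF _ h(1) xy(1)] h(2) permutes_compose[OF h(1)] by auto
    qed (simp_all add: comp_assoc hh)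
  qed
  have "(\<Sum>g\<in>?G. card {x\<in>X. act g x = x}) = (\<Sum>g\<in>?G. \<Sum>x\<in>X. if act g x = x then 1 else 0)"
    using X by (simp add: sum.If_cases Int_def)
  also have "\<dots> = (\<Sum>x\<in>X. \<Sum>g\<in>?G. if act g x = x then 1 else 0)" by (rule sum.swap)
  also have "\<dots> = (\<Sum>x\<in>X. card {g\<in>?G. act g x = x})" using G by (simp add: sum.If_cases Int_def)
  also have "\<dots> = (\<Sum>v\<in>kind ` X. \<Sum>x\<in>{x\<in>X. kind x = v}. card {g\<in>?G. act g x = x})"
    by (rule sum.image_gen[OF X])
  also have "\<dots> = (\<Sum>v\<in>kind ` X. fact (card A))"
  proof (rule sum.cong[OF refl])
    fix v assume "v \<in> kind ` X"
    then obtain x where x: "x \<in> X" "kind x = v" by auto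
    have "(\<Sum>y\<in>{y\<in>X. kind y = v}. card {g\<in>?G. act g y = y}) = (\<Sum>y\<in>{y\<in>X. kind y = v}. card {g\<in>?G. act g x = y})"
    proof (rule sum.cong[OF refl])
      fix y assume "y \<in> {y\<in>X. kind y = v}"
      then have "y \<in> X" "kind x = kind y" using x by simp_all
      then show "card {g\<in>?G. act g y = y} = card {g\<in>?G. act g x = y}" by (rule stab[OF x(1), symmetric])
    qed
    also have "\<dots> = card (\<Union>y\<in>{y\<in>X. kind y = v}. {g\<in>?G. act g x = y})"
      by (rule card_UN_disjoint[symmetric]) (use X G in auto)
    also have "(\<Union>y\<in>{y\<in>X. kind y = v}. {g\<in>?G. act g x = y}) = ?G"
      using closed[OF _ x(1)] invariant[OF _ x(1)] x(2) by auto
    also have "card ?G = fact (card A)" using A by (simp add: card_permutations)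
    finally show "(\<Sum>y\<in>{y\<in>X. kind y = v}. card {g\<in>?G. act g y = y}) = fact (card A)" .
  qed
  finally show ?thesis by (simp add: mult.commute)
qed

section \<open>Marked ordered set partitions\<close>

text \<open>
  An element \<open>x\<close> lies in the block with number \<open>f x\<close>. Block \<open>k <
  length bs\<close> carries the mark \<open>bs ! k\<close>; the block with number \<open>length
  bs\<close> is the unmarked rest, which may be empty.
\<close>

definition marked_partitions :: "nat \<Rightarrow> nat \<Rightarrow> ((nat \<Rightarrow> nat) \<times> nat list) set" where
  "marked_partitions m i = {(f, bs). f \<in> {1..m} \<rightarrow>\<^sub>E {..length bs} \<and>
     (\<forall>k<length bs. 1 \<le> bs ! k \<and> bs ! k < card {x\<in>{1..m}. f x = k}) \<and> sum_list bs = i}"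

definition relabel :: "nat \<Rightarrow> (nat \<Rightarrow> nat) \<Rightarrow> (nat \<Rightarrow> nat) \<Rightarrow> nat \<Rightarrow> nat" where
  "relabel m g f = restrict (f \<circ> inv' g) {1..m}"

definition act_marked :: "nat \<Rightarrow> (nat \<Rightarrow> nat) \<Rightarrow> (nat \<Rightarrow> nat) \<times> nat list \<Rightarrow> (nat \<Rightarrow> nat) \<times> nat list" where
  "act_marked m g = (\<lambda>(f, bs). (relabel m g f, bs))"

lemma finite_marked_partitions: "finite (marked_partitions m i)"
proof (rule finite_subset)
  let ?B = "{bs. set bs \<subseteq> {..i} \<and> length bs \<le> i}"
  show "marked_partitions m i \<subseteq> (\<Union>bs\<in>?B. ({1..m} \<rightarrow>\<^sub>E {..length bs}) \<times> {bs})"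
  proof
    fix z assume "z \<in> marked_partitions m i"
    then obtain f bs where z: "z = (f, bs)" "f \<in> {1..m} \<rightarrow>\<^sub>E {..length bs}" "\<forall>k<length bs. 1 \<le> bs ! k" "sum_list bs = i"
      by (auto simp: marked_partitions_def)
    have "\<forall>b\<in>set bs. 1 \<le> b" using z(3) by (metis in_set_conv_nth)
    then have "length bs \<le> sum_list bs" by (induction bs) auto
    moreover have "\<forall>b\<in>set bs. b \<le> sum_list bs" by (simp add: member_le_sum_list)
    ultimately have "bs \<in> ?B" using z(4) by auto
    then show "z \<in> (\<Union>bs\<in>?B. ({1..m} \<rightarrow>\<^sub>E {..length bs}) \<times> {bs})" using z by blast
  qed
  show "finite (\<Union>bs\<in>?B. ({1..m} \<rightarrow>\<^sub>E {..length bs}) \<times> {bs})"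
    by (intro finite_UN_I finite_lists_length_le finite_cartesian_product finite_PiE) auto
qed

lemma relabel_ext: "relabel m g f \<in> extensional {1..m}" by (simp add: relabel_def)

lemma relabel_comp:
  assumes "g permutes {1..m}" "h permutes {1..m}"
  shows "relabel m (g \<circ> h) f = relabel m g (relabel m h f)"
proof
  fix x
  have "inv' (g \<circ> h) = inv' h \<circ> inv' g" using assms by (simp add: o_inv_distrib permutes_bij)
  then show "relabel m (g \<circ> h) f x = relabel m g (relabel m h f) x"
    using permutes_in_image[OF permutes_inv[OF assms(1)], of x] by (simp add: relabel_def)
qed

lemma relabel_id: "f \<in> extensional {1..m} \<Longrightarrow> relabel m id f = f"
  by (auto simp: relabel_def extensional_def fun_eq_iff inv_id)

lemma image_relabel:
  assumes "g permutes {1..m}"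
  shows "image_mset (\<lambda>x. F (relabel m g f x)) (mset_set {1..m}) = image_mset (\<lambda>x. F (f x)) (mset_set {1..m})"
proof -
  have "image_mset (\<lambda>x. F (relabel m g f x)) (mset_set {1..m}) = image_mset (\<lambda>x. F (f (inv' g x))) (mset_set {1..m})"
    by (rule image_mset_cong) (simp add: relabel_def)
  also have "\<dots> = image_mset (\<lambda>x. F (f x)) (image_mset (inv' g) (mset_set {1..m}))"
    by (simp add: image_mset.compositionality o_def)
  also have "image_mset (inv' g) (mset_set {1..m}) = mset_set {1..m}"
    using permutes_inv[OF assms] by (simp add: permutes_image image_mset_mset_set permutes_inj_on)
  finally show ?thesis .
qed

lemma relabel_block:
  assumes "g permutes {1..m}"
  shows "{x\<in>{1..m}. relabel m g f x = k} = g ` {x\<in>{1..m}. f x = k}"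
proof (intro equalityI subsetI)
  fix x assume x: "x \<in> {x\<in>{1..m}. relabel m g f x = k}"
  then have "inv' g x \<in> {x\<in>{1..m}. f x = k}"
    using permutes_in_image[OF permutes_inv[OF assms], of x] by (auto simp: relabel_def)
  then show "x \<in> g ` {x\<in>{1..m}. f x = k}" using permutes_inverses(1)[OF assms, of x] by (metis imageI)
next
  fix x assume "x \<in> g ` {x\<in>{1..m}. f x = k}"
  then obtain y where y: "y \<in> {1..m}" "f y = k" "x = g y" by auto
  then have "g y \<in> {1..m}" using permutes_in_image[OF assms, of y] by simp
  then show "x \<in> {x\<in>{1..m}. relabel m g f x = k}" using y permutes_inverses(2)[OF assms, of y] by (simp add: relabel_def)
qed

lemma relabel_eq_iff:
  assumes "g permutes {1..m}" "c \<in> extensional {1..m}"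
  shows "relabel m g c = c \<longleftrightarrow> (\<forall>x\<in>{1..m}. c (g x) = c x)"
proof
  assume e: "relabel m g c = c"
  show "\<forall>x\<in>{1..m}. c (g x) = c x"
  proof
    fix x assume "x \<in> {1..m}"
    then have "g x \<in> {1..m}" using permutes_in_image[OF assms(1)] by blast
    then show "c (g x) = c x" using fun_cong[OF e, of "g x"] permutes_inverses(2)[OF assms(1), of x] by (simp add: relabel_def)
  qed
next
  assume a: "\<forall>x\<in>{1..m}. c (g x) = c x"
  show "relabel m g c = c"
  proof
    fix x show "relabel m g c x = c x"
    proof (cases "x \<in> {1..m}")
      case True
      then have "inv' g x \<in> {1..m}" using permutes_in_image[OF permutes_inv[OF assms(1)]] by blast
      then have "c (g (inv' g x)) = c (inv' g x)" using a by blast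
      then show ?thesis using True permutes_inverses(1)[OF assms(1), of x] by (simp add: relabel_def)
    next
      case False
      then have "c x = undefined" using assms(2) by (auto simp: extensional_def)
      then show ?thesis using False by (auto simp: relabel_def)
    qed
  qed
qed

lemma act_marked_closed:
  assumes g: "g permutes {1..m}" and x: "x \<in> marked_partitions m i"
  shows "act_marked m g x \<in> marked_partitions m i"
proof -
  obtain f bs where z: "x = (f, bs)" "f \<in> {1..m} \<rightarrow>\<^sub>E {..length bs}"
      "\<forall>k<length bs. 1 \<le> bs ! k \<and> bs ! k < card {x\<in>{1..m}. f x = k}" "sum_list bs = i"
    using x by (auto simp: marked_partitions_def)
  have "relabel m g f \<in> {1..m} \<rightarrow>\<^sub>E {..length bs}"
    using z(2) permutes_in_image[OF permutes_inv[OF g]] by (auto simp: relabel_def PiE_def Pi_def)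
  moreover have "card {x\<in>{1..m}. relabel m g f x = k} = card {x\<in>{1..m}. f x = k}" for k
    unfolding relabel_block[OF g] by (rule card_image) (rule permutes_inj_on[OF g])
  ultimately show ?thesis using z by (simp add: act_marked_def marked_partitions_def)
qed

lemma act_marked_comp:
  "g permutes {1..m} \<Longrightarrow> h permutes {1..m} \<Longrightarrow> act_marked m (g \<circ> h) x = act_marked m g (act_marked m h x)"
  by (cases x) (simp add: act_marked_def relabel_comp)

lemma act_marked_id: "x \<in> marked_partitions m i \<Longrightarrow> act_marked m id x = x"
  by (auto simp: act_marked_def marked_partitions_def PiE_def relabel_id)

text \<open>
  The colours that occur in each marked block, together with its mark, determine the orbit of a
  coloured marked partition; the colours of the rest are what remains of the given content.
\<close>

definition coloured_kind :: "nat \<Rightarrow> ((nat \<Rightarrow> nat) \<times> nat list) \<times> (nat \<Rightarrow> nat) \<Rightarrow> (nat multiset \<times> nat) list" where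
  "coloured_kind m = (\<lambda>((f, bs), c). map (\<lambda>k. (image_mset c (mset_set {x\<in>{1..m}. f x = k}), bs ! k)) [0..<length bs])"

lemma image_pair_blocks:
  fixes f :: "'b \<Rightarrow> nat" and L :: nat
  assumes "finite A" "\<forall>x\<in>A. f x \<le> L"
  shows "image_mset (\<lambda>x. (f x, c x)) (mset_set A) = (\<Sum>k\<le>L. image_mset (Pair k) (image_mset c (mset_set {x\<in>A. f x = k})))"
proof -
  have "image_mset (\<lambda>x. (f x, c x)) (mset_set A) = (\<Sum>k\<le>L. \<Sum>x\<in>{x\<in>A. f x = k}. {#(f x, c x)#})"
    unfolding image_mset_eq_sum[OF assms(1)] by (rule sum.group[symmetric]) (use assms in auto)
  also have "\<dots> = (\<Sum>k\<le>L. image_mset (Pair k) (image_mset c (mset_set {x\<in>A. f x = k})))"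
  proof (rule sum.cong[OF refl])
    fix k
    have "(\<Sum>x\<in>{x\<in>A. f x = k}. {#(f x, c x)#}) = (\<Sum>x\<in>{x\<in>A. f x = k}. {#(k, c x)#})" by (rule sum.cong) auto
    also have "\<dots> = image_mset (\<lambda>x. (k, c x)) (mset_set {x\<in>A. f x = k})"
      by (rule image_mset_eq_sum[symmetric]) (use assms(1) in simp)
    finally show "(\<Sum>x\<in>{x\<in>A. f x = k}. {#(f x, c x)#}) = image_mset (Pair k) (image_mset c (mset_set {x\<in>A. f x = k}))"
      by (simp add: image_mset.compositionality o_def)
  qed
  finally show ?thesis .
qed

lemma sum_blocks:
  fixes f :: "'b \<Rightarrow> nat" and L :: nat and c :: "'b \<Rightarrow> 'c"
  assumes "finite A" "\<forall>x\<in>A. f x \<le> L"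
  shows "image_mset c (mset_set A) = (\<Sum>k\<le>L. image_mset c (mset_set {x\<in>A. f x = k}))"
proof -
  have "image_mset snd (\<Sum>k\<le>n. image_mset (Pair k) (h k)) = (\<Sum>k\<le>n. h k)" for h :: "nat \<Rightarrow> 'c multiset" and n
    by (induction n) (simp_all add: image_mset.compositionality o_def)
  from this[of "\<lambda>k. image_mset c (mset_set {x\<in>A. f x = k})" L]
  show ?thesis unfolding image_pair_blocks[OF assms, symmetric] by (simp add: image_mset.compositionality o_def)
qed

definition coloured_marked :: "nat \<Rightarrow> nat \<Rightarrow> nat multiset \<Rightarrow> (((nat \<Rightarrow> nat) \<times> nat list) \<times> (nat \<Rightarrow> nat)) set" where
  "coloured_marked m i M = marked_partitions m i \<times> colourings {1..m} M"

text \<open>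
  The pairs of block number and colour form the same multiset for both arguments, so some
  permutation carries the ones to the others.
\<close>

lemma coloured_kind_transitive:
  assumes x: "x \<in> coloured_marked m i M" and y: "y \<in> coloured_marked m i M" and eq: "coloured_kind m x = coloured_kind m y"
  shows "\<exists>g. g permutes {1..m} \<and> (act_marked m g (fst x), relabel m g (snd x)) = y"
proof -
  obtain f bs c where x': "x = ((f, bs), c)" by (metis prod.exhaust)
  obtain f' bs' c' where y': "y = ((f', bs'), c')" by (metis prod.exhaust)
  have f: "f \<in> {1..m} \<rightarrow>\<^sub>E {..length bs}" "c \<in> extensional {1..m}" "image_mset c (mset_set {1..m}) = M"
    using x x' by (auto simp: coloured_marked_def marked_partitions_def colourings_def)
  have f': "f' \<in> {1..m} \<rightarrow>\<^sub>E {..length bs'}" "c' \<in> extensional {1..m}" "image_mset c' (mset_set {1..m}) = M"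
    using y y' by (auto simp: coloured_marked_def marked_partitions_def colourings_def)
  have "map snd (coloured_kind m x) = bs" "map snd (coloured_kind m y) = bs'"
    by (simp_all add: coloured_kind_def x' y' o_def map_nth)
  then have bs: "bs' = bs" using eq by simp
  let ?L = "length bs"
  let ?K = "\<lambda>f c k. image_mset c (mset_set {x\<in>{1..m}. f x = (k :: nat)})"
  have K: "?K f c k = ?K f' c' k" if "k < ?L" for k
    using arg_cong[OF eq, of "\<lambda>l. fst (l ! k)"] that by (simp add: coloured_kind_def x' y' bs)
  have le: "\<forall>x\<in>{1..m}. f x \<le> ?L" "\<forall>x\<in>{1..m}. f' x \<le> ?L" using f(1) f'(1) bs by auto
  have "(\<Sum>k\<le>?L. ?K f c k) = (\<Sum>k\<le>?L. ?K f' c' k)"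
    using sum_blocks[OF _ le(1), of c] sum_blocks[OF _ le(2), of c'] f(3) f'(3) by simp
  moreover have "(\<Sum>k<?L. ?K f c k) = (\<Sum>k<?L. ?K f' c' k)" by (rule sum.cong) (use K in auto)
  ultimately have KL: "?K f c ?L = ?K f' c' ?L" by (simp add: lessThan_Suc_atMost[symmetric])
  have "image_mset (\<lambda>x. (f x, c x)) (mset_set {1..m}) = image_mset (\<lambda>x. (f' x, c' x)) (mset_set {1..m})"
    unfolding image_pair_blocks[OF finite_atLeastAtMost le(1)] image_pair_blocks[OF finite_atLeastAtMost le(2)]
  proof (rule sum.cong[OF refl])
    fix k assume "k \<in> {..?L}"
    then have "?K f c k = ?K f' c' k" using K KL by (cases "k = ?L") auto
    then show "image_mset (Pair k) (?K f c k) = image_mset (Pair k) (?K f' c' k)" by (rule arg_cong)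
  qed
  then obtain p where p: "p permutes {1..m}" "\<forall>x\<in>{1..m}. (f x, c x) = (f' (p x), c' (p x))"
    by (rule image_mset_eq_implies_permutes[OF finite_atLeastAtMost])
  have rel: "relabel m p h = h'" if "\<forall>x\<in>{1..m}. h x = h' (p x)" "h' \<in> extensional {1..m}" for h h' :: "nat \<Rightarrow> nat"
  proof
    fix x show "relabel m p h x = h' x"
    proof (cases "x \<in> {1..m}")
      case True
      then have "inv' p x \<in> {1..m}" using permutes_in_image[OF permutes_inv[OF p(1)]] by blast
      then have "h (inv' p x) = h' x" using that(1) permutes_inverses(1)[OF p(1), of x] by simp
      then show ?thesis using True by (simp add: relabel_def)
    next
      case False
      then have "h' x = undefined" using that(2) by (auto simp: extensional_def)
      then show ?thesis using False by (auto simp: relabel_def)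
    qed
  qed
  have "relabel m p f = f'" "relabel m p c = c'"
    by (rule rel; use p(2) f'(1,2) in \<open>auto simp: PiE_def\<close>)+
  then show ?thesis using p(1) by (intro exI[of _ p]) (simp add: x' y' bs act_marked_def)
qed

lemma coloured_kind_image:
  assumes M: "size M = m"
  shows "coloured_kind m ` coloured_marked m i M = marked_seqs M i"
proof (intro equalityI subsetI)
  fix L assume "L \<in> coloured_kind m ` coloured_marked m i M"
  then obtain f bs c where fc: "((f, bs), c) \<in> coloured_marked m i M" and L: "L = coloured_kind m ((f, bs), c)" by auto
  have f: "f \<in> {1..m} \<rightarrow>\<^sub>E {..length bs}" "\<forall>k<length bs. 1 \<le> bs ! k \<and> bs ! k < card {x\<in>{1..m}. f x = k}" "sum_list bs = i"
      "image_mset c (mset_set {1..m}) = M"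
    using fc by (auto simp: coloured_marked_def marked_partitions_def colourings_def)
  have le: "\<forall>x\<in>{1..m}. f x \<le> length bs" using f(1) by auto
  have "sum_list (map fst L) = (\<Sum>k<length bs. image_mset c (mset_set {x\<in>{1..m}. f x = k}))"
    by (simp add: L coloured_kind_def o_def interv_sum_list_conv_sum_set_nat lessThan_atLeast0)
  also have "\<dots> \<subseteq># (\<Sum>k\<le>length bs. image_mset c (mset_set {x\<in>{1..m}. f x = k}))"
    by (simp add: lessThan_Suc_atMost[symmetric])
  also have "\<dots> = M" using sum_blocks[OF finite_atLeastAtMost le, of c] f(4) by simp
  finally have "sum_list (map fst L) \<subseteq># M" .
  moreover have "map snd L = bs" by (simp add: L coloured_kind_def o_def map_nth)
  moreover have "\<forall>(K, b)\<in>set L. 1 \<le> b \<and> b < size K" using f(2) by (auto simp: L coloured_kind_def)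
  ultimately show "L \<in> marked_seqs M i" using f(3) by (simp add: marked_seqs_def)
next
  fix L assume L: "L \<in> marked_seqs M i"
  let ?l = "length L"
  define K where "K k = (if k < ?l then fst (L ! k) else M - sum_list (map fst L))" for k
  \<comment> \<open>the multiset of pairs of block number and colour of the elements to be found\<close>
  define N where "N = (\<Sum>k\<le>?l. image_mset (Pair k) (K k))"
  have sumK: "(\<Sum>k\<le>?l. K k) = M"
  proof -
    have "(\<Sum>k<?l. K k) = sum_list (map fst L)"
      by (simp add: sum_list_sum_nth K_def lessThan_atLeast0)
    then have "(\<Sum>k\<le>?l. K k) = sum_list (map fst L) + (M - sum_list (map fst L))"
      by (simp add: lessThan_Suc_atMost[symmetric] K_def)
    then show ?thesis using L by (simp add: marked_seqs_def)
  qed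
  have snd_sum: "image_mset snd (\<Sum>k\<le>n. image_mset (Pair k) (h k)) = (\<Sum>k\<le>n. h k)" for h :: "nat \<Rightarrow> nat multiset" and n
    by (induction n) (simp_all add: image_mset.compositionality o_def)
  have sndN: "image_mset snd N = M" unfolding N_def snd_sum by (rule sumK)
  have filt: "filter_mset (\<lambda>p. fst p = k) (\<Sum>k\<le>n. image_mset (Pair k) (K k)) = (if k \<le> n then image_mset (Pair k) (K k) else {#})" for k n
  proof (induction n)
    case 0
    then show ?case by (auto simp: filter_mset_image_mset filter_mset_eq_conv)
  next
    case (Suc n)
    have "filter_mset (\<lambda>p. fst p = k) (image_mset (Pair (Suc n)) (K (Suc n))) = (if k = Suc n then image_mset (Pair k) (K k) else {#})"
      by (auto simp: filter_mset_image_mset filter_mset_eq_conv)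
    then show ?case using Suc by auto
  qed
  have "size N = m" using arg_cong[OF sndN, of size] M by simp
  then obtain h where h: "N = image_mset h (mset_set {..<m})" using mset_as_image[of N] by metis
  define g where "g x = h (x - 1)" for x
  have "image_mset g (mset_set {1..m}) = N"
  proof -
    have "{1..m} = Suc ` {..<m}" by (simp add: lessThan_atLeast0 image_Suc_atLeastLessThan atLeastLessThanSuc_atLeastAtMost)
    then have "mset_set {1..m} = image_mset Suc (mset_set {..<m})" by (simp add: image_mset_mset_set)
    then show ?thesis by (simp add: h g_def image_mset.compositionality o_def)
  qed
  note g = this
  define f where "f = restrict (fst \<circ> g) {1..m}"
  define c where "c = restrict (snd \<circ> g) {1..m}"
  define bs where "bs = map snd L"
  have fc: "f x = fst (g x)" "c x = snd (g x)" if "x \<in> {1..m}" for x using that by (simp_all add: f_def c_def)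
  have cM: "image_mset c (mset_set {1..m}) = M"
  proof -
    have "image_mset c (mset_set {1..m}) = image_mset snd (image_mset g (mset_set {1..m}))"
      unfolding image_mset.compositionality by (rule image_mset_cong) (simp add: fc)
    then show ?thesis using g sndN by simp
  qed
  have block: "image_mset c (mset_set {x\<in>{1..m}. f x = k}) = K k" if k: "k \<le> ?l" for k
  proof -
    have e: "{x\<in>{1..m}. f x = k} = {x\<in>{1..m}. fst (g x) = k}" using fc(1) by auto
    have "image_mset c (mset_set {x\<in>{1..m}. f x = k}) = image_mset snd (image_mset g (mset_set {x\<in>{1..m}. fst (g x) = k}))"
      unfolding image_mset.compositionality e by (rule image_mset_cong) (auto simp: fc)
    also have "image_mset g (mset_set {x\<in>{1..m}. fst (g x) = k}) = filter_mset (\<lambda>p. fst p = k) N"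
      unfolding g[symmetric] by (simp add: filter_mset_image_mset)
    also have "\<dots> = image_mset (Pair k) (K k)" unfolding N_def filt using k by simp
    also have "image_mset snd (image_mset (Pair k) (K k)) = K k" by (simp add: image_mset.compositionality o_def)
    finally show ?thesis .
  qed
  have "f \<in> {1..m} \<rightarrow>\<^sub>E {..length bs}"
  proof -
    have "fst (g x) \<le> ?l" if "x \<in> {1..m}" for x
    proof -
      have "g x \<in># N" unfolding g[symmetric] using that by simp
      then obtain k where "k \<le> ?l" "g x \<in># image_mset (Pair k) (K k)" unfolding N_def by (auto simp: set_mset_sum)
      then show ?thesis by auto
    qed
    then show ?thesis by (auto simp: f_def bs_def)
  qed
  moreover have "1 \<le> bs ! k \<and> bs ! k < card {x\<in>{1..m}. f x = k}" if "k < length bs" for k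
  proof -
    have k: "k < ?l" using that by (simp add: bs_def)
    then have "L ! k \<in> set L" by simp
    then have "1 \<le> snd (L ! k) \<and> snd (L ! k) < size (fst (L ! k))" using L by (auto simp: marked_seqs_def case_prod_unfold)
    moreover have "size (fst (L ! k)) = card {x\<in>{1..m}. f x = k}" using arg_cong[OF block[of k], of size] k by (simp add: K_def)
    ultimately show ?thesis using k by (simp add: bs_def)
  qed
  moreover have "sum_list bs = i" using L by (simp add: marked_seqs_def bs_def)
  ultimately have "((f, bs), c) \<in> coloured_marked m i M"
    using cM by (auto simp: coloured_marked_def marked_partitions_def colourings_def c_def)
  moreover have "coloured_kind m ((f, bs), c) = L"
    by (rule nth_equalityI) (use block in \<open>auto simp: coloured_kind_def bs_def K_def prod_eq_iff\<close>)
  ultimately show "L \<in> coloured_kind m ` coloured_marked m i M" by (metis imageI)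
qed

text \<open>
  Burnside's lemma for coloured marked partitions: a pair is fixed by \<open>g\<close> iff both of
  its components are, and the number of fixed colourings is a coefficient of the power sum
  product.
\<close>

lemma sum_fixed_marked:
  assumes M: "size M = m" "0 \<notin># M"
  shows "(\<Sum>g | g permutes {1..m}. of_nat (card {x\<in>marked_partitions m i. act_marked m g x = x}) * coef (p_prod (cycle_type m g)) M)
    = fact m * of_nat (card (marked_seqs M i))"
proof -
  let ?X = "coloured_marked m i M"
  let ?act = "\<lambda>g x. (act_marked m g (fst x), relabel m g (snd x))"
  have colc: "relabel m g c \<in> colourings {1..m} M" if "g permutes {1..m}" "c \<in> colourings {1..m} M" for g c
    using image_relabel[OF that(1), of "\<lambda>x. x" c] that(2) relabel_ext by (simp add: colourings_def)
  have "(\<Sum>g | g permutes {1..m}. card {x\<in>?X. ?act g x = x}) = fact (card {1..m}) * card (coloured_kind m ` ?X)"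
  proof (rule burnside)
    show "finite ?X" by (simp add: coloured_marked_def finite_marked_partitions finite_colourings)
    show "?act g x \<in> ?X" if "g permutes {1..m}" "x \<in> ?X" for g x
      using that act_marked_closed colc by (auto simp: coloured_marked_def)
    show "?act (g \<circ> h) x = ?act g (?act h x)" if "g permutes {1..m}" "h permutes {1..m}" for g h x
      using that by (simp add: act_marked_comp relabel_comp)
    show "?act id x = x" if "x \<in> ?X" for x
      using that by (auto simp: coloured_marked_def act_marked_id colourings_def relabel_id)
    show "coloured_kind m (?act g x) = coloured_kind m x" if g: "g permutes {1..m}" and x: "x \<in> ?X" for g x
    proof -
      obtain f bs c where x': "x = ((f, bs), c)" by (metis prod.exhaust)
      have "image_mset (relabel m g c) (mset_set {x\<in>{1..m}. relabel m g f x = k}) = image_mset c (mset_set {x\<in>{1..m}. f x = k})" for k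
      proof -
        have "image_mset (relabel m g c) (mset_set (g ` {x\<in>{1..m}. f x = k})) = image_mset (\<lambda>x. relabel m g c (g x)) (mset_set {x\<in>{1..m}. f x = k})"
          by (simp add: image_mset_mset_set[OF permutes_inj_on[OF g], symmetric] image_mset.compositionality o_def)
        also have "\<dots> = image_mset c (mset_set {x\<in>{1..m}. f x = k})"
        proof (rule image_mset_cong)
          fix y assume "y \<in># mset_set {x\<in>{1..m}. f x = k}"
          then have "y \<in> {1..m}" by simp
          then have "g y \<in> {1..m}" using permutes_in_image[OF g] by blast
          then show "relabel m g c (g y) = c y" using permutes_inverses(2)[OF g, of y] by (simp add: relabel_def)
        qed
        finally show ?thesis unfolding relabel_block[OF g] .
      qed
      then show ?thesis by (simp add: coloured_kind_def act_marked_def x')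
    qed
  qed (use coloured_kind_transitive in auto)
  moreover have "card {x\<in>?X. ?act g x = x} = card {x\<in>marked_partitions m i. act_marked m g x = x} * card {c\<in>colourings {1..m} M. \<forall>x\<in>{1..m}. c (g x) = c x}"
    if g: "g permutes {1..m}" for g
  proof -
    have "{x\<in>?X. ?act g x = x} = {x\<in>marked_partitions m i. act_marked m g x = x} \<times> {c\<in>colourings {1..m} M. relabel m g c = c}"
      by (auto simp: coloured_marked_def)
    also have "{c\<in>colourings {1..m} M. relabel m g c = c} = {c\<in>colourings {1..m} M. \<forall>x\<in>{1..m}. c (g x) = c x}"
      using relabel_eq_iff[OF g] by (auto simp: colourings_def)
    finally show ?thesis by (simp add: card_cartesian_product)
  qed
  ultimately have "(\<Sum>g | g permutes {1..m}. card {x\<in>marked_partitions m i. act_marked m g x = x} * card {c\<in>colourings {1..m} M. \<forall>x\<in>{1..m}. c (g x) = c x})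
      = fact m * card (marked_seqs M i)"
    by (simp add: coloured_kind_image[OF M(1)])
  then have "complex_of_nat (\<Sum>g | g permutes {1..m}. card {x\<in>marked_partitions m i. act_marked m g x = x} * card {c\<in>colourings {1..m} M. \<forall>x\<in>{1..m}. c (g x) = c x})
      = of_nat (fact m * card (marked_seqs M i))" by (rule arg_cong)
  then show ?thesis
    using coef_p_prod_cycle_type[OF _ _ M(2), of "{1..m}"] by (simp add: cycle_type_eq)
qed

section \<open>The Frobenius characteristic as a sum over permutations\<close>

lemma mtrace_conjugate:
  assumes \<rho>: "mat_rep (sym_group n) d \<rho>" and p: "\<pi> permutes {1..n}" "\<sigma> permutes {1..n}" "\<tau> permutes {1..n}"
    and eq: "\<pi> \<circ> \<sigma> = \<tau> \<circ> \<pi>"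
  shows "mtrace (\<rho> \<sigma>) = mtrace (\<rho> \<tau>)"
proof -
  note r = mat_repD[OF \<rho>]
  have c: "\<pi> \<in> carrier (sym_group n)" "\<sigma> \<in> carrier (sym_group n)" "\<tau> \<in> carrier (sym_group n)" "inv' \<pi> \<in> carrier (sym_group n)"
    using p permutes_inv[OF p(1)] by (simp_all add: sym_group_carrier)
  have m: "\<rho> (g \<circ> h) = \<rho> g * \<rho> h" if "g \<in> carrier (sym_group n)" "h \<in> carrier (sym_group n)" for g h
    using r(2)[OF that] by (simp add: sym_group_def)
  have e: "\<sigma> = inv' \<pi> \<circ> (\<tau> \<circ> \<pi>)"
    unfolding eq[symmetric] using permutes_inverses(2)[OF p(1)] by (simp add: fun_eq_iff)
  have t: "\<tau> \<circ> \<pi> \<in> carrier (sym_group n)" using p by (simp add: sym_group_carrier permutes_compose)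
  have e2: "\<tau> = (\<tau> \<circ> \<pi>) \<circ> inv' \<pi>"
    using permutes_inverses(1)[OF p(1)] by (simp add: fun_eq_iff)
  have "\<rho> \<sigma> = \<rho> (inv' \<pi>) * \<rho> (\<tau> \<circ> \<pi>)" using m[OF c(4) t] e by simp
  moreover have "\<rho> \<tau> = \<rho> (\<tau> \<circ> \<pi>) * \<rho> (inv' \<pi>)" using m[OF t c(4)] e2 by simp
  ultimately show ?thesis using mtrace_mult_commute[OF r(1)[OF c(4)] r(1)[OF t]] by simp
qed

text \<open>
  The representative chosen by \<open>char_at\<close> is conjugate to \<open>\<sigma>\<close>.
\<close>

lemma char_at_cycle_type:
  assumes V: "mat_rep (sym_group n) d (fst V)" "mat_rep (sym_group n) e (snd V)" and \<sigma>: "\<sigma> permutes {1..n}"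
  shows "char_at n V (cycle_type n \<sigma>) = vrep_char V \<sigma>"
proof -
  let ?P = "\<lambda>\<tau>. \<tau> permutes {1..n} \<and> cycle_type n \<tau> = cycle_type n \<sigma>"
  have "?P (SOME \<tau>. ?P \<tau>)" by (rule someI[of ?P \<sigma>]) (use \<sigma> in simp)
  then obtain \<tau> where \<tau>: "\<tau> = (SOME \<tau>. ?P \<tau>)" "\<tau> permutes {1..n}" "cycle_type_on {1..n} \<tau> = cycle_type_on {1..n} \<sigma>"
    by (simp add: cycle_type_eq)
  obtain \<pi> where \<pi>: "\<pi> permutes {1..n}" "\<pi> \<circ> \<tau> = \<sigma> \<circ> \<pi>"
    by (rule conjugate_if_same_cycle_type[OF finite_atLeastAtMost \<tau>(2) \<sigma> \<tau>(3)])
  show ?thesis unfolding char_at_def \<tau>(1)[symmetric] vrep_char_def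
    using mtrace_conjugate[OF V(1) \<pi>(1) \<tau>(2) \<sigma> \<pi>(2)] mtrace_conjugate[OF V(2) \<pi>(1) \<tau>(2) \<sigma> \<pi>(2)] by simp
qed

lemma coef_frobenius_ch:
  "coef (frobenius_ch n V) M = (\<Sum>\<mu>\<in>partitions n. inverse (of_nat (z_part \<mu>)) * char_at n V \<mu> * coef (p_prod \<mu>) M)"
  by (simp add: frobenius_ch_def coef_sum scale.rep_eq p_prod_def)

text \<open>
  There are \<open>fact n / z_part \<mu>\<close> permutations of cycle type \<open>\<mu>\<close>.
\<close>

lemma coef_frobenius_ch_perms:
  assumes V: "mat_rep (sym_group n) d (fst V)" "mat_rep (sym_group n) e (snd V)"
  shows "fact n * coef (frobenius_ch n V) M = (\<Sum>\<sigma> | \<sigma> permutes {1..n}. vrep_char V \<sigma> * coef (p_prod (cycle_type n \<sigma>)) M)"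
proof -
  let ?S = "{\<sigma>. \<sigma> permutes {1..n}}"
  let ?h = "\<lambda>\<mu>. char_at n V \<mu> * coef (p_prod \<mu>) M"
  have img: "cycle_type n ` ?S \<subseteq> partitions n"
    using sum_cycle_type[of "{1..n}"] zero_notin_cycle_type[of "{1..n}"] by (auto simp: partitions_def cycle_type_eq)
  have "(\<Sum>\<sigma>\<in>?S. vrep_char V \<sigma> * coef (p_prod (cycle_type n \<sigma>)) M) = (\<Sum>\<sigma>\<in>?S. ?h (cycle_type n \<sigma>))"
    by (rule sum.cong) (simp_all add: char_at_cycle_type[OF V])
  also have "\<dots> = (\<Sum>\<mu>\<in>partitions n. \<Sum>\<sigma>\<in>{\<sigma>\<in>?S. cycle_type n \<sigma> = \<mu>}. ?h (cycle_type n \<sigma>))"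
    by (rule sum.group[symmetric, OF _ finite_partitions img]) (simp add: finite_permutations)
  also have "\<dots> = (\<Sum>\<mu>\<in>partitions n. fact n * (inverse (of_nat (z_part \<mu>)) * ?h \<mu>))"
  proof (rule sum.cong[OF refl])
    fix \<mu> assume "\<mu> \<in> partitions n"
    then have \<mu>: "0 \<notin># \<mu>" "sum_mset \<mu> = n" by (auto simp: partitions_def)
    have "(\<Sum>\<sigma>\<in>{\<sigma>\<in>?S. cycle_type n \<sigma> = \<mu>}. ?h (cycle_type n \<sigma>)) = (\<Sum>\<sigma>\<in>{\<sigma>\<in>?S. cycle_type n \<sigma> = \<mu>}. ?h \<mu>)"
      by (rule sum.cong) auto
    also have "\<dots> = of_nat (class_count {1..n} \<mu>) * ?h \<mu>" by (simp add: class_count_def cycle_type_eq)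
    also have "of_nat (class_count {1..n} \<mu>) = (fact n * inverse (of_nat (z_part \<mu>)) :: complex)"
    proof -
      have "class_count {1..n} \<mu> * z_part \<mu> = fact n" using class_count_z_part[of "{1..n}" \<mu>] \<mu> by simp
      then have "of_nat (class_count {1..n} \<mu>) * of_nat (z_part \<mu>) = (fact n :: complex)" by (metis of_nat_mult of_nat_fact)
      moreover have "of_nat (z_part \<mu>) \<noteq> (0 :: complex)" using z_part_pos[OF \<mu>(1)] by simp
      ultimately show ?thesis by (simp add: field_simps)
    qed
    finally show "(\<Sum>\<sigma>\<in>{\<sigma>\<in>?S. cycle_type n \<sigma> = \<mu>}. ?h (cycle_type n \<sigma>)) = fact n * (inverse (of_nat (z_part \<mu>)) * ?h \<mu>)" by simp
  qed
  finally show ?thesis by (simp add: coef_frobenius_ch sum_distrib_left mult.assoc)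
qed

lemma coef_p_prod_eq_0:
  assumes "0 \<notin># \<mu>" "size M \<noteq> sum_mset \<mu> \<or> 0 \<in># M"
  shows "coef (p_prod \<mu>) M = 0"
proof -
  obtain f where f: "\<mu> = image_mset f (mset_set {..<size \<mu>})" by (rule mset_as_image)
  have "f x \<in># \<mu>" if "x < size \<mu>" for x using that by (subst f) auto
  then have pos: "\<forall>x\<in>{..<size \<mu>}. 0 < f x" using assms(1) by (metis gr0I lessThan_iff)
  have "index_choices {..<size \<mu>} f M = {}"
  proof (rule equals0I)
    fix d assume d: "d \<in> index_choices {..<size \<mu>} f M"
    then have e: "(\<Sum>x\<in>{..<size \<mu>}. replicate_mset (f x) (d x)) = M" and d1: "\<forall>x\<in>{..<size \<mu>}. 1 \<le> d x"
      by (auto simp: index_choices_def)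
    have "size M = (\<Sum>x\<in>{..<size \<mu>}. f x)" unfolding e[symmetric] by (simp add: size_multiset_sum)
    also have "\<dots> = sum_mset \<mu>" by (subst f) (simp add: sum_unfold_sum_mset)
    finally have "0 \<in># M" using assms(2) by blast
    then have "0 \<in> d ` {x\<in>{..<size \<mu>}. 0 < f x}" unfolding e[symmetric] set_sum_replicate[OF finite_lessThan] .
    then obtain x where "x \<in> {..<size \<mu>}" "d x = 0" by fastforce
    then show False using bspec[OF d1, of x] by simp
  qed
  then show ?thesis using coef_p_prod[OF finite_lessThan pos f] by simp
qed

lemma coef_frobenius_ch_eq_0: "size M \<noteq> n \<or> 0 \<in># M \<Longrightarrow> coef (frobenius_ch n V) M = 0"
  unfolding coef_frobenius_ch by (rule sum.neutral) (auto simp: partitions_def coef_p_prod_eq_0)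

text \<open>
  The multiplicity \<open>count \<mu> 1\<close> from \<open>coef_p_prod_new\<close> cancels
  against the same factor in \<open>z_part \<mu>\<close>; only partitions \<open>\<mu>\<close>
  with a part 1 contribute.
\<close>

lemma coef_frobenius_ch_new:
  assumes n: "1 \<le> n" and M: "\<And>x. x \<in># M \<Longrightarrow> 2 \<le> x"
  shows "coef (frobenius_ch n V) (add_mset 1 M)
    = (\<Sum>\<nu>\<in>partitions (n - 1). inverse (of_nat (z_part \<nu>)) * char_at n V (add_mset 1 \<nu>) * coef (p_prod \<nu>) M)"
proof -
  have "1 \<notin># M" using M[of 1] by auto
  note new = coef_p_prod_new[OF this, simplified]
  let ?h = "\<lambda>\<mu>. inverse (of_nat (z_part \<mu>)) * char_at n V \<mu> * (of_nat (count \<mu> 1) * coef (p_prod (\<mu> - {#1#})) M)"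
  have "coef (frobenius_ch n V) (add_mset 1 M) = (\<Sum>\<mu>\<in>partitions n. ?h \<mu>)"
    unfolding coef_frobenius_ch by (rule sum.cong) (simp_all add: new)
  also have "\<dots> = (\<Sum>\<mu>\<in>add_mset 1 ` partitions (n - 1). ?h \<mu>)"
  proof (rule sum.mono_neutral_right[OF finite_partitions])
    show "add_mset 1 ` partitions (n - 1) \<subseteq> partitions n" using n by (auto simp: partitions_def)
    show "\<forall>\<mu>\<in>partitions n - add_mset 1 ` partitions (n - 1). ?h \<mu> = 0"
    proof
      fix \<mu> assume \<mu>: "\<mu> \<in> partitions n - add_mset 1 ` partitions (n - 1)"
      have "1 \<notin># \<mu>"
      proof
        assume "1 \<in># \<mu>"
        then obtain \<nu> where "\<mu> = add_mset 1 \<nu>" by (metis multi_member_split)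
        moreover from this have "\<nu> \<in> partitions (n - 1)" using \<mu> by (auto simp: partitions_def)
        ultimately show False using \<mu> by blast
      qed
      then have "count \<mu> 1 = 0" by (simp add: not_in_iff)
      then show "?h \<mu> = 0" by (simp only: of_nat_0 mult_zero_left mult_zero_right)
    qed
  qed
  also have "\<dots> = (\<Sum>\<nu>\<in>partitions (n - 1). ?h (add_mset 1 \<nu>))"
    by (rule sum.reindex_cong[OF _ refl]) (simp_all add: inj_on_def)
  also have "\<dots> = (\<Sum>\<nu>\<in>partitions (n - 1). inverse (of_nat (z_part \<nu>)) * char_at n V (add_mset 1 \<nu>) * coef (p_prod \<nu>) M)"
  proof (rule sum.cong[OF refl])
    fix \<nu>
    have z: "z_part (add_mset 1 \<nu>) = z_part \<nu> * 1 * Suc (count \<nu> 1)" by (rule z_part_add) simp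
    have "inverse (of_nat (z_part (add_mset 1 \<nu>))) * of_nat (Suc (count \<nu> 1)) = (inverse (of_nat (z_part \<nu>)) :: complex)"
      by (simp only: z mult_1_right of_nat_mult inverse_mult_distrib mult.assoc
          left_inverse of_nat_neq_0 not_False_eq_True)
    then show "?h (add_mset 1 \<nu>) = inverse (of_nat (z_part \<nu>)) * char_at n V (add_mset 1 \<nu>) * coef (p_prod \<nu>) M"
      by (simp add: mult.assoc mult.left_commute)
  qed
  finally show ?thesis .
qed

section \<open>Coefficients of Eulerian quasisymmetric functions\<close>

lemma permutes_finite: "finite {\<sigma>. \<sigma> permutes {1..n :: nat} \<and> P \<sigma>}"
  by (rule finite_subset[OF _ finite_permutations[OF finite_atLeastAtMost, of 1 n]]) auto

lemma coef_Q_eq_0: "size M \<noteq> m \<or> 0 \<in># M \<Longrightarrow> coef (Q m i) M = 0"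
  by (simp add: Q_def coef_sum coef_fund_qsym_eq_0)

lemma coef_Q:
  assumes M: "size M = m" "0 \<notin># M"
  shows "coef (Q m (int i)) M = of_nat (card (banners M i))"
proof -
  obtain s where s: "decr m s" "content m s = M" using decr_exists[OF M(1)] .
  have "s k \<in># M" if "k \<in> {1..m}" for k using that unfolding s(2)[symmetric] content_def by simp
  then have pos: "\<forall>k\<in>{1..m}. 1 \<le> s k" using M(2) by (metis One_nat_def Suc_leI gr0I)
  have "{\<sigma>\<in>{\<sigma>. \<sigma> permutes {1..m} \<and> int (exc m \<sigma>) = int i}. compatible m s \<sigma>} = {\<sigma>. \<sigma> permutes {1..m} \<and> exc m \<sigma> = i \<and> compatible m s \<sigma>}"
    by auto
  then show ?thesis using coef_sum_fund_qsym[OF s(1) pos permutes_finite[of m "\<lambda>\<sigma>. int (exc m \<sigma>) = int i"]]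
      card_compatible_perms_banners[OF s(1), of i] by (simp add: Q_def s(2))
qed

lemma full_cycle_iff:
  assumes "\<sigma> permutes {1..n}" "1 \<le> n"
  shows "cycle_type n \<sigma> = {#n#} \<longleftrightarrow> orb \<sigma> n = {1..n}"
proof
  have n: "n \<in> {1..n}" using assms(2) by simp
  note sub = orb_subset[OF finite_atLeastAtMost assms(1)]
  assume "cycle_type n \<sigma> = {#n#}"
  moreover have "orb \<sigma> n \<in> orb \<sigma> ` {1..n}" using n by blast
  then have "card (orb \<sigma> n) \<in># cycle_type n \<sigma>" by (simp add: cycle_type_eq cycle_type_on_def)
  ultimately have "card (orb \<sigma> n) = n" by simp
  then show "orb \<sigma> n = {1..n}" using card_subset_eq[OF finite_atLeastAtMost sub[OF n]] by simp
next
  assume o: "orb \<sigma> n = {1..n}"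
  have "orb \<sigma> x = {1..n}" if "x \<in> {1..n}" for x
    using orb_eq[OF finite_atLeastAtMost assms(1), of x n] o that by simp
  then have "orb \<sigma> ` {1..n} = {{1..n}}" using assms(2) by auto
  then show "cycle_type n \<sigma> = {#n#}" by (simp add: cycle_type_eq cycle_type_on_def)
qed

text \<open>
  The label 1 is the least one of \<open>add_mset 1 M\<close> and occurs once, so it is the label
  of position \<open>n\<close>, as \<open>least_label_last\<close> demands.
\<close>

lemma coef_Q_type_cycle:
  assumes n: "2 \<le> n" and M: "\<And>x. x \<in># M \<Longrightarrow> 2 \<le> x" "size M = n - 1"
  shows "coef (Q_type {#n#} (int j)) (add_mset 1 M) = (if j = 0 then 0 else of_nat (card (banners M (j - 1))))"
proof -
  have "size (add_mset 1 M) = n" using M(2) n by simp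
  then obtain s where sc: "decr n s" "content n s = add_mset 1 M" by (rule decr_exists)
  have mem: "s k \<in># add_mset 1 M" if "k \<in> {1..n}" for k using that unfolding sc(2)[symmetric] content_def by simp
  have pos: "\<forall>k\<in>{1..n}. 1 \<le> s k" using mem M(1) by fastforce
  have split: "content n s = add_mset (s n) (content (n - 1) s)"
  proof -
    have "{1..n} = insert n {1..n - 1}" using n by auto
    moreover have "n \<notin> {1..n - 1}" using n by auto
    ultimately show ?thesis unfolding content_def by simp
  qed
  have sn: "s n = 1"
  proof -
    have "1 \<in># content n s" by (simp add: sc(2))
    then obtain k where k: "k \<in> {1..n}" "s k = 1" by (auto simp: content_def)
    then have "s n \<le> 1" using decrD[OF sc(1), of k n] by simp
    moreover have "1 \<le> s n" using pos n by simp
    ultimately show ?thesis by simp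
  qed
  then have cM: "content (n - 1) s = M" using split sc(2) by simp
  interpret least_label_last n s
  proof
    show "2 \<le> n" "decr n s" by fact+
    fix k assume "1 \<le> k" "k < n"
    then have "s k \<in># content (n - 1) s" by (simp add: content_def)
    then show "s n < s k" using M(1) cM sn by fastforce
  qed
  have "coef (Q_type {#n#} (int j)) (add_mset 1 M) = (of_nat (card {\<sigma>\<in>{\<sigma>. \<sigma> permutes {1..n} \<and> int (exc n \<sigma>) = int j \<and> cycle_type n \<sigma> = {#n#}}. compatible n s \<sigma>}) :: 'a)"
    unfolding sc(2)[symmetric] Q_type_def Let_def sum_mset.singleton by (rule coef_sum_fund_qsym[OF sc(1) pos permutes_finite])
  also have "{\<sigma>\<in>{\<sigma>. \<sigma> permutes {1..n} \<and> int (exc n \<sigma>) = int j \<and> cycle_type n \<sigma> = {#n#}}. compatible n s \<sigma>} = {\<sigma>\<in>cycles. exc n \<sigma> = j}"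
    using full_cycle_iff[of _ n] n by (auto simp: cycles_def)
  also have "card {\<sigma>\<in>cycles. exc n \<sigma> = j} = (if j = 0 then 0 else card (banners M (j - 1)))"
  proof (cases j)
    case 0
    then have "{\<sigma>\<in>cycles. exc n \<sigma> = j} = {}" using exc_cycles by auto
    then show ?thesis using 0 by (simp only: card.empty refl if_True)
  next
    case (Suc i)
    then show ?thesis using card_cycles[of i] cM by simp
  qed
  finally show ?thesis by simp
qed

lemma coef_Q_type_eq_0: "size M \<noteq> n \<Longrightarrow> coef (Q_type {#n#} i) M = 0"
  by (simp add: Q_type_def coef_sum coef_fund_qsym_eq_0)

section \<open>The permutation representation of a finite action\<close>

text \<open>
  An enumeration of \<open>X\<close> carries the action over to \<open>{..<card X}\<close>; the
  trace of a permutation matrix counts fixed points.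
\<close>

lemma permutation_rep_of_action:
  fixes act :: "(nat \<Rightarrow> nat) \<Rightarrow> 'x \<Rightarrow> 'x"
  assumes X: "finite X"
    and closed: "\<And>g x. g permutes {1..m} \<Longrightarrow> x \<in> X \<Longrightarrow> act g x \<in> X"
    and comp: "\<And>g h x. g permutes {1..m} \<Longrightarrow> h permutes {1..m} \<Longrightarrow> x \<in> X \<Longrightarrow> act (g \<circ> h) x = act g (act h x)"
    and ident: "\<And>x. x \<in> X \<Longrightarrow> act id x = x"
  obtains \<rho> where "permutation_rep (sym_group m) \<rho>" "mat_rep (sym_group m) (card X) \<rho>"
    "\<And>g. g permutes {1..m} \<Longrightarrow> mtrace (\<rho> g) = of_nat (card {x\<in>X. act g x = x})"
proof -
  define d where "d = card X"
  obtain e where e: "bij_betw e {..<d} X"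
    using ex_bij_betw_nat_finite[OF X] by (auto simp: d_def atLeast0LessThan)
  note e_inj = bij_betw_imp_inj_on[OF e]
  define \<phi> where "\<phi> g = (\<lambda>k\<in>{..<d}. the_inv_into {..<d} e (act g (e k)))" for g
  have eX: "e k \<in> X" if "k < d" for k using bij_betwE[OF e] that by simp
  have e\<phi>: "e (\<phi> g k) = act g (e k)" and \<phi>_less: "\<phi> g k < d" if g: "g permutes {1..m}" and k: "k < d" for g k
  proof -
    have a: "act g (e k) \<in> e ` {..<d}" using closed[OF g eX[OF k]] by (simp add: bij_betw_imp_surj_on[OF e])
    show "e (\<phi> g k) = act g (e k)" using f_the_inv_into_f[OF e_inj a] k by (simp add: \<phi>_def)
    show "\<phi> g k < d" using the_inv_into_into[OF e_inj a subset_refl] k by (simp add: \<phi>_def)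
  qed
  have \<phi>_eqI: "k = l" if "e k = e l" "k < d" "l < d" for k l
    using inj_onD[OF e_inj that(1)] that by simp
  have \<phi>_comp: "\<phi> (g \<circ> h) k = \<phi> g (\<phi> h k)" if g: "g permutes {1..m}" and h: "h permutes {1..m}" and k: "k < d" for g h k
  proof (rule \<phi>_eqI)
    note hk = \<phi>_less[OF h k] and gh = permutes_compose[OF h g]
    show "e (\<phi> (g \<circ> h) k) = e (\<phi> g (\<phi> h k))"
      by (simp only: e\<phi>[OF gh k] e\<phi>[OF g hk] e\<phi>[OF h k] comp[OF g h eX[OF k]])
    show "\<phi> (g \<circ> h) k < d" "\<phi> g (\<phi> h k) < d" by (rule \<phi>_less[OF gh k] \<phi>_less[OF g hk])+
  qed
  have \<phi>_id: "\<phi> id k = k" if "k < d" for k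
    using e\<phi>[OF permutes_id that] \<phi>_less[OF permutes_id that] ident[OF eX[OF that]] that by (intro \<phi>_eqI) simp_all
  have \<phi>_Bij: "\<phi> g \<in> Bij {..<d}" if g: "g permutes {1..m}" for g
  proof -
    have i: "inv' g permutes {1..m}" by (rule permutes_inv[OF g])
    have "bij_betw (\<phi> g) {..<d} {..<d}"
    proof (rule bij_betwI[where g = "\<phi> (inv' g)"])
      show "\<phi> g \<in> {..<d} \<rightarrow> {..<d}" "\<phi> (inv' g) \<in> {..<d} \<rightarrow> {..<d}" using \<phi>_less g i by auto
      show "\<phi> (inv' g) (\<phi> g k) = k" if "k \<in> {..<d}" for k
        using \<phi>_comp[OF i g, of k] \<phi>_id[of k] that permutes_inv_o(2)[OF g] by simp
      show "\<phi> g (\<phi> (inv' g) k) = k" if "k \<in> {..<d}" for k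
        using \<phi>_comp[OF g i, of k] \<phi>_id[of k] that permutes_inv_o(1)[OF g] by simp
    qed
    then show ?thesis by (simp add: Bij_def \<phi>_def)
  qed
  define \<rho> where "\<rho> g = (mat d d (\<lambda>(i, k). if i = \<phi> g k then 1 else 0) :: complex mat)" for g
  have carrier: "g \<in> carrier (sym_group m) \<longleftrightarrow> g permutes {1..m}" for g by (simp add: sym_group_carrier)
  have "group_action (sym_group m) {..<d} \<phi>"
    unfolding group_action_def group_hom_def group_hom_axioms_def
  proof (intro conjI)
    show "group (sym_group m)" by (rule sym_group_is_group)
    show "group (BijGroup {..<d})" by (rule group_BijGroup)
    show "\<phi> \<in> hom (sym_group m) (BijGroup {..<d})"
    proof (rule homI)
      show "\<phi> g \<in> carrier (BijGroup {..<d})" if "g \<in> carrier (sym_group m)" for g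
        using \<phi>_Bij that by (simp add: BijGroup_def carrier)
      fix g h assume gh: "g \<in> carrier (sym_group m)" "h \<in> carrier (sym_group m)"
      then have "\<phi> (g \<circ> h) = compose {..<d} (\<phi> g) (\<phi> h)"
        using \<phi>_comp by (auto simp: carrier compose_def \<phi>_def[of "g \<circ> h"] fun_eq_iff) (auto simp: \<phi>_def)
      then show "\<phi> (g \<otimes>\<^bsub>sym_group m\<^esub> h) = \<phi> g \<otimes>\<^bsub>BijGroup {..<d}\<^esub> \<phi> h"
        using \<phi>_Bij gh by (simp add: BijGroup_def carrier sym_group_mult)
    qed
  qed
  then have perm: "permutation_rep (sym_group m) \<rho>" unfolding permutation_rep_def \<rho>_def by blast
  have "mat_rep (sym_group m) d \<rho>"
    unfolding mat_rep_def
  proof (intro conjI ballI)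
    show "\<rho> g \<in> carrier_mat d d" for g by (simp add: \<rho>_def)
    show "\<rho> \<one>\<^bsub>sym_group m\<^esub> = 1\<^sub>m d"
      by (rule eq_matI) (auto simp: \<rho>_def sym_group_one \<phi>_id)
    fix g h assume gh: "g \<in> carrier (sym_group m)" "h \<in> carrier (sym_group m)"
    show "\<rho> (g \<otimes>\<^bsub>sym_group m\<^esub> h) = \<rho> g * \<rho> h"
    proof (rule eq_matI)
      fix i k assume "i < dim_row (\<rho> g * \<rho> h)" "k < dim_col (\<rho> g * \<rho> h)"
      then have ik: "i < d" "k < d" by (simp_all add: \<rho>_def)
      have "(\<rho> g * \<rho> h) $$ (i, k) = (\<Sum>l<d. (if i = \<phi> g l then 1 else 0) * (if l = \<phi> h k then 1 else 0))"
        using ik by (simp add: \<rho>_def scalar_prod_def atLeast0LessThan)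
      also have "\<dots> = (\<Sum>l<d. if l = \<phi> h k then (if i = \<phi> g l then 1 else 0) else 0)"
        by (rule sum.cong) auto
      also have "\<dots> = (if i = \<phi> g (\<phi> h k) then 1 else 0)"
        using \<phi>_less[of h k] gh(2) ik(2) by (simp add: carrier)
      also have "\<dots> = \<rho> (g \<otimes>\<^bsub>sym_group m\<^esub> h) $$ (i, k)"
        using \<phi>_comp[of g h k] gh ik by (simp add: \<rho>_def carrier sym_group_mult)
      finally show "\<rho> (g \<otimes>\<^bsub>sym_group m\<^esub> h) $$ (i, k) = (\<rho> g * \<rho> h) $$ (i, k)" by simp
    qed (simp_all add: \<rho>_def)
  qed
  moreover have "mtrace (\<rho> g) = of_nat (card {x\<in>X. act g x = x})" if g: "g permutes {1..m}" for g
  proof -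
    have "mtrace (\<rho> g) = (\<Sum>i<d. if i = \<phi> g i then 1 else 0)" by (simp add: mtrace_def \<rho>_def)
    also have "\<dots> = of_nat (card {i\<in>{..<d}. i = \<phi> g i})" by (simp add: sum.If_cases Int_def)
    also have "card {i\<in>{..<d}. i = \<phi> g i} = card (e ` {i\<in>{..<d}. i = \<phi> g i})"
      by (rule card_image[symmetric]) (rule inj_on_subset[OF e_inj], auto)
    also have "e ` {i\<in>{..<d}. i = \<phi> g i} = {x\<in>X. act g x = x}"
    proof (intro equalityI subsetI)
      fix x assume "x \<in> e ` {i\<in>{..<d}. i = \<phi> g i}"
      then obtain i where i: "i < d" "\<phi> g i = i" "x = e i" by auto
      then show "x \<in> {x\<in>X. act g x = x}" using eX[OF i(1)] e\<phi>[OF g i(1)] by simp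
    next
      fix x assume x: "x \<in> {x\<in>X. act g x = x}"
      then have "x \<in> e ` {..<d}" by (simp add: bij_betw_imp_surj_on[OF e])
      then obtain i where i: "i < d" "x = e i" by auto
      then have "\<phi> g i = i" using x e\<phi>[OF g i(1)] \<phi>_less[OF g i(1)] by (intro \<phi>_eqI) simp_all
      then show "x \<in> e ` {i\<in>{..<d}. i = \<phi> g i}" using i by auto
    qed
    finally show ?thesis .
  qed
  ultimately show ?thesis using that perm by (auto simp: d_def)
qed

section \<open>The restriction to the stabilizer\<close>

lemma coef_frobenius_ch_marked:
  assumes \<rho>: "mat_rep (sym_group m) d \<rho>"
    and tr: "\<And>g. g permutes {1..m} \<Longrightarrow> mtrace (\<rho> g) = of_nat (card {x\<in>marked_partitions m i. act_marked m g x = x})"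
    and M: "size M = m" "0 \<notin># M"
  shows "coef (frobenius_ch m (vrep_of \<rho>)) M = of_nat (card (banners M i))"
proof -
  have "mat_rep (sym_group m) d (fst (vrep_of \<rho>))" "mat_rep (sym_group m) 0 (snd (vrep_of \<rho>))"
    using \<rho> mat_rep_zero_rep by (simp_all add: vrep_of_def)
  note ch = coef_frobenius_ch_perms[OF this, of M]
  have "vrep_char (vrep_of \<rho>) g = of_nat (card {x\<in>marked_partitions m i. act_marked m g x = x})" if "g permutes {1..m}" for g
    using tr[OF that] by (simp add: vrep_char_def vrep_of_def zero_rep_def mtrace_def)
  then have "fact m * coef (frobenius_ch m (vrep_of \<rho>)) M = fact m * of_nat (card (marked_seqs M i))"
    unfolding ch sum_fixed_marked[OF M, symmetric] by (intro sum.cong) auto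
  then show ?thesis using marked_seqs_banners[of M i] by simp
qed

theorem theorem6p7:
  fixes n j :: nat and V :: "(nat \<Rightarrow> nat) vrep"
  assumes "n \<ge> 2" and "j \<le> n - 1"
    and "virtual_rep (sym_group n) V"
    and "frobenius_ch n V = Q_type {#n#} (int j)"
  shows "\<exists>\<rho>. permutation_rep (sym_group (n - 1)) \<rho> \<and>
    vrep_eq (sym_group (n - 1)) (vrep_restrict (sym_group (n - 1)) V) (vrep_of \<rho>) \<and>
    frobenius_ch (n - 1) (vrep_of \<rho>) = Q (n - 1) (int j - 1)"
proof -
  define m where "m = n - 1"
  \<comment> \<open>for \<open>j = 0\<close> everything vanishes, as cycles of length at least 2 have excedances\<close>
  define X where "X = (if j = 0 then {} else marked_partitions m (j - 1))"
  let ?b = "\<lambda>M. if j = 0 then 0 else of_nat (card (banners M (j - 1))) :: complex"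
  have "finite X" by (simp add: X_def finite_marked_partitions)
  then obtain \<rho> where \<rho>: "permutation_rep (sym_group m) \<rho>" "mat_rep (sym_group m) (card X) \<rho>"
    and tr: "\<And>g. g permutes {1..m} \<Longrightarrow> mtrace (\<rho> g) = of_nat (card {x\<in>X. act_marked m g x = x})"
    by (rule permutation_rep_of_action[of X m "act_marked m"])
      (auto simp: X_def act_marked_closed act_marked_comp act_marked_id split: if_splits)
  define W where "W = vrep_of \<rho>"
  have W: "mat_rep (sym_group m) (card X) (fst W)" "mat_rep (sym_group m) 0 (snd W)"
    using \<rho>(2) mat_rep_zero_rep by (simp_all add: W_def vrep_of_def)
  have W_char: "vrep_char W g = mtrace (\<rho> g)" for g
    by (simp add: W_def vrep_char_def vrep_of_def zero_rep_def mtrace_def)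
  have coef_W: "coef (frobenius_ch m W) M = ?b M" if M: "size M = m" "0 \<notin># M" for M
  proof (cases "j = 0")
    case True
    then have "vrep_char W g = 0" if "g permutes {1..m}" for g using tr[OF that] by (simp add: W_char X_def)
    then have "fact m * coef (frobenius_ch m W) M = 0"
      unfolding coef_frobenius_ch_perms[OF W] by (intro sum.neutral) auto
    then show ?thesis using True by simp
  next
    case False
    then show ?thesis using coef_frobenius_ch_marked[OF \<rho>(2) _ M, of "j - 1"] tr by (simp add: X_def W_def)
  qed
  have frob: "frobenius_ch m W = Q m (int j - 1)"
  proof (rule pseries_eqI)
    fix M
    show "coef (frobenius_ch m W) M = coef (Q m (int j - 1)) M"
    proof (cases "size M = m \<and> 0 \<notin># M")
      case False
      then show ?thesis using coef_frobenius_ch_eq_0[of M m W] coef_Q_eq_0[of M m "int j - 1"] by auto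
    next
      case True
      show ?thesis
      proof (cases "j = 0")
        case True
        then have "Q m (int j - 1) = (0 :: complex pseries)" by (auto simp: Q_def)
        then show ?thesis using coef_W[of M] True \<open>size M = m \<and> 0 \<notin># M\<close> by (simp add: coef_zero)
      next
        case False
        then have "int j - 1 = int (j - 1)" by simp
        then show ?thesis using coef_W[of M] coef_Q[of M m "j - 1", where 'a = complex] True False by simp
      qed
    qed
  qed
  obtain d e where V: "mat_rep (sym_group n) d (fst V)" "mat_rep (sym_group n) e (snd V)"
    using assms(3) mat_rep_of_representation[OF sym_group_is_group] unfolding virtual_rep_def by metis
  \<comment> \<open>the coefficients of a linear relation that holds on all monomials in the variables with index at least 2\<close>
  let ?a = "\<lambda>\<nu>. inverse (of_nat (z_part \<nu>)) * (char_at n V (add_mset 1 \<nu>) - char_at m W \<nu>)"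
  have "?a \<nu> = 0" if "\<nu> \<in> partitions m" for \<nu>
  proof (rule p_prod_independent[OF finite_partitions[of m] _ _ that])
    show "0 \<notin># \<mu>" if "\<mu> \<in> partitions m" for \<mu> using that by (simp add: partitions_def)
    fix M :: "nat multiset" assume M: "\<And>x. x \<in># M \<Longrightarrow> 2 \<le> x"
    have M0: "0 \<notin># M" using M[of 0] by auto
    have "(\<Sum>\<nu>\<in>partitions m. ?a \<nu> * coef (p_prod \<nu>) M) = coef (frobenius_ch n V) (add_mset 1 M) - coef (frobenius_ch m W) M"
      using coef_frobenius_ch_new[of n M V] M assms(1)
      by (simp add: m_def coef_frobenius_ch sum_subtractf[symmetric] algebra_simps)
    also have "\<dots> = 0"
    proof (cases "size M = m")
      case True
      then show ?thesis using coef_Q_type_cycle[of n M j] M assms(1) coef_W[OF True M0] by (simp add: assms(4) m_def)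
    next
      case False
      then have "size (add_mset 1 M) \<noteq> n" by (auto simp: m_def)
      then show ?thesis using coef_Q_type_eq_0[of "add_mset 1 M" n] coef_frobenius_ch_eq_0[of M m W] False by (simp add: assms(4))
    qed
    finally show "(\<Sum>\<nu>\<in>partitions m. ?a \<nu> * coef (p_prod \<nu>) M) = 0" .
  qed
  then have key: "char_at n V (add_mset 1 \<nu>) = char_at m W \<nu>" if "\<nu> \<in> partitions m" for \<nu>
    using that z_part_pos[of \<nu>] by (fastforce simp: partitions_def)
  have sub: "g permutes {1..n}" if "g permutes {1..m}" for g
    by (rule permutes_subset[OF that]) (auto simp: m_def)
  have char: "vrep_char V g = mtrace (\<rho> g)" if g: "g permutes {1..m}" for g
  proof -
    have "{1..n} = insert n {1..m}" "n \<notin> {1..m}" using assms(1) by (auto simp: m_def)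
    then have "cycle_type n g = add_mset 1 (cycle_type m g)"
      using cycle_type_insert_fixed[OF finite_atLeastAtMost g] by (simp add: cycle_type_eq)
    moreover have "cycle_type m g \<in> partitions m"
      using sum_cycle_type[OF finite_atLeastAtMost g] zero_notin_cycle_type[OF finite_atLeastAtMost g]
      by (simp add: partitions_def cycle_type_eq)
    ultimately show ?thesis
      using key[of "cycle_type m g"] char_at_cycle_type[OF V sub[OF g]] char_at_cycle_type[OF W g] W_char by simp
  qed
  let ?R = "vrep_restrict (sym_group m) V"
  have restr: "mat_rep (sym_group m) k (restrict \<tau> (carrier (sym_group m)))" if "mat_rep (sym_group n) k \<tau>" for k \<tau>
  proof -
    interpret group "sym_group m" by (rule sym_group_is_group)
    have "carrier (sym_group m) \<subseteq> carrier (sym_group n)" using sub by (auto simp: sym_group_carrier)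
    then show ?thesis using that m_closed one_closed
      by (auto simp: mat_rep_def sym_group_mult sym_group_one subset_iff)
  qed
  have "vrep_eq (sym_group m) ?R (vrep_of \<rho>)"
  proof (rule vrep_eq_if_same_character[OF sym_group_is_group])
    show "finite (carrier (sym_group m))" by (simp add: sym_group_def finite_permutations)
    show "mat_rep (sym_group m) d (fst ?R)" "mat_rep (sym_group m) e (snd ?R)"
      using restr V by (simp_all add: vrep_restrict_def)
    show "mat_rep (sym_group m) (card X) \<rho>" by fact
    fix g assume "g \<in> carrier (sym_group m)"
    then show "vrep_char ?R g = mtrace (\<rho> g)"
      using char[of g] by (simp add: vrep_char_def vrep_restrict_def sym_group_carrier)
  qed
  then show ?thesis using \<rho>(1) frob by (auto simp: m_def W_def)
qed

end
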